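(* Let $T>0$, $u_0\in H$ and let $Y\in C([0,T);L^2)\cap C((0,T);L^\infty)$ be weakly divergence free and such that $\|Y(t)\|_\infty$ remains bounded as $t\to0^+$. Let $$u_j(x,t):=(\Phi(t)\ast u_{0,j})(x)+\int_0^t\!\!\int_{\mathbb{R}^3}\frac{\partial}{\partial y_i}\big[\mathcal{T}_{jk}(x-y,t-s)\big]\,Y_i(y,s)Y_k(y,s)\,dy\,ds,\qquad j=1,2,3,$$ $$p(t):=\partial_k\partial_i(-\Delta)^{-1}\big(Y_i(t)Y_k(t)\big).$$ Then $u,p$ comprise a distributional solution of the Stokes equations $\partial_tu-\Delta u+\nabla p=F$, $\operatorname{div}u=0$ in $\mathbb{R}^3\times(0,T)$ with initial data $u_0$ and $F=-(Y\cdot\nabla)Y$. Moreover this solution is unique in the class $u\in C([0,T);L^2)$, $p\in L^1_{loc}(\mathbb{R}^3\times[0,T))$ (where two solutions are identified if their velocities coincide and their pressures differ by a function of time only).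
   Context: All function spaces are over $\mathbb{R}^3$; repeated indices are summed over $1,2,3$; $\ast$ is convolution in space; $\|\cdot\|_\infty$ is the $L^\infty$ norm. A vector field $v$ is weakly divergence free if $\int v\cdot\nabla g=0$ for all $g\in C_0^\infty(\mathbb{R}^3)$ (for time-dependent fields, at each time). $H=\{f\in L^2:f\text{ weakly divergence free}\}$. Heat kernel: $\Phi(x,t)=(4\pi t)^{-3/2}e^{-|x|^2/4t}$. Oseen kernel: $\mathcal{T}_{ij}(x,t)=\delta_{ij}\Phi(x,t)+\partial_i\partial_jP(x,t)$, where $P(x,t)=\frac{1}{4\pi^{3/2}t^{1/2}|x|}\int_0^{|x|}e^{-\xi^2/4t}\,d\xi$ (extended smoothly to $x=0$). $(-\Delta)^{-1}f(x)=\int\frac{f(y)}{4\pi|x-y|}\,dy$; the operator $\partial_i\partial_k(-\Delta)^{-1}$ (derivatives in the sense of distributions) is bounded from $L^2$ to $L^2$, being the Fourier multiplier with symbol $-\xi_i\xi_k/|\xi|^2$. A pair $u,p$ is a distributional solution of the Stokes equations with initial data $u_0$ and $F=-(Y\cdot\nabla)Y$ if $u(t)$ is weakly divergence free for $t\in(0,T)$ and $$\int u_0\cdot\phi(0)\,dx+\int_0^T\!\!\int\big(u\cdot(\phi_t+\Delta\phi)+p\,\operatorname{div}\phi\big)=-\int_0^T\!\!\int Y\cdot(Y\cdot\nabla)\phi$$ for all $\phi\in C_0^\infty(\mathbb{R}^3\times[0,T);\mathbb{R}^3)$. *)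

theory Defs
  imports "HOL-Analysis.Analysis" "HOL-Probability.Essential_Supremum"
begin

text \<open>
  A time-dependent field is a function of time and then space, \<open>u t x\<close>. Elements of Lebesgue
  spaces are given by Borel representatives (for each fixed time, or jointly in time and space
  for \<open>L1_loc\<close>); every statement below is insensitive to the choice of representative.
\<close>

subsection \<open>Test functions\<close>

fun iterated_derivative :: "'a::real_normed_vector list \<Rightarrow> ('a \<Rightarrow> 'b::real_normed_vector) \<Rightarrow> 'a \<Rightarrow> 'b"
  where
    "iterated_derivative [] f = f"
  | "iterated_derivative (v # vs) f = (\<lambda>x. frechet_derivative (iterated_derivative vs f) (at x) v)"

definition smooth :: "('a::real_normed_vector \<Rightarrow> 'b::real_normed_vector) \<Rightarrow> bool"
  where "smooth f \<longleftrightarrow> (\<forall>vs x. iterated_derivative vs f differentiable (at x))"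

definition test_functions :: "'a::euclidean_space set \<Rightarrow> ('a \<Rightarrow> 'b::euclidean_space) set"
  where "test_functions S = {f. smooth f \<and> compact (closure {x. f x \<noteq> 0}) \<and> closure {x. f x \<noteq> 0} \<subseteq> S}"

text \<open>
  The elements of $C_0^\infty(\mathbb{R}^3\times[0,T))$ are smooth up to and including \<open>t = 0\<close>,
  where they need not vanish, i.e. they are the restrictions to \<open>t \<ge> 0\<close> of smooth functions with
  compact support in $(-\infty,T)\times\mathbb{R}^3$. We quantify over the latter; only their
  values for \<open>t \<ge> 0\<close> are ever used.
\<close>

definition spacetime_test_functions :: "real \<Rightarrow> (real \<times> (real^3) \<Rightarrow> real^3) set"
  where "spacetime_test_functions T = test_functions ({..<T} \<times> UNIV)"

subsection \<open>Spatial differential operators\<close>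

definition pd :: "3 \<Rightarrow> (real^3 \<Rightarrow> 'b::real_normed_vector) \<Rightarrow> real^3 \<Rightarrow> 'b"
  where "pd i f x = frechet_derivative f (at x) (axis i 1)"

definition grad :: "(real^3 \<Rightarrow> real) \<Rightarrow> real^3 \<Rightarrow> real^3"
  where "grad f x = (\<chi> i. pd i f x)"

definition divergence :: "(real^3 \<Rightarrow> real^3) \<Rightarrow> real^3 \<Rightarrow> real"
  where "divergence f x = (\<Sum>i\<in>UNIV. pd i f x $ i)"

definition laplacian :: "(real^3 \<Rightarrow> 'b::real_normed_vector) \<Rightarrow> real^3 \<Rightarrow> 'b"
  where "laplacian f x = (\<Sum>i\<in>UNIV. pd i (pd i f) x)"

definition advect :: "real^3 \<Rightarrow> (real^3 \<Rightarrow> real^3) \<Rightarrow> real^3 \<Rightarrow> real^3"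
  where "advect a f x = (\<Sum>i\<in>UNIV. (a $ i) *\<^sub>R pd i f x)"

subsection \<open>Function spaces\<close>

definition L2 :: "('a::euclidean_space \<Rightarrow> 'b::euclidean_space) set"
  where "L2 = {f. f \<in> borel_measurable borel \<and> integrable lborel (\<lambda>x. (norm (f x))\<^sup>2)}"

definition L2_norm :: "('a::euclidean_space \<Rightarrow> 'b::euclidean_space) \<Rightarrow> real"
  where "L2_norm f = sqrt (LINT x|lborel. (norm (f x))\<^sup>2)"

definition Linf_norm :: "('a::euclidean_space \<Rightarrow> 'b::euclidean_space) \<Rightarrow> ereal"
  where "Linf_norm f = esssup lborel (\<lambda>x. ereal (norm (f x)))"

definition Linf :: "('a::euclidean_space \<Rightarrow> 'b::euclidean_space) set"
  where "Linf = {f. f \<in> borel_measurable borel \<and> Linf_norm f < \<infinity>}"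

definition cont_L2 :: "real set \<Rightarrow> (real \<Rightarrow> 'a::euclidean_space \<Rightarrow> 'b::euclidean_space) set"
  where "cont_L2 I = {u. \<forall>t\<in>I. u t \<in> L2 \<and> ((\<lambda>s. L2_norm (\<lambda>x. u s x - u t x)) \<longlongrightarrow> 0) (at t within I)}"

definition cont_Linf :: "real set \<Rightarrow> (real \<Rightarrow> 'a::euclidean_space \<Rightarrow> 'b::euclidean_space) set"
  where "cont_Linf I = {u. \<forall>t\<in>I. u t \<in> Linf \<and> ((\<lambda>s. Linf_norm (\<lambda>x. u s x - u t x)) \<longlongrightarrow> 0) (at t within I)}"

definition L1_loc :: "'a::euclidean_space set \<Rightarrow> ('a \<Rightarrow> 'b::euclidean_space) set"
  where "L1_loc S = {f. \<forall>K. compact K \<longrightarrow> K \<subseteq> S \<longrightarrow> set_integrable lborel K f}"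

definition weakly_div_free :: "(real^3 \<Rightarrow> real^3) \<Rightarrow> bool"
  where "weakly_div_free v \<longleftrightarrow>
    (\<forall>g \<in> test_functions UNIV. (LINT x|lborel. v x \<bullet> grad g x) = 0)"

definition H_space :: "(real^3 \<Rightarrow> real^3) set"
  where "H_space = {f \<in> L2. weakly_div_free f}"

subsection \<open>Kernels\<close>

definition heat_kernel :: "real^3 \<Rightarrow> real \<Rightarrow> real"
  where "heat_kernel x t = (4 * pi * t) powr (- 3 / 2) * exp (- (norm x)\<^sup>2 / (4 * t))"

text \<open>The value at \<open>x = 0\<close> is the limit of the quotient, which makes the function smooth in \<open>x\<close>.\<close>

definition oseen_potential :: "real^3 \<Rightarrow> real \<Rightarrow> real"
  where "oseen_potential x t =
    (if x = 0 then 1 / (4 * pi powr (3 / 2) * t powr (1 / 2))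
     else 1 / (4 * pi powr (3 / 2) * t powr (1 / 2) * norm x)
            * integral {0..norm x} (\<lambda>\<xi>. exp (- \<xi>\<^sup>2 / (4 * t))))"

definition oseen_kernel :: "3 \<Rightarrow> 3 \<Rightarrow> real^3 \<Rightarrow> real \<Rightarrow> real"
  where "oseen_kernel i j x t =
    (if i = j then heat_kernel x t else 0) + pd i (pd j (\<lambda>z. oseen_potential z t)) x"

definition convolution :: "(real^3 \<Rightarrow> real) \<Rightarrow> (real^3 \<Rightarrow> real) \<Rightarrow> real^3 \<Rightarrow> real"
  where "convolution f g x = (LINT y|lborel. f (x - y) * g y)"

text \<open>At \<open>t = 0\<close>, where the heat kernel is undefined, the velocity is given the initial value.\<close>

definition stokes_velocity ::
    "(real^3 \<Rightarrow> real^3) \<Rightarrow> (real \<Rightarrow> real^3 \<Rightarrow> real^3) \<Rightarrow> real \<Rightarrow> real^3 \<Rightarrow> real^3"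
  where "stokes_velocity u0 Y t x =
    (if t = 0 then u0 x
     else (\<chi> j. convolution (\<lambda>z. heat_kernel z t) (\<lambda>y. u0 y $ j) x
       + (LINT s:{0..t}|lborel. LINT y|lborel.
            (\<Sum>i\<in>UNIV. \<Sum>k\<in>UNIV.
               pd i (\<lambda>z. oseen_kernel j k (x - z) (t - s)) y * Y s y $ i * Y s y $ k))))"

subsection \<open>The pressure\<close>

definition newton_potential :: "(real^3 \<Rightarrow> real) \<Rightarrow> real^3 \<Rightarrow> real"
  where "newton_potential f x = (LINT y|lborel. f y / (4 * pi * norm (x - y)))"

definition has_distr_deriv2 :: "3 \<Rightarrow> 3 \<Rightarrow> (real^3 \<Rightarrow> real) \<Rightarrow> (real^3 \<Rightarrow> real) \<Rightarrow> bool"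
  where "has_distr_deriv2 k i f g \<longleftrightarrow>
    f \<in> L1_loc UNIV \<and> g \<in> L1_loc UNIV \<and>
    (\<forall>\<phi> \<in> test_functions UNIV.
       (LINT x|lborel. g x * \<phi> x) = (LINT x|lborel. f x * pd k (pd i \<phi>) x))"

text \<open>
  A joint representative on $[0,T)\times\mathbb{R}^3$ of
  $p(t)=\partial_k\partial_i(-\Delta)^{-1}(Y_i(t)Y_k(t))$, \<open>0 < t < T\<close>. The functions \<open>h k i\<close> are
  the individual summands, which the relation determines up to null sets. The Newton potential
  converges here because the products $Y_i(t)Y_k(t)$ lie in $L^1\cap L^\infty$.
\<close>

definition is_stokes_pressure ::
    "real \<Rightarrow> (real \<Rightarrow> real^3 \<Rightarrow> real^3) \<Rightarrow> (real \<Rightarrow> real^3 \<Rightarrow> real) \<Rightarrow> bool"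
  where "is_stokes_pressure T Y p \<longleftrightarrow>
    set_borel_measurable lborel ({0..<T} \<times> UNIV) (\<lambda>(t, x). p t x) \<and>
    (\<forall>t\<in>{0<..<T}. \<exists>h :: 3 \<Rightarrow> 3 \<Rightarrow> real^3 \<Rightarrow> real.
       (\<forall>k i. h k i \<in> L2 \<and>
          has_distr_deriv2 k i (newton_potential (\<lambda>y. Y t y $ i * Y t y $ k)) (h k i)) \<and>
       (AE x in lborel. p t x = (\<Sum>k\<in>UNIV. \<Sum>i\<in>UNIV. h k i x)))"

subsection \<open>Distributional solutions of the Stokes equations\<close>

text \<open>
  The forcing is $F=-(Y\cdot\nabla)Y$. The space-time integrals are iterated integrals, so that
  for a velocity in $C([0,T);L^2)$ no jointly measurable representative has to be chosen.
\<close>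

definition distributional_stokes_solution ::
    "real \<Rightarrow> (real^3 \<Rightarrow> real^3) \<Rightarrow> (real \<Rightarrow> real^3 \<Rightarrow> real^3) \<Rightarrow>
     (real \<Rightarrow> real^3 \<Rightarrow> real^3) \<Rightarrow> (real \<Rightarrow> real^3 \<Rightarrow> real) \<Rightarrow> bool"
  where "distributional_stokes_solution T u0 Y u p \<longleftrightarrow>
    (\<forall>t\<in>{0<..<T}. weakly_div_free (u t)) \<and>
    (\<forall>\<phi> \<in> spacetime_test_functions T.
       (LINT x|lborel. u0 x \<bullet> \<phi> (0, x))
       + (LINT t:{0<..<T}|lborel. LINT x|lborel.
            u t x \<bullet> (vector_derivative (\<lambda>s. \<phi> (s, x)) (at t) + laplacian (\<lambda>z. \<phi> (t, z)) x)
            + p t x * divergence (\<lambda>z. \<phi> (t, z)) x)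
       = - (LINT t:{0<..<T}|lborel. LINT x|lborel.
              Y t x \<bullet> advect (Y t x) (\<lambda>z. \<phi> (t, z)) x))"

definition stokes_class ::
    "real \<Rightarrow> ((real \<Rightarrow> real^3 \<Rightarrow> real^3) \<times> (real \<Rightarrow> real^3 \<Rightarrow> real)) set"
  where "stokes_class T =
    {(u, p). u \<in> cont_L2 {0..<T} \<and> (\<lambda>(t, x). p t x) \<in> L1_loc ({0..<T} \<times> UNIV)}"

definition same_stokes_solution ::
    "real \<Rightarrow> (real \<Rightarrow> real^3 \<Rightarrow> real^3) \<times> (real \<Rightarrow> real^3 \<Rightarrow> real) \<Rightarrow>
     (real \<Rightarrow> real^3 \<Rightarrow> real^3) \<times> (real \<Rightarrow> real^3 \<Rightarrow> real) \<Rightarrow> bool"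
  where "same_stokes_solution T = (\<lambda>(u, p) (v, q).
    (\<forall>t\<in>{0..<T}. AE x in lborel. v t x = u t x) \<and>
    (\<exists>c :: real \<Rightarrow> real. AE (t, x) in lborel. t \<in> {0<..<T} \<longrightarrow> q t x = p t x + c t))"

end

theory Submission
 imports Defs "HOL-Probability.Distributions"
begin

text \<open>
 Write the velocity as the heat flow of the data minus the convolution of the products $Y_iY_k$ with
 the space-time kernel $\partial_i\mathcal T_{jk}$, which is integrable on $(0,T)\times\mathbb R^3$, since
 its $L^1$ norm at time $t$ is of order $t^{-1/2}$. The weak formulation then follows by moving the kernel
 onto the test function, where Duhamel's identity for the heat kernel and for its potential $P$ applies; as
 $P(\cdot,t)$ tends to the Newton kernel as $t\to0$, what remains besides $\partial_i\psi$ is the Newton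
 potential of third derivatives of the test function, and this is exactly the contribution of the pressure.

 For uniqueness, testing the difference $w$ of two velocities with
 $\eta(t)(\Delta\psi\,e_j-\nabla\partial_j\psi)$ shows that $\Delta w_j$ solves the heat equation with zero
 data in the sense of distributions. Averaging over translates with the heat kernel turns the Laplacian
 into a derivative in an additional variable $b$, so $\langle w_j(t),e^{b\Delta}\Delta\psi\rangle$ is a function
 of $t+b$ and vanishes. Hence $\langle w_j(t),e^{b\Delta}\psi\rangle$ does not depend on $b$, and it tends
 to $0$ as $b\to\infty$. Two pressures then differ by a distribution invariant under
 spatial translations.
\<close>

text \<open>Three obstacles shape the development. Fields are given slice by slice in time, while
  Fubini needs joint measurability; continuous curves in \<open>L2\<close> therefore receive jointly
  measurable representatives, and the locale \<open>forcing\<close> works with such representatives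
  of the products instead of with \<open>Y\<close>. The bound for second derivatives of Newton
  potentials is obtained without the Fourier transform, by integration by parts against the
  integrable kernel P(.,a) - P(.,b), neither potential being integrable alone; the operator itself
  then comes from Riesz representation, at the price of the constant 2 instead of 1. Finally, the
  bounds on the forcing are uniform only up to times T' < T, and a competing pressure is only
  locally integrable, so its slices may fail to be integrable at a null set of times; the compact
  support of the test functions below T makes the space-time integrals converge. In the uniqueness
  part the difference of two solutions is never regularised: the heat averages act on the test
  function, so only pairings with smooth functions are differentiated.\<close>

lemmas bo_cong = Bochner_Integration.integral_cong
lemmas bo_integrable_bound = Bochner_Integration.integrable_bound
lemmas bo_integral_sum = Bochner_Integration.integral_sum
lemmas bo_integrable_sum = Bochner_Integration.integrable_sum
lemmas bo_integral_add = Bochner_Integration.integral_add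
lemmas bo_integral_diff = Bochner_Integration.integral_diff
lemmas bo_integral_nonneg = Bochner_Integration.integral_nonneg
lemmas bo_integral_zero = Bochner_Integration.integral_zero
lemmas bo_integrable_diff = Bochner_Integration.integrable_diff
lemmas bo_integrable_add = Bochner_Integration.integrable_add
lemmas bo_integral_minus = Bochner_Integration.integral_minus

abbreviation sinteg :: "'a::euclidean_space set => ('a => 'b::{banach, second_countable_topology}) => bool"
 where "sinteg == set_integrable lborel"
abbreviation TFT :: "real => (real \<times> (real^3) => 'b::euclidean_space) set" where "TFT T == test_functions ({..<T} \<times> UNIV)"
abbreviation integ :: "('a::euclidean_space => 'b::{banach, second_countable_topology}) => bool"
 where "integ == integrable lborel"
abbreviation lebesgue_int :: "('a::euclidean_space => 'b::{banach, second_countable_topology}) => 'b" (binder "LI " [60] 60)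
 where "lebesgue_int f == integral\<^sup>L lborel f"
abbreviation sum_UNIV :: "('a::finite => 'b::comm_monoid_add) => 'b" (binder "SS " 10)
 where "sum_UNIV f == sum f UNIV"
abbreviation BM :: "('a::topological_space => 'b::topological_space) set" where "BM == borel_measurable borel"
abbreviation BM2 :: "('a::euclidean_space \<times> 'b::euclidean_space => 'c::topological_space) set"
 where "BM2 == borel_measurable (lborel \<Otimes>\<^sub>M lborel)"
abbreviation LL :: "('a::euclidean_space \<times> 'b::euclidean_space) measure" where "LL == lborel \<Otimes>\<^sub>M lborel"
abbreviation seq_lim :: "(nat => 'a::topological_space) => 'a => bool" (infix "---->" 60)
 where "f ----> l == filterlim f (nhds l) sequentially"
abbreviation TF :: "('a::euclidean_space => 'b::euclidean_space) set" where "TF == test_functions UNIV"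

text \<open>Tonelli's criterion with a dominating function for the inner \<open>L1\<close> norms.
  The bound \<open>le\<close> by itself carries no information where \<open>h x\<close> is not
  integrable, since the Bochner integral is then 0; \<open>ae\<close> confines this to a null
  set.\<close>

lemma Fubini_bound:
 fixes h :: "'a::euclidean_space => 'b::euclidean_space => real"
 assumes m: "(%(x, y). h x y) : BM2" and g: "integ g" and le: "!!x. (LI y. norm (h x y)) <= g x"
  and ae: "AE x in lborel. integ (h x)"
 shows "integrable (lborel \<Otimes>\<^sub>M lborel) (%(x, y). h x y)"
proof (rule lborel_pair.Fubini_integrable[OF m])
 show "AE x in lborel. integ (%y. case (x, y) of (x, y) => h x y)" using ae by simp
 show "integ (%x. LI y. norm (case (x, y) of (x, y) => h x y))"
 proof (rule bo_integrable_bound[OF g])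
  show "AE x in lborel. norm (LI y. norm (case (x, y) of (x, y) => h x y)) <= norm (g x)"
   using le by (intro AE_I2) (simp add: order_trans[OF _ abs_ge_self])
 qed (use m in measurable)
qed

subsection \<open>Smooth functions\<close>

abbreviation ddir :: "'a::real_normed_vector => ('a => 'b::real_normed_vector) => 'a => 'b"
 where "ddir v f \<equiv> (%x. frechet_derivative f (at x) v)"

lemma iterated_derivative_append:
 "iterated_derivative (vs @ ws) f = iterated_derivative vs (iterated_derivative ws f)"
 by (induction vs) simp_all

lemma smooth_differentiable: "smooth f ==> f differentiable (at x)"
 unfolding smooth_def by (metis iterated_derivative.simps(1))

lemma smooth_ddir: "smooth f ==> smooth (ddir v f)"
 unfolding smooth_def
proof (intro allI)
 fix vs x assume "\<forall>vs x. iterated_derivative vs f differentiable (at x)"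
 then have "iterated_derivative (vs @ [v]) f differentiable (at x)" by blast
 then show "iterated_derivative vs (ddir v f) differentiable (at x)"
 by (simp add: iterated_derivative_append)
qed

text \<open>\<open>iterated_derivative\<close> applies the last direction of its list first, so
  peeling the list from the right replaces \<open>f\<close> by one of its directional derivatives,
  which stays in the class \<open>P\<close>.\<close>

lemma smooth_coinduct [consumes 1, case_names step]:
 assumes "P f"
 and step: "!!f. P f ==> (\<forall>x. f differentiable (at x)) \<and> (\<forall>v. P (ddir v f))"
 shows "smooth f"
proof -
 have "P f ==> \<forall>x. iterated_derivative vs f differentiable (at x)" for vs
 proof (induction vs arbitrary: f rule: rev_induct)
 case Nil then show ?case using step by simp
 next
 case (snoc v vs)
 then show ?case using step[OF snoc.prems] by (simp add: iterated_derivative_append)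
 qed
 then show ?thesis using assms(1) by (simp add: smooth_def)
qed

lemma smooth_has_derivative: "smooth f ==> (f has_derivative frechet_derivative f (at x)) (at x)"
 using smooth_differentiable frechet_derivative_works by blast

lemma smooth_continuous_on: "smooth f ==> continuous_on S f"
 by (meson continuous_at_imp_continuous_on differentiable_imp_continuous_within smooth_differentiable)

lemma smooth_isCont: "smooth f ==> isCont f x"
 by (simp add: differentiable_imp_continuous_within smooth_differentiable)

lemma ddir_eq: "(f has_derivative f') (at x) ==> ddir v f x = f' v"
 by (simp add: frechet_derivative_at[symmetric])

text \<open>By the product rule, derivatives of generators only have to be sums of products of
  generators; the closure under both operations is then a class to which
  \<open>smooth_coinduct\<close> applies.\<close>

inductive_set falgebra :: "('a::real_normed_vector => real) set => ('a => real) set" for S where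
 base: "f : S ==> f : falgebra S"
| add: "f : falgebra S ==> g : falgebra S ==> (%x. f x + g x) : falgebra S"
| mult: "f : falgebra S ==> g : falgebra S ==> (%x. f x * g x) : falgebra S"

lemma smooth_falgebra:
 assumes S: "!!f x. f : S ==> f differentiable (at x)" "!!f v. f : S ==> ddir v f : falgebra S"
 and f: "f : falgebra S"
 shows "smooth f"
proof (rule smooth_coinduct[where P = "%f. f : falgebra S", OF f])
 fix f assume "f : falgebra S"
 then show "(\<forall>x. f differentiable (at x)) \<and> (\<forall>v. ddir v f : falgebra S)"
 proof induction
 case (base f) then show ?case using S by simp
 next
 case (add f g)
 have "ddir v (%x. f x + g x) = (%x. ddir v f x + ddir v g x)" for v
 using add.IH by (intro ext ddir_eq has_derivative_add frechet_derivative_works[THEN iffD1]) auto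
 then show ?case using add by (auto intro: falgebra.add)
 next
 case (mult f g)
 have "ddir v (%x. f x * g x) = (%x. f x * ddir v g x + ddir v f x * g x)" for v
 using mult.IH by (intro ext ddir_eq has_derivative_mult frechet_derivative_works[THEN iffD1]) auto
 then show ?case using mult by (auto intro!: falgebra.add falgebra.mult)
 qed
qed

lemma smooth_mult: "smooth f ==> smooth g ==> smooth (%x. f x * g x :: real)"
 by (rule smooth_falgebra[where S = "Collect smooth"])
 (auto intro: smooth_differentiable falgebra.intros smooth_ddir)

lemma smooth_add:
 assumes "smooth f" "smooth g" shows "smooth (%x. f x + g x)"
proof (rule smooth_coinduct[where P = "%h. \<exists>f g. smooth f \<and> smooth g \<and> h = (%x. f x + g x)"])
 show "\<exists>f' g'. smooth f' \<and> smooth g' \<and> (%x. f x + g x) = (%x. f' x + g' x)" using assms by blast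
next
 fix h :: "'a => 'b" assume "\<exists>f g. smooth f \<and> smooth g \<and> h = (%x. f x + g x)"
 then obtain f g where fg: "smooth f" "smooth g" "h = (%x. f x + g x)" by blast
 have "ddir v h = (%x. ddir v f x + ddir v g x)" for v
 unfolding fg(3) using fg by (intro ext ddir_eq has_derivative_add smooth_has_derivative)
 then show "(\<forall>x. h differentiable (at x)) \<and> (\<forall>v. \<exists>f g. smooth f \<and> smooth g \<and> ddir v h = (%x. f x + g x))"
 using fg by (auto intro: smooth_ddir smooth_differentiable differentiable_add)
qed

lemma ddir_linear_comp:
 assumes "bounded_linear L" "f differentiable (at x)"
 shows "ddir v (%x. L (f x)) x = L (ddir v f x)"
 by (rule ddir_eq[OF bounded_linear.has_derivative[OF assms(1) frechet_derivative_works[THEN iffD1, OF assms(2)]]])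

lemma smooth_linear_comp:
 assumes L: "bounded_linear L" and "smooth f" shows "smooth (%x. L (f x))"
proof (rule smooth_coinduct[where P = "%h. \<exists>f. smooth f \<and> h = (%x. L (f x))"])
 show "\<exists>f'. smooth f' \<and> (%x. L (f x)) = (%x. L (f' x))" using assms by blast
next
 fix h assume "\<exists>f. smooth f \<and> h = (%x. L (f x))"
 then obtain f where f: "smooth f" "h = (%x. L (f x))" by blast
 have "ddir v h = (%x. L (ddir v f x))" for v
 unfolding f(2) using f by (intro ext ddir_linear_comp L smooth_differentiable)
 moreover have "h differentiable (at x)" for x
 unfolding f(2) using smooth_has_derivative[OF f(1), of x] bounded_linear.has_derivative[OF L]
 by (blast intro: differentiableI)
 ultimately show "(\<forall>x. h differentiable (at x)) \<and> (\<forall>v. \<exists>f. smooth f \<and> ddir v h = (%x. L (f x)))"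
 using f by (auto intro: smooth_ddir)
qed

lemma ddir_affine:
 assumes "bounded_linear A" "smooth f"
 shows "ddir v (%x. f (A x + c)) x = ddir (A v) f (A x + c)"
proof -
 have "((%x. A x + c) has_derivative A) (at x)"
 using bounded_linear_imp_has_derivative[OF assms(1)] by (auto intro!: derivative_eq_intros)
 from diff_chain_at[OF this smooth_has_derivative[OF assms(2), of "A x + c"]]
 show ?thesis by (intro ddir_eq[THEN trans]) (auto simp: o_def)
qed

lemma smooth_affine:
 assumes A: "bounded_linear A" and "smooth f" shows "smooth (%x. f (A x + c))"
proof (rule smooth_coinduct[where P = "%h. \<exists>f. smooth f \<and> h = (%x. f (A x + c))"])
 show "\<exists>f'. smooth f' \<and> (%x. f (A x + c)) = (%x. f' (A x + c))" using assms by blast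
next
 fix h assume "\<exists>f. smooth f \<and> h = (%x. f (A x + c))"
 then obtain f where f: "smooth f" "h = (%x. f (A x + c))" by blast
 have "ddir v h = (%x. ddir (A v) f (A x + c))" for v
 unfolding f(2) using f by (intro ext ddir_affine A)
 moreover have "h differentiable (at x)" for x
 proof -
 have "((%x. A x + c) has_derivative A) (at x)"
 using bounded_linear_imp_has_derivative[OF A] by (auto intro!: derivative_eq_intros)
 from diff_chain_at[OF this smooth_has_derivative[OF f(1), of "A x + c"]]
 show ?thesis unfolding f(2) o_def by (blast intro: differentiableI)
 qed
 ultimately show "(\<forall>x. h differentiable (at x)) \<and> (\<forall>v. \<exists>f. smooth f \<and> ddir v h = (%x. f (A x + c)))"
 using f by (auto intro: smooth_ddir)
qed

lemma smooth_const: "smooth (%x. c)"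
 by (rule smooth_coinduct[where P = "%h. \<exists>c. h = (%x. c)"]) auto

lemma smooth_cmult: "smooth f ==> smooth (%x. c * f x :: real)"
 using smooth_linear_comp[OF bounded_linear_mult_right] .


lemma smooth_sum: "(!!i. i : I ==> smooth (f i)) ==> smooth (%x. \<Sum>i\<in>I. f i x)"
 by (induction I rule: infinite_finite_induct) (auto intro: smooth_const smooth_add)

lemma smooth_prod: "(!!i. i : I ==> smooth (f i)) ==> smooth (%x. \<Prod>i\<in>I. f i x :: real)"
 by (induction I rule: infinite_finite_induct) (auto intro: smooth_const smooth_mult)

lemma ddir_add: "smooth f ==> smooth g ==> ddir v (%x. f x + g x) = (%x. ddir v f x + ddir v g x)"
 by (intro ext ddir_eq has_derivative_add smooth_has_derivative)

lemma ddir_diff: "smooth f ==> smooth g ==> ddir v (%x. f x - g x) = (%x. ddir v f x - ddir v g x)"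
 by (intro ext ddir_eq has_derivative_diff smooth_has_derivative)

lemma ddir_sum: "(!!i. i : I ==> smooth (f i)) ==> ddir v (%x. \<Sum>i\<in>I. f i x) = (%x. \<Sum>i\<in>I. ddir v (f i) x)"
 by (intro ext ddir_eq has_derivative_sum smooth_has_derivative)

lemma ddir_mult:
 "smooth f ==> smooth g ==> ddir v (%x. f x * g x :: real) x = f x * ddir v g x + ddir v f x * g x"
 by (intro ddir_eq has_derivative_mult smooth_has_derivative)

lemma smooth_vector_derivative:
 assumes "smooth f" shows "((%h. f (x + h *\<^sub>R v)) has_vector_derivative ddir v f (x + h *\<^sub>R v)) (at h within S)"
proof -
 have "((%h. x + h *\<^sub>R v) has_derivative (%h. h *\<^sub>R v)) (at h)"
 by (auto intro!: derivative_eq_intros)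
 from diff_chain_at[OF this smooth_has_derivative[OF assms]]
 have "((%h. f (x + h *\<^sub>R v)) has_derivative (%k. frechet_derivative f (at (x + h *\<^sub>R v)) (k *\<^sub>R v))) (at h)"
 by (simp add: o_def)
 moreover have "(%k. frechet_derivative f (at (x + h *\<^sub>R v)) (k *\<^sub>R v)) = (%k. k *\<^sub>R ddir v f (x + h *\<^sub>R v))"
 using linear_cmul[OF linear_frechet_derivative[OF smooth_differentiable[OF assms]]] by auto
 ultimately show ?thesis
 by (auto simp: has_vector_derivative_def intro: has_derivative_at_withinI)
qed

text \<open>Symmetry comes from differentiating
 $f(x+sv+tw)-f(x+sv)=\int_0^t\partial_wf(x+sv+rw)\,dr$ first in \<open>s\<close> and then in \<open>t\<close>.\<close>

lemma ddir_commute: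
 fixes f :: "'a::real_normed_vector => 'b::banach"
 assumes "smooth f"
 shows "ddir v (ddir w f) = ddir w (ddir v f)"
proof
 fix x
 let ?G = "%s r. ddir w f (x + r *\<^sub>R w + s *\<^sub>R v)"
 let ?H = "%s r. ddir v (ddir w f) (x + r *\<^sub>R w + s *\<^sub>R v)"
 have sw: "smooth (ddir w f)" and sv: "smooth (ddir v f)" and svw: "smooth (ddir v (ddir w f))"
 using assms smooth_ddir by blast+
 have FTC: "integral {0..t} (%r. ?G s r) = f (x + t *\<^sub>R w + s *\<^sub>R v) - f (x + s *\<^sub>R v)" if "0 <= t" for s t
 proof -
 have "((%r. ?G s r) has_integral (f ((x + s *\<^sub>R v) + t *\<^sub>R w) - f ((x + s *\<^sub>R v) + 0 *\<^sub>R w))) {0..t}"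
 using that smooth_vector_derivative[OF assms, of "x + s *\<^sub>R v" w]
 by (intro fundamental_theorem_of_calculus) (auto simp: algebra_simps)
 then show ?thesis by (simp add: integral_unique algebra_simps)
 qed
 have "ddir v f (x + t *\<^sub>R w) - ddir v f x = integral {0..t} (?H 0)" if "0 <= t" for t
 proof -
 have "((%s. integral (cbox 0 t) (?G s)) has_vector_derivative integral (cbox 0 t) (?H 0)) (at 0 within UNIV)"
 proof (rule leibniz_rule_vector_derivative)
 fix s r :: real
 show "((%s. ?G s r) has_vector_derivative ?H s r) (at s within UNIV)"
 using smooth_vector_derivative[OF sw] .
 show "?G s integrable_on cbox 0 t"
 by (intro integrable_continuous continuous_on_compose2[OF smooth_continuous_on[OF sw, of UNIV]]
 continuous_intros) auto
 show "continuous_on (UNIV \<times> cbox 0 t) (%(s, r). ?H s r)"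
 unfolding split_beta
 by (intro continuous_on_compose2[OF smooth_continuous_on[OF svw, of UNIV]] continuous_intros) auto
 qed auto
 moreover have "((%s. f ((x + t *\<^sub>R w) + s *\<^sub>R v) - f (x + s *\<^sub>R v)) has_vector_derivative
 (ddir v f ((x + t *\<^sub>R w) + 0 *\<^sub>R v) - ddir v f (x + 0 *\<^sub>R v))) (at 0)"
 using smooth_vector_derivative[OF assms] by (intro has_vector_derivative_diff)
 ultimately show ?thesis
 using FTC[OF that] by (auto simp: vector_derivative_unique_at)
 qed
 note eq = this
 \<comment> \<open>The identity \<open>eq\<close> is available for nonnegative \<open>t\<close>
   only, so the second differentiation is one-sided. Such derivatives are still unique because 0 is
   a limit point of \<open>{0..1}\<close>.\<close>
 have "((%t. integral {0..t} (?H 0)) has_vector_derivative ?H 0 0) (at 0 within {0..1})"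
 by (intro integral_has_vector_derivative continuous_on_compose2[OF smooth_continuous_on[OF svw, of UNIV]]
 continuous_intros) auto
 then have "((%t. ddir v f (x + t *\<^sub>R w) - ddir v f x) has_vector_derivative ?H 0 0) (at 0 within {0..1})"
 by (rule has_vector_derivative_transform[rotated 2]) (auto simp: eq)
 then have "((%t. ddir v f (x + t *\<^sub>R w)) has_vector_derivative ?H 0 0) (at 0 within {0..1})"
 using has_vector_derivative_add_const[of "%t. ddir v f (x + t *\<^sub>R w)" "- ddir v f x"] by simp
 moreover have "((%t. ddir v f (x + t *\<^sub>R w)) has_vector_derivative ddir w (ddir v f) (x + 0 *\<^sub>R w)) (at 0 within {0..1})"
 by (rule smooth_vector_derivative[OF sv])
 ultimately show "ddir v (ddir w f) x = ddir w (ddir v f) x"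
 using vector_derivative_unique_within[of 0 "{0..1::real}"]
 by (force simp: trivial_limit_within islimpt_Icc)
qed

subsection \<open>Test functions\<close>

lemma test_smooth: "f : test_functions S ==> smooth f"
 by (simp add: test_functions_def)

lemma test_functionsI:
 assumes "smooth f" "compact K" "K \<subseteq> S" "!!x. x \<notin> K ==> f x = 0"
 shows "f : test_functions S"
proof -
 have "closure {x. f x ~= 0} \<subseteq> K"
 using assms by (intro closure_minimal compact_imp_closed) auto
 moreover have "bounded {x. f x ~= 0}"
 using assms by (intro bounded_subset[OF compact_imp_bounded[OF assms(2)]]) auto
 ultimately show ?thesis
 using assms unfolding test_functions_def by auto
qed

lemma test_functionsE:
 assumes "f : test_functions S"
 obtains K where "compact K" "K \<subseteq> S" "!!x. x \<notin> K ==> f x = 0" "!!x v. x \<notin> K ==> ddir v f x = 0"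
proof
 let ?K = "closure {x. f x ~= 0}"
 have *: "smooth f \<and> compact ?K \<and> ?K \<subseteq> S" using assms unfolding test_functions_def mem_Collect_eq .
 show "compact ?K" "?K \<subseteq> S" using * by (rule conjunct2[THEN conjunct1], rule conjunct2[THEN conjunct2])
 show z: "f x = 0" if "x \<notin> ?K" for x using that closure_subset[of "{x. f x ~= 0}"] by auto
 show "ddir v f x = 0" if "x \<notin> ?K" for x v
 proof -
 have "(f has_derivative (%_. 0)) (at x)"
 proof (rule has_derivative_transform_within_open)
 show "((%_. 0) has_derivative (%_. 0)) (at x)" by simp
 show "x : - ?K" using that unfolding Compl_iff .
 show "open (- ?K)" by (rule open_Compl[OF closed_closure])
 show "0 = f y" if "y : - ?K" for y using z[OF that[unfolded Compl_iff]] by (rule sym)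
 qed
 then show ?thesis using ddir_eq by blast
 qed
qed

lemma test_support:
 "f : test_functions S ==> \<exists>K. compact K \<and> K \<subseteq> S \<and> (\<forall>x. x \<notin> K \<longrightarrow> f x = 0)"
 by (erule test_functionsE) blast

lemma test_mono: "S \<subseteq> S' ==> test_functions S \<subseteq> test_functions S'"
 by (auto simp: test_functions_def)

lemma test_ddir: "f : test_functions S ==> ddir v f : test_functions S"
 by (rule test_functionsE, assumption, rule test_functionsI) (auto intro: smooth_ddir test_smooth)

lemma test_add:
 assumes "f : test_functions S" "g : test_functions S"
 shows "(%x. f x + g x) : test_functions S"
proof -
 obtain K L where "compact K" "K \<subseteq> S" "\<forall>x. x \<notin> K \<longrightarrow> f x = 0" "compact L" "L \<subseteq> S" "\<forall>x. x \<notin> L \<longrightarrow> g x = 0"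
 using assms[THEN test_support] by blast
 then show ?thesis
 using assms by (intro test_functionsI[where K = "K \<union> L"] smooth_add) (auto dest: test_smooth)
qed

lemma test_linear_comp:
 assumes "bounded_linear L" "f : test_functions S"
 shows "(%x. L (f x)) : test_functions S"
proof -
 obtain K where "compact K" "K \<subseteq> S" "\<forall>x. x \<notin> K \<longrightarrow> f x = 0"
 using assms(2)[THEN test_support] by blast
 then show ?thesis
 using linear_0[OF bounded_linear.linear[OF assms(1)]]
 by (intro test_functionsI[where K = K] smooth_linear_comp[OF assms(1) test_smooth[OF assms(2)]]) auto
qed

lemma test_cmult: "f : test_functions S ==> (%x. c * f x :: real) : test_functions S"
 using test_linear_comp[OF bounded_linear_mult_right] .

lemma test_diff:
 "f : test_functions S ==> g : test_functions S ==> (%x. f x - g x) : test_functions S"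
 using test_add[OF _ test_linear_comp[OF bounded_linear_minus[OF bounded_linear_ident]], of f S g]
 by simp

lemma zero_test_function: "(%x. 0) : test_functions S"
 by (rule test_functionsI[where K = "{}"]) (auto intro: smooth_const)

lemma test_sum:
 "(!!i. i : I ==> f i : test_functions S) ==> (%x. \<Sum>i\<in>I. f i x) : test_functions S"
 by (induction I rule: infinite_finite_induct) (auto intro: zero_test_function test_add)

lemma test_translate:
 assumes "f : TF"
 shows "(%x. f (x - y)) : TF"
proof -
 obtain K where K: "compact K" "\<forall>x. x \<notin> K \<longrightarrow> f x = 0"
 using assms[THEN test_support] by blast
 have "smooth (%x. f (x + - y))"
 using smooth_affine[OF bounded_linear_ident test_smooth[OF assms]] .
 moreover have "f (x - y) = 0" if "x \<notin> (+) y ` K" for x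
 using that K(2)[rule_format, of "x - y"] by (metis add.commute diff_add_cancel image_eqI)
 ultimately show ?thesis
 using K by (intro test_functionsI[where K = "(+) y ` K"] compact_translation) auto
qed

lemma test_bounded:
 assumes "f : test_functions S"
 obtains C where "0 < C" "!!x. norm (f x) <= C"
proof -
 obtain K where K: "compact K" "\<forall>x. x \<notin> K \<longrightarrow> f x = 0"
 using assms[THEN test_support] by blast
 have "bounded (f ` K)"
 using assms K by (intro compact_imp_bounded compact_continuous_image smooth_continuous_on)
 (auto dest: test_smooth)
 then obtain C where "0 < C" "!!x. x : K ==> norm (f x) <= C" by (auto simp: bounded_pos)
 then show ?thesis using K that[of C] by (metis less_eq_real_def norm_zero)
qed

lemma integrable_compact_support:
 fixes f :: "'a::euclidean_space => 'b::euclidean_space"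
 assumes "continuous_on UNIV f" "compact K" "!!x. x \<notin> K ==> f x = 0"
 shows "integ f"
proof -
 have "integ (%x. indicator K x *\<^sub>R f x)"
 using assms by (intro borel_integrable_compact) (auto intro: continuous_on_subset)
 moreover have "(%x. indicator K x *\<^sub>R f x) = f" using assms by (auto simp: indicator_def)
 ultimately show ?thesis by simp
qed

lemma test_continuous: "f : test_functions S ==> continuous_on A f"
 by (simp add: smooth_continuous_on test_smooth)

lemma test_measurable [measurable_dest]: "f : test_functions S ==> f : BM"
 by (simp add: borel_measurable_continuous_onI test_continuous)

lemma test_integrable: "f : test_functions S ==> integ f"
 using test_support integrable_compact_support[OF test_continuous] by blast

lemma pd_eq_ddir: "pd i f = ddir (axis i 1) f"
 by (auto simp: pd_def)

lemma test_pd: "f : test_functions S ==> pd i f : test_functions S"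
 unfolding pd_eq_ddir by (rule test_ddir)

lemma smooth_pd: "smooth f ==> smooth (pd i f)"
 unfolding pd_eq_ddir by (rule smooth_ddir)

lemma pd_commute: "smooth (f :: _ => 'b::banach) ==> pd i (pd j f) = pd j (pd i f)"
 unfolding pd_eq_ddir by (rule ddir_commute)

lemma laplacian_eq: "laplacian f = (%x. SS i. pd i (pd i f) x)"
 by (auto simp: laplacian_def)

lemma test_laplacian: "f : test_functions S ==> laplacian f : test_functions S"
 unfolding laplacian_eq by (intro test_sum test_pd)

lemma pd_translate: "smooth f ==> pd i (%x. f (x - y)) = (%x. pd i f (x - y))"
 using ddir_affine[OF bounded_linear_ident, where f = f and v = "axis i 1" and c = "- y"] by (intro ext) (simp add: pd_def)

lemma laplacian_translate: "smooth f ==> laplacian (%x. f (x - y)) = (%x. laplacian f (x - y))"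
 by (simp add: laplacian_eq pd_translate smooth_pd)

lemma pd_sum: "(!!k. k : I ==> smooth (f k)) ==> pd i (%x. \<Sum>k\<in>I. f k x) = (%x. \<Sum>k\<in>I. pd i (f k) x)"
 unfolding pd_eq_ddir by (rule ddir_sum)

lemma pd_laplacian: "smooth (f :: _ => 'b::banach) ==> pd i (laplacian f) = laplacian (pd i f)"
 by (simp add: laplacian_eq pd_sum smooth_pd pd_commute[of "pd _ f" i] pd_commute[of f i])

subsection \<open>Bump functions and the fundamental lemma of the calculus of variations\<close>

text \<open>Up to the factor 1/s^k this is the standard flat function exp(-1/s). The family is
  indexed by \<open>k\<close> because differentiation leads from index \<open>k\<close> to
  \<open>k + 1\<close> and \<open>k + 2\<close>; the bump functions use index 0.\<close>

definition exp_bump :: "nat => real => real"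
 where "exp_bump k s = (if 0 < s then exp (- 1 / s) / s ^ k else 0)"

lemma tendsto_exp_bump_0: "(exp_bump k \<longlongrightarrow> 0) (at 0)"
proof -
 have "((%x. x ^ k / exp x) \<longlongrightarrow> 0) (at_top :: real filter)"
 by (rule tendsto_power_div_exp_0)
 then have "((%s. (inverse s) ^ k / exp (inverse s)) \<longlongrightarrow> 0) (at_right (0::real))"
 by (rule filterlim_compose) (rule filterlim_inverse_at_top_right)
 moreover have "\<forall>\<^sub>F s in at_right (0::real). (inverse s) ^ k / exp (inverse s) = exp_bump k s"
 by (auto simp: eventually_at_filter exp_bump_def exp_minus field_simps)
 ultimately have "(exp_bump k \<longlongrightarrow> 0) (at_right 0)"
 by (rule Lim_transform_eventually)
 moreover have "(exp_bump k \<longlongrightarrow> 0) (at_left 0)"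
 by (rule tendsto_eventually) (auto simp: eventually_at_filter exp_bump_def)
 ultimately show ?thesis by (simp add: filterlim_split_at)
qed

lemma exp_bump_has_derivative:
 "(exp_bump k has_real_derivative exp_bump (k + 2) s - k * exp_bump (k + 1) s) (at s)"
proof -
 consider "s < 0" | "s = 0" | "0 < s" by linarith
 then show ?thesis
 proof cases
 case 1
 then have ev: "\<forall>\<^sub>F r in nhds s. r < 0" by (auto simp: eventually_nhds_in_open[OF open_lessThan, simplified])
 show ?thesis
 by (rule DERIV_cong_ev[where g = "%_. 0", OF refl _ refl, THEN iffD2])
 (use 1 ev in \<open>auto simp: exp_bump_def elim!: eventually_mono\<close>)
 next
 case 2
 \<comment> \<open>The difference quotient at the origin is again a member of the family, with index
   \<open>k + 1\<close>, whose limit at 0 is known.\<close>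
 have "((%h. (exp_bump k (0 + h) - exp_bump k 0) / h) \<longlongrightarrow> 0) (at 0)"
 using tendsto_exp_bump_0[of "k + 1"]
 by (rule Lim_transform_eventually) (auto simp: eventually_at_filter exp_bump_def)
 then show ?thesis using 2 by (simp add: DERIV_def exp_bump_def)
 next
 case 3
 then have ev: "\<forall>\<^sub>F r in nhds s. 0 < r" by (auto simp: eventually_nhds_in_open[OF open_greaterThan, simplified])
 show ?thesis
 proof (rule DERIV_cong_ev[where g = "%r. exp (- 1 / r) / r ^ k", OF refl _ refl, THEN iffD2])
 show "\<forall>\<^sub>F r in nhds s. exp_bump k r = exp (- 1 / r) / r ^ k"
 using ev by (rule eventually_mono) (simp add: exp_bump_def)
 have "((%r. exp (- 1 / r) / r ^ k) has_real_derivative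
 (exp (- 1 / s) * (1 / s\<^sup>2) * s ^ k - exp (- 1 / s) * (real k * s ^ (k - 1))) / (s ^ k * s ^ k)) (at s)"
 using 3 by (auto intro!: derivative_eq_intros simp: power2_eq_square)
 also have "(exp (- 1 / s) * (1 / s\<^sup>2) * s ^ k - exp (- 1 / s) * (real k * s ^ (k - 1))) / (s ^ k * s ^ k)
 = exp_bump (k + 2) s - real k * exp_bump (k + 1) s"
 using 3 by (cases k) (simp_all add: exp_bump_def field_simps power2_eq_square)
 finally show "((%r. exp (- 1 / r) / r ^ k) has_real_derivative
 exp_bump (k + 2) s - real k * exp_bump (k + 1) s) (at s)" .
 qed
 qed
qed

lemma smooth_exp_bump: "smooth (exp_bump k)"
proof (rule smooth_falgebra)
 \<comment> \<open>Constants are generators too, because the coefficients of the derivative formula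
   enter as factors.\<close>
 let ?S = "range exp_bump \<union> range (%c _. c)"
 show "exp_bump k : falgebra ?S" by (intro falgebra.base) auto
 fix f assume "f : ?S"
 then consider k where "f = exp_bump k" | c where "f = (%_. c)" by auto
 note cases = this
 show "f differentiable at x" for x
 using cases
 by cases (auto intro!: differentiableI has_field_derivative_imp_has_derivative[OF exp_bump_has_derivative])
 show "ddir v f : falgebra ?S" for v
 proof (use cases in cases)
 fix k assume f: "f = exp_bump k"
 have "ddir v f = (%s. v * exp_bump (k + 2) s + (v * - real k) * exp_bump (k + 1) s)"
 unfolding f
 using ddir_eq[OF has_field_derivative_imp_has_derivative[OF exp_bump_has_derivative]]
 by (auto simp: algebra_simps)
 moreover have "(%s. v * exp_bump (k + 2) s + (v * - real k) * exp_bump (k + 1) s) : falgebra ?S"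
 by (rule falgebra.add; rule falgebra.mult; rule falgebra.base) auto
 ultimately show ?thesis by simp
 next
 fix c assume "f = (%_. c)"
 then have "ddir v f = (%_. 0)" by simp
 then show ?thesis using falgebra.base[of "%_. 0" ?S] by auto
 qed
qed

text \<open>A factor exp(-1/(n r)) tends to 1 as \<open>n\<close> grows if r > 0, and it is cut off
  to 0 for r <= 0. Hence these functions stay below the indicator of the open box and converge to it
  at every point.\<close>

definition box_bump :: "nat => 'a::euclidean_space => 'a => 'a => real"
 where "box_bump n l u x =
 (\<Prod>b\<in>Basis. exp_bump 0 (real n * ((x - l) \<bullet> b)) * exp_bump 0 (real n * ((u - x) \<bullet> b)))"

lemma exp_bump_0_bounds: "0 <= exp_bump 0 s" "exp_bump 0 s <= 1"
 by (auto simp: exp_bump_def)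

lemma box_bump_bounds: "0 <= box_bump n l u x" "box_bump n l u x <= indicator (box l u) x"
proof -
 show "0 <= box_bump n l u x"
 unfolding box_bump_def by (intro prod_nonneg mult_nonneg_nonneg exp_bump_0_bounds)
 show "box_bump n l u x <= indicator (box l u) x"
 proof (cases "x : box l u")
 case True
 then show ?thesis unfolding box_bump_def
 by (simp, intro prod_le_1 conjI mult_nonneg_nonneg mult_le_one exp_bump_0_bounds)
 next
 case False
 then obtain b where b: "b : Basis" "(x - l) \<bullet> b <= 0 \<or> (u - x) \<bullet> b <= 0"
 by (auto simp: mem_box inner_diff_left not_less)
 have "\<not> 0 < real n * ((x - l) \<bullet> b) \<or> \<not> 0 < real n * ((u - x) \<bullet> b)"
 using b(2) by (auto simp: zero_less_mult_iff)
 then have "exp_bump 0 (real n * ((x - l) \<bullet> b)) * exp_bump 0 (real n * ((u - x) \<bullet> b)) = 0"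
 by (auto simp: exp_bump_def)
 then have "box_bump n l u x = 0"
 unfolding box_bump_def using b(1) by (intro prod_zero) auto
 then show ?thesis using False by simp
 qed
qed

lemma box_bump_eq_0: "x \<notin> box l u ==> box_bump n l u x = 0"
 using box_bump_bounds[of n l u x] by simp

lemma box_bump_tendsto: "(%n. box_bump n l u x) ----> indicator (box l u) x"
proof (cases "x : box l u")
 case True
 have *: "(%n. exp_bump 0 (real n * r)) ----> 1" if "0 < r" for r
 proof -
 have "(%n. exp (- (1 / r) * inverse (real n))) ----> exp (- (1 / r) * 0)"
 by (intro tendsto_intros lim_inverse_n)
 moreover have "\<forall>\<^sub>F n in sequentially. exp (- (1 / r) * inverse (real n)) = exp_bump 0 (real n * r)"
 using that by (intro eventually_sequentiallyI[of 1]) (auto simp: exp_bump_def field_simps)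
 ultimately show ?thesis by (simp add: Lim_transform_eventually)
 qed
 have "(%n. box_bump n l u x) ----> (\<Prod>b\<in>(Basis::'a set). 1 * 1)"
 unfolding box_bump_def using True
 by (intro tendsto_prod tendsto_mult *) (auto simp: mem_box inner_diff_left)
 then show ?thesis using True by simp
next
 case False
 then show ?thesis by (simp add: box_bump_eq_0)
qed

lemma box_bump_test_function:
 fixes l u :: "'a::euclidean_space"
 assumes "cbox l u \<subseteq> S" shows "box_bump n l u : test_functions S"
proof (rule test_functionsI[OF _ compact_cbox assms])
 have lin: "bounded_linear (%x::'a. r * (x \<bullet> b))" for r b
 by (intro bounded_linear_intros)
 have "smooth (%x::'a. exp_bump 0 (real n * ((x - l) \<bullet> b)))" for b
 using smooth_affine[OF lin[of "real n" b] smooth_exp_bump, of 0 "- real n * (l \<bullet> b)"]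
 by (simp add: inner_diff_left right_diff_distrib)
 moreover have "smooth (%x::'a. exp_bump 0 (real n * ((u - x) \<bullet> b)))" for b
 using smooth_affine[OF lin[of "- real n" b] smooth_exp_bump, of 0 "real n * (u \<bullet> b)"]
 by (simp add: inner_diff_left right_diff_distrib)
 ultimately show "smooth (box_bump n l u)"
 unfolding box_bump_def by (intro smooth_prod smooth_mult)
 show "box_bump n l u x = 0" if "x \<notin> cbox l u" for x
 using that box_subset_cbox[of l u] by (auto intro: box_bump_eq_0)
qed

text \<open>The positive and negative parts of \<open>g\<close> are densities of two measures that
  agree on open boxes. Open boxes form an intersection-stable generator of the Borel sets, so the
  measures coincide, and then so do the densities almost everywhere.\<close>

lemma AE_zero_if_integral_boxes_zero:
 fixes g :: "'a::euclidean_space => real"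
 assumes g: "integ g" and zero: "!!l u. (LI x. indicator (box l u) x * g x) = 0"
 shows "AE x in lborel. g x = 0"
proof -
 have [measurable]: "g : BM" using g by simp
 let ?p = "%x. ennreal (max 0 (g x))" and ?m = "%x. ennreal (max 0 (- g x))"
 let ?E = "range (%(a, b). box a b::'a set)"
 have int_p: "integ (%x. indicator (box l u) x * max 0 (g x))" for l u
 using integrable_mult_indicator[of "box l u" lborel "%x. max 0 (g x)"] g by simp
 have int_m: "integ (%x. indicator (box l u) x * max 0 (- g x))" for l u
 using integrable_mult_indicator[of "box l u" lborel "%x. max 0 (- g x)"] g by simp
 have box_p: "emeasure (density lborel ?p) (box l u) = ennreal (LI x. indicator (box l u) x * max 0 (g x))" for l u
 proof -
 have "emeasure (density lborel ?p) (box l u) = (\<integral>\<^sup>+x. ennreal (indicator (box l u) x * max 0 (g x)) \<partial>lborel)"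
 by (subst emeasure_density) (auto intro!: nn_integral_cong simp: indicator_def)
 also have "... = ennreal (LI x. indicator (box l u) x * max 0 (g x))"
 using int_p by (intro nn_integral_eq_integral) auto
 finally show ?thesis .
 qed
 have box_m: "emeasure (density lborel ?m) (box l u) = ennreal (LI x. indicator (box l u) x * max 0 (- g x))" for l u
 proof -
 have "emeasure (density lborel ?m) (box l u) = (\<integral>\<^sup>+x. ennreal (indicator (box l u) x * max 0 (- g x)) \<partial>lborel)"
 by (subst emeasure_density) (auto intro!: nn_integral_cong simp: indicator_def)
 also have "... = ennreal (LI x. indicator (box l u) x * max 0 (- g x))"
 using int_m by (intro nn_integral_eq_integral) auto
 finally show ?thesis .
 qed
 have eq: "(LI x. indicator (box l u) x * max 0 (g x)) = (LI x. indicator (box l u) x * max 0 (- g x))" for l u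
 proof -
 have "(LI x. indicator (box l u) x * max 0 (g x)) - (LI x. indicator (box l u) x * max 0 (- g x))
 = (LI x. indicator (box l u) x * g x)"
 unfolding bo_integral_diff[OF int_p int_m, symmetric]
 by (intro Bochner_Integration.integral_cong) (auto simp: max_def)
 then show ?thesis using zero by simp
 qed
 have "density lborel ?p = density lborel ?m"
 proof (rule measure_eqI_generator_eq)
 show "Int_stable ?E" by (auto simp: Int_stable_def box_Int_box)
 show "?E \<subseteq> Pow UNIV" by simp
 show "sets (density lborel ?p) = sigma_sets UNIV ?E" "sets (density lborel ?m) = sigma_sets UNIV ?E"
 by (simp_all add: borel_eq_box)
 let ?A = "%n::nat. box (- (real n *\<^sub>R One)) (real n *\<^sub>R One) :: 'a set"
 show "range ?A \<subseteq> ?E" "(\<Union>i. ?A i) = UNIV"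
 unfolding UN_box_eq_UNIV by auto
 show "emeasure (density lborel ?p) (?A i) ~= \<infinity>" for i by (simp add: box_p)
 show "emeasure (density lborel ?p) X = emeasure (density lborel ?m) X" if "X : ?E" for X
 using that by (auto simp: box_p box_m eq)
 qed
 then have "AE x in lborel. ?p x = ?m x"
 by (intro sigma_finite_measure.density_unique sigma_finite_lborel) auto
 then show ?thesis by eventually_elim (auto simp: max_def split: if_splits)
qed

text \<open>Since \<open>f\<close> is controlled only on closed boxes inside \<open>S\<close>,
  vanishing is shown box by box, and an open set is a countable union of closed boxes. Indicators of
  open boxes are reached from test functions by dominated convergence along
  \<open>box_bump\<close>.\<close>

lemma fundamental_lemma:
 fixes f :: "'a::euclidean_space => real"
 assumes S: "open S" and f: "!!l u. cbox l u \<subseteq> S ==> sinteg (cbox l u) f"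
 and zero: "!!ph. ph : test_functions S ==> (LI x. f x * ph x) = 0"
 shows "AE x in lborel. x : S \<longrightarrow> f x = 0"
proof -
 have box_zero: "(LI x. indicator (box l u) x * f x) = 0" if "cbox l u \<subseteq> S" for l u
 proof -
 let ?F = "%x. indicator (cbox l u) x * f x"
 have F: "integ ?F" using f[OF that] by (simp add: set_integrable_def)
 have [measurable]: "?F : BM" using F by simp
 have [measurable]: "box_bump n l u : BM" for n
 using box_bump_test_function[OF that] by measurable
 have F_eq: "f x * box_bump n l u x = ?F x * box_bump n l u x" for n x
 using box_bump_eq_0[of x l u n] box_subset_cbox[of l u] by (auto simp: indicator_def)
 have "(%n. LI x. ?F x * box_bump n l u x) ----> (LI x. ?F x * indicator (box l u) x)"
 proof (rule integral_dominated_convergence)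
 show "integ (%x. norm (?F x))" using F by simp
 show "AE x in lborel. (%n. ?F x * box_bump n l u x) ----> ?F x * indicator (box l u) x"
 by (intro AE_I2 tendsto_mult tendsto_const box_bump_tendsto)
 have "box_bump n l u x <= 1" for n x
 using box_bump_bounds(2)[of n l u x] by (rule order_trans) (simp add: indicator_def)
 then show "AE x in lborel. norm (?F x * box_bump n l u x) <= norm (?F x)" for n
 using box_bump_bounds(1)[of n l u] by (intro AE_I2) (auto simp: abs_mult intro!: mult_left_le)
 qed measurable
 moreover have "(LI x. ?F x * box_bump n l u x) = 0" for n
 using zero[OF box_bump_test_function[OF that, of n]] by (simp add: F_eq)
 ultimately have "(LI x. ?F x * indicator (box l u) x) = 0"
 by (simp add: LIMSEQ_const_iff)
 moreover have "?F x * indicator (box l u) x = indicator (box l u) x * f x" for x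
 using box_subset_cbox[of l u] by (auto simp: indicator_def)
 ultimately show ?thesis by simp
 qed
 have ae_cbox: "AE x in lborel. x : cbox L U \<longrightarrow> f x = 0" if LU: "cbox L U \<subseteq> S" for L U
 proof -
 let ?g = "%x. indicator (box L U) x * f x"
 have "AE x in lborel. ?g x = 0"
 proof (rule AE_zero_if_integral_boxes_zero)
 have "sinteg (box L U) f"
 using f[OF LU] by (rule set_integrable_subset) (auto simp: box_subset_cbox)
 then show "integ ?g" by (simp add: set_integrable_def)
 fix l u
 obtain l' u' where b: "box l u \<inter> box L U = box l' u'" using box_Int_box[of l u L U] by blast
 show "(LI x. indicator (box l u) x * ?g x) = 0"
 \<comment> \<open>If the open box is empty, its closed counterpart may still be nonempty and leave
   \<open>S\<close>; in that case the integral vanishes simply because the integrand is 0.\<close>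
 proof (cases "box l' u' = {}")
 case True
 then have "(%x. indicator (box l u) x * ?g x) = (%x. 0)"
 using b by (auto simp: indicator_def fun_eq_iff)
 then show ?thesis by (simp only: bo_integral_zero)
 next
 case False
 have "closure (box l' u') \<subseteq> closure (box L U)" using b by (intro closure_mono) auto
 then have "cbox l' u' \<subseteq> S"
 using False LU closure_box[of l' u'] closure_minimal[OF box_subset_cbox[of L U] closed_cbox]
 by (metis order_trans)
 from box_zero[OF this] show ?thesis
 unfolding b[symmetric] by (simp add: indicator_inter_arith mult.assoc)
 qed
 qed
 moreover have "AE x in lborel. x \<notin> cbox L U - box L U"
 using null_sets_cbox_Diff_box by (rule AE_not_in)
 ultimately show ?thesis by eventually_elim (auto simp: indicator_def split: if_splits)
 qed
 have "\<exists>\<D>. countable \<D> \<and> \<D> \<subseteq> Pow S \<and> (\<forall>X\<in>\<D>. \<exists>a b. X = cbox a b) \<and> \<Union>\<D> = S"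
 proof (rule open_countable_Union_open_cbox[OF S])
 fix \<D> assume "countable \<D>" "\<D> \<subseteq> Pow S" "!!X. X : \<D> ==> \<exists>a b. X = cbox a b" "\<Union>\<D> = S"
 then show ?thesis by (intro exI[of _ \<D>] conjI ballI)
 qed
 then obtain \<D> where D: "countable \<D>" "\<D> \<subseteq> Pow S" "\<forall>X\<in>\<D>. \<exists>a b. X = cbox a b" "\<Union>\<D> = S"
 by blast
 have "AE x in lborel. \<forall>X\<in>\<D>. x : X \<longrightarrow> f x = 0"
 unfolding AE_ball_countable[OF D(1)]
 proof
 fix X assume "X : \<D>"
 then obtain a b where "X = cbox a b" using D(3) by auto
 then show "AE x in lborel. x : X \<longrightarrow> f x = 0" using ae_cbox[of a b] D(2) \<open>X : \<D>\<close> by auto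
 qed
 then show ?thesis by eventually_elim (use D(4) in blast)
qed

subsection \<open>Square-integrable functions\<close>

lemma integral_Cauchy_Schwarz:
 fixes f g :: "'a => real"
 assumes [measurable]: "f : borel_measurable M" "g : borel_measurable M"
 and f: "integrable M (%x. (f x)\<^sup>2)" and g: "integrable M (%x. (g x)\<^sup>2)"
 shows "integrable M (%x. f x * g x)"
 and "(\<integral>x. f x * g x \<partial>M)\<^sup>2 <= (\<integral>x. (f x)\<^sup>2 \<partial>M) * (\<integral>x. (g x)\<^sup>2 \<partial>M)"
proof -
 have "integrable M (%x. (f x)\<^sup>2 + (g x)\<^sup>2)" using f g by simp
 then show fg: "integrable M (%x. f x * g x)"
 proof (rule bo_integrable_bound)
 have "\<bar>f x * g x\<bar> <= \<bar>(f x)\<^sup>2 + (g x)\<^sup>2\<bar>" for x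
 proof -
 have "0 <= \<bar>f x\<bar> * \<bar>g x\<bar>" by simp
 moreover have "2 * (\<bar>f x\<bar> * \<bar>g x\<bar>) <= (f x)\<^sup>2 + (g x)\<^sup>2"
 using sum_squares_bound[of "\<bar>f x\<bar>" "\<bar>g x\<bar>"] by (simp add: mult.assoc)
 ultimately have "\<bar>f x\<bar> * \<bar>g x\<bar> <= (f x)\<^sup>2 + (g x)\<^sup>2" by linarith
 then show ?thesis by (simp add: abs_mult)
 qed
 then show "AE x in M. norm (f x * g x) <= norm ((f x)\<^sup>2 + (g x)\<^sup>2)" by simp
 qed measurable
 define A B C where "A = (\<integral>x. (f x)\<^sup>2 \<partial>M)" and "B = (\<integral>x. (g x)\<^sup>2 \<partial>M)" and "C = (\<integral>x. f x * g x \<partial>M)"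
 \<comment> \<open>A nonnegative quadratic polynomial in \<open>t\<close> has nonpositive
   discriminant; below this is read off at the minimiser t = -C/B.\<close>
 have quad: "0 <= A + 2 * t * C + t\<^sup>2 * B" for t
 proof -
 have "0 <= (\<integral>x. (f x + t * g x)\<^sup>2 \<partial>M)" by simp
 also have "... = (\<integral>x. (f x)\<^sup>2 + 2 * t * (f x * g x) + t\<^sup>2 * (g x)\<^sup>2 \<partial>M)"
 by (intro bo_cong refl) (simp add: power2_eq_square algebra_simps)
 also have "... = A + 2 * t * C + t\<^sup>2 * B" using f g fg by (simp add: A_def B_def C_def)
 finally show ?thesis .
 qed
 have B: "0 <= B" by (simp add: B_def)
 have "C\<^sup>2 <= A * B"
 proof (cases "B = 0")
 case True
 have "C = 0"
 proof (rule ccontr)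
 assume "C ~= 0"
 \<comment> \<open>This value of \<open>t\<close> turns A + 2tC into -1, while the quadratic term is
   absent.\<close>
 then show False using quad[of "- (A + 1) / (2 * C)"] True by (simp add: field_simps)
 qed
 then show ?thesis using True by simp
 next
 case False
 have "0 <= (A + 2 * (- C / B) * C + (- C / B)\<^sup>2 * B) * B"
 using quad B by (intro mult_nonneg_nonneg)
 also have "... = A * B - C\<^sup>2" using False by (simp add: field_simps power2_eq_square)
 finally show ?thesis by simp
 qed
 then show "(\<integral>x. f x * g x \<partial>M)\<^sup>2 <= (\<integral>x. (f x)\<^sup>2 \<partial>M) * (\<integral>x. (g x)\<^sup>2 \<partial>M)"
 by (simp add: A_def B_def C_def)
qed

lemma L2_real_iff:
 "(f :: 'a::euclidean_space => real) : L2 \<longleftrightarrow> f : BM \<and> integ (%x. (f x)\<^sup>2)"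
 by (simp add: L2_def)

lemma L2_measurable [measurable_dest]: "f : L2 ==> f : BM"
 by (simp add: L2_def)

lemma L2_sq_integrable: "(f :: 'a::euclidean_space => real) : L2 ==> integ (%x. (f x)\<^sup>2)"
 by (simp add: L2_def)

lemma L2_mult_integrable:
 fixes f g :: "'a::euclidean_space => real"
 assumes "f : L2" "g : L2" shows "integ (%x. f x * g x)"
 using assms by (intro integral_Cauchy_Schwarz) (auto simp: L2_real_iff)

lemma L2_norm_nonneg [simp]: "0 <= L2_norm f"
 by (simp add: L2_norm_def)

lemma L2_norm_sq: "(L2_norm (f :: 'a::euclidean_space => real))\<^sup>2 = (LI x. (f x)\<^sup>2)"
 by (simp add: L2_norm_def)

lemma L2_Cauchy_Schwarz:
 fixes f g :: "'a::euclidean_space => real"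
 assumes "f : L2" "g : L2" shows "\<bar>LI x. f x * g x\<bar> <= L2_norm f * L2_norm g"
proof (rule power2_le_imp_le)
 show "\<bar>LI x. f x * g x\<bar>\<^sup>2 <= (L2_norm f * L2_norm g)\<^sup>2"
 using integral_Cauchy_Schwarz(2)[of f lborel g] assms by (simp add: L2_real_iff power_mult_distrib L2_norm_sq)
qed simp

lemma L2_abs: "(f :: 'a::euclidean_space => real) : L2 ==> (%x. \<bar>f x\<bar>) : L2"
 by (auto simp: L2_real_iff)

lemma L2_norm_abs: "L2_norm (%x. \<bar>f x :: real\<bar>) = L2_norm f"
 by (simp add: L2_norm_def)

lemma L2_cmult: "(f :: 'a::euclidean_space => real) : L2 ==> (%x. c * f x) : L2"
 by (auto simp: L2_real_iff power_mult_distrib)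

lemma L2_norm_cmult: "L2_norm (%x. c * f x :: real) = \<bar>c\<bar> * L2_norm f"
 by (simp add: L2_norm_def power_mult_distrib real_sqrt_mult)

lemma L2_add:
 fixes f g :: "'a::euclidean_space => real"
 assumes "f : L2" "g : L2" shows "(%x. f x + g x) : L2"
proof -
 have "integ (%x. (f x)\<^sup>2 + 2 * (f x * g x) + (g x)\<^sup>2)"
 using assms by (intro bo_integrable_add integrable_mult_right L2_mult_integrable L2_sq_integrable)
 then show ?thesis using assms by (auto simp: L2_real_iff power2_sum algebra_simps)
qed

lemma L2_minus: "(f :: 'a::euclidean_space => real) : L2 ==> (%x. - f x) : L2"
 by (auto simp: L2_real_iff)

lemma L2_diff: "(f :: 'a::euclidean_space => real) : L2 ==> g : L2 ==> (%x. f x - g x) : L2"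
 using L2_add[OF _ L2_minus, of f g] by simp

lemma L2_zero: "(%x. 0 :: real) : L2"
 by (simp add: L2_real_iff)

lemma L2_sum: "(!!i. i : I ==> (f i :: 'a::euclidean_space => real) : L2) ==> (%x. \<Sum>i\<in>I. f i x) : L2"
 by (induction I rule: infinite_finite_induct) (auto intro: L2_zero L2_add)

lemma L2_norm_add_sq:
 fixes f g :: "'a::euclidean_space => real"
 assumes "f : L2" "g : L2"
 shows "(L2_norm (%x. f x + g x))\<^sup>2 = (L2_norm f)\<^sup>2 + 2 * (LI x. f x * g x) + (L2_norm g)\<^sup>2"
proof -
 have "(LI x. (f x + g x)\<^sup>2) = (LI x. (f x)\<^sup>2 + 2 * (f x * g x) + (g x)\<^sup>2)"
 by (intro bo_cong refl) (simp add: power2_eq_square algebra_simps)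
 then show ?thesis
 using L2_mult_integrable[OF assms] assms by (simp add: L2_norm_sq L2_sq_integrable)
qed

lemma L2_triangle:
 fixes f g :: "'a::euclidean_space => real"
 assumes "f : L2" "g : L2" shows "L2_norm (%x. f x + g x) <= L2_norm f + L2_norm g"
proof (rule power2_le_imp_le)
 show "(L2_norm (%x. f x + g x))\<^sup>2 <= (L2_norm f + L2_norm g)\<^sup>2"
 using L2_Cauchy_Schwarz[OF assms] unfolding L2_norm_add_sq[OF assms] power2_sum by linarith
qed simp

lemma L2_norm_minus: "L2_norm (%x. - f x :: real) = L2_norm f"
 by (simp add: L2_norm_def)

lemma L2_norm_diff_commute: "L2_norm (%x. f x - g x :: real) = L2_norm (%x. g x - f x)"
 by (simp add: L2_norm_def power2_commute)

lemma L2_triangle_diff: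
 fixes f g :: "'a::euclidean_space => real"
 assumes "f : L2" "g : L2" shows "L2_norm (%x. f x - g x) <= L2_norm f + L2_norm g"
 using L2_triangle[OF assms(1) L2_minus[OF assms(2)]] by (simp add: L2_norm_minus)

lemma L2_triangle3:
 fixes f g h :: "'a::euclidean_space => real"
 assumes "f : L2" "g : L2" "h : L2"
 shows "L2_norm (%x. f x - h x) <= L2_norm (%x. f x - g x) + L2_norm (%x. g x - h x)"
 using L2_triangle[OF L2_diff[OF assms(1,2)] L2_diff[OF assms(2,3)]] by simp

lemma L2_norm_le_add:
 fixes f g :: "'a::euclidean_space => real"
 assumes "f : L2" "g : L2" shows "L2_norm f <= L2_norm g + L2_norm (%x. f x - g x)"
 using L2_triangle[OF assms(2) L2_diff[OF assms]] by simp

lemma L2_norm_sum_le: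
 assumes "finite I" "!!i. i : I ==> (f i :: 'a::euclidean_space => real) : L2"
 shows "L2_norm (%x. \<Sum>i\<in>I. f i x) <= (\<Sum>i\<in>I. L2_norm (f i))"
 using assms
proof (induction I)
 case empty then show ?case by (simp add: L2_norm_def)
next
 case (insert i I)
 then show ?case using L2_triangle[of "f i" "%x. \<Sum>i\<in>I. f i x"] by (force intro: L2_sum)
qed

lemma L2_cong_AE:
 fixes f g :: "'a::euclidean_space => 'b::euclidean_space"
 assumes "f : L2" "g : BM" "AE x in lborel. f x = g x"
 shows "g : L2"
proof -
 have [measurable]: "f : BM" "g : BM" using assms by (auto simp: L2_def)
 have "integ (%x. (norm (f x))\<^sup>2) \<longleftrightarrow> integ (%x. (norm (g x))\<^sup>2)"
 by (intro integrable_cong_AE) (use assms(3) in auto)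
 then show ?thesis using assms by (simp add: L2_def)
qed

lemma L2_norm_cong_AE:
 assumes [measurable]: "f : BM" "g : BM"
 and "AE x in lborel. f x = g x"
 shows "L2_norm f = L2_norm g"
 unfolding L2_norm_def using assms(3) by (intro arg_cong[where f = sqrt] integral_cong_AE) auto


lemma L2_set_integrable:
 fixes f :: "'a::euclidean_space => real"
 assumes "f : L2" "A : sets borel" "emeasure lborel A < \<infinity>"
 shows "sinteg A f"
 unfolding set_integrable_def
proof (rule bo_integrable_bound)
 show "integ (%x. indicator A x + (f x)\<^sup>2)"
 using assms by (intro bo_integrable_add L2_sq_integrable integrable_real_indicator) auto
 have "\<bar>f x\<bar> <= 1 + (f x)\<^sup>2" for x
 using sum_squares_bound[of "\<bar>f x\<bar>" 1] by simp
 then show "AE x in lborel. norm (indicator A x *\<^sub>R f x) <= norm (indicator A x + (f x)\<^sup>2 :: real)"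
 by (auto simp: indicator_def abs_of_nonneg)
 show "(%x. indicator A x *\<^sub>R f x) : borel_measurable lborel"
 using assms by measurable
qed

lemma L2_Fatou:
 fixes f :: "nat => 'a::euclidean_space => real"
 assumes f: "!!n. f n : L2" and lim: "AE x in lborel. (%n. f n x) ----> h x"
 and h: "h : BM" and C: "0 <= C" "\<forall>\<^sub>F n in sequentially. L2_norm (f n) <= C"
 shows "h : L2" "L2_norm h <= C"
proof -
 have [measurable]: "f n : BM" for n using f by (simp add: L2_def)
 have [measurable]: "h : BM" by fact
 have fn: "(\<integral>\<^sup>+x. ennreal ((f n x)\<^sup>2) \<partial>lborel) = ennreal ((L2_norm (f n))\<^sup>2)" for n
 unfolding L2_norm_sq using L2_sq_integrable[OF f] by (intro nn_integral_eq_integral) auto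
 have "(\<integral>\<^sup>+x. ennreal ((h x)\<^sup>2) \<partial>lborel) <= (\<integral>\<^sup>+x. liminf (%n. ennreal ((f n x)\<^sup>2)) \<partial>lborel)"
 proof (rule nn_integral_mono_AE)
 show "AE x in lborel. ennreal ((h x)\<^sup>2) <= liminf (%n. ennreal ((f n x)\<^sup>2))"
 using lim
 proof eventually_elim
 case (elim x)
 then have "(%n. ennreal ((f n x)\<^sup>2)) ----> ennreal ((h x)\<^sup>2)"
 by (intro tendsto_ennrealI tendsto_power)
 from lim_imp_Liminf[OF _ this] show ?case by simp
 qed
 qed
 also have "... <= liminf (%n. \<integral>\<^sup>+x. ennreal ((f n x)\<^sup>2) \<partial>lborel)"
 by (rule nn_integral_liminf) measurable
 also have "... <= liminf (%n. ennreal (C\<^sup>2))"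
 using C(2) unfolding fn
 by (intro Liminf_mono) (auto elim!: eventually_mono intro!: ennreal_leI power_mono)
 finally have le: "(\<integral>\<^sup>+x. ennreal ((h x)\<^sup>2) \<partial>lborel) <= ennreal (C\<^sup>2)" by (simp add: Liminf_const)
 then have "(\<integral>\<^sup>+x. ennreal ((h x)\<^sup>2) \<partial>lborel) < \<infinity>" by (auto simp: less_top intro: le_less_trans)
 then have int: "integ (%x. (h x)\<^sup>2)" by (intro integrableI_nonneg) auto
 then show "h : L2" using h by (simp add: L2_real_iff)
 have "(L2_norm h)\<^sup>2 <= C\<^sup>2"
 using le nn_integral_eq_integral[OF int] by (simp add: L2_norm_sq)
 then show "L2_norm h <= C" using C(1) by (rule power2_le_imp_le)
qed

text \<open>By monotone convergence the series of squares has a finite integral, so it converges for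
  almost every \<open>x\<close> and its terms tend to 0.\<close>

lemma L2_summable_AE:
 fixes f :: "nat => 'a::euclidean_space => real"
 assumes f: "!!n. f n : L2" and sum: "summable (%n. (L2_norm (f n))\<^sup>2)"
 shows "AE x in lborel. (%n. f n x) ----> 0"
proof -
 have [measurable]: "f n : BM" for n using f by (simp add: L2_def)
 have fn: "(\<integral>\<^sup>+x. ennreal ((f n x)\<^sup>2) \<partial>lborel) = ennreal ((L2_norm (f n))\<^sup>2)" for n
 unfolding L2_norm_sq using L2_sq_integrable[OF f] by (intro nn_integral_eq_integral) auto
 have "(\<integral>\<^sup>+x. (\<Sum>n. ennreal ((f n x)\<^sup>2)) \<partial>lborel) = (\<Sum>n. ennreal ((L2_norm (f n))\<^sup>2))"
 unfolding fn[symmetric] by (rule nn_integral_suminf) measurable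
 also have "... = ennreal (\<Sum>n. (L2_norm (f n))\<^sup>2)" using sum by (intro suminf_ennreal2) auto
 finally have "(\<integral>\<^sup>+x. (\<Sum>n. ennreal ((f n x)\<^sup>2)) \<partial>lborel) ~= \<infinity>" by simp
 then have "AE x in lborel. (\<Sum>n. ennreal ((f n x)\<^sup>2)) ~= \<infinity>"
 by (intro nn_integral_PInf_AE) measurable
 then show ?thesis
 proof eventually_elim
 case (elim x)
 then have "summable (%n. (f n x)\<^sup>2)" by (intro summable_suminf_not_top) auto
 then have "(%n. sqrt ((f n x)\<^sup>2)) ----> sqrt 0"
 by (intro tendsto_real_sqrt summable_LIMSEQ_zero)
 then show ?case by (simp add: tendsto_rabs_zero_iff)
 qed
qed

section \<open>Completeness, Riesz representation and density of test functions in
  \<open>L2\<close>\<close>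

lemma summable_quarter:
 fixes a :: "nat => real"
 assumes "!!n. 0 <= a n" "!!n. a n <= (1/4)^n" shows "summable a"
proof (rule summable_comparison_test')
 show "summable (%n. (1/4::real)^n)" by (rule summable_geometric) simp
 show "norm (a n) <= (1/4)^n" for n using assms(1)[of n] assms(2)[of n] by simp
qed

lemma L2_complete:
 fixes f :: "nat => 'a::euclidean_space => real"
 assumes f: "!!n. f n : L2"
 and Cauchy: "!!e. 0 < e ==> \<exists>N. \<forall>m\<ge>N. \<forall>n\<ge>N. L2_norm (%x. f m x - f n x) <= e"
 obtains h where "h : L2" "(%n. L2_norm (%x. f n x - h x)) ----> 0"
proof -
 have "\<exists>N. \<forall>k. (\<forall>m\<ge>N k. \<forall>n\<ge>N k. L2_norm (%x. f m x - f n x) <= (1/4)^k)"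
 by (rule choice) (auto intro: Cauchy)
 then obtain N where N: "!!k m n. m \<ge> N k ==> n \<ge> N k ==> L2_norm (%x. f m x - f n x) <= (1/4)^k" by blast
 \<comment> \<open>The sum makes \<open>r k\<close> at least as large as each of N 0, ..., N k, so
   the subsequence meets every accuracy up to 4^-k from index \<open>k\<close> on.\<close>
 define r where "r k = k + (\<Sum>j\<le>k. N j)" for k
 have r_N: "N k <= r m" if "k <= m" for k m
 unfolding r_def using member_le_sum[of k "{..m}" N] that by force
 have r_ge: "k <= r k" for k by (simp add: r_def)
 have [measurable]: "f n : BM" for n using f by (simp add: L2_def)
 define g where "g k = f (r k)" for k
 \<comment> \<open>The squared norms of the rescaled increments are at most 4^-k, hence summable, so
   \<open>d k x\<close> tends to 0 almost everywhere. This forces the increments themselves below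
   2^-k eventually and makes the telescoping series converge absolutely.\<close>
 define d where "d k x = 2^k * (g (Suc k) x - g k x)" for k x
 have d: "d k : L2" for k unfolding d_def g_def by (intro L2_cmult L2_diff f)
 have "L2_norm (d k) <= (1/2)^k" for k
 proof -
 have "L2_norm (d k) = 2^k * L2_norm (%x. g (Suc k) x - g k x)"
 unfolding d_def L2_norm_cmult by simp
 also have "... <= 2^k * (1/4)^k" unfolding g_def by (intro mult_left_mono N r_N) auto
 finally show ?thesis by (simp add: power_mult_distrib[symmetric])
 qed
 then have d4: "(L2_norm (d k))\<^sup>2 <= (1/4)^k" for k
 proof -
 have "(L2_norm (d k))\<^sup>2 <= ((1/2)^k)\<^sup>2"
 using \<open>!!k. L2_norm (d k) <= (1/2)^k\<close> by (intro power_mono) auto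
 also have "((1/2)^k)\<^sup>2 = (1/4::real)^k"
 unfolding power2_eq_square power_mult_distrib[symmetric] by simp
 finally show ?thesis .
 qed
 have "summable (%k. (L2_norm (d k))\<^sup>2)"
 using d4 by (intro summable_quarter zero_le_power2)
 with d have "AE x in lborel. (%k. d k x) ----> 0" by (rule L2_summable_AE)
 then have ae: "AE x in lborel. convergent (%k. g k x)"
 proof eventually_elim
 case (elim x)
 then obtain K where K: "!!k. k \<ge> K ==> \<bar>d k x\<bar> < 1" using LIMSEQ_D[OF elim, of 1] by auto
 have "summable (%k. g (Suc k) x - g k x)"
 proof (rule summable_comparison_test'[where g = "%k. (1/2)^k" and N = K])
 fix k assume "k \<ge> K"
 from K[OF this] have "2^k * \<bar>g (Suc k) x - g k x\<bar> < 1" by (simp add: d_def abs_mult)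
 then show "norm (g (Suc k) x - g k x) <= (1/2)^k"
 by (simp add: power_one_over pos_le_divide_eq mult.commute)
 qed (simp add: summable_geometric)
 then have "convergent (%n. \<Sum>k<n. g (Suc k) x - g k x)" by (simp add: summable_iff_convergent)
 then have "convergent (%n. g n x - g 0 x)" unfolding sum_lessThan_telescope[of "%k. g k x"] .
 then show ?case by (simp add: convergent_diff_const_right_iff)
 qed
 define h where "h x = lim (%k. g k x)" for x
 have [measurable]: "g k : BM" for k unfolding g_def by measurable
 have h[measurable]: "h : BM" unfolding h_def by measurable
 have lim: "AE x in lborel. (%k. g k x) ----> h x"
 using ae by eventually_elim (simp add: h_def convergent_LIMSEQ_iff)
 \<comment> \<open>Fatou's lemma along the subsequence gives membership in \<open>L2\<close> and the
   norm bound for every late index \<open>m\<close>, so the full sequence converges and not only the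
   subsequence.\<close>
 have key: "(%x. f m x - h x) : L2 \<and> L2_norm (%x. f m x - h x) <= (1/4)^k" if "m \<ge> N k" for m k
 proof -
 have a: "(%x. f m x - g n x) : L2" for n unfolding g_def by (intro L2_diff f)
 have b: "AE x in lborel. (%n. f m x - g n x) ----> f m x - h x"
 using lim by eventually_elim (intro tendsto_diff tendsto_const)
 have c: "\<forall>\<^sub>F n in sequentially. L2_norm (%x. f m x - g n x) <= (1/4)^k"
 unfolding g_def by (intro eventually_sequentiallyI[of k] N that r_N)
 have "(%x. f m x - h x) : BM" by measurable
 moreover have "0 <= (1/4::real)^k" by simp
 ultimately show ?thesis
 using L2_Fatou(1)[OF a b _ _ c] L2_Fatou(2)[OF a b _ _ c] by blast
 qed
 show thesis
 proof
 show "h : L2" using L2_diff[OF f[of "N 0"] conjunct1[OF key[of 0 "N 0"]]] by simp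
 show "(%n. L2_norm (%x. f n x - h x)) ----> 0"
 proof (rule LIMSEQ_I)
 fix e :: real assume "0 < e"
 then obtain k where k: "(1/4)^k < e" using real_arch_pow_inv[of e "1/4"] by auto
 show "\<exists>no. \<forall>n\<ge>no. norm (L2_norm (%x. f n x - h x) - 0) < e"
 using key[of k] k by (intro exI[of _ "N k"]) (auto intro: le_less_trans)
 qed
 qed
qed

lemma L2_pairing_tendsto:
 fixes f :: "'b => 'a::euclidean_space => real"
 assumes f: "!!n. f n : L2" "h : L2" "((%n. L2_norm (%x. f n x - h x)) \<longlongrightarrow> 0) F" and g: "g : L2"
 shows "((%n. LI x. f n x * g x) \<longlongrightarrow> (LI x. h x * g x)) F"
proof (rule Lim_null[THEN iffD2], rule Lim_null_comparison)
 show "\<forall>\<^sub>F n in F. norm ((LI x. f n x * g x) - (LI x. h x * g x))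
 <= L2_norm (%x. f n x - h x) * L2_norm g"
 proof (rule always_eventually, rule allI)
 fix n
 have "(LI x. f n x * g x) - (LI x. h x * g x) = (LI x. (f n x - h x) * g x)"
 using f g by (simp add: L2_mult_integrable left_diff_distrib)
 then show "norm ((LI x. f n x * g x) - (LI x. h x * g x)) <= L2_norm (%x. f n x - h x) * L2_norm g"
 using L2_Cauchy_Schwarz[OF L2_diff[OF f(1,2)] g] by simp
 qed
 show "((%n. L2_norm (%x. f n x - h x) * L2_norm g) \<longlongrightarrow> 0) F"
 using tendsto_mult_left_zero[OF f(3)] .
qed

lemma L2_norm_tendsto:
 fixes f :: "'b => 'a::euclidean_space => real"
 assumes f: "!!n. f n : L2" "h : L2" "((%n. L2_norm (%x. f n x - h x)) \<longlongrightarrow> 0) F"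
 shows "((%n. L2_norm (f n)) \<longlongrightarrow> L2_norm h) F"
proof (rule Lim_null[THEN iffD2], rule Lim_null_comparison[OF _ f(3)], rule always_eventually, rule allI)
 fix n
 show "norm (L2_norm (f n) - L2_norm h) <= L2_norm (%x. f n x - h x)"
 using L2_norm_le_add[OF f(1,2), of n] L2_norm_le_add[OF f(2,1), of n]
 by (simp add: L2_norm_diff_commute[of h] abs_le_iff)
qed

text \<open>The representing function is the limit of a minimising sequence of $\|f\|^2-2\ell(f)$, which
 is a Cauchy sequence by the parallelogram law.\<close>

lemma L2_Riesz:
 fixes V :: "('a::euclidean_space => real) set" and L :: "('a => real) => real"
 assumes V: "V \<subseteq> L2" "!!f g. f : V ==> g : V ==> (%x. f x + g x) : V"
 "!!c f. f : V ==> (%x. c * f x) : V" and V0: "(%x. 0) : V"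
 and L: "!!f g. f : V ==> g : V ==> L (%x. f x + g x) = L f + L g"
 "!!c f. f : V ==> L (%x. c * f x) = c * L f"
 and C: "0 <= C" "!!f. f : V ==> \<bar>L f\<bar> <= C * L2_norm f"
 obtains h ph where "h : L2" "!!f. f : V ==> (LI x. h x * f x) = L f" "L2_norm h <= C"
 "!!n. ph n : V" "(%n. L2_norm (%x. ph n x - h x)) ----> 0"
proof -
 define J where "J f = (L2_norm f)\<^sup>2 - 2 * L f" for f
 have VL: "f : L2" if "f : V" for f using V that by blast
 have J_bound: "- (C\<^sup>2) <= J f" if "f : V" for f
 proof -
 have "0 <= (L2_norm f - C)\<^sup>2" by simp
 also have "... = (L2_norm f)\<^sup>2 - 2 * (C * L2_norm f) + C\<^sup>2" by (simp add: power2_diff algebra_simps)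
 finally show ?thesis using C(2)[OF that] unfolding J_def by linarith
 qed
 define m where "m = Inf (J ` V)"
 have bdd: "bdd_below (J ` V)" using J_bound by (intro bdd_belowI[of _ "- (C\<^sup>2)"]) auto
 have m_le: "m <= J f" if "f : V" for f unfolding m_def using bdd that by (intro cInf_lower) auto
 have "\<exists>f. \<forall>n. f n : V \<and> J (f n) < m + 1 / real (Suc n)"
 proof (rule choice, rule allI)
 fix n
 have "m < m + 1 / real (Suc n)" by simp
 then obtain y where "y : J ` V" "y < m + 1 / real (Suc n)"
 unfolding m_def using cInf_lessD[of "J ` V" "Inf (J ` V) + 1 / real (Suc n)"] V0 by auto
 then show "\<exists>f. f : V \<and> J f < m + 1 / real (Suc n)" by blast
 qed
 then obtain f where fV: "!!n. f n : V" and fJ: "!!n. J (f n) < m + 1 / real (Suc n)" by blast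
 have J_line: "J (%x. p x + t * q x) = J p + 2 * t * ((LI x. p x * q x) - L q) + t\<^sup>2 * (L2_norm q)\<^sup>2"
 if "p : V" "q : V" for p q t
 proof -
 have "(LI x. p x * (t * q x)) = t * (LI x. p x * q x)"
 by (simp add: mult.left_commute)
 then show ?thesis
 unfolding J_def using that V L VL
 by (simp add: L2_norm_add_sq L2_cmult L2_norm_cmult power_mult_distrib algebra_simps)
 qed
 have par: "(L2_norm (%x. p x - q x))\<^sup>2 <= 2 * (J p - m) + 2 * (J q - m)" if "p : V" "q : V" for p q
 proof -
 let ?d = "%x. p x + - 1 * q x"
 have d: "?d : V" using that V by blast
 have "m <= J (%x. q x + (1/2) * ?d x)" by (intro m_le V d that)
 also have "... = J q + ((LI x. q x * ?d x) - L ?d) + (1/4) * (L2_norm ?d)\<^sup>2"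
 unfolding J_line[OF that(2) d] by (simp add: power2_eq_square)
 finally have 1: "m <= J q + ((LI x. q x * ?d x) - L ?d) + (1/4) * (L2_norm ?d)\<^sup>2" .
 have "J p = J (%x. q x + 1 * ?d x)" by simp
 also have "... = J q + 2 * ((LI x. q x * ?d x) - L ?d) + (L2_norm ?d)\<^sup>2"
 unfolding J_line[OF that(2) d] by simp
 finally show ?thesis using 1 by simp
 qed
 have "\<exists>N. \<forall>i\<ge>N. \<forall>j\<ge>N. L2_norm (%x. f i x - f j x) <= e" if "0 < e" for e
 proof -
 obtain N where N: "4 / real (Suc N) < e\<^sup>2"
 proof -
 have "0 < e\<^sup>2 / 4" using \<open>0 < e\<close> by simp
 then obtain N where "inverse (real (Suc N)) < e\<^sup>2 / 4" using reals_Archimedean by blast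
 then have "4 / real (Suc N) < e\<^sup>2" by (simp add: field_simps)
 then show ?thesis using that by blast
 qed
 have small: "J (f i) - m <= 1 / real (Suc N)" if "i \<ge> N" for i
 proof -
 have "1 / real (Suc i) <= 1 / real (Suc N)" using that by (simp add: field_simps)
 then show ?thesis using fJ[of i] by linarith
 qed
 have "L2_norm (%x. f i x - f j x) <= e" if "i \<ge> N" "j \<ge> N" for i j
 proof (rule power2_le_imp_le)
 have "(L2_norm (%x. f i x - f j x))\<^sup>2 <= 4 / real (Suc N)"
 using par[OF fV fV, of i j] small[OF that(1)] small[OF that(2)] by simp
 then show "(L2_norm (%x. f i x - f j x))\<^sup>2 <= e\<^sup>2" using N by linarith
 qed (use \<open>0 < e\<close> in simp)
 then show ?thesis by blast
 qed
 from L2_complete[of f, OF VL[OF fV] this]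
 obtain h where h: "h : L2" "(%n. L2_norm (%x. f n x - h x)) ----> 0" by blast
 have rep: "(LI x. h x * g x) = L g" if g: "g : V" for g
 proof -
 define D where "D = (LI x. h x * g x) - L g"
 have Dt: "(%n. (LI x. f n x * g x) - L g) ----> D"
 unfolding D_def by (intro tendsto_diff tendsto_const L2_pairing_tendsto h VL fV g)
 \<comment> \<open>Minimality of \<open>m\<close> along the line f n + t g, in the limit of large
   \<open>n\<close>. The term 1/(n+1) is the excess of \<open>J (f n)\<close> over the infimum and
   disappears; what remains is the first variation, whose linear coefficient must vanish.\<close>
 have ineq: "0 <= 2 * t * D + t\<^sup>2 * (L2_norm g)\<^sup>2" for t
 proof (rule LIMSEQ_le[OF tendsto_const])
 show "(%n. 1 / real (Suc n) + 2 * t * ((LI x. f n x * g x) - L g) + t\<^sup>2 * (L2_norm g)\<^sup>2)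
 ----> 2 * t * D + t\<^sup>2 * (L2_norm g)\<^sup>2"
 using tendsto_add[OF tendsto_add[OF lim_1_over_n[THEN LIMSEQ_Suc] tendsto_mult[OF tendsto_const Dt]] tendsto_const]
 by simp
 have "0 <= 1 / real (Suc n) + 2 * t * ((LI x. f n x * g x) - L g) + t\<^sup>2 * (L2_norm g)\<^sup>2" for n
 using m_le[OF V(2)[OF fV V(3)[OF g]], of n t] fJ[of n] unfolding J_line[OF fV g] by linarith
 then show "\<exists>N. \<forall>n\<ge>N. 0 <= 1 / real (Suc n) + 2 * t * ((LI x. f n x * g x) - L g) + t\<^sup>2 * (L2_norm g)\<^sup>2"
 by blast
 qed
 have "D = 0"
 proof (rule ccontr)
 assume D: "D ~= 0"
 \<comment> \<open>Adding 1 keeps \<open>s\<close> positive even if \<open>g\<close> has norm 0, so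
   that t = -D/s is always a legitimate test value.\<close>
 define s where "s = 1 + (L2_norm g)\<^sup>2"
 have s: "0 < s" by (simp add: s_def add_pos_nonneg)
 have "0 <= 2 * (- D / s) * D + (- D / s)\<^sup>2 * (L2_norm g)\<^sup>2" by (rule ineq)
 also have "... <= 2 * (- D / s) * D + (- D / s)\<^sup>2 * s"
 by (intro add_left_mono mult_left_mono) (auto simp: s_def)
 also have "... = - (D\<^sup>2 / s)" using s by (simp add: field_simps power2_eq_square)
 finally have "0 <= - (D\<^sup>2 / s)" .
 moreover have "0 < D\<^sup>2 / s" using D s by (intro divide_pos_pos) auto
 ultimately show False by linarith
 qed
 then show ?thesis by (simp add: D_def)
 qed
 have "(L2_norm h)\<^sup>2 <= C * L2_norm h"
 proof (rule LIMSEQ_le)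
 show "(%n. LI x. f n x * h x) ----> (L2_norm h)\<^sup>2"
 proof -
 have "(L2_norm h)\<^sup>2 = (LI x. h x * h x)" unfolding L2_norm_sq by (simp add: power2_eq_square)
 then show ?thesis using L2_pairing_tendsto[OF VL[OF fV] h(1,2) h(1)] by simp
 qed
 show "(%n. C * L2_norm (f n)) ----> C * L2_norm h"
 by (intro tendsto_mult tendsto_const L2_norm_tendsto h VL fV)
 have "(LI x. f n x * h x) <= C * L2_norm (f n)" for n
 using rep[OF fV, of n] C(2)[OF fV, of n] by (simp add: mult.commute)
 then show "\<exists>N. \<forall>n\<ge>N. (LI x. f n x * h x) <= C * L2_norm (f n)" by blast
 qed
 then have "L2_norm h <= C"
 using C(1) L2_norm_nonneg[of h] by (cases "L2_norm h = 0") (auto simp: power2_eq_square mult_le_cancel_right)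
 then show thesis using that[of h f] h rep fV by blast
qed

lemma test_L2: "(f :: 'a::euclidean_space => real) : test_functions S ==> f : L2"
proof -
 assume f: "f : test_functions S"
 obtain K where K: "compact K" "\<forall>x. x \<notin> K \<longrightarrow> f x = 0" using test_support[OF f] by blast
 have "integ (%x. (f x)\<^sup>2)"
 using K by (intro integrable_compact_support[of _ K] continuous_intros test_continuous[OF f]) auto
 then show ?thesis using f by (simp add: L2_real_iff test_measurable)
qed

lemma L2_eq_AE_if_test:
 fixes f g :: "'a::euclidean_space => real"
 assumes "f : L2" "g : L2"
 and eq: "!!ph. ph : TF ==> (LI x. f x * ph x) = (LI x. g x * ph x)"
 shows "AE x in lborel. f x = g x"
proof -
 have d: "(%x. f x - g x) : L2" using assms by (intro L2_diff)
 have "AE x in lborel. x : UNIV \<longrightarrow> f x - g x = 0"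
 proof (rule fundamental_lemma)
 show "sinteg (cbox l u) (%x. f x - g x)" for l u
 using d by (rule L2_set_integrable) (use emeasure_lborel_cbox_finite in auto)
 show "(LI x. (f x - g x) * ph x) = 0" if "ph : TF" for ph
 using eq[OF that] assms(1,2) test_L2[OF that] by (simp add: left_diff_distrib L2_mult_integrable)
 qed simp
 then show ?thesis by simp
qed

text \<open>Riesz representation of f -> <g, f> on the space of test functions yields a limit of
  test functions that pairs with every test function as \<open>g\<close> does; by the fundamental
  lemma it equals \<open>g\<close> almost everywhere.\<close>

lemma test_dense:
 fixes g :: "'a::euclidean_space => real"
 assumes g: "g : L2" and e: "0 < e"
 obtains ph where "ph : TF" "L2_norm (%x. g x - ph x) < e"
proof -
 let ?V = "TF :: ('a => real) set"
 obtain h ph where h: "h : L2" "!!f. f : ?V ==> (LI x. h x * f x) = (LI x. g x * f x)"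
 and ph: "!!n. ph n : ?V" "(%n. L2_norm (%x. ph n x - h x)) ----> 0"
 proof (rule L2_Riesz[of ?V "%f. LI x. g x * f x" "L2_norm g"])
 show "\<bar>LI x. g x * f x\<bar> <= L2_norm g * L2_norm f" if "f : ?V" for f
 using L2_Cauchy_Schwarz[OF g test_L2[OF that]] .
 show "(LI x. g x * (f x + f' x)) = (LI x. g x * f x) + (LI x. g x * f' x)"
 if "f : ?V" "f' : ?V" for f f'
 using that g by (simp add: distrib_left L2_mult_integrable test_L2)
 show "(LI x. g x * (c * f x)) = c * (LI x. g x * f x)" for c f
 by (simp add: mult.left_commute)
 qed (auto intro: test_add test_cmult zero_test_function test_L2)
 have ae: "AE x in lborel. h x = g x" by (intro L2_eq_AE_if_test h g)
 obtain n where n: "L2_norm (%x. ph n x - h x) < e" using LIMSEQ_D[OF ph(2) e] by auto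
 have "L2_norm (%x. ph n x - h x) = L2_norm (%x. ph n x - g x)"
 using ae h(1) g ph(1)[of n]
 by (intro L2_norm_cong_AE borel_measurable_diff) (auto intro: L2_measurable test_measurable)
 then show thesis using that[OF ph(1)[of n]] n L2_norm_diff_commute[of "ph n" g] by simp
qed

text \<open>Minkowski's inequality in weighted form: Cauchy-Schwarz in \<open>m\<close> with
  \<open>k\<close> split as sgn(k) sqrt|k| times sqrt|k|, followed by Tonelli. With \<open>M\<close>
  the Lebesgue measure on space, space-time or time it covers spatial convolutions, space-time
  potentials and time integrals alike.\<close>

lemma L2_integral:
 fixes k :: "'m => real" and F :: "'m => 'a::euclidean_space => real"
 assumes M: "sigma_finite_measure M"
 and [measurable]: "(%(m, x). F m x) : borel_measurable (M \<Otimes>\<^sub>M lborel)"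
 and k: "integrable M k" and F: "!!m. F m : L2"
 and kF: "integrable M (%m. \<bar>k m\<bar> * (L2_norm (F m))\<^sup>2)"
 shows "AE x in lborel. integrable M (%m. k m * F m x)"
 and "(%x. \<integral>m. k m * F m x \<partial>M) : L2"
 and "(L2_norm (%x. \<integral>m. k m * F m x \<partial>M))\<^sup>2 <= (\<integral>m. \<bar>k m\<bar> \<partial>M) * (\<integral>m. \<bar>k m\<bar> * (L2_norm (F m))\<^sup>2 \<partial>M)"
 and "g : L2 ==> integrable (M \<Otimes>\<^sub>M lborel) (%(m, x). k m * F m x * g x)"
 and "g : L2 ==> (LI x. (\<integral>m. k m * F m x \<partial>M) * g x) = (\<integral>m. k m * (LI x. F m x * g x) \<partial>M)"
proof -
 interpret M: sigma_finite_measure M by fact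
 interpret P: pair_sigma_finite M "lborel :: 'a measure" by (simp add: pair_sigma_finite_def M sigma_finite_lborel)
 have [measurable]: "k : borel_measurable M" using k by simp
 let ?B = "\<integral>m. \<bar>k m\<bar> * (L2_norm (F m))\<^sup>2 \<partial>M"
 have int2: "integrable (M \<Otimes>\<^sub>M lborel) (%(m, x). \<bar>k m\<bar> * (F m x)\<^sup>2)"
 proof (rule P.Fubini_integrable)
 show "(%(m, x). \<bar>k m\<bar> * (F m x)\<^sup>2) : borel_measurable (M \<Otimes>\<^sub>M lborel)" by measurable
 show "integrable M (%m. LI x. norm (case (m, x) of (m, x) => \<bar>k m\<bar> * (F m x)\<^sup>2))"
 using kF by (simp add: abs_mult L2_norm_sq)
 show "AE m in M. integ (%x. case (m, x) of (m, x) => \<bar>k m\<bar> * (F m x)\<^sup>2)"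
 using F by (auto simp: L2_sq_integrable)
 qed
 have ae2: "AE x in lborel. integrable M (%m. \<bar>k m\<bar> * (F m x)\<^sup>2)"
 using P.AE_integrable_snd[of "%m x. \<bar>k m\<bar> * (F m x)\<^sup>2"] int2 by simp
 have B: "(LI x. \<integral>m. \<bar>k m\<bar> * (F m x)\<^sup>2 \<partial>M) = ?B"
 using P.Fubini_integral[of "%m x. \<bar>k m\<bar> * (F m x)\<^sup>2"] int2 by (simp add: L2_norm_sq)
 have intB: "integ (%x. \<integral>m. \<bar>k m\<bar> * (F m x)\<^sup>2 \<partial>M)"
 using P.integrable_snd[of "%m x. \<bar>k m\<bar> * (F m x)\<^sup>2"] int2 by simp
 have F_meas: "(%m. F m x) : borel_measurable M" for x by measurable
 have pt: "integrable M (%m. k m * F m x) \<and> (\<integral>m. k m * F m x \<partial>M)\<^sup>2 <= (\<integral>m. \<bar>k m\<bar> \<partial>M) * (\<integral>m. \<bar>k m\<bar> * (F m x)\<^sup>2 \<partial>M)"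
 if "integrable M (%m. \<bar>k m\<bar> * (F m x)\<^sup>2)" for x
 proof -
 have [measurable]: "(%m. F m x) : borel_measurable M" by (rule F_meas)
 let ?f = "%m. sgn (k m) * sqrt \<bar>k m\<bar>" and ?g = "%m. sqrt \<bar>k m\<bar> * F m x"
 have f2: "(?f m)\<^sup>2 = \<bar>k m\<bar>" and g2: "(?g m)\<^sup>2 = \<bar>k m\<bar> * (F m x)\<^sup>2" and fg: "?f m * ?g m = k m * F m x" for m
 proof -
 show "(?f m)\<^sup>2 = \<bar>k m\<bar>" by (simp add: power_mult_distrib sgn_if)
 show "(?g m)\<^sup>2 = \<bar>k m\<bar> * (F m x)\<^sup>2" by (simp add: power_mult_distrib)
 have "?f m * ?g m = sgn (k m) * (sqrt \<bar>k m\<bar> * sqrt \<bar>k m\<bar>) * F m x" by simp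
 then show "?f m * ?g m = k m * F m x" by (simp add: sgn_mult_abs)
 qed
 have "integrable M (%m. ?f m * ?g m)"
 "(\<integral>m. ?f m * ?g m \<partial>M)\<^sup>2 <= (\<integral>m. (?f m)\<^sup>2 \<partial>M) * (\<integral>m. (?g m)\<^sup>2 \<partial>M)"
 using k that by (intro integral_Cauchy_Schwarz; simp only: f2 g2 integrable_abs; measurable)+
 then show ?thesis by (simp only: fg f2 g2)
 qed
 show "AE x in lborel. integrable M (%m. k m * F m x)"
 using ae2 by eventually_elim (use pt in blast)
 have [measurable]: "(%x. \<integral>m. k m * F m x \<partial>M) : BM"
 proof -
 have "(%x. \<integral>m. k m * F m x \<partial>M) : borel_measurable lborel"
 by (intro M.borel_measurable_lebesgue_integral) measurable
 then show ?thesis by simp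
 qed
 have sq_le: "AE x in lborel. (\<integral>m. k m * F m x \<partial>M)\<^sup>2 <= (\<integral>m. \<bar>k m\<bar> \<partial>M) * (\<integral>m. \<bar>k m\<bar> * (F m x)\<^sup>2 \<partial>M)"
 using ae2 by eventually_elim (use pt in blast)
 have int: "integ (%x. (\<integral>m. k m * F m x \<partial>M)\<^sup>2)"
 proof (rule bo_integrable_bound)
 show "integ (%x. (\<integral>m. \<bar>k m\<bar> \<partial>M) * (\<integral>m. \<bar>k m\<bar> * (F m x)\<^sup>2 \<partial>M))" using intB by simp
 show "AE x in lborel. norm ((\<integral>m. k m * F m x \<partial>M)\<^sup>2) <= norm ((\<integral>m. \<bar>k m\<bar> \<partial>M) * (\<integral>m. \<bar>k m\<bar> * (F m x)\<^sup>2 \<partial>M))"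
 using sq_le by eventually_elim (simp add: abs_of_nonneg)
 qed measurable
 show "(%x. \<integral>m. k m * F m x \<partial>M) : L2" using int by (simp add: L2_real_iff)
 have "(L2_norm (%x. \<integral>m. k m * F m x \<partial>M))\<^sup>2 = (LI x. (\<integral>m. k m * F m x \<partial>M)\<^sup>2)" by (rule L2_norm_sq)
 also have "... <= (LI x. (\<integral>m. \<bar>k m\<bar> \<partial>M) * (\<integral>m. \<bar>k m\<bar> * (F m x)\<^sup>2 \<partial>M))"
 using int intB sq_le by (intro integral_mono_AE) auto
 also have "... = (\<integral>m. \<bar>k m\<bar> \<partial>M) * ?B" using B by simp
 finally show "(L2_norm (%x. \<integral>m. k m * F m x \<partial>M))\<^sup>2 <= (\<integral>m. \<bar>k m\<bar> \<partial>M) * ?B" .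
 assume g: "g : L2"
 then have [measurable]: "g : BM" by (rule L2_measurable)
 show int3: "integrable (M \<Otimes>\<^sub>M lborel) (%(m, x). k m * F m x * g x)"
 proof (rule P.Fubini_integrable)
 show "(%(m, x). k m * F m x * g x) : borel_measurable (M \<Otimes>\<^sub>M lborel)" by measurable
 show "AE m in M. integ (%x. case (m, x) of (m, x) => k m * F m x * g x)"
 using L2_mult_integrable[OF F g] by (auto simp: mult.assoc)
 show "integrable M (%m. LI x. norm (case (m, x) of (m, x) => k m * F m x * g x))"
 proof (rule bo_integrable_bound)
 show "integrable M (%m. (\<bar>k m\<bar> + \<bar>k m\<bar> * (L2_norm (F m))\<^sup>2) * L2_norm g)"
 using k kF by (intro integrable_mult_left bo_integrable_add integrable_abs)
 have "norm (LI x. norm (k m * F m x * g x)) <= (\<bar>k m\<bar> + \<bar>k m\<bar> * (L2_norm (F m))\<^sup>2) * L2_norm g" for m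
 proof -
 have "(LI x. norm (k m * F m x * g x)) = \<bar>k m\<bar> * (LI x. \<bar>F m x\<bar> * \<bar>g x\<bar>)"
 by (simp add: abs_mult mult.assoc)
 also have "... <= \<bar>k m\<bar> * (L2_norm (F m) * L2_norm g)"
 using L2_Cauchy_Schwarz[OF L2_abs[OF F] L2_abs[OF g], of m]
 by (intro mult_left_mono) (auto simp: L2_norm_abs)
 also have "... <= \<bar>k m\<bar> * ((1 + (L2_norm (F m))\<^sup>2) * L2_norm g)"
 proof -
 \<comment> \<open>Only the weighted squares of the norms are known to be integrable, so the first
   power is absorbed into 1 plus the square.\<close>
 have "L2_norm (F m) <= 1 + (L2_norm (F m))\<^sup>2"
 using sum_squares_bound[of "L2_norm (F m)" 1] L2_norm_nonneg[of "F m"] unfolding mult_1_right power_one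
 by linarith
 then show ?thesis by (intro mult_left_mono mult_right_mono) auto
 qed
 finally show ?thesis by (simp add: algebra_simps)
 qed
 then show "AE m in M. norm (LI x. norm (case (m, x) of (m, x) => k m * F m x * g x))
 <= norm ((\<bar>k m\<bar> + \<bar>k m\<bar> * (L2_norm (F m))\<^sup>2) * L2_norm g)"
 by (intro AE_I2) (simp add: abs_of_nonneg mult_nonneg_nonneg)
 qed measurable
 qed
 have "(LI x. (\<integral>m. k m * F m x \<partial>M) * g x) = (LI x. (\<integral>m. k m * F m x * g x \<partial>M))" by simp
 also have "... = (\<integral>m. (LI x. k m * F m x * g x) \<partial>M)"
 using P.Fubini_integral[of "%m x. k m * F m x * g x"] int3 by simp
 also have "... = (\<integral>m. k m * (LI x. F m x * g x) \<partial>M)" by (simp add: mult.assoc)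
 finally show "(LI x. (\<integral>m. k m * F m x \<partial>M) * g x) = (\<integral>m. k m * (LI x. F m x * g x) \<partial>M)" .
qed

subsection \<open>Translations, dilations and integration by parts\<close>

lemma
 fixes f :: "'a::euclidean_space => real" and c :: real
 assumes c: "c ~= 0" and [measurable]: "f : BM"
 shows integrable_affine_iff: "integ (%x. f (t + c *\<^sub>R x)) \<longleftrightarrow> integ f"
 and integral_affine: "(LI x. f (t + c *\<^sub>R x)) = (LI x. f x) / \<bar>c\<bar> ^ DIM('a)"
proof -
 let ?T = "%x. t + c *\<^sub>R x"
 have *: "lborel = density (distr lborel borel ?T) (%_. ennreal (\<bar>c\<bar> ^ DIM('a)))"
 using lborel_affine[OF c, of t] by simp
 have [measurable]: "?T : BM" by simp
 have "integ f \<longleftrightarrow> integrable (density (distr lborel borel ?T) (%_. ennreal (\<bar>c\<bar> ^ DIM('a)))) f"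
 using * by simp
 also have "... \<longleftrightarrow> integrable (distr lborel borel ?T) (%x. \<bar>c\<bar> ^ DIM('a) *\<^sub>R f x)"
 by (intro integrable_density) auto
 also have "... \<longleftrightarrow> integ (%x. \<bar>c\<bar> ^ DIM('a) * f (?T x))"
 by (subst integrable_distr_eq) auto
 also have "... \<longleftrightarrow> integ (%x. f (?T x))" using c by simp
 finally show "integ (%x. f (?T x)) \<longleftrightarrow> integ f" ..
 have "(LI x. f x) = integral\<^sup>L (density (distr lborel borel ?T) (%_. ennreal (\<bar>c\<bar> ^ DIM('a)))) f"
 using * by simp
 also have "... = (LINT x|distr lborel borel ?T. \<bar>c\<bar> ^ DIM('a) *\<^sub>R f x)"
 by (intro integral_density) auto
 also have "... = (LI x. \<bar>c\<bar> ^ DIM('a) * f (?T x))"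
 by (subst integral_distr) auto
 finally show "(LI x. f (?T x)) = (LI x. f x) / \<bar>c\<bar> ^ DIM('a)"
 using c by simp
qed

lemma
 fixes f :: "'a::euclidean_space => real"
 assumes [measurable]: "f : BM"
 shows integrable_translate_iff: "integ (%x. f (x - y)) \<longleftrightarrow> integ f"
 and integral_translate: "(LI x. f (x - y)) = (LI x. f x)"
 and integrable_reflect_iff: "integ (%x. f (y - x)) \<longleftrightarrow> integ f"
 and integral_reflect: "(LI x. f (y - x)) = (LI x. f x)"
 using integrable_affine_iff[of 1 f "- y"] integral_affine[of 1 f "- y"]
 integrable_affine_iff[of "-1" f y] integral_affine[of "-1" f y] by simp_all

lemma
 fixes f :: "'a::euclidean_space => real"
 assumes f: "f : L2"
 shows L2_translate: "(%x. f (x - y)) : L2"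
 and L2_norm_translate: "L2_norm (%x. f (x - y)) = L2_norm f"
proof -
 have [measurable]: "f : BM" using f by (rule L2_measurable)
 show "(%x. f (x - y)) : L2"
 using integrable_translate_iff[of "%x. (f x)\<^sup>2" y] f by (simp add: L2_real_iff)
 show "L2_norm (%x. f (x - y)) = L2_norm f"
 using integral_translate[of "%x. (f x)\<^sup>2" y] by (simp add: L2_norm_def)
qed

text \<open>Translations are isometries of \<open>L2\<close> and test functions are dense, so it
  suffices to treat a test function. There dominated convergence applies, because all translates
  along a convergent sequence live in one compact set.\<close>

lemma L2_translate_continuous:
 fixes f :: "'a::euclidean_space => real"
 assumes f: "f : L2"
 shows "((%y. L2_norm (%x. f (x - y) - f x)) \<longlongrightarrow> 0) (at 0)"
proof -
 have test: "(%n. L2_norm (%x. ph (x - y n) - ph x)) ----> 0"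
 if ph: "ph : TF" and y: "y ----> (0::'a)" for ph :: "'a => real" and y
 proof -
 obtain K where K: "compact K" "\<forall>x. x \<notin> K \<longrightarrow> ph x = 0" using test_support[OF ph] by blast
 obtain C where C: "0 < C" "!!x. norm (ph x) <= C" using test_bounded[OF ph] by blast
 obtain R where R: "!!n. norm (y n) <= R"
 using convergent_imp_bounded[OF y] by (auto simp: bounded_iff)
 have R0: "0 <= R" using order_trans[OF norm_ge_zero R[of 0]] .
 let ?K = "{a + b |a b. a : K \<and> b : cball 0 R}"
 have cK: "compact ?K" by (intro compact_sums K compact_cball)
 have [measurable]: "ph : BM" using ph by (rule test_measurable)
 have out: "ph (x - y n) = 0" "ph x = 0" if "x \<notin> ?K" for x n
 proof -
 have "x - y n \<notin> K"
 proof
 assume "x - y n : K"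
 then have "(x - y n) + y n : ?K" using R[of n] by (auto simp: dist_norm intro!: exI)
 then show False using that by simp
 qed
 then show "ph (x - y n) = 0" using K by blast
 have "x \<notin> K"
 proof
 assume "x : K"
 then have "x + 0 : ?K" using R0 by (intro CollectI exI conjI refl) auto
 then show False using that by simp
 qed
 then show "ph x = 0" using K by blast
 qed
 have "(%n. LI x. (ph (x - y n) - ph x)\<^sup>2) ----> (LINT x|(lborel::'a measure). 0)"
 proof (rule integral_dominated_convergence[where w = "%x. (2 * C)\<^sup>2 * indicator ?K x"])
 show "integ (%x. (2 * C)\<^sup>2 * indicator ?K x)"
 using emeasure_compact_finite[OF cK] compact_imp_closed[OF cK]
 by (intro integrable_mult_right integrable_real_indicator) (auto simp: less_top)
 show "AE x in lborel. (%n. (ph (x - y n) - ph x)\<^sup>2) ----> 0"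
 proof (intro AE_I2)
 fix x
 have "(%n. ph (x - y n)) ----> ph (x - 0)"
 by (intro isCont_tendsto_compose[OF smooth_isCont[OF test_smooth[OF ph]]] tendsto_intros y)
 then have "(%n. (ph (x - y n) - ph x)\<^sup>2) ----> (ph (x - 0) - ph x)\<^sup>2"
 by (intro tendsto_intros)
 then show "(%n. (ph (x - y n) - ph x)\<^sup>2) ----> 0" by simp
 qed
 show "AE x in lborel. norm ((ph (x - y n) - ph x)\<^sup>2) <= (2 * C)\<^sup>2 * indicator ?K x" for n
 proof (intro AE_I2)
 fix x
 show "norm ((ph (x - y n) - ph x)\<^sup>2) <= (2 * C)\<^sup>2 * indicator ?K x"
 proof (cases "x : ?K")
 case True
 have "\<bar>ph (x - y n) - ph x\<bar> <= 2 * C"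
 using C(2)[of "x - y n"] C(2)[of x] by simp
 then have "(ph (x - y n) - ph x)\<^sup>2 <= (2 * C)\<^sup>2"
 using power_mono[of "\<bar>ph (x - y n) - ph x\<bar>" "2 * C" 2] by simp
 then show ?thesis using True by simp
 next
 case False
 then show ?thesis using out[OF False] by simp
 qed
 qed
 qed measurable
 then have "(%n. sqrt (LI x. (ph (x - y n) - ph x)\<^sup>2)) ----> sqrt 0"
 by (intro tendsto_real_sqrt) simp
 then show ?thesis by (simp add: L2_norm_def)
 qed
 show ?thesis
 proof (rule tendsto_at_iff_sequentially[THEN iffD2], intro allI impI)
 fix y :: "nat => 'a" assume "\<forall>i. y i : UNIV - {0}" and y: "y ----> 0"
 show "((%y. L2_norm (%x. f (x - y) - f x)) \<circ> y) ----> 0"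
 unfolding o_def
 proof (rule LIMSEQ_I)
 fix e :: real assume e: "0 < e"
 obtain ph where ph: "ph : TF" "L2_norm (%x. f x - ph x) < e / 4"
 using test_dense[OF f, of "e / 4"] e by auto
 have phL: "ph : L2" using ph(1) by (rule test_L2)
 obtain N where N: "!!n. n \<ge> N ==> L2_norm (%x. ph (x - y n) - ph x) < e / 4"
 using LIMSEQ_D[OF test[OF ph(1) y], of "e / 4"] e by auto
 have "L2_norm (%x. f (x - y n) - f x) < e" if "n \<ge> N" for n
 proof -
 have "L2_norm (%x. f (x - y n) - f x) <= L2_norm (%x. f (x - y n) - ph (x - y n)) + L2_norm (%x. ph (x - y n) - f x)"
 by (intro L2_triangle3 L2_translate f phL)
 also have "L2_norm (%x. f (x - y n) - ph (x - y n)) = L2_norm (%x. f x - ph x)"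
 using L2_norm_translate[OF L2_diff[OF f phL]] .
 also have "L2_norm (%x. ph (x - y n) - f x) <= L2_norm (%x. ph (x - y n) - ph x) + L2_norm (%x. ph x - f x)"
 by (intro L2_triangle3 L2_translate f phL)
 finally show ?thesis using N[OF that] ph(2) e L2_norm_diff_commute[of f ph] by linarith
 qed
 then show "\<exists>no. \<forall>n\<ge>no. norm (L2_norm (%x. f (x - y n) - f x) - 0) < e" by auto
 qed
 qed
qed

lemma differentiable_vector_derivative:
 assumes "!!x. f differentiable (at x)"
 shows "((%h. f (x + h *\<^sub>R v)) has_vector_derivative ddir v f (x + h *\<^sub>R v)) (at h within S)"
proof -
 have "((%h. x + h *\<^sub>R v) has_derivative (%h. h *\<^sub>R v)) (at h)"
 by (auto intro!: derivative_eq_intros)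
 from diff_chain_at[OF this frechet_derivative_works[THEN iffD1, OF assms]]
 have "((%h. f (x + h *\<^sub>R v)) has_derivative (%k. frechet_derivative f (at (x + h *\<^sub>R v)) (k *\<^sub>R v))) (at h)"
 by (simp add: o_def)
 moreover have "(%k. frechet_derivative f (at (x + h *\<^sub>R v)) (k *\<^sub>R v)) = (%k. k *\<^sub>R ddir v f (x + h *\<^sub>R v))"
 using linear_cmul[OF linear_frechet_derivative[OF assms]] by auto
 ultimately show ?thesis
 by (auto simp: has_vector_derivative_def intro: has_derivative_at_withinI)
qed

lemma ddir_zero_outside:
 assumes "closed K" "\<forall>x. x \<notin> K \<longrightarrow> f x = 0" "x \<notin> K" shows "ddir v f x = 0"
proof -
 have "(f has_derivative (%_. 0)) (at x)"
 proof (rule has_derivative_transform_within_open)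
 show "((%_. 0) has_derivative (%_. 0)) (at x)" by simp
 show "x : - K" using assms(3) unfolding Compl_iff .
 show "open (- K)" using assms(1) by (rule open_Compl)
 show "0 = f y" if "y : - K" for y using assms(2) that by auto
 qed
 then show ?thesis using ddir_eq by blast
qed

text \<open>By translation invariance
 $0=\int(f(x+v)-f(x))\,dx=\int_0^1\int\partial_vf(x+rv)\,dx\,dr=\int\partial_vf$.\<close>

lemma integral_ddir_eq_0:
 fixes f :: "'a::euclidean_space => real"
 assumes diff: "!!x. f differentiable (at x)" and cont: "continuous_on UNIV (ddir v f)"
 and K: "compact K" "\<forall>x. x \<notin> K \<longrightarrow> f x = 0"
 shows "(LI x. ddir v f x) = 0"
proof -
 let ?D = "ddir v f"
 have contf: "continuous_on UNIV f"
 using diff by (meson continuous_at_imp_continuous_on differentiable_imp_continuous_within)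
 have intf: "integ f" using contf K by (auto intro: integrable_compact_support)
 have intD: "integ ?D"
 using cont K(1) ddir_zero_outside[OF compact_imp_closed[OF K(1)] K(2)] by (auto intro: integrable_compact_support)
 have [measurable]: "f : BM" "?D : BM" using intf intD by auto
 let ?h = "%r x. indicator {0..1} r * ?D (x + r *\<^sub>R v)"
 have trD: "integ (%x. ?D (x + r *\<^sub>R v))" "(LI x. ?D (x + r *\<^sub>R v)) = (LI x. ?D x)"
 "(LI x. \<bar>?D (x + r *\<^sub>R v)\<bar>) = (LI x. \<bar>?D x\<bar>)" for r
 using integrable_translate_iff[of ?D "- r *\<^sub>R v"] integral_translate[of ?D "- r *\<^sub>R v"]
 integral_translate[of "%x. \<bar>?D x\<bar>" "- r *\<^sub>R v"] intD by simp_all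
 have int: "integrable (LL) (%(r, x). ?h r x)"
 proof (rule lborel_pair.Fubini_integrable)
 show "integ (%r. LI x. norm (case (r, x) of (r, x) => ?h r x))"
 by (simp add: abs_mult trD)
 show "AE r in lborel. integ (%x. case (r, x) of (r, x) => ?h r x)"
 by (simp add: trD)
 qed measurable
 have "(LI x. f (x + v) - f x) = (LI x. (LI r. ?h r x))"
 proof (intro bo_cong refl)
 fix x
 have "(LI r. indicator {0..1} r *\<^sub>R ?D (x + r *\<^sub>R v)) = f (x + 1 *\<^sub>R v) - f (x + 0 *\<^sub>R v)"
 proof (rule integral_FTC_atLeastAtMost)
 show "continuous_on {0..1} (%r. ?D (x + r *\<^sub>R v))"
 by (intro continuous_on_compose2[OF cont] continuous_intros) auto
 qed (auto intro: differentiable_vector_derivative diff)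
 then show "f (x + v) - f x = (LI r. ?h r x)" by simp
 qed
 also have "... = (LI r. (LI x. ?h r x))"
 using lborel_pair.Fubini_integral[of ?h] int by simp
 also have "... = (LI x. ?D x)" by (simp add: trD)
 finally have "(LI x. ?D x) = (LI x. f (x + v) - f x)" ..
 also have "... = 0"
 using integrable_translate_iff[of f "- v"] integral_translate[of f "- v"] intf by simp
 finally show ?thesis .
qed

lemma pd_mult:
 fixes f g :: "real^3 => real"
 assumes "f differentiable (at x)" "g differentiable (at x)"
 shows "pd i (%x. f x * g x) x = f x * pd i g x + pd i f x * g x"
 unfolding pd_def using assms
 by (intro ddir_eq has_derivative_mult frechet_derivative_works[THEN iffD1])

text \<open>The product \<Theta> ph has compact support, so its derivative integrates to 0. For
  \<Theta> only C^1 regularity is asked and nothing at infinity, which admits the heat kernel and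
  its slowly decaying potential.\<close>

lemma integration_by_parts:
 fixes \<Theta> ph :: "real^3 => real"
 assumes diff: "!!x. \<Theta> differentiable (at x)" and cont: "continuous_on UNIV (pd i \<Theta>)"
 and ph: "ph : TF"
 shows "(LI x. \<Theta> x * pd i ph x) = - (LI x. pd i \<Theta> x * ph x)"
proof -
 obtain K where K: "compact K" "\<forall>x. x \<notin> K \<longrightarrow> ph x = 0" using test_support[OF ph] by blast
 have sm: "smooth ph" using ph by (rule test_smooth)
 have K': "\<forall>x. x \<notin> K \<longrightarrow> pd i ph x = 0"
 unfolding pd_def using ddir_zero_outside[OF compact_imp_closed[OF K(1)] K(2)] by blast
 have cont\<Theta>: "continuous_on UNIV \<Theta>"
 using diff by (meson continuous_at_imp_continuous_on differentiable_imp_continuous_within)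
 have eq: "pd i (%x. \<Theta> x * ph x) = (%x. \<Theta> x * pd i ph x + pd i \<Theta> x * ph x)"
 by (intro ext pd_mult diff smooth_differentiable sm)
 have c1: "continuous_on UNIV (%x. \<Theta> x * pd i ph x)" and c2: "continuous_on UNIV (%x. pd i \<Theta> x * ph x)"
 by (intro continuous_intros cont\<Theta> cont smooth_continuous_on smooth_pd sm)+
 have "(LI x. ddir (axis i 1) (%x. \<Theta> x * ph x) x) = 0"
 proof (rule integral_ddir_eq_0[OF _ _ K(1)])
 show "(%x. \<Theta> x * ph x) differentiable (at x)" for x
 by (intro differentiable_mult diff smooth_differentiable sm)
 show "continuous_on UNIV (ddir (axis i 1) (%x. \<Theta> x * ph x))"
 using eq c1 c2 unfolding pd_eq_ddir[symmetric] by (auto intro: continuous_on_add)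
 qed (use K in simp)
 then have "(LI x. \<Theta> x * pd i ph x + pd i \<Theta> x * ph x) = 0"
 using eq by (simp add: pd_eq_ddir)
 moreover have "integ (%x. \<Theta> x * pd i ph x)" "integ (%x. pd i \<Theta> x * ph x)"
 using c1 c2 K(1) K(2) K' by (auto intro: integrable_compact_support)
 ultimately show ?thesis by simp
qed

subsection \<open>Continuous curves in \<open>L\<^sup>2\<close>\<close>

lemma norm_vec3_sq: "(norm (x :: real^3))\<^sup>2 = (SS i. (x $ i)\<^sup>2)"
 by (simp add: norm_vec_def L2_set_def sum_nonneg)

lemma borel_measurable_vec_iff:
 "(f :: 'm => real^'n) : borel_measurable M \<longleftrightarrow> (\<forall>i. (%x. f x $ i) : borel_measurable M)"
proof -
 have "(\<forall>b\<in>Basis. (%x. f x \<bullet> b) : borel_measurable M) \<longleftrightarrow> (\<forall>i. (%x. f x \<bullet> axis i 1) : borel_measurable M)"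
 by (auto simp: Basis_vec_def)
 then show ?thesis
 using borel_measurable_euclidean_space[of f M] by (simp add: inner_axis)
qed

lemma L2_vec_iff: "(f :: 'a::euclidean_space => real^3) : L2 \<longleftrightarrow> (\<forall>i. (%x. f x $ i) : L2)"
proof safe
 fix i assume f: "f : L2"
 have [measurable]: "(%x. f x $ i) : BM"
 using f[THEN L2_measurable] by (simp add: borel_measurable_vec_iff)
 have "integ (%x. (f x $ i)\<^sup>2)"
 proof (rule bo_integrable_bound)
 show "integ (%x. (norm (f x))\<^sup>2)" using f by (simp add: L2_def)
 show "AE x in lborel. norm ((f x $ i)\<^sup>2) <= norm ((norm (f x))\<^sup>2)"
 using component_le_norm_cart[of "f _" i] by (auto simp: abs_le_square_iff[symmetric])
 qed measurable
 then show "(%x. f x $ i) : L2" by (simp add: L2_real_iff)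
next
 assume *: "\<forall>i. (%x. f x $ i) : L2"
 have "f : BM"
 using * by (simp add: borel_measurable_vec_iff L2_real_iff)
 moreover have "integ (%x. (norm (f x))\<^sup>2)"
 unfolding norm_vec3_sq using * by (intro bo_integrable_sum) (simp add: L2_real_iff)
 ultimately show "f : L2" by (simp add: L2_def)
qed

lemma L2_norm_vec_sq:
 assumes "(f :: 'a::euclidean_space => real^3) : L2"
 shows "(L2_norm f)\<^sup>2 = (SS i. (L2_norm (%x. f x $ i))\<^sup>2)"
proof -
 have "(L2_norm f)\<^sup>2 = (LI x. (norm (f x))\<^sup>2)" by (simp add: L2_norm_def)
 also have "... = (SS i. LI x. (f x $ i)\<^sup>2)"
 unfolding norm_vec3_sq using assms by (intro bo_integral_sum) (simp add: L2_vec_iff L2_real_iff)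
 finally show ?thesis by (simp add: L2_norm_sq)
qed

lemma L2_norm_component_le:
 assumes "(f :: 'a::euclidean_space => real^3) : L2" shows "L2_norm (%x. f x $ i) <= L2_norm f"
proof (rule power2_le_imp_le)
 show "(L2_norm (%x. f x $ i))\<^sup>2 <= (L2_norm f)\<^sup>2"
 unfolding L2_norm_vec_sq[OF assms] by (rule member_le_sum) auto
qed simp

lemma L2_vec_diff:
 assumes "f : L2" "g : L2" shows "(%x. f x - g x :: real^3) : L2"
 using assms by (auto simp: L2_vec_iff intro: L2_diff)

lemma cont_L2_vec_iff:
 "(u :: real => 'a::euclidean_space => real^3) : cont_L2 I \<longleftrightarrow> (\<forall>i. (%t x. u t x $ i) : cont_L2 I)"
proof
 assume u: "u : cont_L2 I"
 have "(%t x. u t x $ i) : cont_L2 I" for i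
 proof -
 have "((%s. L2_norm (%x. u s x $ i - u t x $ i)) \<longlongrightarrow> 0) (at t within I)" if t: "t : I" for t
 proof (rule Lim_null_comparison)
 show "((%s. L2_norm (%x. u s x - u t x)) \<longlongrightarrow> 0) (at t within I)" using u t by (simp add: cont_L2_def)
 show "\<forall>\<^sub>F s in at t within I. norm (L2_norm (%x. u s x $ i - u t x $ i)) <= L2_norm (%x. u s x - u t x)"
 proof (rule eventually_at_filter[THEN iffD2, OF always_eventually], intro allI impI)
 fix s assume "s : I"
 then have "(%x. u s x - u t x) : L2" using u t by (intro L2_vec_diff) (auto simp: cont_L2_def)
 from L2_norm_component_le[OF this, of i]
 show "norm (L2_norm (%x. u s x $ i - u t x $ i)) <= L2_norm (%x. u s x - u t x)" by simp
 qed
 qed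
 then show ?thesis using u by (auto simp: cont_L2_def L2_vec_iff)
 qed
 then show "\<forall>i. (%t x. u t x $ i) : cont_L2 I" ..
next
 assume *: "\<forall>i. (%t x. u t x $ i) : cont_L2 I"
 then have L2: "u t : L2" if "t : I" for t using that by (auto simp: cont_L2_def L2_vec_iff)
 have "((%s. L2_norm (%x. u s x - u t x)) \<longlongrightarrow> 0) (at t within I)" if t: "t : I" for t
 proof -
 have "((%s. sqrt (SS i. (L2_norm (%x. u s x $ i - u t x $ i))\<^sup>2)) \<longlongrightarrow> sqrt (\<Sum>i\<in>(UNIV::3 set). 0\<^sup>2)) (at t within I)"
 using * t by (intro tendsto_real_sqrt tendsto_sum tendsto_power) (auto simp: cont_L2_def)
 moreover have "\<forall>\<^sub>F s in at t within I. sqrt (SS i. (L2_norm (%x. u s x $ i - u t x $ i))\<^sup>2) = L2_norm (%x. u s x - u t x)"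
 proof (rule eventually_at_filter[THEN iffD2, OF always_eventually], intro allI impI)
 fix s assume s: "s : I"
 show "sqrt (SS i. (L2_norm (%x. u s x $ i - u t x $ i))\<^sup>2) = L2_norm (%x. u s x - u t x)"
 using L2_norm_vec_sq[OF L2_vec_diff[OF L2[OF s] L2[OF t]]]
 by (intro real_sqrt_unique) auto
 qed
 ultimately show ?thesis by (simp add: Lim_transform_eventually)
 qed
 then show "u : cont_L2 I" using L2 by (simp add: cont_L2_def)
qed

lemma cont_L2_L2: "u : cont_L2 I ==> t : I ==> u t : L2"
 by (simp add: cont_L2_def)

lemma cont_L2_dist:
 assumes "u : cont_L2 I" "t : I" "0 < e"
 obtains d where "0 < d" "!!s. s : I ==> \<bar>s - t\<bar> < d ==> L2_norm (%x. u s x - u t x) < e"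
proof -
 have "((%s. L2_norm (%x. u s x - u t x)) \<longlongrightarrow> 0) (at t within I)" using assms by (simp add: cont_L2_def)
 then obtain d where d: "0 < d" "\<forall>s\<in>I. s ~= t \<and> dist s t < d \<longrightarrow> L2_norm (%x. u s x - u t x) < e"
 using assms(3) by (force simp: tendsto_iff eventually_at)
 have "L2_norm (%x. u s x - u t x) < e" if "s : I" "\<bar>s - t\<bar> < d" for s
 using d(2) that assms(3) by (cases "s = t") (auto simp: dist_real_def L2_norm_def)
 then show thesis using that[OF d(1)] by blast
qed

lemma cont_L2_norm_continuous:
 fixes u :: "real => 'a::euclidean_space => real"
 assumes u: "u : cont_L2 I" shows "continuous_on I (%t. L2_norm (u t))"
 unfolding continuous_on_def
proof
 fix t assume t: "t : I"
 show "((%t. L2_norm (u t)) \<longlongrightarrow> L2_norm (u t)) (at t within I)"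
 proof (rule Lim_null[THEN iffD2], rule Lim_null_comparison)
 show "((%s. L2_norm (%x. u s x - u t x)) \<longlongrightarrow> 0) (at t within I)" using u t by (simp add: cont_L2_def)
 show "\<forall>\<^sub>F s in at t within I. norm (L2_norm (u s) - L2_norm (u t)) <= L2_norm (%x. u s x - u t x)"
 proof (rule eventually_at_filter[THEN iffD2, OF always_eventually], intro allI impI)
 fix s assume s: "s : I"
 have L: "u s : L2" "u t : L2" using u s t by (auto simp: cont_L2_def)
 show "norm (L2_norm (u s) - L2_norm (u t)) <= L2_norm (%x. u s x - u t x)"
 using L2_norm_le_add[OF L] L2_norm_le_add[OF L(2,1)] L2_norm_diff_commute[of "u s" "u t"]
 by (simp add: abs_le_iff)
 qed
 qed
qed

lemma cont_L2_mono: "u : cont_L2 I ==> J \<subseteq> I ==> u : cont_L2 J"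
 by (auto simp: cont_L2_def intro: tendsto_within_subset)

lemma cont_L2_bounded:
 fixes u :: "real => 'a::euclidean_space => real"
 assumes u: "u : cont_L2 {0..<T}" and "T' < T"
 obtains C where "0 < C" "!!t. t : {0..T'} ==> L2_norm (u t) <= C"
proof -
 have "continuous_on {0..T'} (%t. L2_norm (u t))"
 by (rule continuous_on_subset[OF cont_L2_norm_continuous[OF u]]) (use assms(2) in auto)
 then have "bounded ((%t. L2_norm (u t)) ` {0..T'})"
 by (intro compact_imp_bounded compact_continuous_image) auto
 then obtain C where "0 < C" "!!t. t : {0..T'} ==> L2_norm (u t) <= C"
 by (auto simp: bounded_pos)
 then show thesis using that by blast
qed

text \<open>On countably many intervals with rational endpoints that cover \<open>I\<close> the curve varies by less than
 $4^{-n}$; freezing it on each of them gives jointly measurable approximations.\<close>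

lemma cont_L2_representative:
 fixes u :: "real => 'a::euclidean_space => real"
 assumes u: "u : cont_L2 I"
 obtains G where "G : borel_measurable (borel :: (real \<times> 'a) measure)"
 "!!t. t : I ==> AE x in lborel. G (t, x) = u t x"
proof -
 define iv :: "nat => real set" where "iv k = (case from_nat k of (p, q) => {of_rat p <..< of_rat q})" for k
 define good where "good n k c \<longleftrightarrow> c : I \<and> (\<forall>s\<in>I \<inter> iv k. L2_norm (%x. u s x - u c x) < (1/4)^n)" for n :: nat and k c
 define cen where "cen n k = (SOME c. good n k c)" for n k
 define idx where "idx n t = (LEAST k. t : iv k \<and> (\<exists>c. good n k c))" for n t
 have open_iv: "open (iv k)" for k unfolding iv_def by (auto split: prod.split)
 have ex: "\<exists>k. t : iv k \<and> (\<exists>c. good n k c)" if t: "t : I" for n t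
 proof -
 obtain d where d: "0 < d" "!!s. s : I ==> \<bar>s - t\<bar> < d ==> L2_norm (%x. u s x - u t x) < (1/4)^n"
 using cont_L2_dist[OF u t, of "(1/4)^n"] by auto
 obtain p where p: "t - d < of_rat p" "of_rat p < t" using of_rat_dense[of "t - d" t] d(1) by auto
 obtain q where q: "t < of_rat q" "of_rat q < t + d" using of_rat_dense[of t "t + d"] d(1) by auto
 have iv: "iv (to_nat (p, q)) = {of_rat p <..< of_rat q}" by (simp add: iv_def)
 have "good n (to_nat (p, q)) t"
 unfolding good_def iv using t p q by (auto intro!: d(2))
 then show ?thesis using iv p q by (intro exI[of _ "to_nat (p, q)"]) auto
 qed
 have idx: "t : iv (idx n t)" "good n (idx n t) (cen n (idx n t))" if "t : I" for n t
 proof -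
 have *: "t : iv (idx n t) \<and> (\<exists>c. good n (idx n t) c)"
 unfolding idx_def using ex[OF that] by (rule LeastI_ex)
 then show "t : iv (idx n t)" by blast
 show "good n (idx n t) (cen n (idx n t))" unfolding cen_def using * by (metis someI_ex)
 qed
 \<comment> \<open>The default 0 keeps \<open>U n k\<close> measurable for every index; for times in
   \<open>I\<close> the selected centre lies in \<open>I\<close>, so the true slice is taken
   there.\<close>
 define U where "U n k x = (if cen n k : I then u (cen n k) x else 0)" for n k x
 have [measurable]: "U n k : BM" for n k
 using u by (cases "cen n k : I") (auto simp: U_def[abs_def] cont_L2_def L2_def)
 have [measurable]: "idx n : borel \<rightarrow>\<^sub>M count_space UNIV" for n
 proof -
 have [measurable]: "iv k : sets borel" for k using open_iv by simp
 show ?thesis unfolding idx_def by measurable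
 qed
 define G' where "G' n = (%(t, x). U n (idx n t) x)" for n
 have [measurable]: "G' n : borel_measurable (borel :: (real \<times> 'a) measure)" for n
 proof -
 have "(%z. U n (idx n (fst z)) (snd z)) : borel_measurable (borel \<Otimes>\<^sub>M (borel :: 'a measure))"
 by (rule measurable_compose_countable[where f = "%k z. U n k (snd z)"]) measurable
 then show ?thesis by (simp add: G'_def case_prod_beta' borel_prod)
 qed
 define G where "G z = lim (%n. G' n z)" for z
 have "G : BM" unfolding G_def by measurable
 moreover have "AE x in lborel. G (t, x) = u t x" if t: "t : I" for t
 proof -
 have ut: "u t : L2" using u t by (simp add: cont_L2_def)
 have UL: "U n (idx n t) : L2" for n
 using u by (cases "cen n (idx n t) : I") (auto simp: U_def[abs_def] cont_L2_def L2_zero)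
 have le: "L2_norm (%x. U n (idx n t) x - u t x) <= (1/4)^n" for n
 proof -
 have c: "cen n (idx n t) : I" "L2_norm (%x. u t x - u (cen n (idx n t)) x) < (1/4)^n"
 using idx[OF t, of n] t by (auto simp: good_def)
 then show ?thesis by (simp add: U_def L2_norm_diff_commute[of "u t"])
 qed
 have "AE x in lborel. (%n. U n (idx n t) x - u t x) ----> 0"
 proof (rule L2_summable_AE[OF L2_diff[OF UL ut]])
 have "(L2_norm (%x. U n (idx n t) x - u t x))\<^sup>2 <= (1/4)^n" for n
 proof -
 have "(L2_norm (%x. U n (idx n t) x - u t x))\<^sup>2 <= ((1/4)^n)\<^sup>2" by (intro power_mono le) simp
 also have "... <= (1/4)^n" by (simp add: power2_eq_square mult_le_cancel_left1 power_le_one)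
 finally show ?thesis .
 qed
 then show "summable (%n. (L2_norm (%x. U n (idx n t) x - u t x))\<^sup>2)"
 by (intro summable_quarter zero_le_power2)
 qed
 then show ?thesis
 proof eventually_elim
 case (elim x)
 then have "(%n. U n (idx n t) x) ----> u t x" by (simp add: Lim_null[symmetric])
 then show ?case by (simp add: G_def G'_def limI)
 qed
 qed
 ultimately show thesis using that by blast
qed

subsection \<open>Radial functions\<close>

text \<open>Radial functions are written as functions of |x|^2 rather than of |x|, which keeps them
  differentiable at the origin. Derivatives up to third order are recorded because the gradient of
  the Oseen kernel contains third derivatives of \<open>P\<close>.\<close>

locale radial_chain =
 fixes g :: "nat => real => real"
 assumes chain: "!!m r. (g m has_real_derivative g (Suc m) r) (at r)"
begin

definition rd0 :: "real^3 => real" where "rd0 x = g 0 (x \<bullet> x)"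
definition rd1 :: "3 => real^3 => real" where "rd1 i x = 2 * x $ i * g 1 (x \<bullet> x)"
definition rd2 :: "3 => 3 => real^3 => real"
 where "rd2 i j x = 2 * of_bool (i = j) * g 1 (x \<bullet> x) + 4 * x $ i * x $ j * g 2 (x \<bullet> x)"
definition rd3 :: "3 => 3 => 3 => real^3 => real"
 where "rd3 i j k x = 4 * (of_bool (i = j) * x $ k + of_bool (i = k) * x $ j + of_bool (j = k) * x $ i) * g 2 (x \<bullet> x)
 + 8 * x $ i * x $ j * x $ k * g 3 (x \<bullet> x)"

lemma radial_has_derivative:
 "((%x. g m (x \<bullet> x)) has_derivative (%v. 2 * (x \<bullet> v) * g (Suc m) (x \<bullet> x))) (at (x :: real^3))"
proof -
 have "((%x. x \<bullet> x) has_derivative (%v. x \<bullet> v + v \<bullet> x)) (at x)"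
 by (auto intro!: derivative_eq_intros)
 from diff_chain_at[OF this has_field_derivative_imp_has_derivative[OF chain]]
 have "((%x. g m (x \<bullet> x)) has_derivative (%v. g (Suc m) (x \<bullet> x) * (x \<bullet> v + v \<bullet> x))) (at x)"
 by (simp add: o_def)
 then show ?thesis by (simp add: inner_commute mult.commute)
qed

lemma nth_has_derivative: "((%x :: real^3. x $ i) has_derivative (%v. v $ i)) (at x)"
 by (rule bounded_linear_imp_has_derivative) (rule bounded_linear_vec_nth)

lemma g_cont: "continuous_on S (%x :: real^3. g m (x \<bullet> x))"
 using radial_has_derivative
 by (intro continuous_at_imp_continuous_on ballI) (rule has_derivative_continuous)

lemma nth_cont: "continuous_on S (%x :: real^3. x $ i)"
 by (intro continuous_intros)

lemma rd_cont: "continuous_on S rd0" "continuous_on S (rd1 i)" "continuous_on S (rd2 i j)" "continuous_on S (rd3 i j k)"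
 unfolding rd0_def[abs_def] rd1_def[abs_def] rd2_def[abs_def] rd3_def[abs_def]
 by (intro continuous_intros g_cont nth_cont)+

lemma rd0_der: "(rd0 has_derivative (%v. 2 * (x \<bullet> v) * g 1 (x \<bullet> x))) (at x)"
 unfolding rd0_def[abs_def] using radial_has_derivative[of 0] by simp

lemma rd1_der: "(rd1 i has_derivative (%v. 2 * v $ i * g 1 (x \<bullet> x) + 2 * x $ i * (2 * (x \<bullet> v) * g 2 (x \<bullet> x)))) (at x)"
 unfolding rd1_def[abs_def]
 by (rule has_derivative_eq_rhs, rule derivative_eq_intros, rule has_derivative_mult_right[OF nth_has_derivative],
 rule radial_has_derivative, rule refl) (simp add: numeral_2_eq_2 algebra_simps fun_eq_iff)

lemma rd2_der: "(rd2 i j has_derivative (%v. 2 * of_bool (i = j) * (2 * (x \<bullet> v) * g 2 (x \<bullet> x))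
 + 4 * (v $ i * x $ j + x $ i * v $ j) * g 2 (x \<bullet> x) + 4 * x $ i * x $ j * (2 * (x \<bullet> v) * g 3 (x \<bullet> x)))) (at x)"
proof -
 have 1: "((%x. 2 * of_bool (i = j) * g 1 (x \<bullet> x)) has_derivative (%v. 2 * of_bool (i = j) * (2 * (x \<bullet> v) * g 2 (x \<bullet> x)))) (at x)"
 using has_derivative_mult_right[OF radial_has_derivative[of 1 x], of "2 * of_bool (i = j)"]
 by (simp add: numeral_2_eq_2)
 have 2: "((%x. x $ i * x $ j) has_derivative (%v. x $ i * v $ j + v $ i * x $ j)) (at x)"
 by (rule has_derivative_mult[OF nth_has_derivative nth_has_derivative])
 have 3: "((%x. (x $ i * x $ j) * g 2 (x \<bullet> x)) has_derivative
 (%v. (x $ i * x $ j) * (2 * (x \<bullet> v) * g 3 (x \<bullet> x)) + (x $ i * v $ j + v $ i * x $ j) * g 2 (x \<bullet> x))) (at x)"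
 using has_derivative_mult[OF 2 radial_has_derivative[of 2 x]] by (simp add: numeral_3_eq_3 numeral_2_eq_2)
 from has_derivative_add[OF 1 has_derivative_mult_right[OF 3, of 4]]
 show ?thesis unfolding rd2_def[abs_def] by (simp add: algebra_simps)
qed

lemma rd_differentiable: "rd0 differentiable (at x)" "rd1 i differentiable (at x)" "rd2 i j differentiable (at x)"
 using rd0_der rd1_der rd2_der by (blast intro: differentiableI)+

lemma pd_rd: "pd i rd0 = rd1 i" "pd j (rd1 i) = rd2 i j" "pd k (rd2 i j) = rd3 i j k"
proof -
 have ax: "axis l (1::real) $ m = of_bool (l = m)" for l m :: 3 by (simp add: axis_def)
 show "pd i rd0 = rd1 i"
 unfolding pd_def ddir_eq[OF rd0_der] by (simp add: rd1_def inner_axis fun_eq_iff)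
 show "pd j (rd1 i) = rd2 i j"
 unfolding pd_def ddir_eq[OF rd1_der] by (simp add: rd2_def inner_axis ax fun_eq_iff of_bool_def)
 show "pd k (rd2 i j) = rd3 i j k"
 unfolding pd_def ddir_eq[OF rd2_der] by (simp add: rd3_def inner_axis ax fun_eq_iff of_bool_def)
qed

lemma laplacian_rd0: "laplacian rd0 x = 6 * g 1 (x \<bullet> x) + 4 * (x \<bullet> x) * g 2 (x \<bullet> x)"
proof -
 have "laplacian rd0 x = (SS i. 2 * g 1 (x \<bullet> x) + 4 * (x $ i * x $ i) * g 2 (x \<bullet> x))"
 by (simp add: laplacian_def pd_rd rd2_def mult.assoc)
 also have "... = 6 * g 1 (x \<bullet> x) + 4 * (SS i. x $ i * x $ i) * g 2 (x \<bullet> x)"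
 by (simp add: sum.distrib sum_distrib_left sum_distrib_right)
 finally show ?thesis by (simp add: inner_vec_def)
qed

end

subsection \<open>The heat kernel and its potential\<close>

text \<open>With $G_0(\rho)=\int_0^1e^{-a^2\rho/4}\,da$ the potential of the Oseen kernel is
 $P(x,t)=\frac{1}{4\pi^{3/2}t^{1/2}}G_0(|x|^2/t)$; \<open>pot_moment m\<close> is the \<open>m\<close>-th derivative of $G_0$.\<close>

definition pot_moment :: "nat => real => real"
 where "pot_moment m \<rho> = integral {0..1} (%a. (- (a\<^sup>2 / 4)) ^ m * exp (- (a\<^sup>2 * \<rho> / 4)))"

text \<open>The heat kernel as a function of r = |x|^2, differentiated \<open>m\<close> times in
  \<open>r\<close>. The denominator is (4 pi t)^(3/2) written without real powers.\<close>

definition heat_rad :: "real => nat => real => real"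
 where "heat_rad t m r = (- 1 / (4 * t)) ^ m * exp (- r / (4 * t)) / (8 * pi * sqrt pi * (t * sqrt t))"

definition pot_rad :: "real => nat => real => real"
 where "pot_rad t m r = pot_moment m (r / t) / (4 * pi * sqrt pi * (sqrt t * t ^ m))"

lemma pot_moment_deriv: "(pot_moment m has_real_derivative pot_moment (Suc m) \<rho>) (at \<rho>)"
proof -
 have "((%\<rho>. integral (cbox 0 1) (%a. (- (a\<^sup>2 / 4)) ^ m * exp (- (a\<^sup>2 * \<rho> / 4)))) has_field_derivative
 integral (cbox 0 1) (%a. (- (a\<^sup>2 / 4)) ^ Suc m * exp (- (a\<^sup>2 * \<rho> / 4)))) (at \<rho> within UNIV)"
 proof (rule leibniz_rule_field_derivative)
 show "((%\<rho>. (- (a\<^sup>2 / 4)) ^ m * exp (- (a\<^sup>2 * \<rho> / 4))) has_field_derivative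
 (- (a\<^sup>2 / 4)) ^ Suc m * exp (- (a\<^sup>2 * \<rho> / 4))) (at \<rho> within UNIV)" for \<rho> a :: real
 by (auto intro!: derivative_eq_intros)
 show "(%a. (- (a\<^sup>2 / 4)) ^ m * exp (- (a\<^sup>2 * \<rho> / 4))) integrable_on cbox 0 1" for \<rho> :: real
 by (intro integrable_continuous continuous_intros) auto
 show "continuous_on (UNIV \<times> cbox 0 1) (%(\<rho>, a). (- (a\<^sup>2 / 4)) ^ Suc m * exp (- (a\<^sup>2 * \<rho> / 4)) :: real)"
 unfolding split_beta by (intro continuous_intros) auto
 qed auto
 then show ?thesis by (simp add: pot_moment_def[abs_def])
qed

text \<open>The combined integrand is the derivative in \<open>a\<close> of a exp(-a^2 \<rho>/4), so
  only the endpoint a = 1 contributes. It is the relation behind the time derivative of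
  \<open>P\<close>.\<close>

lemma pot_moment_identity_0: "pot_moment 0 \<rho> + 2 * \<rho> * pot_moment 1 \<rho> = exp (- \<rho> / 4)"
proof -
 have 1: "((%a. exp (- (a\<^sup>2 * \<rho> / 4)) + 2 * \<rho> * ((- (a\<^sup>2 / 4)) * exp (- (a\<^sup>2 * \<rho> / 4)))) has_integral
 (1 * exp (- (1\<^sup>2 * \<rho> / 4)) - 0 * exp (- (0\<^sup>2 * \<rho> / 4)))) {0..1}"
 by (rule fundamental_theorem_of_calculus)
 (auto intro!: derivative_eq_intros simp: has_real_derivative_iff_has_vector_derivative[symmetric]
 power2_eq_square algebra_simps)
 have 2: "((%a. exp (- (a\<^sup>2 * \<rho> / 4)) + 2 * \<rho> * ((- (a\<^sup>2 / 4)) * exp (- (a\<^sup>2 * \<rho> / 4)))) has_integral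
 (pot_moment 0 \<rho> + 2 * \<rho> * pot_moment 1 \<rho>)) {0..1}"
 unfolding pot_moment_def power_0 mult_1_left power_one_right
 by (intro has_integral_add has_integral_mult_right integrable_integral integrable_continuous_real continuous_intros) auto
 show ?thesis using has_integral_unique[OF 2 1] by simp
qed

text \<open>The derivative in \<rho> of the preceding identity, here obtained from the primitive
  -a^3 exp(-a^2 \<rho>/4)/4. It is the relation behind the Laplacian of \<open>P\<close>.\<close>

lemma pot_moment_identity_1: "3 * pot_moment 1 \<rho> + 2 * \<rho> * pot_moment 2 \<rho> = - exp (- \<rho> / 4) / 4"
proof -
 have 1: "((%a. 3 * ((- (a\<^sup>2 / 4)) * exp (- (a\<^sup>2 * \<rho> / 4))) + 2 * \<rho> * ((- (a\<^sup>2 / 4))\<^sup>2 * exp (- (a\<^sup>2 * \<rho> / 4)))) has_integral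
 (- 1 / 4 * 1^3 * exp (- (1\<^sup>2 * \<rho> / 4)) - - 1 / 4 * 0^3 * exp (- (0\<^sup>2 * \<rho> / 4)))) {0..1}"
 by (rule fundamental_theorem_of_calculus)
 (auto intro!: derivative_eq_intros simp: has_real_derivative_iff_has_vector_derivative[symmetric]
 power2_eq_square power3_eq_cube field_simps)
 have 2: "((%a. 3 * ((- (a\<^sup>2 / 4)) * exp (- (a\<^sup>2 * \<rho> / 4))) + 2 * \<rho> * ((- (a\<^sup>2 / 4))\<^sup>2 * exp (- (a\<^sup>2 * \<rho> / 4)))) has_integral
 (3 * pot_moment 1 \<rho> + 2 * \<rho> * pot_moment 2 \<rho>)) {0..1}"
 unfolding pot_moment_def power_one_right
 by (intro has_integral_add has_integral_mult_right integrable_integral integrable_continuous_real continuous_intros) auto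
 show ?thesis using has_integral_unique[OF 2 1] by simp
qed

lemma heat_chain: "radial_chain (heat_rad t)"
proof unfold_locales
 fix m r
 let ?a = "- 1 / (4 * t)" and ?C = "8 * pi * sqrt pi * (t * sqrt t)"
 have "((%r. exp (a * r)) has_real_derivative a * exp (a * r)) (at r)" for a :: real
 by (auto intro!: derivative_eq_intros)
 note this[of ?a]
 from DERIV_cmult[OF this, of "?a ^ m / ?C"]
 show "(heat_rad t m has_real_derivative heat_rad t (Suc m) r) (at r)"
 by (simp add: heat_rad_def[abs_def] mult_ac)
qed

lemma pot_chain: assumes "0 < t" shows "radial_chain (pot_rad t)"
proof unfold_locales
 fix m r
 have "((%r. pot_moment m (r / t)) has_real_derivative pot_moment (Suc m) (r / t) * (1 / t)) (at r)"
 by (rule DERIV_chain2[OF pot_moment_deriv DERIV_cdivide[OF DERIV_ident]])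
 from DERIV_cdivide[OF this, of "4 * pi * sqrt pi * (sqrt t * t ^ m)"]
 show "(pot_rad t m has_real_derivative pot_rad t (Suc m) r) (at r)"
 by (simp add: pot_rad_def[abs_def] mult.assoc mult.left_commute mult.commute)
qed

abbreviation heat :: "real => real^3 => real" where "heat t \<equiv> radial_chain.rd0 (heat_rad t)"
abbreviation pot :: "real => real^3 => real" where "pot t \<equiv> radial_chain.rd0 (pot_rad t)"

interpretation heat: radial_chain "heat_rad t" for t by (rule heat_chain)

lemma heat_eq: "heat t x = exp (- (x \<bullet> x) / (4 * t)) / (8 * pi * sqrt pi * (t * sqrt t))"
 by (simp add: heat.rd0_def heat_rad_def)

lemma pot_eq: "pot t x = pot_moment 0 (x \<bullet> x / t) / (4 * pi * sqrt pi * sqrt t)"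
 if "0 < t"
 using radial_chain.rd0_def[OF pot_chain[OF that]] by (simp add: pot_rad_def)

lemma powr_three_halves: "0 < t ==> t powr (3 / 2) = t * sqrt t"
proof -
 assume t: "0 < t"
 have "t powr (1 + 1 / 2) = t powr 1 * t powr (1 / 2)" by (rule powr_add)
 then show ?thesis using t by (simp add: powr_half_sqrt)
qed

lemma heat_kernel_eq: assumes "0 < t" shows "heat_kernel x t = heat t x"
proof -
 have "(4 * pi * t) powr (- 3 / 2) = 1 / ((4 * pi * t) powr (3 / 2))"
 by (simp add: powr_minus_divide[symmetric])
 also have "(4 * pi * t) powr (3 / 2) = 4 * pi * t * sqrt (4 * pi * t)"
 using assms by (intro powr_three_halves) simp
 also have "... = 8 * pi * sqrt pi * (t * sqrt t)" by (simp add: real_sqrt_mult)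
 finally show ?thesis by (simp add: heat_kernel_def heat_eq dot_square_norm)
qed

section \<open>The error function and the comparison of \<open>P\<close> with the Newton
  kernel\<close>

definition gauss_erf :: "real => real" where "gauss_erf N = integral {0..N} (%s. exp (- s\<^sup>2))"

lemma exp_scaled_integral:
 assumes "0 < k" "0 < b"
 shows "integral {0..b} (%s. exp (- (s\<^sup>2 * k\<^sup>2))) = gauss_erf (b * k) / k"
proof -
 have 1: "(gauss_erf has_vector_derivative exp (- s\<^sup>2)) (at s within {0..b * k})" if "s : {0..b * k}" for s
 unfolding gauss_erf_def[abs_def] by (rule integral_has_vector_derivative) (use that in \<open>auto intro!: continuous_intros\<close>)
 have "((%s. gauss_erf (s * k) / k) has_vector_derivative exp (- (s\<^sup>2 * k\<^sup>2))) (at s within {0..b})" if s: "s : {0..b}" for s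
 proof -
 have "((%s. s * k) has_real_derivative k) (at s within {0..b})" by (auto intro!: derivative_eq_intros)
 moreover have "(gauss_erf has_real_derivative exp (- (s * k)\<^sup>2)) (at (s * k) within (%s. s * k) ` {0..b})"
 proof (rule DERIV_subset)
 show "(gauss_erf has_real_derivative exp (- (s * k)\<^sup>2)) (at (s * k) within {0..b * k})"
 using 1[of "s * k"] s assms by (simp add: has_real_derivative_iff_has_vector_derivative mult_right_mono)
 qed (use assms in \<open>auto intro: mult_right_mono\<close>)
 ultimately have "((%s. gauss_erf (s * k)) has_real_derivative exp (- (s * k)\<^sup>2) * k) (at s within {0..b})"
 using DERIV_image_chain[of gauss_erf _ "%s. s * k" s "{0..b}" k] by (simp add: o_def)
 from DERIV_cdivide[OF this, of k]
 show ?thesis using assms by (simp add: has_real_derivative_iff_has_vector_derivative power_mult_distrib)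
 qed
 then have "((%s. exp (- (s\<^sup>2 * k\<^sup>2))) has_integral gauss_erf (b * k) / k - gauss_erf (0 * k) / k) {0..b}"
 using assms by (intro fundamental_theorem_of_calculus) auto
 then show ?thesis by (simp add: integral_unique gauss_erf_def)
qed

text \<open>Rescaling turns both integrals into \<open>gauss_erf\<close> of |x|/(2 sqrt t). At the
  origin the integrand of \<open>pot_moment 0\<close> is 1, which reproduces the prescribed limit
  value.\<close>

lemma oseen_potential_eq: assumes t: "0 < t" shows "oseen_potential x t = pot t x"
proof (cases "x = 0")
 case True
 then show ?thesis using t
 by (simp add: oseen_potential_def pot_eq pot_moment_def powr_three_halves powr_half_sqrt)
next
 case False
 define k where "k = norm x"
 have k: "0 < k" using False by (simp add: k_def)
 define q where "q = 1 / (2 * sqrt t)"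
 have q: "0 < q" using t by (simp add: q_def)
 have q2: "q\<^sup>2 = 1 / (4 * t)" using t by (simp add: q_def power_mult_distrib power_divide)
 have 1: "integral {0..k} (%\<xi>. exp (- \<xi>\<^sup>2 / (4 * t))) = gauss_erf (k * q) / q"
 using exp_scaled_integral[OF q k] by (simp add: q2)
 have "pot_moment 0 (x \<bullet> x / t) = integral {0..1} (%s. exp (- (s\<^sup>2 * (k * q)\<^sup>2)))"
 by (simp add: pot_moment_def power_mult_distrib q2 k_def dot_square_norm mult_ac)
 also have "... = gauss_erf (k * q) / (k * q)" using exp_scaled_integral[of "k * q" 1] k q by simp
 finally show ?thesis
 using False t 1 by (simp add: oseen_potential_def pot_eq powr_three_halves powr_half_sqrt k_def mult_ac)
qed

lemma gauss_erf_eq: "0 <= N ==> gauss_erf N = (LI s. indicator {..N} s *\<^sub>R (indicator {0..} s *\<^sub>R exp (- s\<^sup>2)))"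
proof -
 have "gauss_erf N = (LINT s:{0..N}|lborel. exp (- s\<^sup>2))"
 unfolding gauss_erf_def
 by (rule set_borel_integral_eq_integral(2)[symmetric]) (intro borel_integrable_atLeastAtMost' continuous_intros)
 also have "... = (LI s. indicator {..N} s *\<^sub>R (indicator {0..} s *\<^sub>R exp (- s\<^sup>2)))"
 unfolding set_lebesgue_integral_def by (intro bo_cong refl) (auto simp: indicator_def)
 finally show ?thesis .
qed


lemma gauss_erf_le: "gauss_erf N <= sqrt pi / 2"
proof (cases "0 <= N")
 case True
 have i: "integ (%x::real. indicator {0..} x *\<^sub>R exp (- x\<^sup>2))"
 using gaussian_moment_0 by (rule integrable.intros)
 have "gauss_erf N <= (LI s. indicator {0..} s *\<^sub>R exp (- s\<^sup>2))"
 unfolding gauss_erf_eq[OF True]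
 by (rule integral_mono[OF integrable_mult_indicator[OF _ i] i]) (auto simp: indicator_def)
 then show ?thesis using gaussian_moment_0 by (simp add: has_bochner_integral_iff)
next
 case False
 then show ?thesis by (simp add: gauss_erf_def)
qed

lemma gauss_erf_tendsto: "(gauss_erf \<longlongrightarrow> sqrt pi / 2) at_top"
proof -
 have i: "integ (%x::real. indicator {0..} x *\<^sub>R exp (- x\<^sup>2))"
 using gaussian_moment_0 by (rule integrable.intros)
 have "((%N. LI s. indicator {..N} s *\<^sub>R (indicator {0..} s *\<^sub>R exp (- s\<^sup>2))) \<longlongrightarrow> sqrt pi / 2) at_top"
 using tendsto_integral_at_top[OF sets_lborel i]
 unfolding has_bochner_integral_integral_eq[OF gaussian_moment_0] .
 then show ?thesis
 by (rule Lim_transform_eventually) (auto intro!: eventually_mono[OF eventually_ge_at_top[of 0]] simp: gauss_erf_eq)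
qed

text \<open>At the origin the value is 0 by the convention for division, so comparisons with
  \<open>pot\<close> exclude this point, which is a null set.\<close>

definition newton_kernel :: "real^3 => real" where "newton_kernel x = 1 / (4 * pi * norm x)"

text \<open>Here \<open>t\<close> occurs only in the argument of \<open>gauss_erf\<close>, which
  tends to infinity as t decreases to 0. This gives both the domination by
  \<open>newton_kernel\<close> and the convergence to it.\<close>

lemma pot_erf: assumes "0 < t" "x ~= 0"
 shows "pot t x = gauss_erf (norm x / (2 * sqrt t)) / (2 * pi * sqrt pi * norm x)"
proof -
 define k where "k = norm x / (2 * sqrt t)"
 have k: "0 < k" using assms by (simp add: k_def)
 have "k\<^sup>2 = (x \<bullet> x) / (4 * t)" using assms by (simp add: k_def power_divide power_mult_distrib dot_square_norm)
 then have "pot_moment 0 (x \<bullet> x / t) = integral {0..1} (%s. exp (- (s\<^sup>2 * k\<^sup>2)))"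
 using assms by (simp add: pot_moment_def mult_ac)
 also have "... = gauss_erf k / k" using exp_scaled_integral[OF k, of 1] by simp
 finally show ?thesis using assms by (simp add: pot_eq k_def)
qed

lemma pot_nonneg: "0 < t ==> 0 <= pot t x"
 by (simp add: pot_eq pot_moment_def Henstock_Kurzweil_Integration.integral_nonneg integrable_continuous_real continuous_intros)

lemma pot_le_newton: assumes "0 < t" "x ~= 0" shows "pot t x <= newton_kernel x"
proof -
 have "pot t x <= (sqrt pi / 2) / (2 * pi * sqrt pi * norm x)"
 unfolding pot_erf[OF assms] by (intro divide_right_mono gauss_erf_le) simp
 then show ?thesis by (simp add: newton_kernel_def)
qed

lemma pot_le: assumes "0 < t" shows "pot t x <= 1 / (4 * pi * sqrt pi * sqrt t)"
proof -
 have "pot_moment 0 (x \<bullet> x / t) <= integral {0..1::real} (%_. 1)"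
 unfolding pot_moment_def power_0 mult_1_left
 using assms by (intro integral_le integrable_continuous_real continuous_intros) auto
 then show ?thesis using assms by (simp add: pot_eq divide_right_mono)
qed

lemma pot_tendsto_newton: assumes "x ~= 0" shows "((%t. pot t x) \<longlongrightarrow> newton_kernel x) (at_right 0)"
proof -
 have "LIM t at_right 0. norm x / 2 * inverse (sqrt t) :> at_top"
 proof (rule filterlim_tendsto_pos_mult_at_top[OF tendsto_const])
 have "((%t. sqrt t) \<longlongrightarrow> 0) (at_right 0)" using tendsto_real_sqrt[OF tendsto_ident_at, of 0 "{0<..}"] by simp
 moreover have "\<forall>\<^sub>F t in at_right 0. 0 < sqrt t" by (auto simp: eventually_at_filter)
 ultimately show "LIM t at_right 0. inverse (sqrt t) :> at_top"
 by (intro filterlim_inverse_at_top)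
 qed (use assms in simp)
 then have "((%t. gauss_erf (norm x / 2 * inverse (sqrt t))) \<longlongrightarrow> sqrt pi / 2) (at_right 0)"
 by (rule filterlim_compose[OF gauss_erf_tendsto])
 then have "((%t. gauss_erf (norm x / 2 * inverse (sqrt t)) / (2 * pi * sqrt pi * norm x))
 \<longlongrightarrow> (sqrt pi / 2) / (2 * pi * sqrt pi * norm x)) (at_right 0)"
 using assms by (intro tendsto_divide tendsto_const) auto
 moreover have "\<forall>\<^sub>F t in at_right 0. gauss_erf (norm x / 2 * inverse (sqrt t)) / (2 * pi * sqrt pi * norm x) = pot t x"
 using eventually_at_right_less[of 0]
 proof (rule eventually_mono)
 fix t :: real assume "0 < t"
 have E: "norm x / 2 * inverse (sqrt t) = norm x / (2 * sqrt t)"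
 by (simp only: divide_inverse inverse_mult_distrib mult.assoc)
 show "gauss_erf (norm x / 2 * inverse (sqrt t)) / (2 * pi * sqrt pi * norm x) = pot t x"
 unfolding E by (rule pot_erf[OF \<open>0 < t\<close> assms, symmetric])
 qed
 ultimately have "((%t. pot t x) \<longlongrightarrow> (sqrt pi / 2) / (2 * pi * sqrt pi * norm x)) (at_right 0)"
 by (rule Lim_transform_eventually)
 then show ?thesis by (simp add: newton_kernel_def mult.assoc)
qed

lemma laplacian_heat: assumes "0 < t"
 shows "laplacian (heat t) x = (x \<bullet> x / (4 * t\<^sup>2) - 3 / (2 * t)) * heat t x"
proof -
 define H where "H = heat t x"
 have H: "heat_rad t m (x \<bullet> x) = (- 1 / (4 * t)) ^ m * H" for m
 by (simp add: heat_rad_def H_def heat_eq)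
 show ?thesis
 unfolding heat.laplacian_rd0 H H_def[symmetric] using assms by (simp add: field_simps power2_eq_square)
qed

text \<open>The radial Laplacian is 2/A times the left side of \<open>pot_moment_identity_1\<close>.
  In other words, P(.,t) is the Newton potential of the heat kernel.\<close>

lemma laplacian_pot: assumes t: "0 < t" shows "laplacian (pot t) x = - heat t x"
proof -
 define A where "A = 4 * pi * sqrt pi * (sqrt t * t)"
 have A: "A ~= 0" using t by (simp add: A_def)
 have "laplacian (pot t) x = 6 * pot_rad t 1 (x \<bullet> x) + 4 * (x \<bullet> x) * pot_rad t 2 (x \<bullet> x)"
 using radial_chain.laplacian_rd0[OF pot_chain[OF t]] .
 also have "... = 2 * (3 * pot_moment 1 (x \<bullet> x / t) + 2 * (x \<bullet> x / t) * pot_moment 2 (x \<bullet> x / t)) / A"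
 using t by (simp add: pot_rad_def A_def power2_eq_square field_simps)
 also have "... = - heat t x"
 unfolding pot_moment_identity_1 using t by (simp add: heat_eq A_def mult_ac)
 finally show ?thesis .
qed

lemma heat_time_deriv: assumes t: "0 < t"
 shows "((%t. heat t x) has_real_derivative laplacian (heat t) x) (at t)"
proof -
 let ?r = "x \<bullet> x" and ?C = "8 * pi * sqrt pi"
 have "((%t. exp (- ?r / (4 * t))) has_real_derivative exp (- ?r / (4 * t)) * (?r / (4 * t\<^sup>2))) (at t)"
 using t by (auto intro!: derivative_eq_intros simp: power2_eq_square)
 moreover have "((%t. ?C * (t * sqrt t)) has_real_derivative ?C * (sqrt t + t * (inverse (sqrt t) / 2))) (at t)"
 using t by (auto intro!: derivative_eq_intros)
 ultimately have "((%t. exp (- ?r / (4 * t)) / (?C * (t * sqrt t))) has_real_derivative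
 (exp (- ?r / (4 * t)) * (?r / (4 * t\<^sup>2)) * (?C * (t * sqrt t))
 - exp (- ?r / (4 * t)) * (?C * (sqrt t + t * (inverse (sqrt t) / 2))))
 / ((?C * (t * sqrt t)) * (?C * (t * sqrt t)))) (at t)"
 using t by (intro DERIV_divide) auto
 also have "(exp (- ?r / (4 * t)) * (?r / (4 * t\<^sup>2)) * (?C * (t * sqrt t))
 - exp (- ?r / (4 * t)) * (?C * (sqrt t + t * (inverse (sqrt t) / 2))))
 / ((?C * (t * sqrt t)) * (?C * (t * sqrt t))) = laplacian (heat t) x"
 proof -
 define s E where "s = sqrt t" and "E = exp (- ?r / (4 * t))"
 have s: "0 < s" "t = s * s" using t by (auto simp: s_def)
 show ?thesis unfolding laplacian_heat[OF t] heat_eq s_def[symmetric] E_def[symmetric]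
 using s(1) unfolding s(2) by (simp add: field_simps power2_eq_square)
 qed
 finally show ?thesis by (simp add: heat_eq)
qed

text \<open>Differentiating the factor t^(-1/2) and the argument |x|^2/t produces exactly the
  combination in \<open>pot_moment_identity_0\<close>. So \<open>P\<close> solves the heat equation
  although it is not integrable.\<close>

lemma pot_time_deriv: assumes t: "0 < t"
 shows "((%t. pot t x) has_real_derivative laplacian (pot t) x) (at t)"
proof -
 let ?r = "x \<bullet> x"
 have ev: "\<forall>\<^sub>F s in nhds t. 0 < s" using t by (auto simp: eventually_nhds_in_open[OF open_greaterThan, simplified])
 have "((%s. pot_moment 0 (?r / s)) has_real_derivative pot_moment 1 (?r / t) * (- ?r / t\<^sup>2)) (at t)"
 proof (rule DERIV_chain2[where f = "pot_moment 0" and g = "%s. ?r / s"])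
 show "(pot_moment 0 has_real_derivative pot_moment 1 (?r / t)) (at (?r / t))" using pot_moment_deriv[of 0] by simp
 show "((%s. ?r / s) has_real_derivative - ?r / t\<^sup>2) (at t)"
 using t by (auto intro!: derivative_eq_intros simp: power2_eq_square)
 qed
 moreover have "((%s. 4 * pi * sqrt pi * sqrt s) has_real_derivative 4 * pi * sqrt pi * (inverse (sqrt t) / 2)) (at t)"
 using t by (auto intro!: derivative_eq_intros)
 ultimately have "((%s. pot_moment 0 (?r / s) / (4 * pi * sqrt pi * sqrt s)) has_real_derivative
 ((pot_moment 1 (?r / t) * (- ?r / t\<^sup>2)) * (4 * pi * sqrt pi * sqrt t)
 - pot_moment 0 (?r / t) * (4 * pi * sqrt pi * (inverse (sqrt t) / 2)))
 / ((4 * pi * sqrt pi * sqrt t) * (4 * pi * sqrt pi * sqrt t))) (at t)"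
 using t by (intro DERIV_divide) auto
 also have "((pot_moment 1 (?r / t) * (- ?r / t\<^sup>2)) * (4 * pi * sqrt pi * sqrt t)
 - pot_moment 0 (?r / t) * (4 * pi * sqrt pi * (inverse (sqrt t) / 2)))
 / ((4 * pi * sqrt pi * sqrt t) * (4 * pi * sqrt pi * sqrt t))
 = - (pot_moment 0 (?r / t) + 2 * (?r / t) * pot_moment 1 (?r / t)) / (8 * pi * sqrt pi * (t * sqrt t))"
 proof -
 define s where "s = sqrt t"
 have s: "0 < s" "t = s * s" using t by (auto simp: s_def)
 show ?thesis unfolding s_def[symmetric] using s(1) unfolding s(2)
 by (simp add: field_simps power2_eq_square)
 qed
 also have "... = laplacian (pot t) x"
 unfolding pot_moment_identity_0 laplacian_pot[OF t] by (simp add: heat_eq)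
 finally have D: "((%s. pot_moment 0 (?r / s) / (4 * pi * sqrt pi * sqrt s)) has_real_derivative laplacian (pot t) x) (at t)" .
 have "\<forall>\<^sub>F s in nhds t. pot_moment 0 (?r / s) / (4 * pi * sqrt pi * sqrt s) = pot s x"
 using ev by (rule eventually_mono) (simp add: pot_eq)
 from iffD1[OF DERIV_cong_ev[OF refl this refl] D] show ?thesis .
qed

section \<open>Positivity, mass and moments of the heat kernel\<close>

lemma heat_nonneg: "0 < t ==> 0 <= heat t x"
 by (simp add: heat_eq)

lemma heat_le: "0 < t ==> heat t x <= 1 / (8 * pi * sqrt pi * (t * sqrt t))"
 unfolding heat_eq by (intro divide_right_mono) (auto simp: divide_nonpos_pos)

lemma heat_minus: "heat t (- x) = heat t x" by (simp add: heat_eq)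

lemma heat_diff_commute: "heat t (x - y) = heat t (y - x)"
 using heat_minus[of t "x - y"] by simp

lemma heat_measurable [measurable]: "(%z. heat (fst z) (snd z)) : borel_measurable (borel \<Otimes>\<^sub>M borel)"
 unfolding heat_eq by measurable

lemma heat_measurable' [measurable (raw)]:
 assumes "f : borel_measurable M" "g : borel_measurable M"
 shows "(%z. heat (f z) (g z)) : borel_measurable M"
 using measurable_compose[OF measurable_Pair[OF assms] heat_measurable] by simp

text \<open>Three independent Gaussians of variance 2t, one per coordinate; this reduces the total
  mass to that of the one-dimensional normal density.\<close>

lemma heat_prod: assumes "0 < t"
 shows "heat t x = (\<Prod>b\<in>Basis. normal_density 0 (sqrt (2 * t)) (x \<bullet> b))"
proof -
 have sq: "sqrt (2 * pi * (sqrt (2 * t))\<^sup>2) = 2 * sqrt pi * sqrt t"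
 proof -
 have "2 * pi * (sqrt (2 * t))\<^sup>2 = 4 * (pi * t)" using assms by simp
 then show ?thesis by (simp add: real_sqrt_mult)
 qed
 have "(\<Prod>b\<in>(Basis :: (real^3) set). normal_density 0 (sqrt (2 * t)) (x \<bullet> b))
 = (\<Prod>b\<in>(Basis :: (real^3) set). 1 / (2 * sqrt pi * sqrt t)) * (\<Prod>b\<in>Basis. exp (- (x \<bullet> b)\<^sup>2 / (4 * t)))"
 unfolding normal_density_def sq prod.distrib[symmetric] using assms by simp
 also have "(\<Prod>b\<in>(Basis :: (real^3) set). 1 / (2 * sqrt pi * sqrt t)) = 1 / (8 * pi * sqrt pi * (t * sqrt t))"
 proof -
 have "(2 * sqrt pi * sqrt t) ^ 3 = 8 * (sqrt pi * sqrt pi) * sqrt pi * ((sqrt t * sqrt t) * sqrt t)" by algebra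
 then show ?thesis using assms by (simp add: power_divide)
 qed
 also have "(\<Prod>b\<in>Basis. exp (- (x \<bullet> b)\<^sup>2 / (4 * t))) = exp (- (x \<bullet> x) / (4 * t))"
 proof -
 have "(\<Sum>b\<in>Basis. - (x \<bullet> b)\<^sup>2 / (4 * t)) = - (x \<bullet> x) / (4 * t)"
 unfolding euclidean_inner[of x x] by (simp add: sum_negf sum_divide_distrib power2_eq_square)
 then show ?thesis by (simp add: exp_sum[symmetric])
 qed
 finally show ?thesis by (simp add: heat_eq)
qed

lemma
 assumes t: "0 < t"
 shows heat_integrable: "integ (heat t)" and heat_integral: "(LI x. heat t x) = 1"
proof -
 have 1: "(\<integral>\<^sup>+s. ennreal (normal_density 0 (sqrt (2 * t)) s) \<partial>lborel) = 1"
 using t by (subst nn_integral_eq_integral) auto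
 have "(\<integral>\<^sup>+x. ennreal (heat t x) \<partial>lborel) = integral\<^sup>N lborel (%x :: real^3. \<Prod>b\<in>Basis. ennreal (normal_density 0 (sqrt (2 * t)) (x \<bullet> b)))"
 unfolding heat_prod[OF t] by (simp add: prod_ennreal)
 also have "... = (\<Prod>b\<in>(Basis :: (real^3) set). (\<integral>\<^sup>+s. ennreal (normal_density 0 (sqrt (2 * t)) s) \<partial>lborel))"
 by (rule nn_integral_lborel_prod) auto
 finally have nn: "(\<integral>\<^sup>+x. ennreal (heat t x) \<partial>lborel) = 1" by (simp add: 1)
 have [measurable]: "heat t : borel_measurable lborel" by measurable
 show "integ (heat t)"
 using nn t by (intro integrableI_nonneg) (auto simp: heat_nonneg)
 show "(LI x. heat t x) = 1"
 using nn t by (subst integral_eq_nn_integral) (auto simp: heat_nonneg)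
qed

text \<open>Half of the Gaussian pays for the power and the other half, exp(-|x|^2/8), is a multiple
  of the heat kernel at time 2. With N = 8(n+1) one has n/N <= 1/8, so the exponential that
  dominates |x|^n costs at most exp(|x|^2/8).\<close>

lemma norm_power_gauss_integrable: "integ (%x :: real^3. norm x ^ n * exp (- (x \<bullet> x) / 4))"
proof (rule bo_integrable_bound)
 let ?C = "(8 * real (Suc n)) ^ n * (8 * pi * sqrt pi * (2 * sqrt 2))"
 show "integ (%x. ?C * heat 2 x)" by (intro integrable_mult_right heat_integrable) simp
 have "norm x ^ n * exp (- (x \<bullet> x) / 4) <= ?C * heat 2 x" for x :: "real^3"
 proof -
 define u N where "u = norm x" and "N = 8 * real (Suc n)"
 have u: "0 <= u" and xx: "x \<bullet> x = u\<^sup>2" and N: "8 <= N" by (auto simp: u_def dot_square_norm N_def)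
 have "u <= 1 + u\<^sup>2" using sum_squares_bound[of u 1] u by (simp add: mult.commute)
 also have "... <= N * (1 + u\<^sup>2 / N)" using N by (simp add: distrib_left)
 also have "... <= N * exp (u\<^sup>2 / N)" using N by (intro mult_left_mono exp_ge_add_one_self) auto
 finally have "u ^ n <= (N * exp (u\<^sup>2 / N)) ^ n" using u by (intro power_mono)
 also have "... = N ^ n * exp (real n * (u\<^sup>2 / N))" by (simp only: power_mult_distrib exp_of_nat_mult)
 also have "... <= N ^ n * exp (u\<^sup>2 / 8)"
 proof -
 have "real n * (u\<^sup>2 / N) <= u\<^sup>2 / 8" by (simp add: N_def field_simps)
 then show ?thesis using N by (intro mult_left_mono) auto
 qed
 finally have "u ^ n * exp (- u\<^sup>2 / 4) <= N ^ n * exp (u\<^sup>2 / 8) * exp (- u\<^sup>2 / 4)"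
 by (intro mult_right_mono) auto
 also have "... = N ^ n * exp (- u\<^sup>2 / 8)" by (simp add: exp_add[symmetric])
 also have "... = ?C * heat 2 x" by (simp add: heat_eq xx N_def)
 finally show ?thesis by (simp add: xx u_def)
 qed
 then show "AE x in lborel. norm (norm x ^ n * exp (- (x \<bullet> x) / 4)) <= norm (?C * heat 2 x)"
 by (intro AE_I2) (simp add: heat_nonneg abs_of_nonneg)
qed measurable

section \<open>Integrability of the gradient of the Oseen kernel\<close>

lemma pot_moment_measurable [measurable]: "pot_moment m : BM"
 by (intro borel_measurable_continuous_onI continuous_at_imp_continuous_on ballI DERIV_isCont[OF pot_moment_deriv])

text \<open>Integrating over \<open>x\<close> first, the substitution x -> x/a yields |a|^-(n+3),
  which cancels the a^(2m) of the moment exactly when n + 3 = 2m and leaves a constant on the unit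
  interval. The cases (n,m) = (1,2) and (3,3) are the ones that occur in the kernel.\<close>

lemma norm_power_pot_moment_integrable:
 assumes nm: "n + 3 = 2 * m"
 shows "integ (%x :: real^3. norm x ^ n * pot_moment m (x \<bullet> x))"
proof -
 let ?h = "%a (x :: real^3). indicator {0..1} a * ((- (a\<^sup>2 / 4)) ^ m * (norm x ^ n * exp (- (a\<^sup>2 * (x \<bullet> x) / 4))))"
 let ?f = "%x :: real^3. norm x ^ n * exp (- (x \<bullet> x) / 4)"
 have f: "integ ?f" by (rule norm_power_gauss_integrable)
 have [measurable]: "?f : BM" by measurable
 have sc: "norm x ^ n * exp (- (a\<^sup>2 * (x \<bullet> x) / 4)) = ?f (0 + a *\<^sub>R x) / \<bar>a\<bar> ^ n" if "a ~= 0" for a and x :: "real^3"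
 using that by (simp add: power_mult_distrib power2_eq_square mult.assoc)
 have int_x: "integ (%x :: real^3. norm x ^ n * exp (- (a\<^sup>2 * (x \<bullet> x) / 4)))" if "a ~= 0" for a
 unfolding sc[OF that] using integrable_affine_iff[OF that, of ?f 0] f by simp
 have LINT_x: "(LI x. norm (?h a x)) = indicator {0..1} a * ((1 / 4) ^ m * (LI x. ?f x))"
 if a: "a ~= 0" for a
 proof -
 have "(LI x. norm (?h a x))
 = (LI x. indicator {0..1} a * ((a\<^sup>2 / 4) ^ m * (norm (x :: real^3) ^ n * exp (- (a\<^sup>2 * (x \<bullet> x) / 4)))))"
 proof -
 have "norm (?h a x) = indicator {0..1} a * ((a\<^sup>2 / 4) ^ m * (norm x ^ n * exp (- (a\<^sup>2 * (x \<bullet> x) / 4))))" for x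
 by (simp add: abs_mult power_abs)
 then show ?thesis by (simp only:)
 qed
 also have "... = indicator {0..1} a * ((a\<^sup>2 / 4) ^ m * ((LI x. ?f (0 + a *\<^sub>R x)) / \<bar>a\<bar> ^ n))"
 unfolding sc[OF a] by simp
 also have "(LI x. ?f (0 + a *\<^sub>R x)) = (LI x. ?f x) / \<bar>a\<bar> ^ 3"
 using integral_affine[OF a, of ?f 0] by simp
 also have "(a\<^sup>2 / 4) ^ m * ((LI x. ?f x) / \<bar>a\<bar> ^ 3 / \<bar>a\<bar> ^ n) = (1 / 4) ^ m * (LI x. ?f x)"
 proof -
 have "(a\<^sup>2) ^ m = \<bar>a\<bar> ^ (2 * m)" by (simp add: power_mult)
 also have "... = \<bar>a\<bar> ^ 3 * \<bar>a\<bar> ^ n" unfolding nm[symmetric] by (simp add: power_add)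
 finally show ?thesis using a by (simp add: power_divide)
 qed
 finally show ?thesis .
 qed
 have "integrable (LL) (%(a, x). ?h a x)"
 proof (rule lborel_pair.Fubini_integrable)
 have ne0: "AE a in lborel. a ~= (0::real)" by (rule AE_lborel_singleton)
 show "AE a in lborel. integ (%x. case (a, x) of (a, x) => ?h a x)"
 using ne0 by eventually_elim (simp add: int_x)
 have "integ (%a :: real. indicator {0..1} a * ((1 / 4) ^ m * (LI x. ?f x)))"
 by (intro integrable_mult_left integrable_real_indicator) auto
 then show "integ (%a. LI x. norm (case (a, x) of (a, x) => ?h a x))"
 by (rule integrable_cong_AE_imp) (use ne0 LINT_x in \<open>auto elim!: eventually_mono\<close>)
 qed measurable
 then have "integ (%x. LI a. ?h a x)"
 using lborel_pair.integrable_snd[of ?h] by simp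
 moreover have "(LI a. ?h a x) = norm x ^ n * pot_moment m (x \<bullet> x)" for x
 proof -
 have "(LI a. ?h a x) = norm x ^ n * (LINT a:{0..1}|lborel. (- (a\<^sup>2 / 4)) ^ m * exp (- (a\<^sup>2 * (x \<bullet> x) / 4)))"
 unfolding set_lebesgue_integral_def integral_mult_right_zero[symmetric]
 by (intro bo_cong refl) (simp add: mult_ac)
 also have "(LINT a:{0..1}|lborel. (- (a\<^sup>2 / 4)) ^ m * exp (- (a\<^sup>2 * (x \<bullet> x) / 4))) = pot_moment m (x \<bullet> x)"
 unfolding pot_moment_def
 by (rule set_borel_integral_eq_integral(2)) (intro borel_integrable_atLeastAtMost' continuous_intros; simp)
 finally show ?thesis .
 qed
 ultimately show ?thesis by simp
qed

text \<open>$\partial_i\mathcal T_{jk}(x,t)$, which scales as $t^{-2}\kappa(x/\sqrt t)$ with $\kappa\in L^1$.\<close>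

definition oseen_grad :: "3 => 3 => 3 => real => real^3 => real"
 where "oseen_grad i j k t x = of_bool (j = k) * (2 * x $ i * heat_rad t 1 (x \<bullet> x))
 + (4 * (of_bool (k = j) * x $ i + of_bool (k = i) * x $ j + of_bool (j = i) * x $ k) * pot_rad t 2 (x \<bullet> x)
 + 8 * x $ k * x $ j * x $ i * pot_rad t 3 (x \<bullet> x))"

lemma heat_pot_rad_measurable [measurable (raw)]:
 assumes [measurable]: "f : borel_measurable M" "g : borel_measurable M"
 shows "(%z. heat_rad (f z) m (g z)) : borel_measurable M" "(%z. pot_rad (f z) m (g z)) : borel_measurable M"
 unfolding heat_rad_def pot_rad_def by measurable

lemma vec_nth_measurable [measurable]: "(%x :: real^3. x $ i) : BM"
 by (intro borel_measurable_continuous_onI continuous_intros)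

lemma oseen_grad_measurable [measurable (raw)]:
 assumes [measurable]: "f : borel_measurable M" "g : borel_measurable M"
 shows "(%z. oseen_grad i j k (f z) (g z)) : borel_measurable M"
proof -
 have [measurable]: "(%z. g z $ l) : borel_measurable M" for l
 using measurable_compose[OF assms(2) vec_nth_measurable] .
 show ?thesis unfolding oseen_grad_def by measurable
qed

lemma oseen_grad_scale: assumes t: "0 < t"
 shows "oseen_grad i j k t x = oseen_grad i j k 1 ((1 / sqrt t) *\<^sub>R x) / t\<^sup>2"
proof -
 define s where "s = sqrt t"
 have s: "0 < s" "t = s * s" using t by (auto simp: s_def)
 define z where "z = (1 / s) *\<^sub>R x"
 have x: "x = s *\<^sub>R z" using s by (simp add: z_def)
 have zz: "x \<bullet> x / t = z \<bullet> z" using s by (simp add: x power2_eq_square)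
 have h: "heat_rad t 1 (x \<bullet> x) = heat_rad 1 1 (z \<bullet> z) / (t * (t * s))"
 proof -
 have "- (x \<bullet> x) / (4 * t) = - (z \<bullet> z) / (4 * 1)" unfolding zz[symmetric] by simp
 then show ?thesis unfolding heat_rad_def by (simp add: s_def[symmetric] mult_ac)
 qed
 have p: "pot_rad t m (x \<bullet> x) = pot_rad 1 m (z \<bullet> z) / (s * t ^ m)" for m
 by (simp add: pot_rad_def zz s_def[symmetric])
 show ?thesis
 unfolding s_def[symmetric] z_def[symmetric] oseen_grad_def h p using s(1) unfolding x s(2)
 by (simp add: field_simps power2_eq_square power3_eq_cube)
qed

lemma oseen_grad_1_integrable: "integ (oseen_grad i j k 1)"
proof (rule bo_integrable_bound)
 let ?c = "4 * pi * sqrt pi"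
 \<comment> \<open>The factor 12 is 4 times three terms of size |x|. The minus sign makes the last
   summand nonnegative, since the third moment carries an odd power of -a^2/4.\<close>
 let ?B = "%x :: real^3. norm x ^ 1 * exp (- (x \<bullet> x) / 4) + 12 * (norm x ^ 1 * pot_moment 2 (x \<bullet> x)) + 8 * (- (norm x ^ 3 * pot_moment 3 (x \<bullet> x)))"
 show "integ ?B"
 by (intro bo_integrable_add integrable_mult_right integrable_minus
 norm_power_gauss_integrable norm_power_pot_moment_integrable) auto
 have c1: "1 <= ?c"
 proof -
 have "1 <= pi" "1 <= sqrt pi" using pi_gt3 by auto
 then have "1 * 1 <= pi * sqrt pi" by (intro mult_mono) auto
 then show ?thesis by simp
 qed
 have abs3: "\<bar>a + (b + c)\<bar> <= \<bar>a\<bar> + \<bar>b\<bar> + \<bar>c\<bar>" for a b c :: real by linarith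
 have "\<bar>oseen_grad i j k 1 x\<bar> <= ?B x" for x
 proof -
 let ?r = "x \<bullet> x"
 have n: "\<bar>x $ l\<bar> <= norm x" for l by (rule component_le_norm_cart)
 have m2: "0 <= pot_moment 2 ?r"
 unfolding pot_moment_def
 by (intro Henstock_Kurzweil_Integration.integral_nonneg integrable_continuous_real continuous_intros) auto
 have m3: "0 <= - pot_moment 3 ?r"
 proof -
 have "0 <= integral {0..1} (%a. - ((- (a\<^sup>2 / 4)) ^ 3 * exp (- (a\<^sup>2 * ?r / 4))))"
 by (intro Henstock_Kurzweil_Integration.integral_nonneg integrable_continuous_real continuous_intros)
 (auto simp: power3_eq_cube)
 then show ?thesis by (simp add: pot_moment_def)
 qed
 have A: "\<bar>of_bool (j = k) * (2 * x $ i * heat_rad 1 1 ?r)\<bar> <= norm x * exp (- ?r / 4)"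
 proof -
 have "\<bar>heat_rad 1 1 ?r\<bar> = exp (- ?r / 4) / (8 * ?c)" by (simp add: heat_rad_def abs_mult)
 also have "... <= exp (- ?r / 4) / 2" using c1 by (intro divide_left_mono) auto
 finally have "\<bar>x $ i\<bar> * \<bar>heat_rad 1 1 ?r\<bar> <= norm x * (exp (- ?r / 4) / 2)" by (intro mult_mono n) auto
 then show ?thesis by (simp add: abs_mult)
 qed
 have P: "\<bar>pot_rad 1 m ?r\<bar> <= \<bar>pot_moment m ?r\<bar>" for m
 using c1 divide_left_mono[of 1 ?c "\<bar>pot_moment m ?r\<bar>"] by (simp add: pot_rad_def)
 define S where "S = of_bool (k = j) * x $ i + of_bool (k = i) * x $ j + of_bool (j = i) * x $ k"
 have s3: "\<bar>S\<bar> <= 3 * norm x"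
 unfolding S_def using n[of i] n[of j] n[of k] norm_ge_zero[of x] by (auto simp: of_bool_def)
 have B: "\<bar>4 * S * pot_rad 1 2 ?r\<bar> <= 12 * (norm x * pot_moment 2 ?r)"
 proof -
 have "\<bar>S\<bar> * \<bar>pot_rad 1 2 ?r\<bar> <= 3 * norm x * \<bar>pot_moment 2 ?r\<bar>"
 by (intro mult_mono s3 P) auto
 then show ?thesis using m2 by (simp add: abs_mult mult.assoc)
 qed
 have C: "\<bar>8 * x $ k * x $ j * x $ i * pot_rad 1 3 ?r\<bar> <= 8 * (- (norm x ^ 3 * pot_moment 3 ?r))"
 proof -
 have "\<bar>x $ k\<bar> * \<bar>x $ j\<bar> * \<bar>x $ i\<bar> * \<bar>pot_rad 1 3 ?r\<bar> <= norm x * norm x * norm x * \<bar>pot_moment 3 ?r\<bar>"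
 by (intro mult_mono n P) auto
 then have "8 * (\<bar>x $ k\<bar> * \<bar>x $ j\<bar> * \<bar>x $ i\<bar> * \<bar>pot_rad 1 3 ?r\<bar>) <= 8 * (norm x * norm x * norm x * \<bar>pot_moment 3 ?r\<bar>)"
 by (rule mult_left_mono) simp
 moreover have "\<bar>8 * a * b * c * p\<bar> = 8 * (\<bar>a\<bar> * \<bar>b\<bar> * \<bar>c\<bar> * \<bar>p\<bar>)" for a b c p :: real
 by (simp add: abs_mult)
 moreover have "8 * (norm x * norm x * norm x * \<bar>pot_moment 3 ?r\<bar>) = 8 * (- (norm x ^ 3 * pot_moment 3 ?r))"
 using m3 by (simp add: power3_eq_cube)
 ultimately show ?thesis by (simp only:)
 qed
 show ?thesis unfolding oseen_grad_def power_one_right S_def[symmetric] 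
 by (rule order_trans[OF abs3 add_mono[OF add_mono[OF A B] C]])
 qed
 then show "AE x in lborel. norm (oseen_grad i j k 1 x) <= norm (?B x)"
 by (intro AE_I2) (simp only: real_norm_def, rule order_trans[OF _ abs_ge_self])
qed measurable

text \<open>Scaling contributes t^-2 and the change of variables t^(3/2); the resulting t^(-1/2) is
  integrable at time 0.\<close>

lemma
 assumes t: "0 < t"
 shows oseen_grad_integrable: "integ (oseen_grad i j k t)"
 and oseen_grad_L1: "(LI x. \<bar>oseen_grad i j k t x\<bar>) = (LI x. \<bar>oseen_grad i j k 1 x\<bar>) / sqrt t"
proof -
 define s where "s = sqrt t"
 have s: "0 < s" "t = s * s" using t by (auto simp: s_def)
 have eq: "oseen_grad i j k t = (%x. oseen_grad i j k 1 (0 + (1 / s) *\<^sub>R x) / t\<^sup>2)"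
 using oseen_grad_scale[OF t] by (auto simp: s_def)
 have [measurable]: "oseen_grad i j k 1 : BM" by measurable
 show "integ (oseen_grad i j k t)"
 unfolding eq using integrable_affine_iff[of "1 / s" "oseen_grad i j k 1" 0] s oseen_grad_1_integrable by simp
 have "(LI x. \<bar>oseen_grad i j k t x\<bar>) = (LI x. \<bar>oseen_grad i j k 1 (0 + (1 / s) *\<^sub>R x)\<bar>) / t\<^sup>2"
 unfolding eq by simp
 also have "... = (LI x. \<bar>oseen_grad i j k 1 x\<bar>) / s"
 using s integral_affine[of "1 / s" "%x. \<bar>oseen_grad i j k 1 x\<bar>" 0]
 by (simp add: power_divide power2_eq_square power3_eq_cube)
 finally show "(LI x. \<bar>oseen_grad i j k t x\<bar>) = (LI x. \<bar>oseen_grad i j k 1 x\<bar>) / sqrt t"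
 by (simp add: s_def)
qed

text \<open>The sign comes from differentiating in \<open>y\<close> through x - y. It is the reason
  why the velocity later appears as heat flow minus potential.\<close>

lemma oseen_grad_eq:
 assumes t: "0 < t"
 shows "pd i (%z. oseen_kernel j k (x - z) t) y = - oseen_grad i j k t (x - y)"
proof -
 interpret pot: radial_chain "pot_rad t" by (rule pot_chain[OF t])
 have k: "oseen_kernel j k = (%w s. (if j = k then heat_kernel w s else 0) + pd j (pd k (%z. oseen_potential z s)) w)"
 by (intro ext) (simp add: oseen_kernel_def)
 have eq: "oseen_kernel j k w t = of_bool (j = k) * heat t w + pot.rd2 k j w" for w
 unfolding oseen_kernel_def oseen_potential_eq[OF t] heat_kernel_eq[OF t] by (simp add: pot.pd_rd)
 let ?D = "%v. of_bool (j = k) * frechet_derivative (heat t) (at (x - y)) v + frechet_derivative (pot.rd2 k j) (at (x - y)) v"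
 have "((%w. of_bool (j = k) * heat t w + pot.rd2 k j w) has_derivative ?D) (at (x - y))"
 by (intro has_derivative_add has_derivative_mult_right frechet_derivative_works[THEN iffD1] heat.rd_differentiable pot.rd_differentiable)
 moreover have "((%z. x - z) has_derivative uminus) (at y)" by (auto intro!: derivative_eq_intros)
 ultimately have "((%z. of_bool (j = k) * heat t (x - z) + pot.rd2 k j (x - z)) has_derivative (%v. ?D (- v))) (at y)"
 using diff_chain_at[of "%z. x - z" uminus y] by (fastforce simp: o_def)
 then have "pd i (%z. oseen_kernel j k (x - z) t) y = ?D (- axis i 1)"
 unfolding eq pd_def by (rule ddir_eq)
 also have "... = - ?D (axis i 1)"
 using linear_neg[OF linear_frechet_derivative[OF heat.rd_differentiable(1)]]
 linear_neg[OF linear_frechet_derivative[OF pot.rd_differentiable(3)]] by simp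
 also have "?D (axis i 1) = of_bool (j = k) * heat.rd1 t i (x - y) + pot.rd3 k j i (x - y)"
 unfolding heat.pd_rd(1)[symmetric] pot.pd_rd(3)[symmetric] pd_def ..
 also have "... = oseen_grad i j k t (x - y)"
 by (simp add: oseen_grad_def heat.rd1_def pot.rd3_def)
 finally show ?thesis .
qed

subsection \<open>Newton potentials of test functions\<close>

lemma pot_measurable [measurable (raw)]:
 assumes "g : borel_measurable M" "0 < t"
 shows "(%z. pot t (g z)) : borel_measurable M"
 unfolding pot_eq[OF assms(2)] using assms(1) by measurable

text \<open>From the time derivative of \<open>P\<close>, which is minus the heat kernel. Thus a
  difference of two potentials is nonnegative and integrable with mass b - a, although each
  potential decays only like 1/|x|.\<close>

lemma pot_diff_eq:
 assumes "0 < a" "a <= b"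
 shows "(LI s. indicator {a..b} s * heat s x) = pot a x - pot b x"
proof -
 have "(LI s. indicator {a..b} s *\<^sub>R - heat s x) = pot b x - pot a x"
 proof (rule integral_FTC_atLeastAtMost[OF assms(2)])
 fix s assume s: "a <= s" "s <= b"
 then have "0 < s" using assms by simp
 from pot_time_deriv[OF this, of x] laplacian_pot[OF this, of x]
 show "((%s. pot s x) has_vector_derivative - heat s x) (at s within {a..b})"
 by (simp add: has_real_derivative_iff_has_vector_derivative has_vector_derivative_at_within)
 next
 show "continuous_on {a..b} (%s. - heat s x)"
 unfolding heat_eq using assms by (intro continuous_intros) auto
 qed
 then show ?thesis by simp
qed

lemma
 assumes ab: "0 < a" "a <= b"
 shows pot_diff_integrable: "integ (%x. pot a x - pot b x)"
 and pot_diff_integral: "(LI x. pot a x - pot b x) = b - a"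
 and pot_diff_nonneg: "0 <= pot a x - pot b x"
proof -
 let ?h = "%s x. indicator {a..b} s * heat s x"
 have i: "integ (%x. ?h s x)" "(LI x. ?h s x) = indicator {a..b} s" "0 <= ?h s x" for s x
 using ab by (auto simp: indicator_def heat_integral heat_integrable heat_nonneg)
 have int: "integrable (LL) (%(s, x). ?h s x)"
 proof (rule lborel_pair.Fubini_integrable)
 have "integ (%s. indicator {a..b} s :: real)" by (intro integrable_real_indicator) (auto simp: ab)
 then show "integ (%s. LI x. norm (case (s, x) of (s, x) => ?h s x))"
 by (simp only: prod.case real_norm_def abs_of_nonneg[OF i(3)] i(2))
 show "AE s in lborel. integ (%x. case (s, x) of (s, x) => ?h s x)"
 using i(1) by (intro AE_I2) simp
 qed measurable
 show "integ (%x. pot a x - pot b x)"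
 using lborel_pair.integrable_snd[of ?h] int by (simp add: pot_diff_eq[OF ab])
 have "(LI x. LI s. ?h s x) = (LI s. LI x. ?h s x)"
 using lborel_pair.Fubini_integral[of ?h] int by simp
 also have "... = (LI s. indicator {a..b} s)" by (simp only: i(2))
 finally show "(LI x. pot a x - pot b x) = b - a"
 using ab by (simp add: pot_diff_eq[OF ab])
 show "0 <= pot a x - pot b x"
 unfolding pot_diff_eq[OF ab, symmetric] using i(3) by (intro bo_integral_nonneg)
qed

lemma newton_kernel_measurable [measurable]: "newton_kernel : BM"
 unfolding newton_kernel_def[abs_def] by measurable

lemma newton_kernel_nonneg: "0 <= newton_kernel x" by (simp add: newton_kernel_def)

text \<open>Fatou's lemma along P(.,1/n) - P(.,1), whose mass is 1 - 1/n. This splits the Newton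
  kernel into an integrable singular part and the bounded function P(.,1).\<close>

lemma newton_minus_pot_nn_integral: "(\<integral>\<^sup>+x. ennreal (newton_kernel x - pot 1 x) \<partial>lborel) <= 1"
proof -
 let ?f = "%n x. ennreal (pot (1 / real (Suc n)) x - pot 1 x)"
 have seq: "filterlim (%n. 1 / real (Suc n)) (at_right 0) sequentially"
 using LIMSEQ_Suc[OF lim_1_over_n] by (auto simp: filterlim_at)
 have "AE x in lborel. x ~= (0 :: real^3)" by (rule AE_lborel_singleton)
 then have "(\<integral>\<^sup>+x. ennreal (newton_kernel x - pot 1 x) \<partial>lborel) <= (\<integral>\<^sup>+x. liminf (%n. ?f n x) \<partial>lborel)"
 proof (intro nn_integral_mono_AE, eventually_elim)
 fix x :: "real^3" assume "x ~= 0"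
 then have "(%n. pot (1 / real (Suc n)) x) ----> newton_kernel x"
 by (rule filterlim_compose[OF pot_tendsto_newton seq])
 then have "(%n. ?f n x) ----> ennreal (newton_kernel x - pot 1 x)"
 by (intro tendsto_ennrealI tendsto_diff tendsto_const)
 from lim_imp_Liminf[OF _ this] show "ennreal (newton_kernel x - pot 1 x) <= liminf (%n. ?f n x)" by simp
 qed
 also have "... <= liminf (%n. \<integral>\<^sup>+x. ?f n x \<partial>lborel)"
 by (rule nn_integral_liminf) measurable
 also have "... <= liminf (%n. 1)"
 proof (rule Liminf_mono, rule always_eventually, rule allI)
 fix n
 have "0 < 1 / real (Suc n)" "1 / real (Suc n) <= 1" by auto
 note * = pot_diff_integrable[OF this] pot_diff_integral[OF this] pot_diff_nonneg[OF this]
 have "(\<integral>\<^sup>+x. ?f n x \<partial>lborel) = ennreal (1 - 1 / real (Suc n))"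
 using * by (subst nn_integral_eq_integral) auto
 then show "(\<integral>\<^sup>+x. ?f n x \<partial>lborel) <= 1" by (simp add: ennreal_le_1)
 qed
 finally show ?thesis by (simp add: Liminf_const)
qed

text \<open>The singular part of the kernel, of mass at most 1, is paired with the bound
  \<open>C\<close>; the remaining P(.,1), bounded by 1, is paired with the \<open>L1\<close> norm of
  \<open>g\<close>.\<close>

lemma
 fixes g :: "real^3 => real"
 assumes g: "integ g" "!!x. \<bar>g x\<bar> <= C"
 shows newton_conv_integrable: "integ (%x. newton_kernel (x - y) * g x)"
 and newton_conv_bound: "(LI x. newton_kernel (x - y) * \<bar>g x\<bar>) <= C + (LI x. \<bar>g x\<bar>)"
proof -
 have C: "0 <= C" using order_trans[OF abs_ge_zero g(2)] .
 have [measurable]: "g : BM" using g by simp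
 let ?W = "%x. newton_kernel x - pot 1 x"
 have ae: "AE x in lborel. 0 <= ?W x"
 using AE_lborel_singleton[of 0] by eventually_elim (simp add: pot_le_newton)
 have W: "integ ?W"
 using newton_minus_pot_nn_integral ae by (intro integrableI_nonneg) (auto intro: le_less_trans)
 have W1: "(LI x. ?W x) <= 1"
 using newton_minus_pot_nn_integral nn_integral_eq_integral[OF W ae] by (simp add: ennreal_le_1)
 let ?B = "%x. C * \<bar>?W (x - y)\<bar> + \<bar>g x\<bar>"
 have W': "integ (%x. ?W (x - y))" using integrable_translate_iff[of ?W y] W by simp
 have B: "integ ?B" using W' g by (intro bo_integrable_add integrable_mult_right integrable_abs)
 have le: "newton_kernel (x - y) * \<bar>g x\<bar> <= ?B x" for x
 proof -
 have "pot 1 z <= 1" for z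
 proof -
 have "1 <= pi" "1 <= sqrt pi" using pi_gt3 by auto
 then have "1 * 1 <= pi * sqrt pi" by (intro mult_mono) auto
 then have "1 / (4 * pi * sqrt pi * sqrt 1) <= 1" by simp
 then show ?thesis using pot_le[of 1 z] by linarith
 qed
 then have "newton_kernel (x - y) <= \<bar>?W (x - y)\<bar> + 1" by (smt (verit))
 then have "newton_kernel (x - y) * \<bar>g x\<bar> <= (\<bar>?W (x - y)\<bar> + 1) * \<bar>g x\<bar>" by (intro mult_right_mono) auto
 also have "... <= \<bar>?W (x - y)\<bar> * C + 1 * \<bar>g x\<bar>"
 unfolding distrib_right using g(2) by (intro add_mono mult_left_mono) auto
 finally show ?thesis by (simp add: mult.commute)
 qed
 show *: "integ (%x. newton_kernel (x - y) * g x)"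
 proof (rule bo_integrable_bound[OF B])
 show "AE x in lborel. norm (newton_kernel (x - y) * g x) <= norm (?B x)"
 using le by (intro AE_I2) (simp add: abs_mult newton_kernel_nonneg abs_of_nonneg C)
 qed measurable
 have *: "integ (%x. newton_kernel (x - y) * \<bar>g x\<bar>)"
 using integrable_abs[OF *] by (simp add: abs_mult newton_kernel_nonneg)
 have "(LI x. newton_kernel (x - y) * \<bar>g x\<bar>) <= (LI x. ?B x)"
 by (intro integral_mono * B le)
 also have "... = C * (LI x. \<bar>?W (x - y)\<bar>) + (LI x. \<bar>g x\<bar>)"
 using W' g by simp
 also have "(LI x. \<bar>?W (x - y)\<bar>) = (LI x. \<bar>?W x\<bar>)"
 by (rule integral_translate[of "%x. \<bar>?W x\<bar>"]) measurable
 also have "(LI x. \<bar>?W x\<bar>) = (LI x. ?W x)"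
 using ae by (intro integral_cong_AE) (auto elim!: eventually_mono)
 also have "C * (LI x. ?W x) <= C * 1" by (intro mult_left_mono W1 C)
 finally show "(LI x. newton_kernel (x - y) * \<bar>g x\<bar>) <= C + (LI x. \<bar>g x\<bar>)" by simp
qed

lemma L2_shift: "(f :: 'a::euclidean_space => real) : L2 ==> (%x. f (x + z)) : L2"
 and L2_norm_shift: "(f :: 'a::euclidean_space => real) : L2 ==> L2_norm (%x. f (x + z)) = L2_norm f"
 using L2_translate[of f "- z"] L2_norm_translate[of f "- z"] by simp_all

lemma integral_shift_kernel:
 fixes k f :: "'a::euclidean_space => real"
 assumes [measurable]: "k : BM" "f : BM"
 shows "(LI x. k (x - y) * f x) = (LI z. k z * f (y + z))"
 using integral_translate[of "%z. k z * f (y + z)" y] by simp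

text \<open>Young's inequality for an \<open>L1\<close> kernel and an \<open>L2\<close> function, as
  a superposition of translates by \<open>L2_integral\<close>. The kernel is taken at x - y with
  \<open>x\<close> integrated, the orientation that arises when it is moved onto a test
  function.\<close>

lemma
 fixes k f :: "'a::euclidean_space => real"
 assumes k: "integ k" and f: "f : L2"
 shows L2_conv: "(%y. LI x. k (x - y) * f x) : L2"
 and L2_conv_norm: "L2_norm (%y. LI x. k (x - y) * f x) <= (LI x. \<bar>k x\<bar>) * L2_norm f"
 and L2_conv_pairing: "g : L2 ==> (LI y. (LI x. k (x - y) * f x) * g y)
 = (LI z. k z * (LI y. f (y + z) * g y))"
proof -
 have [measurable]: "k : BM" "f : BM"
 using k f by (auto intro: L2_measurable)
 let ?F = "%z y. f (y + z)"
 have m: "(%(z, y). ?F z y) : BM2" by measurable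
 have F: "?F z : L2" for z by (rule L2_shift[OF f])
 have kF: "integ (%z. \<bar>k z\<bar> * (L2_norm (?F z))\<^sup>2)"
 unfolding L2_norm_shift[OF f] using k by simp
 have eq: "(%y. LI x. k (x - y) * f x) = (%y. LI z. k z * f (y + z))"
 by (intro ext integral_shift_kernel) measurable
 note * = L2_integral[OF sigma_finite_lborel m k F kF]
 show "(%y. LI x. k (x - y) * f x) : L2" unfolding eq by (rule *(2))
 show "L2_norm (%y. LI x. k (x - y) * f x) <= (LI x. \<bar>k x\<bar>) * L2_norm f"
 proof (rule power2_le_imp_le)
 have "(LI z. \<bar>k z\<bar> * (L2_norm (?F z))\<^sup>2) = (LI z. \<bar>k z\<bar>) * (L2_norm f)\<^sup>2"
 unfolding L2_norm_shift[OF f] by simp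
 then show "(L2_norm (%y. LI x. k (x - y) * f x))\<^sup>2 <= ((LI x. \<bar>k x\<bar>) * L2_norm f)\<^sup>2"
 using *(3) unfolding eq by (simp add: power2_eq_square mult_ac)
 qed simp
 assume g: "g : L2"
 show "(LI y. (LI x. k (x - y) * f x) * g y) = (LI z. k z * (LI y. f (y + z) * g y))"
 using *(5)[OF g] by (simp only: eq[THEN fun_cong])
qed

text \<open>The Newton potential in the form in which it acts on the test function; since the kernel
  is even, it is the same operator as \<open>newton_potential\<close>.\<close>

definition newton_conv :: "(real^3 => real) => real^3 => real"
 where "newton_conv g y = (LI x. newton_kernel (x - y) * g x)"


lemma newton_potential_eq: "newton_potential f x = (LI y. f y * newton_kernel (x - y))"
 by (simp add: newton_potential_def newton_kernel_def)

lemma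
 fixes f g :: "real^3 => real"
 assumes f: "integ f" and g: "integ g" "!!x. \<bar>g x\<bar> <= C"
 shows newton_potential_times_integrable: "integ (%x. newton_potential f x * g x)"
 and newton_potential_pairing: "(LI x. newton_potential f x * g x) = (LI y. f y * newton_conv g y)"
 and newton_conv_times_integrable: "integ (%y. f y * newton_conv g y)"
proof -
 have [measurable]: "f : BM" "g : BM" using f g by auto
 let ?h = "%y x. f y * (newton_kernel (x - y) * g x)"
 have int: "integrable (LL) (%(y, x). ?h y x)"
 proof (rule Fubini_bound)
 show "integ (%y. \<bar>f y\<bar> * (C + (LI x. \<bar>g x\<bar>)))" using f by simp
 show "(LI x. norm (?h y x)) <= \<bar>f y\<bar> * (C + (LI x. \<bar>g x\<bar>))" for y
 proof -
 have "(LI x. norm (?h y x)) = \<bar>f y\<bar> * (LI x. newton_kernel (x - y) * \<bar>g x\<bar>)"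
 by (simp add: abs_mult newton_kernel_nonneg)
 also have "... <= \<bar>f y\<bar> * (C + (LI x. \<bar>g x\<bar>))"
 by (intro mult_left_mono newton_conv_bound g) auto
 finally show ?thesis .
 qed
 show "AE y in lborel. integ (%x. ?h y x)"
 using newton_conv_integrable[OF g] by (intro AE_I2) simp
qed measurable
 have 1: "(LI y. ?h y x) = newton_potential f x * g x" for x
 unfolding newton_potential_eq integral_mult_left_zero[symmetric] by (simp only: mult.assoc)
 have 2: "(LI x. ?h y x) = f y * newton_conv g y" for y
 unfolding newton_conv_def by simp
 show "integ (%x. newton_potential f x * g x)"
 using lborel_pair.integrable_snd[of ?h] int by (simp add: 1)
 show "(LI x. newton_potential f x * g x) = (LI y. f y * newton_conv g y)"
 using lborel_pair.Fubini_integral[of ?h, OF int] unfolding 1 2 .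
 show "integ (%y. f y * newton_conv g y)"
 using lborel_pair.integrable_fst[of ?h, OF int] unfolding 2 .
qed

lemma newton_potential_L1_loc:
 assumes f: "integ f" shows "newton_potential f : L1_loc UNIV"
 unfolding L1_loc_def set_integrable_def
proof (intro CollectI allI impI)
 fix K :: "(real^3) set" assume "compact K"
 then have "integ (%x. indicator K x :: real)"
 using emeasure_compact_finite[of K] compact_imp_closed[of K]
 by (intro integrable_real_indicator) (auto simp: less_top)
 from newton_potential_times_integrable[OF f this, of 1]
 show "integ (%x. indicator K x *\<^sub>R newton_potential f x)"
 by (simp add: mult.commute indicator_def)
qed

section \<open>Second derivatives of Newton potentials as bounded operators on
  \<open>L2\<close>\<close>

lemma pd_shift2: "smooth f ==> pd i (pd j (%x. f (x + y))) x = pd i (pd j f) (x + y)"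
 using pd_translate[of f j "- y"] pd_translate[OF smooth_pd, of f i j "- y"] by simp

lemma pd_add: "smooth f ==> smooth g ==> pd i (%x. f x + g x) = (%x. pd i f x + pd i g x)"
 unfolding pd_eq_ddir by (rule ddir_add)

lemma pd_cmult: "smooth f ==> pd i (%x. c * f x :: real) = (%x. c * pd i f x)"
 unfolding pd_eq_ddir by (intro ext ddir_linear_comp bounded_linear_mult_right smooth_differentiable)

lemma test_integration_by_parts:
 fixes \<alpha> \<beta> :: "real^3 => real"
 assumes "\<alpha> : TF" "\<beta> : TF"
 shows "(LI x. \<alpha> x * pd i \<beta> x) = - (LI x. pd i \<alpha> x * \<beta> x)"
 using assms
 by (intro integration_by_parts smooth_differentiable smooth_continuous_on smooth_pd) (auto dest: test_smooth)

text \<open>Each of the two integrations by parts moves one derivative across. After summation over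
  \<open>i\<close> and \<open>k\<close> this is the identity between the squared norms of the
  Hessian and of the Laplacian.\<close>

lemma hessian_pairing:
 fixes \<alpha> \<beta> :: "real^3 => real"
 assumes a: "\<alpha> : TF" and b: "\<beta> : TF"
 shows "(LI x. pd k (pd i \<alpha>) x * pd k (pd i \<beta>) x) = (LI x. pd i (pd i \<alpha>) x * pd k (pd k \<beta>) x)"
proof -
 note sm = test_smooth[OF a] test_smooth[OF b]
 have "(LI x. pd k (pd i \<alpha>) x * pd k (pd i \<beta>) x) = - (LI x. pd i \<alpha> x * pd k (pd k (pd i \<beta>)) x)"
 using test_integration_by_parts[of "pd i \<alpha>" "pd k (pd i \<beta>)" k] a b by (simp add: test_pd)
 also have "pd k (pd k (pd i \<beta>)) = pd i (pd k (pd k \<beta>))"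
 using sm by (simp add: pd_commute[of _ k i] smooth_pd)
 also have "- (LI x. pd i \<alpha> x * pd i (pd k (pd k \<beta>)) x) = (LI x. pd i (pd i \<alpha>) x * pd k (pd k \<beta>) x)"
 using test_integration_by_parts[of "pd i \<alpha>" "pd k (pd k \<beta>)" i] a b by (simp add: test_pd)
 finally show ?thesis .
qed


text \<open>The translation by \<open>y\<close> is transferred to the test function, so that the
  unshifted \<open>integration_by_parts\<close> applies; compact support of \<open>ph\<close>
  replaces decay of \<Theta>.\<close>

lemma laplacian_by_parts:
 fixes \<Theta> :: "real^3 => real"
 assumes "!!x. \<Theta> differentiable (at x)" "!!i x. pd i \<Theta> differentiable (at x)"
 "!!i. continuous_on UNIV (pd i \<Theta>)" "!!i j. continuous_on UNIV (pd j (pd i \<Theta>))"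
 and ph: "ph : TF"
 shows "(LI x. \<Theta> (x - y) * laplacian ph x) = (LI x. laplacian \<Theta> (x - y) * ph x)"
 and "(LI x. pd i (pd j \<Theta>) (x - y) * ph x) = (LI x. \<Theta> (x - y) * pd i (pd j ph) x)"
proof -
 let ?f = "%x. ph (x + y)"
 have f: "?f : TF" using test_translate[OF ph, of "- y"] by simp
 have pdf: "pd i (pd j ?f) x = pd i (pd j ph) (x + y)" for i j x
 by (rule pd_shift2[OF test_smooth[OF ph]])
 have cont\<Theta>: "continuous_on UNIV \<Theta>"
 using assms(1) by (meson continuous_at_imp_continuous_on differentiable_imp_continuous_within)
 have sh: "(LI x. G (x - y) * g x) = (LI x. G x * g (x + y))"
 if "continuous_on UNIV G" "g : TF" for G g :: "real^3 => real"
 using integral_shift_kernel[of G g y] that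
 by (simp add: borel_measurable_continuous_onI test_measurable add.commute)
 have two: "(LI x. \<Theta> x * pd j (pd i ?f) x) = (LI x. pd i (pd j \<Theta>) x * ?f x)" for i j
 using integration_by_parts[of \<Theta> j "pd i ?f"] integration_by_parts[of "pd j \<Theta>" i ?f] assms f
 by (simp add: test_pd)
 show "(LI x. pd i (pd j \<Theta>) (x - y) * ph x) = (LI x. \<Theta> (x - y) * pd i (pd j ph) x)"
 unfolding sh[OF assms(4) ph] sh[OF cont\<Theta> test_pd[OF test_pd[OF ph]]] two[symmetric]
 using pd_commute[OF test_smooth[OF ph], of i j]
 by (simp add: pdf)
 have contL: "continuous_on UNIV (laplacian \<Theta>)"
 unfolding laplacian_eq by (intro continuous_on_sum assms)
 have int: "integ (%x. G x * g x)" if "continuous_on UNIV G" "g : TF" for G g :: "real^3 => real"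
 proof -
 note G = that(1) and g = that(2)
 obtain K where "compact K" "\<forall>x. x \<notin> K \<longrightarrow> g x = 0" using test_support[OF g] by blast
 then show ?thesis
 by (intro integrable_compact_support[of _ K] continuous_intros G test_continuous[OF g]) auto
 qed
 have "(LI x. \<Theta> (x - y) * laplacian ph x) = (LI x. (SS i. \<Theta> x * pd i (pd i ?f) x))"
 unfolding sh[OF cont\<Theta> test_laplacian[OF ph]] by (simp add: laplacian_def pdf sum_distrib_left)
 also have "... = (SS i. LI x. \<Theta> x * pd i (pd i ?f) x)"
 by (intro bo_integral_sum int cont\<Theta> test_pd f)
 also have "... = (SS i. LI x. pd i (pd i \<Theta>) x * ?f x)" by (simp only: two)
 also have "... = (LI x. (SS i. pd i (pd i \<Theta>) x * ?f x))"
 by (intro bo_integral_sum[symmetric] int assms f)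
 also have "... = (LI x. laplacian \<Theta> (x - y) * ph x)"
 unfolding sh[OF contL ph] by (simp add: laplacian_def sum_distrib_right)
 finally show "(LI x. \<Theta> (x - y) * laplacian ph x) = (LI x. laplacian \<Theta> (x - y) * ph x)" .
qed

lemma heat_regular: "heat t differentiable (at x)" "pd i (heat t) differentiable (at x)"
 "continuous_on UNIV (pd i (heat t))" "continuous_on UNIV (pd j (pd i (heat t)))"
 by (simp_all add: heat.pd_rd heat.rd_differentiable heat.rd_cont)

lemma pot_regular: assumes "0 < t"
 shows "pot t differentiable (at x)" "pd i (pot t) differentiable (at x)"
 "continuous_on UNIV (pd i (pot t))" "continuous_on UNIV (pd j (pd i (pot t)))" "continuous_on UNIV (pot t)"
proof -
 interpret radial_chain "pot_rad t" by (rule pot_chain[OF assms])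
 show "pot t differentiable (at x)" "pd i (pot t) differentiable (at x)"
 "continuous_on UNIV (pd i (pot t))" "continuous_on UNIV (pd j (pd i (pot t)))" "continuous_on UNIV (pot t)"
 by (simp_all add: pd_rd rd_differentiable rd_cont)
qed

lemma pot_mult_le:
 assumes "0 < a" shows "\<bar>pot a z * r\<bar> <= (1 / (4 * pi * sqrt pi * sqrt a)) * \<bar>r\<bar>"
proof -
 have "\<bar>pot a z * r\<bar> = pot a z * \<bar>r\<bar>" by (simp add: abs_mult pot_nonneg[OF assms(1)])
 also have "... <= (1 / (4 * pi * sqrt pi * sqrt a)) * \<bar>r\<bar>" by (intro mult_right_mono pot_le[OF assms(1)]) simp
 finally show ?thesis .
qed

lemma pot_conv_integrable:
 assumes "0 < a" "integ g"
 shows "integ (%x. pot a (x - y) * g x)"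
proof (rule bo_integrable_bound)
 show "integ (%x. (1 / (4 * pi * sqrt pi * sqrt a)) * \<bar>g x\<bar>)" using assms(2) by simp
 show "(%x. pot a (x - y) * g x) : borel_measurable lborel" using assms by measurable
 show "AE x in lborel. norm (pot a (x - y) * g x) <= norm ((1 / (4 * pi * sqrt pi * sqrt a)) * \<bar>g x\<bar>)"
 unfolding real_norm_def by (intro AE_I2 order_trans[OF pot_mult_le[OF assms(1)] abs_ge_self])
qed


text \<open>The key estimate. For $W=P(\cdot,a)-P(\cdot,b)$ integration by parts gives
 $\sum_{ik}\|W*\partial_k\partial_i\phi\|^2=\|W*\Delta\phi\|^2=\|(\Phi_b-\Phi_a)*\phi\|^2\le4\|\phi\|^2$.\<close>

lemma L2_norm_conv_hessian:
 fixes ph :: "real^3 => real"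
 assumes ab: "0 < a" "a <= b" and ph: "ph : TF"
 defines "W \<equiv> %x. pot a x - pot b x"
 shows "(%y. LI x. W (x - y) * pd k (pd i ph) x) : L2"
 and "L2_norm (%y. LI x. W (x - y) * pd k (pd i ph) x) <= 2 * L2_norm ph"
proof -
 have b: "0 < b" using ab by simp
 have W: "integ W" unfolding W_def by (rule pot_diff_integrable[OF ab])
 define V where "V g y = (LI x. W (x - y) * g x)" for g y
 have TF2: "pd k (pd i ph) : TF" for i k by (intro test_pd ph)
 note L = test_L2[OF TF2]
 have VL: "V (pd k (pd i ph)) : L2" for i k unfolding V_def by (rule L2_conv[OF W L])
 show "(%y. LI x. W (x - y) * pd k (pd i ph) x) : L2" using VL by (simp add: V_def[abs_def])
 \<comment> \<open>Written as a double superposition, the pairing of two convolutions involves only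
   translates of test functions. Integration by parts can then be carried out under the kernels,
   where compact support is available.\<close>
 have pairing: "(LI y. V f y * V g y) = (LI z. W z * (LI w. W w * (LI y. g (y + w) * f (y + z))))"
 if "f : TF" "g : TF" for f g
 proof -
 have fL: "f : L2" "g : L2" using that test_L2 by auto
 have "(LI y. V f y * V g y) = (LI z. W z * (LI y. f (y + z) * V g y))"
 unfolding V_def by (intro L2_conv_pairing[OF W fL(1)] L2_conv[OF W fL(2)])
 moreover have "(LI y. f (y + z) * V g y) = (LI w. W w * (LI y. g (y + w) * f (y + z)))" for z
 using L2_conv_pairing[OF W fL(2) L2_shift[OF fL(1)], of z] unfolding V_def by (simp add: mult.commute)
 ultimately show ?thesis by simp
 qed
 have eq: "(LI y. V (pd k (pd i ph)) y * V (pd k (pd i ph)) y) = (LI y. V (pd k (pd k ph)) y * V (pd i (pd i ph)) y)" for i k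
 proof -
 have "(LI y. pd k (pd i ph) (y + w) * pd k (pd i ph) (y + z)) = (LI y. pd i (pd i ph) (y + w) * pd k (pd k ph) (y + z))" for w z
 proof -
 have s: "(%x. ph (x + w)) : TF" for w using test_translate[OF ph, of "- w"] by simp
 have p: "pd i (pd j (%x. ph (x + w))) x = pd i (pd j ph) (x + w)" for i j x w
 by (rule pd_shift2[OF test_smooth[OF ph]])
 show ?thesis using hessian_pairing[OF s[of w] s[of z], of k i] by (simp add: p)
 qed
 then show ?thesis unfolding pairing[OF TF2 TF2] by simp
 qed
 let ?U = "%y. SS i. V (pd i (pd i ph)) y"
 have sum_eq: "(SS k i. (L2_norm (V (pd k (pd i ph))))\<^sup>2) = (L2_norm ?U)\<^sup>2"
 proof -
 have "(SS k i. (L2_norm (V (pd k (pd i ph))))\<^sup>2)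
 = (SS k i. LI y. V (pd k (pd k ph)) y * V (pd i (pd i ph)) y)"
 unfolding L2_norm_sq by (simp only: power2_eq_square eq)
 also have "... = (LI y. (SS k i. V (pd k (pd k ph)) y * V (pd i (pd i ph)) y))"
 by (subst bo_integral_sum;
 (subst bo_integral_sum)?; intro bo_integrable_sum L2_mult_integrable VL refl)
 also have "... = (LI y. (?U y)\<^sup>2)" by (simp only: power2_eq_square sum_product)
 finally show ?thesis by (simp only: L2_norm_sq)
 qed
 have U: "?U = (%y. (LI x. heat b (x - y) * ph x) - (LI x. heat a (x - y) * ph x))"
 proof
 fix y
 have int: "integ (%x. pot c (x - y) * g x)" if "0 < c" "g : TF" for c g
 using that by (intro pot_conv_integrable test_integrable)
 have "?U y = (SS i. (LI x. pot a (x - y) * pd i (pd i ph) x) - (LI x. pot b (x - y) * pd i (pd i ph) x))"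
 unfolding V_def W_def using int[OF ab(1) TF2] int[OF b TF2] by (simp add: left_diff_distrib)
 also have "... = (LI x. pot a (x - y) * laplacian ph x) - (LI x. pot b (x - y) * laplacian ph x)"
 using int[OF ab(1) TF2] int[OF b TF2] by (simp add: laplacian_def sum_distrib_left sum_subtractf)
 also have "... = (LI x. heat b (x - y) * ph x) - (LI x. heat a (x - y) * ph x)"
 unfolding laplacian_by_parts(1)[OF pot_regular(1-4)[OF ab(1)] ph] laplacian_by_parts(1)[OF pot_regular(1-4)[OF b] ph]
 laplacian_pot[OF ab(1)] laplacian_pot[OF b] by simp
 finally show "?U y = (LI x. heat b (x - y) * ph x) - (LI x. heat a (x - y) * ph x)" .
 qed
 have phL: "ph : L2" using ph by (rule test_L2)
 have heat_bound: "L2_norm (%y. LI x. heat c (x - y) * ph x) <= L2_norm ph" if "0 < c" for c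
 using L2_conv_norm[OF heat_integrable[OF that] phL] heat_integral[OF that] heat_nonneg[OF that] by simp
 have "L2_norm ?U <= L2_norm ph + L2_norm ph"
 unfolding U
 using L2_triangle_diff[OF L2_conv[OF heat_integrable[OF b] phL] L2_conv[OF heat_integrable[OF ab(1)] phL]]
 heat_bound[OF ab(1)] heat_bound[OF b] by linarith
 then have U2: "(L2_norm ?U)\<^sup>2 <= (2 * L2_norm ph)\<^sup>2" by (intro power_mono) auto
 have "(L2_norm (V (pd k (pd i ph))))\<^sup>2 <= (SS i. (L2_norm (V (pd k (pd i ph))))\<^sup>2)"
 by (rule member_le_sum[of i UNIV "%i. (L2_norm (V (pd k (pd i ph))))\<^sup>2"]) auto
 also have "... <= (SS k i. (L2_norm (V (pd k (pd i ph))))\<^sup>2)"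
 by (rule member_le_sum[of k UNIV "%k. SS i. (L2_norm (V (pd k (pd i ph))))\<^sup>2"]) (auto intro: sum_nonneg)
 also have "... <= (2 * L2_norm ph)\<^sup>2" unfolding sum_eq by (rule U2)
 finally have "L2_norm (V (pd k (pd i ph))) <= 2 * L2_norm ph" by (rule power2_le_imp_le) simp
 then show "L2_norm (%y. LI x. W (x - y) * pd k (pd i ph) x) <= 2 * L2_norm ph"
 by (simp add: V_def[abs_def])
qed

lemma pot_conv_tendsto_newton:
 assumes g: "integ g" "!!x. \<bar>g x\<bar> <= C"
 and seq: "filterlim s (at_right 0) sequentially" "!!n. 0 < s n"
 shows "(%n. LI x. pot (s n) (x - y) * g x) ----> newton_conv g y"
 unfolding newton_conv_def
proof (rule integral_dominated_convergence)
 have [measurable]: "g : BM" using g by simp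
 show "integ (%x. \<bar>newton_kernel (x - y) * g x\<bar>)"
 using newton_conv_integrable[OF g] by (rule integrable_abs)
 have ae: "AE x in lborel. x ~= y" by (rule AE_lborel_singleton)
 then show "AE x in lborel. (%n. pot (s n) (x - y) * g x) ----> newton_kernel (x - y) * g x"
 by eventually_elim (auto intro!: tendsto_mult tendsto_const filterlim_compose[OF pot_tendsto_newton seq(1)])
 show "AE x in lborel. norm (pot (s n) (x - y) * g x) <= \<bar>newton_kernel (x - y) * g x\<bar>" for n
 using ae by eventually_elim
 (auto simp: abs_mult newton_kernel_nonneg pot_nonneg seq(2) intro!: mult_right_mono pot_le_newton)
 show "(%x. newton_kernel (x - y) * g x) : borel_measurable lborel" by measurable
 show "(%x. pot (s n) (x - y) * g x) : borel_measurable lborel" for n using seq(2)[of n] by measurable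
qed

lemma pot_conv_bound:
 assumes g: "integ g" "!!x. \<bar>g x\<bar> <= C" and a: "0 < a"
 shows "\<bar>LI x. pot a (x - y) * g x\<bar> <= C + (LI x. \<bar>g x\<bar>)"
proof -
 have [measurable]: "g : BM" using g by simp
 have "\<bar>LI x. pot a (x - y) * g x\<bar> <= (LI x. \<bar>pot a (x - y) * g x\<bar>)"
 by (rule integral_abs_bound)
 also have "... <= (LI x. newton_kernel (x - y) * \<bar>g x\<bar>)"
 proof (rule integral_mono_AE)
 show "integ (%x. \<bar>pot a (x - y) * g x\<bar>)" by (intro integrable_abs pot_conv_integrable a g)
 show "integ (%x. newton_kernel (x - y) * \<bar>g x\<bar>)"
 using integrable_abs[OF newton_conv_integrable[OF g, of y]] by (simp add: abs_mult newton_kernel_nonneg)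
 show "AE x in lborel. \<bar>pot a (x - y) * g x\<bar> <= newton_kernel (x - y) * \<bar>g x\<bar>"
 using AE_lborel_singleton[of y] by eventually_elim
 (auto simp: abs_mult pot_nonneg a intro!: mult_right_mono pot_le_newton)
 qed
 also have "... <= C + (LI x. \<bar>g x\<bar>)" by (rule newton_conv_bound[OF g])
 finally show ?thesis .
qed

text \<open>The bound for the truncated kernel is uniform in \<open>a\<close> and \<open>b\<close>.
  As a tends to 0, P(.,a) becomes the Newton kernel, and P(.,b) disappears for large
  \<open>b\<close> because its supremum is of order b^(-1/2).\<close>

lemma newton_conv_hessian_bound:
 assumes f: "integ f" "f : L2" and ph: "ph : TF"
 shows "\<bar>LI y. f y * newton_conv (pd k (pd i ph)) y\<bar> <= 2 * L2_norm f * L2_norm ph"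
proof -
 let ?g = "pd k (pd i ph)"
 have gT: "?g : TF" by (intro test_pd ph)
 have g: "integ ?g" using gT by (rule test_integrable)
 have [measurable]: "f : BM" "?g : BM" using f g by auto
 obtain C where C: "!!x. \<bar>?g x\<bar> <= C" using test_bounded[OF gT] by auto
 let ?D = "C + (LI x. \<bar>?g x\<bar>)"
 \<comment> \<open>One index drives both limits; n + 1 instead of n ensures 0 < a <= b from the
   start.\<close>
 define a b where "a n = 1 / real (Suc n)" and "b n = real (Suc n)" for n
 have ab: "0 < a n" "a n <= b n" "0 < b n" for n
 by (auto simp: a_def b_def field_simps)
 let ?V = "%n y. LI x. (pot (a n) (x - y) - pot (b n) (x - y)) * ?g x"
 have V_eq: "?V n y = (LI x. pot (a n) (x - y) * ?g x) - (LI x. pot (b n) (x - y) * ?g x)" for n y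
 using pot_conv_integrable[OF ab(1) g] pot_conv_integrable[OF ab(3) g] by (simp add: left_diff_distrib)
 have seq: "filterlim a (at_right 0) sequentially"
 using LIMSEQ_Suc[OF lim_1_over_n] ab(1) by (auto simp: filterlim_at a_def[abs_def])
 have lim2: "(%n. LI x. pot (b n) (x - y) * ?g x) ----> 0" for y
 proof (rule Lim_null_comparison)
 have "\<bar>LI x. pot (b n) (x - y) * ?g x\<bar> <= 1 / (4 * pi * sqrt pi * sqrt (b n)) * (LI x. \<bar>?g x\<bar>)" for n
 proof -
 have "\<bar>LI x. pot (b n) (x - y) * ?g x\<bar> <= (LI x. \<bar>pot (b n) (x - y) * ?g x\<bar>)"
 by (rule integral_abs_bound)
 also have "... <= (LI x. 1 / (4 * pi * sqrt pi * sqrt (b n)) * \<bar>?g x\<bar>)"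
 using pot_conv_integrable[OF ab(3) g] g
 by (intro integral_mono integrable_abs integrable_mult_right pot_mult_le[OF ab(3)])
 finally show ?thesis by simp
 qed
 then show "\<forall>\<^sub>F n in sequentially. norm (LI x. pot (b n) (x - y) * ?g x) <= 1 / (4 * pi * sqrt pi * sqrt (b n)) * (LI x. \<bar>?g x\<bar>)"
 by simp
 have "LIM n sequentially. b n :> at_top"
 unfolding b_def using filterlim_compose[OF filterlim_real_sequentially filterlim_Suc] .
 then have "(%n. inverse (sqrt (b n))) ----> 0"
 by (intro tendsto_inverse_0_at_top filterlim_compose[OF sqrt_at_top])
 then have "(%n. (1 / (4 * pi * sqrt pi)) * inverse (sqrt (b n)) * (LI x. \<bar>?g x\<bar>)) ----> (1 / (4 * pi * sqrt pi)) * 0 * (LI x. \<bar>?g x\<bar>)"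
 by (intro tendsto_mult tendsto_const)
 then show "(%n. 1 / (4 * pi * sqrt pi * sqrt (b n)) * (LI x. \<bar>?g x\<bar>)) ----> 0"
 by (simp only: divide_inverse inverse_mult_distrib mult.assoc mult_1_left mult_zero_left mult_zero_right)
 qed
 have "(%n. LI y. f y * ?V n y) ----> (LI y. f y * newton_conv ?g y)"
 proof (rule integral_dominated_convergence)
 show "integ (%y. \<bar>f y\<bar> * (2 * ?D))" using f by simp
 show "AE y in lborel. (%n. f y * ?V n y) ----> f y * newton_conv ?g y"
 proof (intro AE_I2 tendsto_mult tendsto_const)
 fix y
 show "(%n. ?V n y) ----> newton_conv ?g y"
 unfolding V_eq using tendsto_diff[OF pot_conv_tendsto_newton[OF g C seq ab(1)] lim2] by simp
 qed
 have "\<bar>?V n y\<bar> <= 2 * ?D" for n y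
 unfolding V_eq mult_2
 by (rule order_trans[OF abs_triangle_ineq4 add_mono[OF pot_conv_bound[OF g C ab(1)] pot_conv_bound[OF g C ab(3)]]])
 then show "AE y in lborel. norm (f y * ?V n y) <= \<bar>f y\<bar> * (2 * ?D)" for n
 by (intro AE_I2) (simp add: abs_mult mult_left_mono)
 show "(%y. f y * newton_conv ?g y) : borel_measurable lborel" unfolding newton_conv_def by measurable
 show "(%y. f y * ?V n y) : borel_measurable lborel" for n
 using ab(1)[of n] ab(3)[of n] by measurable
 qed
 then have "(%n. \<bar>LI y. f y * ?V n y\<bar>) ----> \<bar>LI y. f y * newton_conv ?g y\<bar>"
 by (rule tendsto_rabs)
 moreover have "\<bar>LI y. f y * ?V n y\<bar> <= 2 * L2_norm f * L2_norm ph" for n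
 proof -
 have "\<bar>LI y. f y * ?V n y\<bar> <= L2_norm f * L2_norm (?V n)"
 by (intro L2_Cauchy_Schwarz f L2_norm_conv_hessian(1)[OF ab(1,2) ph])
 also have "... <= L2_norm f * (2 * L2_norm ph)"
 by (intro mult_left_mono L2_norm_conv_hessian(2)[OF ab(1,2) ph]) simp
 finally show ?thesis by simp
 qed
 ultimately show ?thesis by (intro LIMSEQ_le_const2[where a = "2 * L2_norm f * L2_norm ph"]) auto
qed

lemma test_newton_pairing:
 assumes "integ f" "ph : TF"
 shows "(LI x. newton_potential f x * ph x) = (LI y. f y * newton_conv ph y)"
 "integ (%x. newton_potential f x * ph x)" "integ (%y. f y * newton_conv ph y)"
proof -
 obtain C where C: "!!x. \<bar>ph x\<bar> <= C" using test_bounded[OF assms(2)] by auto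
 note * = assms(1) test_integrable[OF assms(2)] C
 show "(LI x. newton_potential f x * ph x) = (LI y. f y * newton_conv ph y)"
 by (rule newton_potential_pairing[OF *])
 show "integ (%x. newton_potential f x * ph x)" by (rule newton_potential_times_integrable[OF *])
 show "integ (%y. f y * newton_conv ph y)" by (rule newton_conv_times_integrable[OF *])
qed

lemma L2_L1_loc: "(h :: 'a::euclidean_space => real) : L2 ==> h : L1_loc S"
 unfolding L1_loc_def
 by (intro CollectI allI impI L2_set_integrable borel_compact) (auto dest: emeasure_compact_finite)

text \<open>The functional that pairs the Newton potential of \<open>f\<close> with second
  derivatives of a test function is bounded in the \<open>L2\<close> norm of the latter, so Riesz
  representation supplies \<open>h\<close>. The constant 2 comes from the two heat convolutions in
  the truncated kernel.\<close>

lemma riesz_transform_exists: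
 assumes f: "integ f" "f : L2"
 obtains h where "h : L2" "has_distr_deriv2 k i (newton_potential f) h" "L2_norm h <= 2 * L2_norm f"
proof -
 let ?V = "TF :: (real^3 => real) set"
 let ?L = "%ph. LI x. newton_potential f x * pd k (pd i ph) x"
 have pd2_add: "pd k (pd i (%x. p x + q x)) = (%x. pd k (pd i p) x + pd k (pd i q) x)"
 if "p : ?V" "q : ?V" for p q
 using that by (simp add: pd_add smooth_pd test_smooth)
 have pd2_cmult: "pd k (pd i (%x. c * p x)) = (%x. c * pd k (pd i p) x)" if "p : ?V" for p c
 using that by (simp add: pd_cmult smooth_pd test_smooth)
 have T2: "pd k (pd i ph) : ?V" if "ph : ?V" for ph using that by (intro test_pd)
 have bound: "\<bar>?L ph\<bar> <= 2 * L2_norm f * L2_norm ph" if "ph : ?V" for ph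
 unfolding test_newton_pairing(1)[OF f(1) T2[OF that]] by (rule newton_conv_hessian_bound[OF f that])
 obtain h where h: "h : L2" "!!ph. ph : ?V ==> (LI x. h x * ph x) = ?L ph" "L2_norm h <= 2 * L2_norm f"
 proof (rule L2_Riesz[of ?V ?L "2 * L2_norm f"])
 show "?L (%x. p x + q x) = ?L p + ?L q" if "p : ?V" "q : ?V" for p q
 using test_newton_pairing(2)[OF f(1) T2[OF that(1)]] test_newton_pairing(2)[OF f(1) T2[OF that(2)]]
 by (simp add: pd2_add[OF that] distrib_left)
 show "?L (%x. c * p x) = c * ?L p" if "p : ?V" for p c
 by (simp add: pd2_cmult[OF that] mult.left_commute)
 show "\<bar>?L p\<bar> <= 2 * L2_norm f * L2_norm p" if "p : ?V" for p by (rule bound[OF that])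
 qed (auto intro: test_add test_cmult zero_test_function test_L2)
 have "has_distr_deriv2 k i (newton_potential f) h"
 unfolding has_distr_deriv2_def using h by (auto intro: newton_potential_L1_loc f L2_L1_loc)
 then show thesis using that h by blast
qed

text \<open>The distributional relation determines \<open>h\<close> almost everywhere and is linear
  in \<open>f\<close>, so h - h' is the transform of f - g. This is what makes the pressure
  continuous in time, whatever slices were chosen.\<close>

lemma riesz_transform_diff_bound:
 assumes f: "integ f" "f : L2" and g: "integ g" "g : L2"
 and h: "h : L2" "has_distr_deriv2 k i (newton_potential f) h"
 and h': "h' : L2" "has_distr_deriv2 k i (newton_potential g) h'"
 shows "L2_norm (%x. h x - h' x) <= 2 * L2_norm (%x. f x - g x)"
proof -
 have d: "integ (%x. f x - g x)" "(%x. f x - g x) : L2" using f g by (auto intro: L2_diff)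
 obtain H where H: "H : L2" "has_distr_deriv2 k i (newton_potential (%x. f x - g x)) H"
 "L2_norm H <= 2 * L2_norm (%x. f x - g x)"
 using riesz_transform_exists[OF d, of k i] by blast
 have hd: "(%x. h x - h' x) : L2" using h h' by (intro L2_diff)
 have "AE x in lborel. h x - h' x = H x"
 proof (rule L2_eq_AE_if_test[OF hd H(1)])
 fix ph :: "real^3 => real" assume ph: "ph : TF"
 then have T2: "pd k (pd i ph) : TF" by (intro test_pd)
 have "(LI x. (h x - h' x) * ph x) = (LI x. h x * ph x) - (LI x. h' x * ph x)"
 using h h' test_L2[OF ph] by (simp add: left_diff_distrib L2_mult_integrable)
 also have "... = (LI y. f y * newton_conv (pd k (pd i ph)) y) - (LI y. g y * newton_conv (pd k (pd i ph)) y)"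
 using h(2) h'(2) ph test_newton_pairing(1)[OF f(1) T2] test_newton_pairing(1)[OF g(1) T2]
 by (simp add: has_distr_deriv2_def)
 also have "... = (LI y. (f y - g y) * newton_conv (pd k (pd i ph)) y)"
 using test_newton_pairing(3)[OF f(1) T2] test_newton_pairing(3)[OF g(1) T2] by (simp add: left_diff_distrib)
 also have "... = (LI x. H x * ph x)"
 using H(2) ph test_newton_pairing(1)[OF d(1) T2] by (simp add: has_distr_deriv2_def)
 finally show "(LI x. (h x - h' x) * ph x) = (LI x. H x * ph x)" .
 qed
 then have "L2_norm (%x. h x - h' x) = L2_norm H"
 by (intro L2_norm_cong_AE) (use hd H in \<open>auto intro: L2_measurable\<close>)
 then show ?thesis using H(3) by simp
qed

lemma newton_potential_zero: "newton_potential (%x. 0) = (%x. 0)"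
 by (auto simp: newton_potential_def)

lemma riesz_transform_bound:
 assumes f: "integ f" "f : L2" and h: "h : L2" "has_distr_deriv2 k i (newton_potential f) h"
 shows "L2_norm h <= 2 * L2_norm f"
proof -
 have "has_distr_deriv2 k i (newton_potential (%x. 0)) (%x. 0)"
 by (simp add: has_distr_deriv2_def newton_potential_zero L2_L1_loc L2_zero)
 from riesz_transform_diff_bound[OF f _ L2_zero h L2_zero this] show ?thesis by simp
qed

subsection \<open>Space-time test functions\<close>

abbreviation dt :: "(real \<times> (real^3) => 'b::real_normed_vector) => real \<times> (real^3) => 'b"
 where "dt \<equiv> ddir (1, 0)"
abbreviation dx :: "3 => (real \<times> (real^3) => 'b::real_normed_vector) => real \<times> (real^3) => 'b"
 where "dx i \<equiv> ddir (0, axis i 1)"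
text \<open>The backward heat operator, minus the formal adjoint of the heat operator. It is what
  the weak formulation applies to each component of the test function.\<close>

definition heat_op :: "(real \<times> (real^3) => real) => real \<times> (real^3) => real"
 where "heat_op ps z = dt ps z + (SS i. dx i (dx i ps) z)"

lemma smooth_slice: "smooth ps ==> smooth (%x. ps (t, x))"
 using smooth_affine[of "%x. (0, x)" ps "(t, 0)"] by (simp add: bounded_linear_Pair bounded_linear_zero bounded_linear_ident)

lemma pd_slice: "smooth ps ==> pd i (%x. ps (t, x)) = (%x. dx i ps (t, x))"
proof
 fix x assume "smooth ps"
 have "bounded_linear (%x :: real^3. (0 :: real, x))"
 by (intro bounded_linear_Pair bounded_linear_zero bounded_linear_ident)
 from ddir_affine[OF this \<open>smooth ps\<close>, where v = "axis i 1" and c = "(t, 0)" and x = x]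
 show "pd i (%x. ps (t, x)) x = dx i ps (t, x)" by (simp add: pd_def)
qed

lemma pd_slice2: "smooth ps ==> pd i (pd j (%x. ps (t, x))) = (%x. dx i (dx j ps) (t, x))"
 using pd_slice[where ps = "dx j ps", OF smooth_ddir] by (simp only: pd_slice)

lemma laplacian_slice: "smooth ps ==> laplacian (%x. ps (t, x)) x = (SS i. dx i (dx i ps) (t, x))"
 unfolding laplacian_def by (simp only: pd_slice2)

lemma dt_slice: "smooth ps ==> ((%t. ps (t, x)) has_vector_derivative dt ps (t, x)) (at t within S)"
 using smooth_vector_derivative[of ps "(0, x)" "(1, 0)" t S] by simp

lemma test_slice:
 assumes "ps : test_functions S" shows "(%x. ps (t, x)) : TF"
proof -
 obtain K where K: "compact K" "\<forall>z. z \<notin> K \<longrightarrow> ps z = 0" using test_support[OF assms] by blast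
 have "ps (t, x) = 0" if "x \<notin> snd ` K" for x
 using that K(2) by (metis image_eqI snd_conv)
 then show ?thesis
 using K(1) assms by (intro test_functionsI[where K = "snd ` K"] smooth_slice compact_continuous_image continuous_intros)
 (auto dest: test_smooth)
qed

lemma test_heat_op: "ps : test_functions S ==> heat_op ps : test_functions S"
 unfolding heat_op_def[abs_def] by (intro test_add test_sum test_ddir)

lemma heat_op_dx: "smooth ps ==> heat_op (dx i ps) = dx i (heat_op ps)"
proof -
 assume ps: "smooth ps"
 have s: "smooth (dt ps)" "smooth (dx k (dx k ps))" for k using ps smooth_ddir by blast+
 have "dx i (heat_op ps) = (%z. dx i (dt ps) z + dx i (%z. SS k. dx k (dx k ps) z) z)"
 unfolding heat_op_def[abs_def] by (rule ddir_add[OF s(1) smooth_sum[OF s(2)]])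
 also have "dx i (%z. SS k. dx k (dx k ps) z) = (%z. SS k. dx i (dx k (dx k ps)) z)"
 by (rule ddir_sum[OF s(2)])
 also have "dx i (dt ps) = dt (dx i ps)" by (rule ddir_commute[OF ps])
 also have "(%z. SS k. dx i (dx k (dx k ps)) z) = (%z. SS k. dx k (dx k (dx i ps)) z)"
 proof -
 have "dx i (dx k (dx k ps)) = dx k (dx k (dx i ps))" for k
 unfolding ddir_commute[OF smooth_ddir[OF ps], where v = "(0, axis i 1)" and w = "(0, axis k 1)"]
 ddir_commute[OF ps, where v = "(0, axis i 1)" and w = "(0, axis k 1)"] ..
 from fun_cong[OF this] show ?thesis by (intro ext sum.cong refl)
 qed
 finally show ?thesis unfolding heat_op_def[abs_def] by simp
qed

subsection \<open>Duhamel's identity\<close>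

text \<open>Valid for the heat kernel and for its potential, since both solve the heat equation for \<open>t > 0\<close>.\<close>

locale heat_solution =
 fixes \<Theta> L :: "real => real^3 => real"
 assumes deriv: "!!t x. 0 < t ==> ((%t. \<Theta> t x) has_real_derivative L t x) (at t)"
 and cont: "continuous_on ({0<..} \<times> UNIV) (%(t, x). \<Theta> t x)" "continuous_on ({0<..} \<times> UNIV) (%(t, x). L t x)"
 and parts: "!!t y ph. 0 < t ==> ph : TF ==>
 (LI x. \<Theta> t (x - y) * laplacian ph x) = (LI x. L t (x - y) * ph x)"
begin

text \<open>The time derivative of \<Theta>_t(x - y) g_t(x) is integrated over space and over
  \<open>{\<alpha>..\<beta>}\<close>, and \<open>parts\<close> transfers the spatial operator from
  \<Theta> to \<open>g\<close>. The lower time stays positive because the kernels are singular at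
  0.\<close>

lemma duhamel:
 assumes ab: "0 < \<alpha>" "\<alpha> <= \<beta>"
 and g: "!!t. g t : TF"
 and g': "!!t x. t : {\<alpha>..\<beta>} ==> ((%t. g t x) has_real_derivative g' t x) (at t within {\<alpha>..\<beta>})"
 and c: "continuous_on ({\<alpha>..\<beta>} \<times> UNIV) (%(t, x). g t x)" "continuous_on ({\<alpha>..\<beta>} \<times> UNIV) (%(t, x). g' t x)"
 and K: "compact K" "!!t x. x \<notin> K ==> g t x = 0" "!!t x. x \<notin> K ==> g' t x = 0"
 shows "(LINT t:{\<alpha>..\<beta>}|lborel. LI x. \<Theta> t (x - y) * (g' t x + laplacian (g t) x))
 = (LI x. \<Theta> \<beta> (x - y) * g \<beta> x) - (LI x. \<Theta> \<alpha> (x - y) * g \<alpha> x)"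
proof -
 let ?I = "{\<alpha>..\<beta>}"
 let ?h = "%t x. indicator ?I t * (L t (x - y) * g t x + \<Theta> t (x - y) * g' t x)"
 have sub: "(%z. (fst z, snd z - y)) ` (?I \<times> S) \<subseteq> {0<..} \<times> UNIV" for S using ab by auto
 have cs: "continuous_on (?I \<times> S) (%z. \<Theta> (fst z) (snd z - y))" "continuous_on (?I \<times> S) (%z. L (fst z) (snd z - y))" for S
 proof -
 have cz: "continuous_on (?I \<times> S) (%z. (fst z, snd z - y))" by (intro continuous_intros)
 show "continuous_on (?I \<times> S) (%z. \<Theta> (fst z) (snd z - y))" "continuous_on (?I \<times> S) (%z. L (fst z) (snd z - y))"
 using continuous_on_compose2[OF cont(1) cz sub] continuous_on_compose2[OF cont(2) cz sub] by simp_all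
 qed
 have gs: "continuous_on (?I \<times> S) (%z. g (fst z) (snd z))" "continuous_on (?I \<times> S) (%z. g' (fst z) (snd z))" for S
 using continuous_on_subset[OF c(1), of "?I \<times> S"] continuous_on_subset[OF c(2), of "?I \<times> S"]
 by (auto simp: split_beta)
 have int: "integrable (LL) (%(t, x). ?h t x)"
 proof -
 have "integ (%z. indicator (?I \<times> K) z *\<^sub>R
 (L (fst z) (snd z - y) * g (fst z) (snd z) + \<Theta> (fst z) (snd z - y) * g' (fst z) (snd z)))"
 by (intro borel_integrable_compact compact_Times compact_Icc K continuous_intros cs gs)
 moreover have "(%z. indicator (?I \<times> K) z *\<^sub>R
 (L (fst z) (snd z - y) * g (fst z) (snd z) + \<Theta> (fst z) (snd z - y) * g' (fst z) (snd z))) = (%(t, x). ?h t x)"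
 using K(2,3) by (auto simp: indicator_def fun_eq_iff)
 ultimately show ?thesis by (simp add: lborel_prod)
 qed
 have 1: "(LI t. ?h t x) = \<Theta> \<beta> (x - y) * g \<beta> x - \<Theta> \<alpha> (x - y) * g \<alpha> x" for x
 proof -
 have "(LI t. indicator ?I t *\<^sub>R (L t (x - y) * g t x + \<Theta> t (x - y) * g' t x)) = \<Theta> \<beta> (x - y) * g \<beta> x - \<Theta> \<alpha> (x - y) * g \<alpha> x"
 proof (rule integral_FTC_atLeastAtMost[OF ab(2)])
 fix t assume t: "\<alpha> <= t" "t <= \<beta>"
 then have "0 < t" using ab by simp
 then have "((%t. \<Theta> t (x - y) * g t x) has_real_derivative (L t (x - y) * g t x + g' t x * \<Theta> t (x - y))) (at t within ?I)"
 using t by (intro DERIV_mult g' has_field_derivative_at_within[OF deriv]) auto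
 then show "((%t. \<Theta> t (x - y) * g t x) has_vector_derivative (L t (x - y) * g t x + \<Theta> t (x - y) * g' t x)) (at t within ?I)"
 by (simp add: has_real_derivative_iff_has_vector_derivative mult.commute)
 next
 have cx: "continuous_on ?I (%t. f (fst (t, x)) (snd (t, x)))" if "continuous_on (?I \<times> UNIV) (%z. f (fst z) (snd z))" for f :: "real => real^3 => real"
 by (rule continuous_on_compose2[OF that, of ?I "%t. (t, x)"]) (auto intro!: continuous_intros)
 show "continuous_on ?I (%t. L t (x - y) * g t x + \<Theta> t (x - y) * g' t x)"
 using cx[OF gs(1)] cx[OF gs(2)] cx[of "%t x. \<Theta> t (x - y)", OF cs(1)] cx[of "%t x. L t (x - y)", OF cs(2)]
 by (intro continuous_intros) auto
 qed
 then show ?thesis by simp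
 qed
 have contx: "continuous_on UNIV (%x. \<Theta> t (x - y))" "continuous_on UNIV (%x. L t (x - y))" if "0 < t" for t
 proof -
 have s: "(%x. (t, x - y)) ` UNIV \<subseteq> {0<..} \<times> UNIV" using that by auto
 have cz: "continuous_on UNIV (%x. (t, x - y))" by (intro continuous_intros)
 show "continuous_on UNIV (%x. \<Theta> t (x - y))" "continuous_on UNIV (%x. L t (x - y))"
 using continuous_on_compose2[OF cont(1) cz s] continuous_on_compose2[OF cont(2) cz s] by simp_all
 qed
 have 2: "(LI x. ?h t x) = indicator ?I t * (LI x. \<Theta> t (x - y) * (g' t x + laplacian (g t) x))" for t
 proof (cases "t : ?I")
 case True
 then have t: "0 < t" using ab by simp
 have tm: "continuous_on UNIV (%x. f (fst (t, x)) (snd (t, x)))" if "continuous_on (?I \<times> UNIV) (%z. f (fst z) (snd z))" for f :: "real => real^3 => real"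
 by (rule continuous_on_compose2[OF that, of UNIV "%x. (t, x)"]) (use True in \<open>auto intro!: continuous_intros\<close>)
 have gl: "laplacian (g t) : TF" by (intro test_laplacian g)
 have i1: "integ (%x. L t (x - y) * g t x)" "integ (%x. \<Theta> t (x - y) * g' t x)"
 using tm[OF gs(1)] tm[OF gs(2)] contx[OF t] K
 by (auto intro!: integrable_compact_support[of _ K] continuous_intros)
 obtain K' where K': "compact K'" "\<forall>x. x \<notin> K' \<longrightarrow> laplacian (g t) x = 0" using test_support[OF gl] by blast
 have i2: "integ (%x. \<Theta> t (x - y) * laplacian (g t) x)"
 by (intro integrable_compact_support[of _ K'] continuous_intros contx t test_continuous[OF gl]) (use K' in auto)
 have "(LI x. L t (x - y) * g t x + \<Theta> t (x - y) * g' t x) = (LI x. \<Theta> t (x - y) * (g' t x + laplacian (g t) x))"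
 using i1 i2 parts[OF t g, of y t] by (simp add: distrib_left)
 then show ?thesis using True by simp
 qed simp
 have gb: "integ (%x. \<Theta> t (x - y) * g t x)" if "0 < t" for t
 proof -
 obtain K' where K': "compact K'" "\<forall>x. x \<notin> K' \<longrightarrow> g t x = 0" using test_support[OF g] by blast
 show ?thesis
 by (intro integrable_compact_support[of _ K'] continuous_intros contx that test_continuous[OF g]) (use K' in auto)
 qed
 have "(LINT t:?I|lborel. LI x. \<Theta> t (x - y) * (g' t x + laplacian (g t) x)) = (LI t. LI x. ?h t x)"
 unfolding 2 set_lebesgue_integral_def by simp
 also have "... = (LI x. LI t. ?h t x)"
 using lborel_pair.Fubini_integral[of ?h, OF int] by (rule sym)
 also have "... = (LI x. \<Theta> \<beta> (x - y) * g \<beta> x) - (LI x. \<Theta> \<alpha> (x - y) * g \<alpha> x)"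
 unfolding 1 using gb[OF ab(1)] gb[of \<beta>] ab by simp
 finally show ?thesis .
qed

end

lemma heat_joint_continuous: "continuous_on ({0<..} \<times> UNIV) (%(t, x). heat t x)"
 unfolding heat_eq split_beta by (intro continuous_intros) auto

interpretation heat_sol: heat_solution heat "%t. laplacian (heat t)"
proof
 show "((%t. heat t x) has_real_derivative laplacian (heat t) x) (at t)" if "0 < t" for t x
 by (rule heat_time_deriv[OF that])
 show "continuous_on ({0<..} \<times> UNIV) (%(t, x). heat t x)" by (rule heat_joint_continuous)
 have "continuous_on ({0<..} \<times> UNIV) (%(t, x :: real^3). (x \<bullet> x / (4 * t\<^sup>2) - 3 / (2 * t)) * heat t x)"
 using heat_joint_continuous unfolding split_beta by (intro continuous_intros) auto
 then show "continuous_on ({0<..} \<times> UNIV) (%(t, x). laplacian (heat t) x)"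
 by (rule continuous_on_eq) (auto simp: laplacian_heat)
 show "(LI x. heat t (x - y) * laplacian ph x) = (LI x. laplacian (heat t) (x - y) * ph x)"
 if "ph : TF" for t y ph
 by (rule laplacian_by_parts(1)[OF heat_regular that])
qed

interpretation pot_sol: heat_solution pot "%t x. - heat t x"
proof
 show "((%t. pot t x) has_real_derivative - heat t x) (at t)" if "0 < t" for t x
 using pot_time_deriv[OF that] laplacian_pot[OF that] by simp
 have c: "continuous_on UNIV (pot_moment 0)"
 by (intro continuous_at_imp_continuous_on ballI DERIV_isCont[OF pot_moment_deriv])
 have "continuous_on ({0<..} \<times> UNIV) (%(t, x :: real^3). pot_moment 0 (x \<bullet> x / t) / (4 * pi * sqrt pi * sqrt t))"
 unfolding split_beta
 by (intro continuous_on_divide continuous_on_mult continuous_on_const continuous_on_real_sqrt continuous_on_fst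
 continuous_on_id continuous_on_compose2[OF c, of "{0<..} \<times> UNIV" "%z. snd z \<bullet> snd z / fst z"]
 continuous_on_inner continuous_on_snd) auto
 then show "continuous_on ({0<..} \<times> UNIV) (%(t, x). pot t x)"
 by (rule continuous_on_eq) (auto simp: pot_eq)
 show "continuous_on ({0<..} \<times> UNIV) (%(t, x). - heat t x)"
 using heat_joint_continuous unfolding split_beta by (intro continuous_intros)
 show "(LI x. pot t (x - y) * laplacian ph x) = (LI x. - heat t (x - y) * ph x)"
 if "0 < t" "ph : TF" for t y ph
 using laplacian_by_parts(1)[OF pot_regular(1-4)[OF that(1)] that(2)] laplacian_pot[OF that(1)] by simp
qed

text \<open>Approximate identity, by the substitution $x=y+\sqrt t\,z$.\<close>

lemma heat_substitution:
 assumes t: "0 < t" and [measurable]: "f : BM"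
 shows "(LI x. heat t (x - y) * f x) = (LI z. heat 1 z * f (y + sqrt t *\<^sub>R z))"
proof -
 define s where "s = sqrt t"
 have s: "0 < s" "t = s * s" using t by (auto simp: s_def)
 have sc: "heat t (s *\<^sub>R z) = heat 1 z / s ^ 3" for z
 proof -
 have "- ((s *\<^sub>R z) \<bullet> (s *\<^sub>R z)) / (4 * t) = - (z \<bullet> z) / (4 * 1)" using s by simp
 then show ?thesis unfolding heat_eq s_def[symmetric] using s by (simp add: power3_eq_cube)
 qed
 let ?G = "%x. heat t (x - y) * f x"
 have "(LI z. ?G (y + s *\<^sub>R z)) = (LI x. ?G x) / \<bar>s\<bar> ^ 3"
 using integral_affine[of s ?G y] s by simp
 moreover have "(LI z. ?G (y + s *\<^sub>R z)) = (LI z. heat 1 z * f (y + s *\<^sub>R z)) / s ^ 3"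
 using sc by simp
 ultimately have "(LI x. ?G x) = (LI z. heat 1 z * f (y + s *\<^sub>R z))" using s(1) by simp
 then show ?thesis unfolding s_def .
qed

text \<open>After the substitution the weight no longer depends on time and C times it dominates.
  The functions \<open>f n\<close> vary with \<open>n\<close> because the test function will be
  evaluated at the moving time s + \<epsilon> n.\<close>

lemma heat_conv_tendsto:
 assumes \<epsilon>: "!!n. 0 < \<epsilon> n" "\<epsilon> ----> 0"
 and f: "!!n. f n : BM" "!!n x. \<bar>f n x\<bar> <= C"
 and lim: "!!z. (%n. f n (y + sqrt (\<epsilon> n) *\<^sub>R z)) ----> l"
 shows "(%n. LI x. heat (\<epsilon> n) (x - y) * f n x) ----> l"
proof -
 have "(%n. LI z. heat 1 z * f n (y + sqrt (\<epsilon> n) *\<^sub>R z)) ----> (LI z. heat 1 z * l)"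
 proof (rule integral_dominated_convergence)
 show "integ (%z. heat 1 z * C)" by (intro integrable_mult_left heat_integrable) simp
 show "AE z in lborel. (%n. heat 1 z * f n (y + sqrt (\<epsilon> n) *\<^sub>R z)) ----> heat 1 z * l"
 by (intro AE_I2 tendsto_mult tendsto_const lim)
 show "AE z in lborel. norm (heat 1 z * f n (y + sqrt (\<epsilon> n) *\<^sub>R z)) <= heat 1 z * C" for n
 using f(2) by (intro AE_I2) (auto simp: abs_mult heat_nonneg intro!: mult_left_mono)
 show "(%z. heat 1 z * f n (y + sqrt (\<epsilon> n) *\<^sub>R z)) : borel_measurable lborel" for n
 using f(1)[of n] by measurable
 qed measurable
 then show ?thesis using heat_substitution[OF \<epsilon>(1) f(1)] by (simp add: heat_integral)
qed

lemma seq_right_0: "filterlim (%n. c / real (Suc n)) (at_right 0) sequentially" if "0 < c"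
proof -
 have "(%n. c * (1 / real (Suc n))) ----> c * 0"
 by (intro tendsto_mult tendsto_const LIMSEQ_Suc[OF lim_1_over_n])
 then show ?thesis using that by (auto simp: filterlim_at)
qed

lemma set_integral_tendsto_left:
 fixes H :: "real => real"
 assumes H: "sinteg {0<..b} H" and \<epsilon>: "!!n. 0 < \<epsilon> n" "\<epsilon> ----> 0"
 shows "(%n. LINT t:{\<epsilon> n..b}|lborel. H t) ----> (LINT t:{0<..b}|lborel. H t)"
 unfolding set_lebesgue_integral_def
proof (rule integral_dominated_convergence)
 have [measurable]: "(%t. indicator {0<..b} t *\<^sub>R H t) : BM"
 using H by (simp add: set_integrable_def)
 show "integ (%t. norm (indicator {0<..b} t *\<^sub>R H t))"
 using H unfolding set_integrable_def by (rule integrable_norm)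
 have eq: "indicator {\<epsilon> n..b} t *\<^sub>R H t = indicator {\<epsilon> n..b} t *\<^sub>R (indicator {0<..b} t *\<^sub>R H t)" for n t
 using \<epsilon>(1)[of n] by (auto simp: indicator_def)
 show "(%t. indicator {\<epsilon> n..b} t *\<^sub>R H t) : borel_measurable lborel" for n
 unfolding eq by measurable
 show "AE t in lborel. norm (indicator {\<epsilon> n..b} t *\<^sub>R H t) <= norm (indicator {0<..b} t *\<^sub>R H t)" for n
 using \<epsilon>(1)[of n] by (intro AE_I2) (auto simp: indicator_def)
 show "AE t in lborel. (%n. indicator {\<epsilon> n..b} t *\<^sub>R H t) ----> indicator {0<..b} t *\<^sub>R H t"
 proof (intro AE_I2 tendsto_eventually)
 fix t
 show "\<forall>\<^sub>F n in sequentially. indicator {\<epsilon> n..b} t *\<^sub>R H t = indicator {0<..b} t *\<^sub>R H t"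
 proof (cases "0 < t")
 case True
 then have "\<forall>\<^sub>F n in sequentially. \<epsilon> n < t" using order_tendstoD(2)[OF \<epsilon>(2)] by blast
 then show ?thesis by eventually_elim (use True in \<open>auto simp: indicator_def\<close>)
 next
 case False
 then have "\<not> \<epsilon> n <= t" for n using \<epsilon>(1)[of n] by linarith
 then show ?thesis using False by (intro always_eventually) simp
 qed
 qed
 show "(%t. indicator {0<..b} t *\<^sub>R H t) : borel_measurable lborel"
 using H by (simp add: set_integrable_def)
qed

text \<open>Duhamel's identity on \<open>{\<epsilon> n..T - s}\<close> as \<epsilon> n tends to 0.
  The test function vanishes at time \<open>T\<close>, so only the lower endpoint survives, with
  limit \<open>l\<close>; the bound \<open>D\<close> provides integrability up to time 0.\<close>

lemma (in heat_solution) duhamel_limit: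
 assumes meas: "(%z. indicator {0<..} (fst z) * \<Theta> (fst z) (snd z)) : BM"
 and ps: "ps : TFT T" and s: "s < T"
 and D: "!!t. 0 < t ==> \<bar>LI x. \<Theta> t (x - y) * heat_op ps (s + t, x)\<bar> <= D"
 and lim: "!!\<epsilon>. (!!n. 0 < \<epsilon> n) ==> \<epsilon> ----> 0 ==> (%n. LI x. \<Theta> (\<epsilon> n) (x - y) * ps (s + \<epsilon> n, x)) ----> l"
 shows "sinteg {0<..T - s} (%t. LI x. \<Theta> t (x - y) * heat_op ps (s + t, x))"
 and "(LINT t:{0<..T - s}|lborel. LI x. \<Theta> t (x - y) * heat_op ps (s + t, x)) = - l"
proof -
 let ?H = "%t. LI x. \<Theta> t (x - y) * heat_op ps (s + t, x)"
 have sm: "smooth ps" using ps by (rule test_smooth)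
 have [measurable]: "heat_op ps : BM"
 using test_heat_op[OF ps] by (rule test_measurable)
 have [measurable]: "(%t. indicator {0<..} t * ?H t) : BM"
 proof -
 have 1: "(%z. indicator {0<..} (fst z) * \<Theta> (fst z) (snd z)) : borel_measurable (borel \<Otimes>\<^sub>M borel)"
 using meas by (simp add: borel_prod)
 have "(%(t, x). (indicator {0<..} t * \<Theta> t (x - y)) * heat_op ps (s + t, x)) : borel_measurable (borel \<Otimes>\<^sub>M lborel)"
 proof -
 have "(%z. indicator {0<..} (fst z) * \<Theta> (fst z) (snd z - y)) : borel_measurable (borel \<Otimes>\<^sub>M lborel)"
 using measurable_compose[OF _ 1, of "%z. (fst z, snd z - y)" "borel \<Otimes>\<^sub>M lborel"] by simp
 then show ?thesis unfolding split_beta by measurable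
 qed
 from lborel.borel_measurable_lebesgue_integral[OF this]
 have "(%t. LI x. (indicator {0<..} t * \<Theta> t (x - y)) * heat_op ps (s + t, x)) : BM" .
 then show ?thesis by (simp add: mult.assoc)
 qed
 show int: "sinteg {0<..T - s} ?H"
 unfolding set_integrable_def
 proof (rule bo_integrable_bound)
 show "integ (%t. indicator {0<..T - s} t * D)" 
 using s by (intro integrable_mult_left integrable_real_indicator) auto
 show "AE t in lborel. norm (indicator {0<..T - s} t *\<^sub>R ?H t) <= norm (indicator {0<..T - s} t * D)"
 using D by (intro AE_I2) (auto simp: indicator_def intro: order_trans[OF _ abs_ge_self])
 have "(%t. indicator {0<..T - s} t *\<^sub>R ?H t) = (%t. indicator {..T - s} t *\<^sub>R (indicator {0<..} t * ?H t))"
 by (auto simp: indicator_def)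
 then show "(%t. indicator {0<..T - s} t *\<^sub>R ?H t) : borel_measurable lborel" by (simp only:) measurable
 qed
 define \<epsilon> where "\<epsilon> n = (T - s) / real (Suc n)" for n
 have \<epsilon>: "0 < \<epsilon> n" "\<epsilon> n <= T - s" for n
 using s divide_left_mono[of 1 "real (Suc n)" "T - s"] by (auto simp: \<epsilon>_def)
 have \<epsilon>0: "\<epsilon> ----> 0" using seq_right_0[of "T - s"] s by (simp add: \<epsilon>_def[abs_def] filterlim_at)
 obtain K where K: "compact K" "K \<subseteq> {..<T} \<times> UNIV" "\<forall>z. z \<notin> K \<longrightarrow> ps z = 0"
 using test_support[OF ps] by blast
 have K': "compact (snd ` K)" using K(1) by (intro compact_continuous_image continuous_intros)
 have out: "ps (t, x) = 0 \<and> dt ps (t, x) = 0" if "x \<notin> snd ` K" for t x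
 proof -
 have "(t, x) \<notin> K" using that by force
 then show ?thesis using K(3) ddir_zero_outside[OF compact_imp_closed[OF K(1)] K(3)] by blast
 qed
 have psiT: "ps (T, x) = 0" for x using K(2,3) by (metis SigmaE2 lessThan_iff less_irrefl subsetD)
 have shift: "((%t. ps (s + t, x)) has_real_derivative dt ps (s + t, x)) (at t within S)" for t x S
 proof -
 have "((%t. ps ((s, x) + t *\<^sub>R (1, 0))) has_vector_derivative dt ps ((s, x) + t *\<^sub>R (1, 0))) (at t within S)"
 by (rule smooth_vector_derivative[OF sm])
 then show ?thesis by (simp add: has_real_derivative_iff_has_vector_derivative)
 qed
 have eq: "(LINT t:{\<epsilon> n..T - s}|lborel. ?H t) = - (LI x. \<Theta> (\<epsilon> n) (x - y) * ps (s + \<epsilon> n, x))" for n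
 proof -
 have cpsi: "continuous_on A (%(t, x). f (s + t, x))" if "smooth f" for f :: "real \<times> (real^3) => real" and A
 unfolding split_beta
 by (rule continuous_on_compose2[OF smooth_continuous_on[OF that, of UNIV]]) (auto intro!: continuous_intros)
 have "(LINT t:{\<epsilon> n..T - s}|lborel. LI x. \<Theta> t (x - y) * (dt ps (s + t, x) + laplacian (%x. ps (s + t, x)) x))
 = (LI x. \<Theta> (T - s) (x - y) * ps (s + (T - s), x)) - (LI x. \<Theta> (\<epsilon> n) (x - y) * ps (s + \<epsilon> n, x))"
 proof (rule duhamel[OF \<epsilon> _ _ _ _ K'])
 show "(%x. ps (s + t, x)) : TF" for t by (rule test_slice[OF ps])
 show "((%t. ps (s + t, x)) has_real_derivative dt ps (s + t, x)) (at t within {\<epsilon> n..T - s})" for t x by (rule shift)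
 show "continuous_on ({\<epsilon> n..T - s} \<times> UNIV) (%(t, x). ps (s + t, x))" by (rule cpsi[OF sm])
 show "continuous_on ({\<epsilon> n..T - s} \<times> UNIV) (%(t, x). dt ps (s + t, x))" by (rule cpsi[OF smooth_ddir[OF sm]])
 qed (use out in auto)
 then show ?thesis by (simp add: laplacian_slice[OF sm] heat_op_def psiT)
 qed
 have "(%n. LINT t:{\<epsilon> n..T - s}|lborel. ?H t) ----> (LINT t:{0<..T - s}|lborel. ?H t)"
 by (rule set_integral_tendsto_left[OF int \<epsilon>(1) \<epsilon>0])
 moreover have "(%n. LINT t:{\<epsilon> n..T - s}|lborel. ?H t) ----> - l"
 unfolding eq by (intro tendsto_minus lim[OF \<epsilon>(1) \<epsilon>0])
 ultimately show "(LINT t:{0<..T - s}|lborel. ?H t) = - l" by (rule LIMSEQ_unique)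
qed

lemma test_abs_bounded:
 "(f :: 'a::euclidean_space => real) : test_functions S ==> \<exists>C\<ge>0. \<forall>x. \<bar>f x\<bar> <= C"
 by (erule test_bounded) (auto intro: less_imp_le)

lemma heat_conv_abs_le:
 assumes "0 < t" "f : BM" "!!x. \<bar>f x\<bar> <= C"
 shows "\<bar>LI x. heat t (x - y) * f x\<bar> <= C"
proof -
 have [measurable]: "f : BM" by fact
 have h: "integ (%x. heat t (x - y))" "(LI x. heat t (x - y)) = 1"
 using integrable_translate_iff[of "heat t" y] integral_translate[of "heat t" y] heat_integrable[OF assms(1)] heat_integral[OF assms(1)]
 by auto
 have le: "\<bar>heat t (x - y) * f x\<bar> <= heat t (x - y) * C" for x
 using assms by (simp add: abs_mult heat_nonneg mult_left_mono)
 have int: "integ (%x. heat t (x - y) * f x)"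
 using le by (intro bo_integrable_bound[OF integrable_mult_left[OF h(1), of C]])
 (auto intro: order_trans[OF _ abs_ge_self])
 have "\<bar>LI x. heat t (x - y) * f x\<bar> <= (LI x. \<bar>heat t (x - y) * f x\<bar>)" by (rule integral_abs_bound)
 also have "... <= (LI x. heat t (x - y) * C)"
 using int h le by (intro integral_mono) auto
 finally show ?thesis using h by simp
qed

text \<open>The heat kernel is an approximate identity, so the lower endpoint of Duhamel's identity
  converges to the value of the test function at (s, y).\<close>

lemma
 assumes ps: "ps : TFT T" and s: "s < T"
 shows heat_dual_integrable: "sinteg {0<..T - s} (%t. LI x. heat t (x - y) * heat_op ps (s + t, x))"
 and heat_dual: "(LINT t:{0<..T - s}|lborel. LI x. heat t (x - y) * heat_op ps (s + t, x)) = - ps (s, y)"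
proof -
 obtain C where C: "!!z. \<bar>heat_op ps z\<bar> <= C" using test_abs_bounded[OF test_heat_op[OF ps]] by blast
 obtain D where D: "!!z. \<bar>ps z\<bar> <= D" using test_abs_bounded[OF ps] by blast
 have [measurable]: "heat_op ps : BM" "ps : BM"
 using ps test_heat_op[OF ps] by (auto intro: test_measurable)
 have m: "(%z. indicator {0<..} (fst z) * heat (fst z) (snd z)) : BM"
 unfolding borel_prod[symmetric] by measurable
 have b: "\<bar>LI x. heat t (x - y) * heat_op ps (s + t, x)\<bar> <= C" if "0 < t" for t
 by (rule heat_conv_abs_le[OF that _ C]) measurable
 have l: "(%n. LI x. heat (\<epsilon> n) (x - y) * ps (s + \<epsilon> n, x)) ----> ps (s, y)"
 if e: "!!n. 0 < \<epsilon> n" "\<epsilon> ----> 0" for \<epsilon> :: "nat => real"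
 proof (rule heat_conv_tendsto[OF e])
 show "(%x. ps (s + \<epsilon> n, x)) : BM" for n by measurable
 show "\<bar>ps (s + \<epsilon> n, x)\<bar> <= D" for n x by (rule D)
 fix z
 have "(%n. (s + \<epsilon> n, y + sqrt (\<epsilon> n) *\<^sub>R z)) ----> (s + 0, y + sqrt 0 *\<^sub>R z)"
 by (intro tendsto_intros e)
 from isCont_tendsto_compose[OF smooth_isCont[OF test_smooth[OF ps]] this]
 show "(%n. ps (s + \<epsilon> n, y + sqrt (\<epsilon> n) *\<^sub>R z)) ----> ps (s, y)" by simp
 qed
 show "sinteg {0<..T - s} (%t. LI x. heat t (x - y) * heat_op ps (s + t, x))"
 "(LINT t:{0<..T - s}|lborel. LI x. heat t (x - y) * heat_op ps (s + t, x)) = - ps (s, y)"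
 using heat_sol.duhamel_limit[OF m ps s b l] by blast+
qed

lemma pot_eq_rad: "0 < t ==> pot t x = pot_rad t 0 (x \<bullet> x)"
 using radial_chain.rd0_def[OF pot_chain] by blast

text \<open>Here the lower endpoint converges to a Newton potential, because P(.,t) increases to the
  Newton kernel as t decreases to 0. The dominating function is that kernel times a multiple of the
  indicator of a compact set containing the supports of all slices.\<close>

lemma
 assumes ps: "ps : TFT T" and s: "s < T"
 shows pot_dual_integrable: "sinteg {0<..T - s} (%t. LI x. pot t (x - y) * heat_op ps (s + t, x))"
 and pot_dual: "(LINT t:{0<..T - s}|lborel. LI x. pot t (x - y) * heat_op ps (s + t, x)) = - newton_conv (%x. ps (s, x)) y"
proof -
 have [measurable]: "heat_op ps : BM" "ps : BM"
 using ps test_heat_op[OF ps] by (auto intro: test_measurable)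
 have dom: "\<exists>C K. (\<forall>t x. \<bar>f (t, x)\<bar> <= C * indicator K x) \<and> 0 <= C \<and> compact K"
 if f: "f : TFT T" for f :: "real \<times> (real^3) => real"
 proof -
 obtain C where C: "0 <= C" "!!z. \<bar>f z\<bar> <= C" using test_abs_bounded[OF f] by blast
 obtain K where K: "compact K" "\<forall>z. z \<notin> K \<longrightarrow> f z = 0" using test_support[OF f] by blast
 have "\<bar>f (t, x)\<bar> <= C * indicator (snd ` K) x" for t x
 proof (cases "x : snd ` K")
 case True then show ?thesis using C(2) by simp
 next
 case False
 then have "(t, x) \<notin> K" by force
 then show ?thesis using K(2) False by simp
 qed
 moreover have "compact (snd ` K)" using K(1) by (intro compact_continuous_image continuous_intros)
 ultimately show ?thesis using C(1) by blast
 qed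
 have indK: "integ (%x. C * indicator K x :: real)" if "compact K" for C and K :: "(real^3) set"
 using emeasure_compact_finite[OF that] compact_imp_closed[OF that]
 by (intro integrable_mult_right integrable_real_indicator) (auto simp: less_top)
 have bnd: "\<bar>C * indicator K x\<bar> <= \<bar>C\<bar>" for C :: real and K :: "(real^3) set" and x by (auto simp: indicator_def)
 have m: "(%z. indicator {0<..} (fst z) * pot (fst z) (snd z)) : BM"
 proof -
 have "(%z :: real \<times> (real^3). indicator {0<..} (fst z) * pot (fst z) (snd z)) = (%z. indicator {0<..} (fst z) * pot_rad (fst z) 0 (snd z \<bullet> snd z))"
 by (auto simp: fun_eq_iff indicator_def pot_eq_rad)
 then show ?thesis unfolding borel_prod[symmetric] by simp
 qed
 obtain C K where CK: "!!t x. \<bar>heat_op ps (t, x)\<bar> <= C * indicator K x" "0 <= C" "compact K"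
 using dom[OF test_heat_op[OF ps]] by blast
 have b: "\<bar>LI x. pot t (x - y) * heat_op ps (s + t, x)\<bar> <= C + (LI x. C * indicator K x)" if t: "0 < t" for t
 proof -
 have fi: "integ (%x. heat_op ps (s + t, x))"
 using test_integrable[OF test_slice[OF test_heat_op[OF ps]]] .
 have "\<bar>heat_op ps (s + t, x)\<bar> <= C" for x using CK(1)[of "s + t" x] CK(2) by (cases "x : K") auto
 from pot_conv_bound[OF fi this t]
 have "\<bar>LI x. pot t (x - y) * heat_op ps (s + t, x)\<bar> <= C + (LI x. \<bar>heat_op ps (s + t, x)\<bar>)" .
 also have "... <= C + (LI x. C * indicator K x)"
 using CK fi indK by (intro add_left_mono integral_mono integrable_abs) auto
 finally show ?thesis .
 qed
 obtain C' K' where CK': "!!t x. \<bar>ps (t, x)\<bar> <= C' * indicator K' x" "0 <= C'" "compact K'"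
 using dom[OF ps] by blast
 have l: "(%n. LI x. pot (\<epsilon> n) (x - y) * ps (s + \<epsilon> n, x)) ----> newton_conv (%x. ps (s, x)) y"
 if e: "!!n. 0 < \<epsilon> n" "\<epsilon> ----> 0" for \<epsilon> :: "nat => real"
 unfolding newton_conv_def
 proof (rule integral_dominated_convergence)
 have seq: "filterlim \<epsilon> (at_right 0) sequentially" 
 using e e(1)[THEN less_imp_neq, THEN not_sym] by (simp add: filterlim_at)
 show "integ (%x. newton_kernel (x - y) * (C' * indicator K' x))"
 by (rule newton_conv_integrable[OF indK[OF CK'(3)] bnd])
 have ae: "AE x in lborel. x ~= y" by (rule AE_lborel_singleton)
 then show "AE x in lborel. (%n. pot (\<epsilon> n) (x - y) * ps (s + \<epsilon> n, x)) ----> newton_kernel (x - y) * ps (s, x)"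
 proof eventually_elim
 case (elim x)
 have "(%n. (s + \<epsilon> n, x)) ----> (s + 0, x)" by (intro tendsto_intros e)
 from isCont_tendsto_compose[OF smooth_isCont[OF test_smooth[OF ps]] this]
 have "(%n. ps (s + \<epsilon> n, x)) ----> ps (s, x)" by simp
 moreover have "(%n. pot (\<epsilon> n) (x - y)) ----> newton_kernel (x - y)"
 using elim by (intro filterlim_compose[OF pot_tendsto_newton seq]) simp
 ultimately show ?case by (intro tendsto_mult)
 qed
 show "AE x in lborel. norm (pot (\<epsilon> n) (x - y) * ps (s + \<epsilon> n, x)) <= newton_kernel (x - y) * (C' * indicator K' x)" for n
 using ae
 proof eventually_elim
 case (elim x)
 have "pot (\<epsilon> n) (x - y) * \<bar>ps (s + \<epsilon> n, x)\<bar> <= newton_kernel (x - y) * (C' * indicator K' x)"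
 using elim by (intro mult_mono pot_le_newton e CK' newton_kernel_nonneg) auto
 then show ?case by (simp add: abs_mult pot_nonneg e)
 qed
 show "(%x. newton_kernel (x - y) * ps (s, x)) : borel_measurable lborel" by measurable
 show "(%x. pot (\<epsilon> n) (x - y) * ps (s + \<epsilon> n, x)) : borel_measurable lborel" for n using e(1)[of n] by measurable
 qed
 show "sinteg {0<..T - s} (%t. LI x. pot t (x - y) * heat_op ps (s + t, x))"
 "(LINT t:{0<..T - s}|lborel. LI x. pot t (x - y) * heat_op ps (s + t, x)) = - newton_conv (%x. ps (s, x)) y"
 using pot_sol.duhamel_limit[OF m ps s b l] by blast+
qed

subsection \<open>The space-time kernel\<close>

text \<open>The cut-off in time makes the kernel integrable on all of space-time. Together with a
  forcing extended by 0 to negative times it turns the integral over 0 < s < t into a plain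
  convolution.\<close>

definition st_kernel :: "real => 3 => 3 => 3 => real \<times> (real^3) => real"
 where "st_kernel T i j k z = indicator {0<..<T} (fst z) * oseen_grad i j k (fst z) (snd z)"

lemma st_kernel_measurable [measurable]: "st_kernel T i j k : BM"
 unfolding st_kernel_def[abs_def] borel_prod[symmetric] by measurable

lemma inverse_sqrt_integrable: assumes "0 < T" shows "integ (%t. indicator {0<..<T} t / sqrt t)"
proof -
 have "sinteg (einterval (ereal 0) (ereal T)) (%t. 1 / sqrt t)"
 proof (rule interval_integral_FTC_nonneg(1)[where F = "%t. 2 * sqrt t" and A = 0 and B = "2 * sqrt T"])
 show "DERIV (%t. 2 * sqrt t) t :> 1 / sqrt t" if "ereal 0 < ereal t" for t
 proof -
 have "0 < t" using that by simp
 from DERIV_cmult[OF DERIV_real_sqrt[OF this], of 2] show ?thesis by (simp add: inverse_eq_divide)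
 qed
 show "isCont (%t. 1 / sqrt t) t" if "ereal 0 < ereal t" for t
 using that by (auto intro!: continuous_divide isCont_real_sqrt)
 have c: "((%t. 2 * sqrt t) \<longlongrightarrow> 2 * sqrt t) (at t within S)" for t S
 by (intro tendsto_mult tendsto_const tendsto_real_sqrt tendsto_ident_at)
 show "(((%t. 2 * sqrt t) \<circ> real_of_ereal) \<longlongrightarrow> 0) (at_right (ereal 0))"
 unfolding ereal_tendsto_simps using c[of 0] by simp
 show "(((%t. 2 * sqrt t) \<circ> real_of_ereal) \<longlongrightarrow> 2 * sqrt T) (at_left (ereal T))"
 unfolding ereal_tendsto_simps by (rule c)
 show "ereal 0 < ereal T" using assms by simp
 show "AE t in lborel. ereal 0 < ereal t \<longrightarrow> ereal t < ereal T \<longrightarrow> 0 <= 1 / sqrt t" by simp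
 qed
 moreover have "einterval (ereal 0) (ereal T) = {0<..<T}" by (auto simp: einterval_def)
 ultimately show ?thesis by (simp add: set_integrable_def)
qed

lemma st_kernel_integrable: assumes T: "0 < T" shows "integ (st_kernel T i j k)"
proof -
 let ?h = "%t x. indicator {0<..<T} t * oseen_grad i j k t x"
 have "integrable (LL) (%(t, x). ?h t x)"
 proof (rule lborel_pair.Fubini_integrable)
 show "AE t in lborel. integ (%x. case (t, x) of (t, x) => ?h t x)"
 by (intro AE_I2) (auto simp: indicator_def oseen_grad_integrable)
 have *: "(LI x. norm (?h t x)) = indicator {0<..<T} t / sqrt t * (LI x. \<bar>oseen_grad i j k 1 x\<bar>)" for t
 using oseen_grad_L1[of t i j k] by (cases "t : {0<..<T}") auto
 show "integ (%t. LI x. norm (case (t, x) of (t, x) => ?h t x))"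
 using integrable_mult_left[OF inverse_sqrt_integrable[OF T]] by (simp only: prod.case *)
 qed measurable
 then show ?thesis by (simp add: lborel_prod st_kernel_def[abs_def] case_prod_unfold)
qed

text \<open>All derivatives go to the test function, leaving \<Phi> and \<open>P\<close> themselves,
  for which the limit form of Duhamel's identity holds. The heat part takes one derivative, the
  potential part three.\<close>

lemma oseen_grad_by_parts:
 assumes t: "0 < t" and ph: "ph : TF"
 shows "(LI x. oseen_grad i j k t (x - y) * ph x)
 = - of_bool (j = k) * (LI x. heat t (x - y) * pd i ph x) - (LI x. pot t (x - y) * pd j (pd k (pd i ph)) x)"
proof -
 interpret pot: radial_chain "pot_rad t" by (rule pot_chain[OF t])
 have og: "oseen_grad i j k t x = of_bool (j = k) * pd i (heat t) x + pd i (pd j (pd k (pot t))) x" for x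
 by (simp add: oseen_grad_def heat.pd_rd pot.pd_rd heat.rd1_def pot.rd3_def)
 let ?f = "%x. ph (x + y)"
 have f: "?f : TF" using test_translate[OF ph, of "- y"] by simp
 have sh: "(LI x. G (x - y) * g x) = (LI x. G x * g (x + y))"
 if "continuous_on UNIV G" "g : TF" for G g :: "real^3 => real"
 using integral_shift_kernel[of G g y] that
 by (simp add: borel_measurable_continuous_onI test_measurable add.commute)
 have pdf: "pd i ?f = (%x. pd i ph (x + y))" using pd_translate[of ph i "- y"] test_smooth[OF ph] by simp
 have ibp: "(LI x. pd i G (x - y) * ph x) = - (LI x. G (x - y) * pd i ph x)"
 if "!!x. G differentiable (at x)" "continuous_on UNIV (pd i G)" for G :: "real^3 => real"
 proof -
 have "continuous_on UNIV G"
 using that(1) by (meson continuous_at_imp_continuous_on differentiable_imp_continuous_within)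
 then show ?thesis
 unfolding sh[OF that(2) ph] using integration_by_parts[OF that f]
 by (simp add: sh test_pd[OF ph] pdf)
 qed
 have int: "integ (%x. G (x - y) * ph x)" if "continuous_on UNIV G" for G :: "real^3 => real"
 proof -
 note G = that
 obtain K where "compact K" "\<forall>x. x \<notin> K \<longrightarrow> ph x = 0" using test_support[OF ph] by blast
 then show ?thesis
 by (intro integrable_compact_support[of _ K] continuous_intros continuous_on_compose2[OF G] test_continuous[OF ph]) auto
 qed
 have "(LI x. oseen_grad i j k t (x - y) * ph x)
 = of_bool (j = k) * (LI x. pd i (heat t) (x - y) * ph x) + (LI x. pd i (pd j (pd k (pot t))) (x - y) * ph x)"
 unfolding og distrib_right mult.assoc
 using int[of "pd i (heat t)"] int[of "pd i (pd j (pd k (pot t)))"]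
 by (simp add: heat.pd_rd pot.pd_rd heat.rd_cont pot.rd_cont)
 also have "(LI x. pd i (heat t) (x - y) * ph x) = - (LI x. heat t (x - y) * pd i ph x)"
 by (rule ibp) (simp_all add: heat.pd_rd heat.rd_cont heat.rd_differentiable)
 also have "(LI x. pd i (pd j (pd k (pot t))) (x - y) * ph x) = - (LI x. pd j (pd k (pot t)) (x - y) * pd i ph x)"
 by (rule ibp) (simp_all add: pot.pd_rd pot.rd_cont pot.rd_differentiable)
 also have "(LI x. pd j (pd k (pot t)) (x - y) * pd i ph x) = (LI x. pot t (x - y) * pd j (pd k (pd i ph)) x)"
 by (rule laplacian_by_parts(2)[OF pot_regular(1-4)[OF t] test_pd[OF ph]])
 finally show ?thesis by simp
qed

lemma set_integral_combination:
 fixes H P :: "real => real"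
 assumes "sinteg A H" "sinteg A P"
 shows "(LINT t:A|lborel. - c * H t - P t) = - c * (LINT t:A|lborel. H t) - (LINT t:A|lborel. P t)"
proof -
 have "(LINT t:A|lborel. - c * H t - P t) = (LI t. - c * (indicator A t * H t) - indicator A t * P t)"
 unfolding set_lebesgue_integral_def by (intro bo_cong refl) (simp add: algebra_simps)
 then show ?thesis using assms by (simp add: set_integrable_def set_lebesgue_integral_def)
qed

text \<open>Spatial derivatives commute with \<open>heat_op\<close>, so after integration by parts
  the integrands have the form treated by \<open>heat_dual\<close> and \<open>pot_dual\<close>.
  Their minus signs cancel those of \<open>oseen_grad_by_parts\<close>.\<close>

lemma oseen_dual:
 assumes T: "0 < T" and ps: "ps : TFT T" and s: "0 <= s" "s < T"
 shows "(LI z. st_kernel T i j k (z - (s, y)) * heat_op ps z)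
 = of_bool (j = k) * dx i ps (s, y) + newton_conv (%x. dx j (dx k (dx i ps)) (s, x)) y"
proof -
 let ?\<theta> = "heat_op ps"
 have sm: "smooth ps" using ps by (rule test_smooth)
 have \<theta>T: "?\<theta> : TFT T" by (rule test_heat_op[OF ps])
 have [measurable]: "?\<theta> : BM" using \<theta>T by (rule test_measurable)
 obtain C where C: "!!z. \<bar>?\<theta> z\<bar> <= C" using test_abs_bounded[OF \<theta>T] by blast
 have int: "integ (%z. st_kernel T i j k z * ?\<theta> ((s, y) + z))"
 proof (rule bo_integrable_bound)
 show "integ (%z. st_kernel T i j k z * C)" by (intro integrable_mult_left st_kernel_integrable T)
 have "\<bar>?\<theta> z\<bar> <= \<bar>C\<bar>" for z using C[of z] by simp
 then show "AE z in lborel. norm (st_kernel T i j k z * ?\<theta> ((s, y) + z)) <= norm (st_kernel T i j k z * C)"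
 by (intro AE_I2) (auto simp: abs_mult intro!: mult_left_mono)
 qed measurable
 \<comment> \<open>The shifted kernel is cut only at time s + T, but the test function already
   vanishes from time \<open>T\<close> on; thus the effective range is 0 < t < T - s.\<close>
 have \<theta>0: "?\<theta> (t, x) = 0" if "T <= t" for t x
 proof -
 obtain K where "K \<subseteq> {..<T} \<times> UNIV" "\<forall>z. z \<notin> K \<longrightarrow> ?\<theta> z = 0" using test_support[OF \<theta>T] by blast
 then show ?thesis using that by force
 qed
 let ?h = "%t x. st_kernel T i j k (t, x) * ?\<theta> (s + t, y + x)"
 have "(LI z. st_kernel T i j k (z - (s, y)) * ?\<theta> z) = (LI z. st_kernel T i j k z * ?\<theta> ((s, y) + z))"
 by (intro integral_shift_kernel) measurable
 also have "... = (LINT z|(LL). (case z of (t, x) => ?h t x))"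
 by (simp add: lborel_prod case_prod_unfold plus_prod_def)
 also have "... = (LI t. LI x. ?h t x)"
 using int by (intro lborel_pair.integral_fst[symmetric]) (simp add: lborel_prod case_prod_unfold plus_prod_def)
 also have "... = (LINT t:{0<..T - s}|lborel.
 - of_bool (j = k) * (LI x. heat t (x - y) * heat_op (dx i ps) (s + t, x))
 - (LI x. pot t (x - y) * heat_op (dx j (dx k (dx i ps))) (s + t, x)))"
 unfolding set_lebesgue_integral_def
 proof (intro bo_cong refl)
 fix t
 let ?R = "- of_bool (j = k) * (LI x. heat t (x - y) * heat_op (dx i ps) (s + t, x))
 - (LI x. pot t (x - y) * heat_op (dx j (dx k (dx i ps))) (s + t, x))"
 have "(LI x. ?h t x) = ?R" if t: "0 < t" "t < T"
 proof -
 have "(LI x. ?h t x) = (LI x. oseen_grad i j k t x * ?\<theta> (s + t, y + x))"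
 using t by (simp add: st_kernel_def)
 also have "... = (LI x. oseen_grad i j k t (x - y) * ?\<theta> (s + t, x))"
 by (rule integral_shift_kernel[symmetric]) measurable
 also have "... = - of_bool (j = k) * (LI x. heat t (x - y) * pd i (%x. ?\<theta> (s + t, x)) x)
 - (LI x. pot t (x - y) * pd j (pd k (pd i (%x. ?\<theta> (s + t, x)))) x)"
 by (rule oseen_grad_by_parts[OF t(1) test_slice[OF \<theta>T]])
 also have "pd i (%x. ?\<theta> (s + t, x)) = (%x. heat_op (dx i ps) (s + t, x))"
 using pd_slice[OF test_smooth[OF \<theta>T]] heat_op_dx[OF sm] by simp
 also have "pd j (pd k (%x. heat_op (dx i ps) (s + t, x))) = (%x. heat_op (dx j (dx k (dx i ps))) (s + t, x))"
 unfolding heat_op_dx[OF smooth_ddir[OF smooth_ddir[OF sm]]] heat_op_dx[OF smooth_ddir[OF sm]]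
 by (rule pd_slice2[OF test_smooth[OF test_heat_op[OF test_ddir[OF ps]]]])
 finally show ?thesis .
 qed
 moreover have "(LI x. ?h t x) = 0" if "\<not> (0 < t \<and> t < T) \<or> T - s < t"
 proof -
 have "(%x. ?h t x) = (%x. 0)" using that \<theta>0[of "s + t"] by (auto simp: st_kernel_def indicator_def fun_eq_iff)
 then show ?thesis by (simp only: bo_integral_zero)
 qed
 \<comment> \<open>For s = 0 the endpoint t = T belongs to the half-open interval of the dual
   identities but not to the support of \<open>st_kernel\<close>. Both sides agree there because the
   test function is 0 at time \<open>T\<close>.\<close>
 moreover have "?R = 0" if "t = T - s"
 proof -
 have "heat_op f (T, x) = 0" if "f : TFT T" for f x
 proof -
 note f = that
 obtain K where "K \<subseteq> {..<T} \<times> UNIV" "\<forall>z. z \<notin> K \<longrightarrow> heat_op f z = 0"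
 using test_support[OF test_heat_op[OF f]] by blast
 then show ?thesis by force
 qed
 then show ?thesis using that ps by (simp add: test_ddir)
 qed
 ultimately show "(LI x. ?h t x) = indicator {0<..T - s} t *\<^sub>R ?R"
 using s by (cases "0 < t \<and> t < T"; cases "t <= T - s"; cases "t = T - s"; auto simp: indicator_def)
 qed
 also have "... = - of_bool (j = k) * (LINT t:{0<..T - s}|lborel. LI x. heat t (x - y) * heat_op (dx i ps) (s + t, x))
 - (LINT t:{0<..T - s}|lborel. LI x. pot t (x - y) * heat_op (dx j (dx k (dx i ps))) (s + t, x))"
 by (rule set_integral_combination[OF heat_dual_integrable[OF test_ddir[OF ps] s(2)]
 pot_dual_integrable[OF test_ddir[OF test_ddir[OF test_ddir[OF ps]]] s(2)]])
 also have "... = of_bool (j = k) * dx i ps (s, y) + newton_conv (%x. dx j (dx k (dx i ps)) (s, x)) y"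
 unfolding heat_dual[OF test_ddir[OF ps] s(2)]
 pot_dual[OF test_ddir[OF test_ddir[OF test_ddir[OF ps]]] s(2)] by simp
 finally show ?thesis .
qed

subsection \<open>The velocity\<close>

lemma
 fixes k :: "'m => real" and F :: "'m => 'a::euclidean_space => real"
 assumes M: "sigma_finite_measure M" and k: "integrable M k"
 and m[measurable]: "(%(m, x). F m x) : borel_measurable (M \<Otimes>\<^sub>M lborel)"
 and F: "!!m. F m : L2" and C: "!!m. k m ~= 0 ==> L2_norm (F m) <= C"
 shows L2_integral_bounded_integrable: "integrable M (%m. \<bar>k m\<bar> * (L2_norm (F m))\<^sup>2)"
 and L2_integral_bounded: "AE x in lborel. integrable M (%m. k m * F m x)"
 "(%x. \<integral>m. k m * F m x \<partial>M) : L2"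
proof -
 interpret M: sigma_finite_measure M by fact
 have [measurable]: "k : borel_measurable M" using k by simp
 have [measurable]: "(%m. (L2_norm (F m))\<^sup>2) : borel_measurable M" unfolding L2_norm_sq by measurable
 show kF: "integrable M (%m. \<bar>k m\<bar> * (L2_norm (F m))\<^sup>2)"
 proof (rule bo_integrable_bound)
 show "integrable M (%m. \<bar>k m\<bar> * C\<^sup>2)" using k by simp
 have "\<bar>k m\<bar> * (L2_norm (F m))\<^sup>2 <= \<bar>k m\<bar> * C\<^sup>2" for m
 using C[of m] by (cases "k m = 0") (auto intro!: mult_left_mono power_mono)
 then show "AE m in M. norm (\<bar>k m\<bar> * (L2_norm (F m))\<^sup>2) <= norm (\<bar>k m\<bar> * C\<^sup>2)" by simp
 qed measurable
 show "AE x in lborel. integrable M (%m. k m * F m x)" "(%x. \<integral>m. k m * F m x \<partial>M) : L2"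
 using L2_integral(1,2)[OF M m k F kF] by blast+
qed

text \<open>Dominated convergence for superpositions: the squared norm of the difference is at most
  the \<open>L1\<close> norm of \<open>k\<close> times the weighted integral of the squared
  distances, which is dominated by (2C)^2 |k|. Bounds are asked only where \<open>k\<close> is
  nonzero, so the support of the kernel can limit the times involved.\<close>

lemma L2_integral_tendsto:
 fixes k :: "'m => real" and F :: "'m => 'a::euclidean_space => real" and Fn :: "nat => 'm => 'a => real"
 assumes M: "sigma_finite_measure M" and k: "integrable M k"
 and m: "(%(m, x). F m x) : borel_measurable (M \<Otimes>\<^sub>M lborel)" "!!n. (%(m, x). Fn n m x) : borel_measurable (M \<Otimes>\<^sub>M lborel)"
 and F: "!!m. F m : L2" "!!n m. Fn n m : L2"
 and C: "!!m. k m ~= 0 ==> L2_norm (F m) <= C" "!!n m. k m ~= 0 ==> L2_norm (Fn n m) <= C"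
 and lim: "AE m in M. k m ~= 0 \<longrightarrow> (%n. L2_norm (%x. Fn n m x - F m x)) ----> 0"
 shows "(%n. L2_norm (%x. (\<integral>m. k m * Fn n m x \<partial>M) - (\<integral>m. k m * F m x \<partial>M))) ----> 0"
proof -
 interpret M: sigma_finite_measure M by fact
 note [measurable] = m
 have [measurable]: "k : borel_measurable M" using k by simp
 let ?D = "%n m x. Fn n m x - F m x"
 have D: "?D n m : L2" for n m by (intro L2_diff F)
 have Dm: "(%(m, x). ?D n m x) : borel_measurable (M \<Otimes>\<^sub>M lborel)" for n by measurable
 have DC: "L2_norm (?D n m) <= 2 * C" if "k m ~= 0" for n m
 using L2_triangle_diff[OF F(2,1), of n m m] C(1)[OF that] C(2)[OF that, of n] by linarith
 have kD: "integrable M (%m. \<bar>k m\<bar> * (L2_norm (?D n m))\<^sup>2)" for n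
 by (rule L2_integral_bounded_integrable[OF M k Dm D DC])
 have sq: "(L2_norm (%x. (\<integral>m. k m * Fn n m x \<partial>M) - (\<integral>m. k m * F m x \<partial>M)))\<^sup>2
 <= (\<integral>m. \<bar>k m\<bar> \<partial>M) * (\<integral>m. \<bar>k m\<bar> * (L2_norm (?D n m))\<^sup>2 \<partial>M)" for n
 proof -
 have "L2_norm (%x. (\<integral>m. k m * Fn n m x \<partial>M) - (\<integral>m. k m * F m x \<partial>M)) = L2_norm (%x. \<integral>m. k m * ?D n m x \<partial>M)"
 proof (rule L2_norm_cong_AE)
 have "(%x. (\<integral>m. k m * Fn n m x \<partial>M) - (\<integral>m. k m * F m x \<partial>M)) : L2"
 by (intro L2_diff L2_integral_bounded(2)[OF M k m(2) F(2) C(2)] L2_integral_bounded(2)[OF M k m(1) F(1) C(1)])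
 then show "(%x. (\<integral>m. k m * Fn n m x \<partial>M) - (\<integral>m. k m * F m x \<partial>M)) : BM" by (rule L2_measurable)
 show "(%x. \<integral>m. k m * ?D n m x \<partial>M) : BM"
 by (rule L2_measurable[OF L2_integral_bounded(2)[OF M k Dm D DC]])
 show "AE x in lborel. (\<integral>m. k m * Fn n m x \<partial>M) - (\<integral>m. k m * F m x \<partial>M) = (\<integral>m. k m * ?D n m x \<partial>M)"
 proof -
 have "AE x in lborel. integrable M (%m. k m * Fn n m x)"
 by (rule L2_integral_bounded(1)[OF M k m(2) F(2) C(2)])
 moreover have "AE x in lborel. integrable M (%m. k m * F m x)"
 by (rule L2_integral_bounded(1)[OF M k m(1) F(1) C(1)])
 ultimately show ?thesis by eventually_elim (simp add: right_diff_distrib)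
 qed
 qed
 then show ?thesis using L2_integral(3)[OF M Dm k D kD] by simp
 qed
 have [measurable]: "(%m. (L2_norm (?D n m))\<^sup>2) : borel_measurable M" for n unfolding L2_norm_sq by measurable
 have "(%n. \<integral>m. \<bar>k m\<bar> * (L2_norm (?D n m))\<^sup>2 \<partial>M) ----> (\<integral>m. 0 \<partial>M)"
 proof (rule integral_dominated_convergence)
 show "integrable M (%m. \<bar>k m\<bar> * (2 * C)\<^sup>2)" using k by simp
 show "AE m in M. (%n. \<bar>k m\<bar> * (L2_norm (?D n m))\<^sup>2) ----> 0"
 using lim
 proof eventually_elim
 case (elim m)
 show ?case
 proof (cases "k m = 0")
 case False
 then have "(%n. \<bar>k m\<bar> * (L2_norm (?D n m))\<^sup>2) ----> \<bar>k m\<bar> * 0\<^sup>2"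
 using elim by (intro tendsto_mult tendsto_const tendsto_power) simp
 then show ?thesis by simp
 qed simp
 qed
 have "\<bar>k m\<bar> * (L2_norm (?D n m))\<^sup>2 <= \<bar>k m\<bar> * (2 * C)\<^sup>2" for n m
 proof (cases "k m = 0")
 case False
 then show ?thesis by (intro mult_left_mono power_mono DC) auto
 qed simp
 then show "AE m in M. norm (\<bar>k m\<bar> * (L2_norm (?D n m))\<^sup>2) <= \<bar>k m\<bar> * (2 * C)\<^sup>2" for n by simp
 qed measurable
 then have "(%n. (\<integral>m. \<bar>k m\<bar> \<partial>M) * (\<integral>m. \<bar>k m\<bar> * (L2_norm (?D n m))\<^sup>2 \<partial>M)) ----> 0"
 by (auto intro: tendsto_mult_right_zero)
 then have "(%n. (L2_norm (%x. (\<integral>m. k m * Fn n m x \<partial>M) - (\<integral>m. k m * F m x \<partial>M)))\<^sup>2) ----> 0"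
 by (rule tendsto_sandwich[OF _ _ tendsto_const, rotated 2]) (auto simp: sq)
 from tendsto_real_sqrt[OF this] show ?thesis by simp
qed

lemma cont_L2_sequentially:
 assumes "!!t. t : I ==> u t : L2"
 and "!!t s. t : I ==> (!!n. s n : I) ==> s ----> t ==> (%n. L2_norm (%x. u (s n) x - u t x)) ----> 0"
 shows "u : cont_L2 I"
 unfolding cont_L2_def
proof (intro CollectI ballI conjI assms(1))
 fix t assume t: "t : I"
 show "((%s. L2_norm (%x. u s x - u t x)) \<longlongrightarrow> 0) (at t within I)"
 unfolding tendsto_at_iff_sequentially o_def using assms(2)[OF t] by blast
qed

text \<open>The convolution with the heat kernel after rescaling: the Gaussian weight is fixed and
  time enters only through the translation by sqrt t z. Hence t = 0 gives \<open>f\<close> itself,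
  and continuity in time reduces to continuity of translations.\<close>

definition heat_flow :: "(real^3 => real) => real => real^3 => real"
 where "heat_flow f t x = (LI z. heat 1 z * f (x + sqrt t *\<^sub>R z))"

lemma heat_flow_0: "heat_flow f 0 x = f x"
 by (simp add: heat_flow_def heat_integral)

lemma heat_flow_eq: "0 < t ==> f : BM ==> heat_flow f t x = (LI y. heat t (y - x) * f y)"
 unfolding heat_flow_def by (rule heat_substitution[symmetric])

lemma heat_flow_cont_L2:
 assumes f: "f : L2" shows "heat_flow f : cont_L2 {0..}"
proof (rule cont_L2_sequentially)
 have [measurable]: "f : BM" using f by (rule L2_measurable)
 have meas: "(%(z, x). f (x + c *\<^sub>R z)) : BM2" for c by measurable
 have h1: "integ (heat 1)" by (rule heat_integrable) simp
 note L = L2_shift[OF f] and N = L2_norm_shift[OF f]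
 fix t :: real
 show "heat_flow f t : L2"
 unfolding heat_flow_def[abs_def]
 by (rule L2_integral_bounded(2)[OF sigma_finite_lborel h1 meas L, where C = "L2_norm f"]) (simp add: N)
 fix s :: "nat => real" assume s: "s ----> t"
 show "(%n. L2_norm (%x. heat_flow f (s n) x - heat_flow f t x)) ----> 0"
 unfolding heat_flow_def[abs_def]
 proof (rule L2_integral_tendsto[OF sigma_finite_lborel h1 meas meas L L, where C = "L2_norm f"])
 show "AE z in lborel. heat 1 z ~= 0 \<longrightarrow> (%n. L2_norm (%x. f (x + sqrt (s n) *\<^sub>R z) - f (x + sqrt t *\<^sub>R z))) ----> 0"
 proof (intro AE_I2 impI)
 fix z :: "real^3"
 define h where "h n = (sqrt t - sqrt (s n)) *\<^sub>R z" for n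
 have eq: "L2_norm (%x. f (x + sqrt (s n) *\<^sub>R z) - f (x + sqrt t *\<^sub>R z)) = L2_norm (%x. f (x - h n) - f x)" for n
 using L2_norm_shift[OF L2_diff[OF L2_translate[OF f, of "h n"] f], of "sqrt t *\<^sub>R z"]
 by (simp add: h_def algebra_simps)
 have "h ----> (sqrt t - sqrt t) *\<^sub>R z" unfolding h_def by (intro tendsto_intros s)
 then have h0: "h ----> 0" by simp
 have "((%y. L2_norm (%x. f (x - y) - f x)) \<longlongrightarrow> L2_norm (%x. f (x - 0) - f x)) (at 0)"
 using L2_translate_continuous[OF f] by (simp add: L2_norm_def)
 then have "isCont (%y. L2_norm (%x. f (x - y) - f x)) 0" by (simp add: isCont_def)
 from isCont_tendsto_compose[OF this h0]
 have "(%n. L2_norm (%x. f (x - h n) - f x)) ----> 0" by (simp add: L2_norm_def)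
 then show "(%n. L2_norm (%x. f (x + sqrt (s n) *\<^sub>R z) - f (x + sqrt t *\<^sub>R z))) ----> 0" by (simp only: eq)
 qed
 qed (simp_all add: N)
qed

text \<open>Jointly measurable stand-ins for the products Y_i Y_k, extended by 0 outside (0,T). The
  \<open>L2\<close> bounds serve the regularity of the velocity and pressure, the \<open>L1\<close>
  bounds the pairing with bounded functions; neither is uniform up to time \<open>T\<close>.\<close>

locale forcing =
 fixes T :: real and F :: "3 => 3 => real \<times> (real^3) => real"
 assumes T: "0 < T"
 and F_meas [measurable]: "!!i k. F i k : BM"
 and F_zero: "!!i k t x. t \<notin> {0<..<T} ==> F i k (t, x) = 0"
 and F_cont: "!!i k. (%t x. F i k (t, x)) : cont_L2 {0<..<T}"
 and F_L2_bound: "!!i k T'. T' < T ==> \<exists>C. \<forall>t\<le>T'. L2_norm (%x. F i k (t, x)) <= C"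
 and F_int: "!!i k t. integ (%x. F i k (t, x))"
 and F_L1_bound: "!!i k T'. T' < T ==> \<exists>C. \<forall>t\<le>T'. (LI x. \<bar>F i k (t, x)\<bar>) <= C"
begin

definition B :: "3 => 3 => 3 => real \<times> (real^3) => real"
 where "B i j k z = (LI w. st_kernel T i j k w * F i k (z - w))"

lemma F_L2: "(%x. F i k (t, x)) : L2"
 using cont_L2_L2[OF F_cont] by (cases "t : {0<..<T}") (auto simp: F_zero L2_zero)

lemma F_shift_meas: "(%(w, x). F i k ((t, x) - w)) : BM2"
 unfolding split_beta by measurable

lemma F_shift: "(%x. F i k ((t, x) - w)) : L2" "L2_norm (%x. F i k ((t, x) - w)) = L2_norm (%x. F i k (t - fst w, x))"
 using L2_translate[OF F_L2, of i k "t - fst w" "snd w"] L2_norm_translate[OF F_L2, of i k "t - fst w" "snd w"]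
 by (simp_all add: minus_prod_def)

lemma st_kernel_nonzero: "st_kernel T i j k w ~= 0 ==> 0 < fst w \<and> fst w < T"
 by (auto simp: st_kernel_def indicator_def split: if_splits)

lemma B_AE_integrable: assumes "t < T" shows "AE x in lborel. integ (%w. st_kernel T i j k w * F i k ((t, x) - w))"
 and B_L2: "(%x. B i j k (t, x)) : L2"
proof -
 obtain C where C: "\<forall>s\<le>t. L2_norm (%x. F i k (s, x)) <= C" using F_L2_bound[OF assms] by blast
 have "L2_norm (%x. F i k ((t, x) - w)) <= C" if "st_kernel T i j k w ~= 0" for w
 using st_kernel_nonzero[OF that] C by (simp add: F_shift)
 note * = L2_integral_bounded[OF sigma_finite_lborel st_kernel_integrable[OF T] F_shift_meas F_shift(1) this]
 show "AE x in lborel. integ (%w. st_kernel T i j k w * F i k ((t, x) - w))" by (rule *(1))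
 show "(%x. B i j k (t, x)) : L2" unfolding B_def by (rule *(2))
qed

lemma AE_fst_neq: "AE w in (lborel :: (real \<times> (real^3)) measure). fst w ~= c"
proof -
 have "{c} \<times> (UNIV :: (real^3) set) : null_sets (LL)"
 by (auto simp: null_sets_def lborel.emeasure_pair_measure_Times)
 then have "AE w in (LL :: (real \<times> (real^3)) measure). w \<notin> {c} \<times> UNIV" by (rule AE_not_in)
 then show ?thesis unfolding lborel_prod by (simp add: mem_Times_iff)
qed

lemma B_cont_L2: "(%t x. B i j k (t, x)) : cont_L2 {0..<T}"
proof (rule cont_L2_sequentially)
 fix t assume t: "t : {0..<T}"
 show "(%x. B i j k (t, x)) : L2" using t by (intro B_L2) simp
 fix s assume s: "!!n. s n : {0..<T}" "s ----> t"
 \<comment> \<open>The forcing is bounded only away from \<open>T\<close>; a convergent sequence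
   together with its limit is compact, so its largest element is an admissible T'.\<close>
 have "\<exists>T'<T. t <= T' \<and> (\<forall>n. s n <= T')"
 proof -
 have "compact (insert t (range s))" by (rule compact_sequence_with_limit[OF s(2)])
 then obtain m where m: "m : insert t (range s)" "\<forall>r\<in>insert t (range s). r <= m"
 using compact_attains_sup[of "insert t (range s)"] by blast
 then show ?thesis using t s(1) by (intro exI[of _ m]) auto
 qed
 then obtain T' where T': "T' < T" "t <= T'" "!!n. s n <= T'" by blast
 obtain C where C: "!!r. r <= T' ==> L2_norm (%x. F i k (r, x)) <= C" using F_L2_bound[OF T'(1)] by blast
 have CC: "L2_norm (%x. F i k ((r, x) - w)) <= C" if "st_kernel T i j k w ~= 0" "r <= T'" for w r
 using st_kernel_nonzero[OF that(1)] that(2) C by (simp add: F_shift)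
 show "(%n. L2_norm (%x. B i j k (s n, x) - B i j k (t, x))) ----> 0"
 unfolding B_def
 proof (rule L2_integral_tendsto[OF sigma_finite_lborel st_kernel_integrable[OF T] F_shift_meas F_shift_meas F_shift(1) F_shift(1) CC[OF _ T'(2)] CC[OF _ T'(3)]])
 \<comment> \<open>The extension by 0 may create a jump of \<open>F\<close> at time 0. A translate
   meets this time in the limit only if \<open>fst w = t\<close>, which happens for a null set of
   \<open>w\<close>.\<close>
 show "AE w in lborel. st_kernel T i j k w ~= 0 \<longrightarrow> (%n. L2_norm (%x. F i k ((s n, x) - w) - F i k ((t, x) - w))) ----> 0"
 using AE_fst_neq[of t]
 proof (eventually_elim, intro impI)
 fix w :: "real \<times> (real^3)" assume w: "fst w ~= t" "st_kernel T i j k w ~= 0"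
 have eq: "L2_norm (%x. F i k ((s n, x) - w) - F i k ((t, x) - w)) = L2_norm (%x. F i k (s n - fst w, x) - F i k (t - fst w, x))" for n
 using L2_norm_translate[OF L2_diff[OF F_L2[of i k "s n - fst w"] F_L2[of i k "t - fst w"]], of "snd w"]
 by (simp add: minus_prod_def)
 have lim: "(%n. s n - fst w) ----> t - fst w" by (intro tendsto_intros s)
 show "(%n. L2_norm (%x. F i k ((s n, x) - w) - F i k ((t, x) - w))) ----> 0"
 proof (cases "fst w < t")
 case True
 then have I: "t - fst w : {0<..<T}" using st_kernel_nonzero[OF w(2)] t by auto
 show ?thesis unfolding eq
 proof (rule LIMSEQ_I)
 fix e :: real assume "0 < e"
 then obtain d where d: "0 < d" "!!r. r : {0<..<T} ==> \<bar>r - (t - fst w)\<bar> < d ==> L2_norm (%x. F i k (r, x) - F i k (t - fst w, x)) < e"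
 using cont_L2_dist[OF F_cont I] by blast
 have "\<forall>\<^sub>F n in sequentially. s n - fst w : {0<..<T} \<and> \<bar>(s n - fst w) - (t - fst w)\<bar> < d"
 using eventually_conj[OF topological_tendstoD[OF lim open_greaterThanLessThan I] tendstoD[OF lim d(1)]]
 by (simp only: dist_real_def)
 then obtain N where N: "!!n. n \<ge> N ==> s n - fst w : {0<..<T} \<and> \<bar>(s n - fst w) - (t - fst w)\<bar> < d"
 unfolding eventually_sequentially by blast
 show "\<exists>no. \<forall>n\<ge>no. norm (L2_norm (%x. F i k (s n - fst w, x) - F i k (t - fst w, x)) - 0) < e"
 proof (intro exI allI impI)
 fix n assume "N <= n"
 from d(2)[of "s n - fst w"] N[OF this]
 show "norm (L2_norm (%x. F i k (s n - fst w, x) - F i k (t - fst w, x)) - 0) < e" by simp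
 qed
 qed
 next
 case False
 then have neg: "t - fst w < 0" using w(1) by simp
 have "\<forall>\<^sub>F n in sequentially. s n - fst w < 0" using order_tendstoD(2)[OF lim neg] .
 then have "\<forall>\<^sub>F n in sequentially. L2_norm (%x. F i k (s n - fst w, x) - F i k (t - fst w, x)) = 0"
 by eventually_elim (use neg in \<open>simp add: F_zero L2_norm_def\<close>)
 then show ?thesis unfolding eq by (rule tendsto_eventually)
 qed
 qed
 qed
qed

lemma B_0: "B i j k (0, x) = 0"
proof -
 have "st_kernel T i j k w * F i k ((0, x) - w) = 0" for w
 using st_kernel_nonzero[of i j k w] F_zero[of "0 - fst w" i k "x - snd w"] by (cases "st_kernel T i j k w = 0") (auto simp: minus_prod_def)
 then have "(%w. st_kernel T i j k w * F i k ((0, x) - w)) = (%w. 0)" by auto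
 then show ?thesis unfolding B_def by (simp only: bo_integral_zero)
qed

lemma B_conv: "B i j k z = (LI w. st_kernel T i j k (z - w) * F i k w)"
 unfolding B_def using integral_reflect[of "%w. st_kernel T i j k w * F i k (z - w)" z] by simp

text \<open>Fubini turns the space-time convolution into the iterated integral in which the velocity
  is defined. All \<open>i\<close> and \<open>k\<close> share one exceptional set of
  \<open>x\<close>, and integrability of the slices is kept, so that finite sums can be pulled
  through both integrals.\<close>

lemma B_iterated:
 assumes t: "0 < t" "t < T"
 shows "AE x in lborel. \<forall>i k. B i j k (t, x) = (LI s. LI y. indicator {0<..<t} s * (oseen_grad i j k (t - s) (x - y) * F i k (s, y)))
 \<and> integ (%s. LI y. indicator {0<..<t} s * (oseen_grad i j k (t - s) (x - y) * F i k (s, y)))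
 \<and> (AE s in lborel. integ (%y. indicator {0<..<t} s * (oseen_grad i j k (t - s) (x - y) * F i k (s, y))))"
proof -
 have "AE x in lborel. \<forall>i\<in>UNIV. \<forall>k\<in>UNIV. integ (%w. st_kernel T i j k w * F i k ((t, x) - w))"
 by (intro AE_finite_allI finite B_AE_integrable t)
 then show ?thesis
 proof (eventually_elim, intro allI)
 fix x i k assume "\<forall>i\<in>UNIV. \<forall>k\<in>UNIV. integ (%w. st_kernel T i j k w * F i k ((t, x) - w))"
 then have "integ (%w. st_kernel T i j k w * F i k ((t, x) - w))" by blast
 then have "integ (%w. st_kernel T i j k ((t, x) - w) * F i k w)"
 using integrable_reflect_iff[of "%w. st_kernel T i j k w * F i k ((t, x) - w)" "(t, x)"] by simp
 moreover have "(%w. st_kernel T i j k ((t, x) - w) * F i k w)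
 = (%(s, y). indicator {0<..<t} s * (oseen_grad i j k (t - s) (x - y) * F i k (s, y)))"
 proof
 fix w :: "real \<times> (real^3)"
 obtain s y where w: "w = (s, y)" by (cases w)
 have "F i k (s, y) = 0" if "s <= 0" using that by (simp add: F_zero)
 then show "st_kernel T i j k ((t, x) - w) * F i k w = (case w of (s, y) => (indicator {0<..<t} s * (oseen_grad i j k (t - s) (x - y) * F i k (s, y))))"
 using t by (cases "0 < s") (auto simp: w st_kernel_def minus_prod_def indicator_def)
 qed
 ultimately have int: "integrable (LL) (%(s, y). indicator {0<..<t} s * (oseen_grad i j k (t - s) (x - y) * F i k (s, y)))"
 and eq: "B i j k (t, x) = (LINT w|(LL). (case w of (s, y) => (indicator {0<..<t} s * (oseen_grad i j k (t - s) (x - y) * F i k (s, y)))))"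
 by (simp_all add: lborel_prod B_conv)
 show "B i j k (t, x) = (LI s. LI y. indicator {0<..<t} s * (oseen_grad i j k (t - s) (x - y) * F i k (s, y)))
 \<and> integ (%s. LI y. indicator {0<..<t} s * (oseen_grad i j k (t - s) (x - y) * F i k (s, y)))
 \<and> (AE s in lborel. integ (%y. indicator {0<..<t} s * (oseen_grad i j k (t - s) (x - y) * F i k (s, y))))"
 unfolding eq using lborel_pair.integral_fst[OF int] lborel_pair.integrable_fst[OF int] lborel_pair.AE_integrable_fst[OF int] by simp
 qed
qed

text \<open>The minus sign is that of \<open>oseen_grad_eq\<close>: the velocity is defined with the
  derivative in \<open>y\<close>, while \<open>B\<close> uses the derivative of the kernel in its
  own argument.\<close>

definition vel :: "(real^3 => real^3) => real => 3 => real^3 => real"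
 where "vel u0 t j x = heat_flow (%x. u0 x $ j) t x - (SS i k. B i j k (t, x))"

lemma vel_cont_L2:
 assumes "u0 : L2" shows "(%t x. vel u0 t j x) : cont_L2 {0..<T}"
proof (rule cont_L2_sequentially)
 have u: "(%x. u0 x $ j) : L2" using assms by (simp add: L2_vec_iff)
 have h: "heat_flow (%x. u0 x $ j) : cont_L2 {0..<T}"
 by (rule cont_L2_mono[OF heat_flow_cont_L2[OF u]]) auto
 have BL: "(%x. SS i k. B i j k (t, x)) : L2" if "t : {0..<T}" for t
 using that by (intro L2_sum B_L2) simp
 fix t assume t: "t : {0..<T}"
 show "(%x. vel u0 t j x) : L2" unfolding vel_def using t by (intro L2_diff BL cont_L2_L2[OF h])
 fix s assume s: "!!n. s n : {0..<T}" "s ----> t"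
 have conv: "(%n. L2_norm (%x. w (s n) x - w t x)) ----> 0" if w: "w : cont_L2 {0..<T}" for w :: "real => real^3 => real"
 proof (rule LIMSEQ_I)
 fix e :: real assume e: "0 < e"
 obtain d where d: "0 < d" "!!r. r : {0..<T} ==> \<bar>r - t\<bar> < d ==> L2_norm (%x. w r x - w t x) < e"
 using cont_L2_dist[OF w t e] by blast
 obtain N where "\<forall>n\<ge>N. \<bar>s n - t\<bar> < d" using LIMSEQ_D[OF s(2) d(1)] by auto
 then show "\<exists>no. \<forall>n\<ge>no. norm (L2_norm (%x. w (s n) x - w t x) - 0) < e"
 using d(2) s(1) by auto
 qed
 show "(%n. L2_norm (%x. vel u0 (s n) j x - vel u0 t j x)) ----> 0"
 proof (rule Lim_null_comparison[OF always_eventually])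
 let ?h = "%n x. heat_flow (%x. u0 x $ j) (s n) x - heat_flow (%x. u0 x $ j) t x"
 let ?b = "%n i k x. B i j k (s n, x) - B i j k (t, x)"
 have hL: "?h n : L2" for n using s t by (intro L2_diff cont_L2_L2[OF h])
 have bL: "?b n i k : L2" for n i k using s(1)[of n] t by (intro L2_diff B_L2) auto
 show "\<forall>n. norm (L2_norm (%x. vel u0 (s n) j x - vel u0 t j x)) <= L2_norm (?h n) + (SS i k. L2_norm (?b n i k))"
 proof
 fix n
 have "L2_norm (%x. vel u0 (s n) j x - vel u0 t j x) = L2_norm (%x. ?h n x - (SS i k. ?b n i k x))"
 by (simp add: vel_def sum_subtractf algebra_simps)
 also have "... <= L2_norm (?h n) + L2_norm (%x. SS i k. ?b n i k x)"
 by (intro L2_triangle_diff hL L2_sum bL)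
 also have "L2_norm (%x. SS i k. ?b n i k x) <= (SS i. L2_norm (%x. SS k. ?b n i k x))"
 by (intro L2_norm_sum_le L2_sum bL finite)
 also have "... <= (SS i k. L2_norm (?b n i k))"
 by (intro sum_mono L2_norm_sum_le bL finite)
 finally show "norm (L2_norm (%x. vel u0 (s n) j x - vel u0 t j x)) <= L2_norm (?h n) + (SS i k. L2_norm (?b n i k))"
 by simp
 qed
 have "(%n. L2_norm (?h n) + (SS i k. L2_norm (?b n i k))) ----> 0 + (\<Sum>i\<in>(UNIV::3 set). \<Sum>k\<in>(UNIV::3 set). 0)"
 by (intro tendsto_add tendsto_sum conv[OF h] conv[OF B_cont_L2])
 then show "(%n. L2_norm (?h n) + (SS i k. L2_norm (?b n i k))) ----> 0" by simp
 qed
qed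

text \<open>The definition sums inside both integrals. The sums can be taken out only at points
  where all summands are integrable, hence the equality almost everywhere; measurability is shown
  separately for the function as defined.\<close>

lemma stokes_velocity_AE:
 assumes u0: "u0 : L2" and Y: "!!s. s : {0<..<T} ==> Y s : BM"
 and FY: "!!s i k. s : {0<..<T} ==> AE y in lborel. F i k (s, y) = Y s y $ i * Y s y $ k"
 and t: "0 < t" "t < T"
 shows "(%x. stokes_velocity u0 Y t x $ j) : BM"
 and "AE x in lborel. stokes_velocity u0 Y t x $ j = vel u0 t j x"
proof -
 have [measurable]: "(%y. u0 y $ l) : BM" for l
 using u0[THEN L2_measurable] by (simp add: borel_measurable_vec_iff)
 let ?g = "%i k x s y. indicator {0<..<t} s * (oseen_grad i j k (t - s) (x - y) * F i k (s, y))"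
 let ?G = "%x s. LI y. (SS i k. - ?g i k x s y)"
 have inner: "(LI y. (SS i k. pd i (%z. oseen_kernel j k (x - z) (t - s)) y * Y s y $ i * Y s y $ k)) = ?G x s"
 if s: "0 < s" "s < t" for x s
 proof (rule integral_cong_AE)
 have sT: "s : {0<..<T}" using s t by auto
 have [measurable]: "(%y. Y s y $ l) : BM" for l
 using Y[OF sT] by (simp add: borel_measurable_vec_iff)
 have og: "pd i (%z. oseen_kernel j k (x - z) (t - s)) y = - oseen_grad i j k (t - s) (x - y)" for i k y
 using s by (intro oseen_grad_eq) simp
 show "(%y. SS i k. pd i (%z. oseen_kernel j k (x - z) (t - s)) y * Y s y $ i * Y s y $ k) : borel_measurable lborel"
 unfolding og by measurable
 show "(%y. SS i k. - ?g i k x s y) : borel_measurable lborel" by measurable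
 have "AE y in lborel. \<forall>i\<in>UNIV. \<forall>k\<in>UNIV. F i k (s, y) = Y s y $ i * Y s y $ k"
 by (intro AE_finite_allI finite FY sT)
 then show "AE y in lborel. (SS i k. pd i (%z. oseen_kernel j k (x - z) (t - s)) y * Y s y $ i * Y s y $ k)
 = (SS i k. - ?g i k x s y)"
 by eventually_elim (use s in \<open>simp add: og mult.assoc\<close>)
 qed
 have outer: "(LINT s:{0..t}|lborel. LI y. (SS i k. pd i (%z. oseen_kernel j k (x - z) (t - s)) y * Y s y $ i * Y s y $ k))
 = (LI s. ?G x s)" for x
 unfolding set_lebesgue_integral_def
 proof (rule integral_discrete_difference[of "{0, t}"])
 fix s assume "s \<notin> {0, t}"
 then consider "0 < s" "s < t" | "s \<notin> {0..t}" by force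
 then show "indicator {0..t} s *\<^sub>R (LI y. (SS i k. pd i (%z. oseen_kernel j k (x - z) (t - s)) y * Y s y $ i * Y s y $ k)) = ?G x s"
 proof cases
 case 1 then show ?thesis by (simp add: inner)
 next
 case 2
 then have "indicator {0<..<t} s = (0::real)" by auto
 then show ?thesis using 2 by (simp only: mult_zero_left minus_zero sum.neutral_const bo_integral_zero) simp
 qed
 qed auto
 have sv: "stokes_velocity u0 Y t x $ j = heat_flow (%y. u0 y $ j) t x + (LI s. ?G x s)" for x
 using t outer[of x] by (simp add: stokes_velocity_def Defs.convolution_def heat_kernel_eq heat_flow_eq heat_diff_commute[of t x])
 have [measurable]: "heat_flow (%y. u0 y $ j) t : BM"
 unfolding heat_flow_def[abs_def] by measurable
 show "(%x. stokes_velocity u0 Y t x $ j) : BM"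
 proof -
 have "(%((x, s), y). SS i k. - ?g i k x s y) : borel_measurable ((borel \<Otimes>\<^sub>M lborel) \<Otimes>\<^sub>M lborel)"
 unfolding split_beta by measurable
 then have "(%(x, s). ?G x s) : borel_measurable (borel \<Otimes>\<^sub>M lborel)"
 unfolding split_beta by (intro lborel.borel_measurable_lebesgue_integral) (simp add: split_beta)
 then have "(%x. LI s. ?G x s) : BM"
 by (rule lborel.borel_measurable_lebesgue_integral)
 then show ?thesis unfolding sv by measurable
 qed
 show "AE x in lborel. stokes_velocity u0 Y t x $ j = vel u0 t j x"
 using B_iterated[OF t, of j]
 proof eventually_elim
 case (elim x)
 have "(LI s. ?G x s) = (LI s. (SS i k. - (LI y. ?g i k x s y)))"
 proof (rule integral_cong_AE)
 have "AE s in lborel. \<forall>i\<in>UNIV. \<forall>k\<in>UNIV. integ (%y. ?g i k x s y)"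
 using elim by (intro AE_finite_allI finite) blast
 then show "AE s in lborel. ?G x s = (SS i k. - (LI y. ?g i k x s y))"
 proof eventually_elim
 case (elim s)
 have i: "integ (%y. - ?g i k x s y)" for i k
 using elim[rule_format, OF UNIV_I UNIV_I] by (rule integrable_minus)
 have "?G x s = (SS i k. LI y. - ?g i k x s y)"
 by (subst bo_integral_sum; (subst bo_integral_sum)?;
 intro bo_integrable_sum i refl)
 then show ?case by simp
 qed
 qed measurable
 also have "... = (SS i k. LI s. - (LI y. ?g i k x s y))"
 proof -
 have i: "integ (%s. - (LI y. ?g i k x s y))" for i k
 using elim by (intro integrable_minus) blast
 show ?thesis
 by (subst bo_integral_sum; (subst bo_integral_sum)?;
 intro bo_integrable_sum i refl)
 qed
 also have "... = (SS i k. - B i j k (t, x))"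
 proof (intro sum.cong refl)
 fix i k
 have "B i j k (t, x) = (LI s. LI y. ?g i k x s y)" using elim by blast
 then show "(LI s. - (LI y. ?g i k x s y)) = - B i j k (t, x)"
 by (simp only: bo_integral_minus)
 qed
 finally show ?case by (simp add: sv vel_def sum_negf)
 qed
qed

end

subsection \<open>The weak formulation\<close>

text \<open>The heat semigroup is symmetric because its kernel is even; two applications of
  \<open>L2_conv_pairing\<close> with a reflection between them move it from \<open>f\<close> to
  \<open>g\<close>.\<close>

lemma heat_flow_pairing:
 assumes f: "f : L2" and g: "g : L2" and t: "0 < t"
 shows "(LI x. heat_flow f t x * g x) = (LI y. f y * (LI x. heat t (x - y) * g x))"
proof -
 have [measurable]: "f : BM" "g : BM" using f g by (auto intro: L2_measurable)
 note h = heat_integrable[OF t]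
 have "(LI x. heat_flow f t x * g x) = (LI x. (LI y. heat t (y - x) * f y) * g x)"
 by (simp add: heat_flow_eq[OF t])
 also have "... = (LI z. heat t z * (LI y. f (y + z) * g y))"
 by (rule L2_conv_pairing[OF h f g])
 also have "... = (LI z. heat t z * (LI y. g (y + z) * f y))"
 proof -
 let ?G = "%z. heat t z * (LI y. f (y + z) * g y)"
 have "(LI z. ?G (0 - z)) = (LI z. ?G z)" by (rule integral_reflect) measurable
 moreover have "?G (0 - z) = heat t z * (LI y. g (y + z) * f y)" for z
 proof -
 have "(LI y. f (y + (0 - z)) * g y) = (LI y. (%y. f y * g (y + z)) (y - z))" by simp
 also have "... = (LI y. f y * g (y + z))" by (rule integral_translate) measurable
 finally show ?thesis by (simp add: heat_minus mult.commute)
 qed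
 ultimately show ?thesis by simp
 qed
 also have "... = (LI y. (LI x. heat t (x - y) * g x) * f y)"
 by (rule L2_conv_pairing[OF h g f, symmetric])
 finally show ?thesis by (simp add: mult.commute)
qed

text \<open>T' is the latest time in the support, or 0. It will confine the locally uniform bounds
  on curves and forcing to times where they hold.\<close>

lemma slice_bounds:
 fixes f :: "real \<times> (real^3) => real"
 assumes f: "f : TFT T" and T: "0 < T"
 obtains T' C where "0 <= T'" "T' < T" "0 <= C" "!!t x. T' < t ==> f (t, x) = 0" "!!t. L2_norm (%x. f (t, x)) <= C" "!!z. \<bar>f z\<bar> <= C"
proof -
 obtain K where K: "compact K" "K \<subseteq> {..<T} \<times> UNIV" "\<forall>z. z \<notin> K \<longrightarrow> f z = 0" using test_support[OF f] by blast
 obtain c where c: "0 <= c" "!!z. \<bar>f z\<bar> <= c" using test_abs_bounded[OF f] by blast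
 have "compact (insert 0 (fst ` K))" using K(1) by (intro compact_insert compact_continuous_image continuous_intros)
 then obtain T' where T': "T' : insert 0 (fst ` K)" "\<forall>r\<in>insert 0 (fst ` K). r <= T'"
 using compact_attains_sup[of "insert 0 (fst ` K)"] by blast
 have sK: "compact (snd ` K)" using K(1) by (intro compact_continuous_image continuous_intros)
 let ?D = "sqrt (LI x. c\<^sup>2 * indicator (snd ` K) x)"
 have "L2_norm (%x. f (t, x)) <= ?D" for t
 unfolding L2_norm_def
 proof (intro real_sqrt_le_mono integral_mono)
 have "(%x. f (t, x)) : L2" by (rule test_L2[OF test_slice[OF f]])
 then show "integ (%x. (norm (f (t, x)))\<^sup>2)" by (simp add: L2_def)
 show "integ (%x. c\<^sup>2 * indicator (snd ` K) x)"
 using emeasure_compact_finite[OF sK] compact_imp_closed[OF sK]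
 by (intro integrable_mult_right integrable_real_indicator) (auto simp: less_top)
 fix x
 show "(norm (f (t, x)))\<^sup>2 <= c\<^sup>2 * indicator (snd ` K) x"
 proof (cases "x : snd ` K")
 case True then show ?thesis using power_mono[OF c(2)[of "(t, x)"], of 2] by simp
 next
 case False
 then have "(t, x) \<notin> K" by force
 then show ?thesis using K(3) by simp
 qed
 qed
 moreover have "f (t, x) = 0" if "T' < t" for t x
 proof -
 have "(t, x) \<notin> K" using that T'(2) by force
 then show ?thesis using K(3) by blast
 qed
 moreover have "T' < T" using T'(1) K(2) T by auto
 moreover have "0 <= T'" using T'(2) by simp
 ultimately show thesis
 using that[of T' "max c ?D"] c by (metis le_max_iff_disj)
qed

text \<open>The curve is known slice by slice only; Fubini is applied to a jointly measurable
  \<open>W\<close> and the result is read back for \<open>w\<close>. The local bounds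
  \<open>wb\<close> suffice because \<open>g\<close> vanishes after some time T' < T.\<close>

lemma curve_pairing:
 fixes w :: "real => real^3 => real" and g :: "real \<times> (real^3) => real"
 assumes T: "0 < T" and W[measurable]: "W : BM"
 and Ww: "!!t. t : {0<..<T} ==> AE x in lborel. W (t, x) = w t x"
 and wL: "!!t. t : {0<..<T} ==> w t : L2"
 and wb: "!!T'. T' < T ==> \<exists>C. \<forall>t\<in>{0<..T'}. L2_norm (w t) <= C"
 and g: "g : TFT T"
 shows "integ (%z. indicator {0<..<T} (fst z) * (W z * g z))"
 and "sinteg {0<..<T} (%t. LI x. w t x * g (t, x))"
 and "(LI z. indicator {0<..<T} (fst z) * (W z * g z)) = (LINT t:{0<..<T}|lborel. LI x. w t x * g (t, x))"
proof -
 have gm[measurable]: "g : BM" using g by (rule test_measurable)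
 obtain T' C where TC: "0 <= T'" "T' < T" "0 <= C" "!!t x. T' < t ==> g (t, x) = 0" "!!t. L2_norm (%x. g (t, x)) <= C" "!!z. \<bar>g z\<bar> <= C"
 by (rule slice_bounds[OF g T]) (rule that; assumption)
 obtain D where D: "\<forall>t\<in>{0<..T'}. L2_norm (w t) <= D" using wb[OF TC(2)] by blast
 let ?h = "%t x. indicator {0<..<T} t * (W (t, x) * g (t, x))"
 have WL: "(%x. W (t, x)) : L2" "L2_norm (%x. W (t, x)) = L2_norm (w t)" if "t : {0<..<T}" for t
 proof -
 have ae: "AE x in lborel. w t x = W (t, x)" using Ww[OF that] by eventually_elim simp
 have m: "(%x. W (t, x)) : BM" by measurable
 show "(%x. W (t, x)) : L2" by (rule L2_cong_AE[OF wL[OF that] m ae])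
 show "L2_norm (%x. W (t, x)) = L2_norm (w t)"
 by (rule L2_norm_cong_AE[OF m L2_measurable[OF wL[OF that]] Ww[OF that]])
 qed
 have gL: "(%x. g (t, x)) : L2" for t by (rule test_L2[OF test_slice[OF g]])
 have int: "integrable (LL) (%(t, x). ?h t x)"
 proof (rule Fubini_bound)
 show "integ (%t. indicator {0<..<T} t * (\<bar>D\<bar> * C))"
 using T by (intro integrable_mult_left integrable_real_indicator) auto
 show "(LI x. norm (?h t x)) <= indicator {0<..<T} t * (\<bar>D\<bar> * C)" for t
 proof (cases "t : {0<..<T} \<and> t <= T'")
 case True
 then have t: "t : {0<..<T}" by blast
 have "(LI x. norm (?h t x)) = (LI x. \<bar>W (t, x)\<bar> * \<bar>g (t, x)\<bar>)" using True by (simp add: abs_mult)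
 also have "... <= L2_norm (%x. W (t, x)) * L2_norm (%x. g (t, x))"
 using L2_Cauchy_Schwarz[OF L2_abs[OF WL(1)[OF t]] L2_abs[OF gL[of t]]] by (simp add: L2_norm_abs)
 also have "... <= \<bar>D\<bar> * C"
 proof (intro mult_mono TC(3,5) abs_ge_zero L2_norm_nonneg)
 have "L2_norm (w t) <= D" using D True by simp
 then show "L2_norm (%x. W (t, x)) <= \<bar>D\<bar>" unfolding WL(2)[OF t] by simp
 qed
 finally show ?thesis using True by simp
 next
 case False
 then have "(%x. norm (?h t x)) = (%x. 0)" using TC(4) by (auto simp: indicator_def)
 then have "(LI x. norm (?h t x)) = 0" by (simp only: bo_integral_zero)
 then show ?thesis using TC(3) by simp
 qed
 show "AE t in lborel. integ (%x. ?h t x)"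
 using L2_mult_integrable[OF WL(1) gL] by (intro AE_I2) (auto simp: indicator_def)
qed measurable
 then show "integ (%z. indicator {0<..<T} (fst z) * (W z * g z))"
 by (simp add: lborel_prod case_prod_unfold)
 have eq: "(LI x. ?h t x) = indicator {0<..<T} t *\<^sub>R (LI x. w t x * g (t, x))" for t
 proof (cases "t : {0<..<T}")
 case True
 have [measurable]: "w t : BM" using wL[OF True] by (rule L2_measurable)
 have "(LI x. W (t, x) * g (t, x)) = (LI x. w t x * g (t, x))"
 by (rule integral_cong_AE) (use Ww[OF True] in \<open>auto elim!: eventually_mono\<close>)
 then show ?thesis using True by simp
 qed simp
 show "sinteg {0<..<T} (%t. LI x. w t x * g (t, x))"
 using lborel_pair.integrable_fst[OF int] unfolding eq set_integrable_def .
 show "(LI z. indicator {0<..<T} (fst z) * (W z * g z)) = (LINT t:{0<..<T}|lborel. LI x. w t x * g (t, x))"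
 using lborel_pair.integral_fst[OF int] unfolding eq set_lebesgue_integral_def by (simp add: lborel_prod case_prod_unfold)
qed

lemma cont_L2_pairing_integrable:
 fixes w :: "real => real^3 => real"
 assumes T: "0 < T" and w: "w : cont_L2 {0..<T}" and g: "g : TFT T"
 shows "sinteg {0<..<T} (%t. LI x. w t x * g (t, x))"
proof -
 obtain W where W: "W : borel_measurable (borel :: (real \<times> (real^3)) measure)" "!!t. t : {0..<T} ==> AE x in lborel. W (t, x) = w t x"
 using cont_L2_representative[OF w] by blast
 have b: "\<exists>C. \<forall>t\<in>{0<..T'}. L2_norm (w t) <= C" if T': "T' < T" for T'
 proof -
 obtain C where "!!t. t : {0..T'} ==> L2_norm (w t) <= C" using cont_L2_bounded[OF w T'] by blast
 then show ?thesis by (intro exI[of _ C]) auto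
 qed
 have ae: "AE x in lborel. W (t, x) = w t x" if "t : {0<..<T}" for t using that by (intro W(2)) auto
 have L: "w t : L2" if "t : {0<..<T}" for t using that by (intro cont_L2_L2[OF w]) auto
 show ?thesis by (rule curve_pairing(2)[OF T W(1) ae L b g])
qed

text \<open>Symmetry puts the heat kernel on the test function, Fubini brings the time integral
  inside, and \<open>heat_dual\<close> at starting time 0 evaluates it.\<close>

lemma heat_flow_weak:
 assumes T: "0 < T" and f: "f : L2" and ps: "ps : TFT T"
 shows "(LINT t:{0<..<T}|lborel. LI x. heat_flow f t x * heat_op ps (t, x)) = - (LI y. f y * ps (0, y))"
proof -
 have \<theta>: "heat_op ps : TFT T" by (rule test_heat_op[OF ps])
 have [measurable]: "f : BM" "heat_op ps : BM"
 using f \<theta> by (auto intro: L2_measurable test_measurable)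
 obtain T' C where TC: "0 <= C" "!!t. L2_norm (%x. heat_op ps (t, x)) <= C"
 using slice_bounds[OF \<theta> T] by metis
 let ?H = "%t y. LI x. heat t (x - y) * heat_op ps (t, x)"
 have sl: "(%x. heat_op ps (t, x)) : L2" for t by (rule test_L2[OF test_slice[OF \<theta>]])
 have HL: "?H t : L2" "L2_norm (?H t) <= C" if "0 < t" for t
 using L2_conv[OF heat_integrable[OF that] sl] L2_conv_norm[OF heat_integrable[OF that] sl, of t] TC(2)[of t]
 by (auto simp: heat_integral that heat_nonneg)
 let ?h = "%t y. indicator {0<..<T} t * (f y * ?H t y)"
 have int: "integrable (LL) (%(t, y). ?h t y)"
 proof (rule Fubini_bound)
 show "integ (%t. indicator {0<..<T} t * (L2_norm f * C))"
 using T by (intro integrable_mult_left integrable_real_indicator) auto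
 show "(LI y. norm (?h t y)) <= indicator {0<..<T} t * (L2_norm f * C)" for t
 proof (cases "t : {0<..<T}")
 case True
 then have t: "0 < t" by simp
 have "(LI y. norm (?h t y)) = (LI y. \<bar>f y\<bar> * \<bar>?H t y\<bar>)" using True by (simp add: abs_mult)
 also have "... <= L2_norm f * L2_norm (?H t)"
 using L2_Cauchy_Schwarz[OF L2_abs[OF f] L2_abs[OF HL(1)[OF t]]] by (simp add: L2_norm_abs)
 also have "... <= L2_norm f * C" by (intro mult_left_mono HL t) simp
 finally show ?thesis using True by simp
 qed simp
 show "AE t in lborel. integ (%y. ?h t y)"
 using L2_mult_integrable[OF f HL(1)] by (intro AE_I2) (auto simp: indicator_def)
qed measurable
 have "(LINT t:{0<..<T}|lborel. LI x. heat_flow f t x * heat_op ps (t, x)) = (LI t. LI y. ?h t y)"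
 unfolding set_lebesgue_integral_def
 proof (intro bo_cong refl)
 fix t
 show "indicator {0<..<T} t *\<^sub>R (LI x. heat_flow f t x * heat_op ps (t, x)) = (LI y. ?h t y)"
 using heat_flow_pairing[OF f sl, of t t] by (cases "t : {0<..<T}") simp_all
 qed
 also have "... = (LI y. LI t. ?h t y)"
 by (rule lborel_pair.Fubini_integral[OF int, symmetric])
 also have "... = (LI y. f y * - ps (0, y))"
 proof (intro bo_cong refl)
 fix y
 have "(LI t. ?h t y) = f y * (LINT t:{0<..T - 0}|lborel. ?H t y)"
 proof -
 have "(LI t. ?h t y) = (LI t. f y * (indicator {0<..T - 0} t *\<^sub>R ?H t y))"
 by (rule integral_discrete_difference[of "{T}"]) (auto simp: indicator_def)
 then show ?thesis unfolding set_lebesgue_integral_def by simp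
 qed
 then show "(LI t. ?h t y) = f y * - ps (0, y)" using heat_dual[OF ps T, of y] by simp
 qed
 finally show ?thesis by simp
qed

context forcing
begin

lemma F_strip_integrable:
 assumes "T' < T" shows "integ (%w. indicator {..T'} (fst w) * F i k w)"
proof -
 obtain C where C: "\<forall>t\<le>T'. (LI x. \<bar>F i k (t, x)\<bar>) <= C" using F_L1_bound[OF assms] by blast
 let ?h = "%t x. indicator {..T'} t * F i k (t, x)"
 have "integrable (LL) (%(t, x). ?h t x)"
 proof (rule Fubini_bound)
 show "integ (%t. indicator {0<..<T} t * \<bar>C\<bar>)"
 using T by (intro integrable_mult_left integrable_real_indicator) auto
 show "(LI x. norm (?h t x)) <= indicator {0<..<T} t * \<bar>C\<bar>" for t
 proof (cases "t : {0<..<T}")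
 case True
 then show ?thesis using C by (cases "t <= T'") (auto intro: order_trans[OF _ abs_ge_self])
 next
 case False
 then have "(%x. norm (?h t x)) = (%x. 0)" by (simp add: F_zero)
 then have "(LI x. norm (?h t x)) = 0" by (simp only: bo_integral_zero)
 then show ?thesis by simp
 qed
 show "AE t in lborel. integ (%x. ?h t x)" using F_int by simp
qed measurable
 then show ?thesis by (simp add: lborel_prod case_prod_unfold)
qed

text \<open>Fubini over two copies of space-time moves the kernel from \<open>F\<close> to the test
  function, where \<open>oseen_dual\<close> evaluates it as \<open>R\<close>. Absolute convergence
  rests on the integrable kernel, the boundedness of \<open>heat_op ps\<close> and the
  \<open>L1\<close> bound on \<open>F\<close>.\<close>

lemma
 fixes i j k :: 3 and ps :: "real \<times> (real^3) => real"
 assumes ps: "ps : TFT T"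
 defines "R \<equiv> %z. of_bool (j = k) * dx i ps z + newton_conv (%x. dx j (dx k (dx i ps)) (fst z, x)) (snd z)"
 shows B_weak: "(LINT t:{0<..<T}|lborel. LI x. B i j k (t, x) * heat_op ps (t, x)) = (LINT t:{0<..<T}|lborel. LI y. F i k (t, y) * R (t, y))"
 and B_weak_integrable: "sinteg {0<..<T} (%t. LI y. F i k (t, y) * R (t, y))"
proof -
 have \<theta>: "heat_op ps : TFT T" by (rule test_heat_op[OF ps])
 obtain T' C where TC: "T' < T" "0 <= C" "!!t x. T' < t ==> heat_op ps (t, x) = 0" "!!z. \<bar>heat_op ps z\<bar> <= C"
 using slice_bounds[OF \<theta> T] by metis
 have [measurable]: "heat_op ps : BM" using \<theta> by (rule test_measurable)
 let ?\<theta> = "%z. indicator {0<..<T} (fst z) * heat_op ps z"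
 let ?K = "st_kernel T i j k"
 let ?h = "%w z. F i k w * (?K (z - w) * ?\<theta> z)"
 note Ki = st_kernel_integrable[OF T, of i j k]
 have Kw: "integ (%z. ?K (z - w))" "(LI z. \<bar>?K (z - w)\<bar>) = (LI z. \<bar>?K z\<bar>)" for w
 using integrable_translate_iff[of ?K w] integral_translate[of "%z. \<bar>?K z\<bar>" w] Ki by simp_all
 have "fst : borel_measurable (borel :: (real \<times> (real^3)) measure)" by (intro borel_measurable_continuous_onI continuous_intros)
 then have \<theta>m: "?\<theta> : borel_measurable lborel" by measurable
 have \<theta>C: "\<bar>?\<theta> z\<bar> <= C" for z using TC(2,4) by (auto simp: indicator_def)
 have K\<theta>: "integ (%z. ?K (z - w) * ?\<theta> z)" for w
 proof (rule bo_integrable_bound[OF integrable_mult_left[OF integrable_abs[OF Kw(1)], where c = C]])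
 show "AE z in lborel. norm (?K (z - w) * ?\<theta> z) <= norm (\<bar>?K (z - w)\<bar> * C)"
 using \<theta>C TC(2) by (intro AE_I2) (simp only: real_norm_def abs_mult, auto intro!: mult_left_mono)
 qed (intro borel_measurable_times borel_measurable_integrable[OF Kw(1)] \<theta>m)
 \<comment> \<open>Causality: the kernel is nonzero only if w precedes z in time, and the test
   function vanishes after T'. So \<open>F\<close> enters only up to time T', where it is
   integrable.\<close>
 have K\<theta>_zero: "F i k w * (?K (z - w) * ?\<theta> z) = (indicator {..T'} (fst w) * F i k w) * (?K (z - w) * ?\<theta> z)" for w z
 proof (cases "fst w <= T'")
 case False
 then have "?K (z - w) = 0 \<or> ?\<theta> z = 0"
 using st_kernel_nonzero[of i j k "z - w"] TC(3)[of "fst z" "snd z"] by (auto simp: minus_prod_def)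
 then show ?thesis by auto
 qed simp
 have hm: "(%(w, z). ?h w z) : BM2"
 unfolding case_prod_unfold by (intro borel_measurable_times measurable_compose[OF measurable_snd \<theta>m]) measurable
 have hn: "(%w. LI z. norm (?h w z)) : borel_measurable lborel"
 by (rule lborel.borel_measurable_lebesgue_integral) (use measurable_compose[OF hm borel_measurable_norm] in \<open>simp only: case_prod_unfold\<close>)
 have int: "integrable (LL) (%(w, z). ?h w z)"
 proof (rule Fubini_bound)
 show "integ (%w. \<bar>indicator {..T'} (fst w) * F i k w\<bar> * ((LI z. \<bar>?K z\<bar>) * C))"
 by (intro integrable_mult_left integrable_abs F_strip_integrable TC)
 show "(LI z. norm (?h w z)) <= \<bar>indicator {..T'} (fst w) * F i k w\<bar> * ((LI z. \<bar>?K z\<bar>) * C)" for w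
 proof -
 have "(LI z. norm (?h w z)) = \<bar>indicator {..T'} (fst w) * F i k w\<bar> * (LI z. \<bar>?K (z - w) * ?\<theta> z\<bar>)"
 unfolding K\<theta>_zero real_norm_def abs_mult[of _ "?K _ * _"] by simp
 also have "(LI z. \<bar>?K (z - w) * ?\<theta> z\<bar>) <= (LI z. \<bar>?K (z - w)\<bar> * C)"
 proof (rule integral_mono)
 show "integ (%z. \<bar>?K (z - w) * ?\<theta> z\<bar>)" by (rule integrable_abs[OF K\<theta>])
 show "integ (%z. \<bar>?K (z - w)\<bar> * C)" by (intro integrable_mult_left integrable_abs Kw)
 show "\<bar>?K (z - w) * ?\<theta> z\<bar> <= \<bar>?K (z - w)\<bar> * C" for z
 unfolding abs_mult[of "?K _"] by (intro mult_left_mono \<theta>C) simp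
 qed
 also have "(LI z. \<bar>?K (z - w)\<bar> * C) = (LI z. \<bar>?K z\<bar>) * C" using Kw(2) by simp
 finally show ?thesis by (simp add: mult_left_mono)
 qed
 show "AE w in lborel. integ (%z. ?h w z)"
 using K\<theta> by (intro AE_I2) simp
qed (rule hm)
 have 1: "(LI w. ?h w z) = B i j k z * ?\<theta> z" for z
 proof -
 have "(LI w. ?h w z) = (LI w. (?K (z - w) * F i k w) * ?\<theta> z)"
 by (intro bo_cong refl) (simp only: mult_ac)
 then show ?thesis unfolding B_conv by (simp only: integral_mult_left_zero)
 qed
 have 2: "(LI z. ?h w z) = F i k w * R w" for w
 proof (cases "fst w : {0<..<T}")
 case True
 have e: "?K (z - w) * ?\<theta> z = ?K (z - w) * heat_op ps z" for z
 proof (cases "fst z : {0<..<T}")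
 case False
 then have "?K (z - w) = 0 \<or> heat_op ps z = 0"
 using st_kernel_nonzero[of i j k "z - w"] TC(1) TC(3)[of "fst z" "snd z"] True by (auto simp: minus_prod_def; blast)
 then show ?thesis by auto
 qed simp
 have "(LI z. ?h w z) = F i k w * (LI z. ?K (z - (fst w, snd w)) * heat_op ps z)" unfolding e by simp
 also have "(LI z. ?K (z - (fst w, snd w)) * heat_op ps z) = R w"
 using True oseen_dual[OF T ps, of "fst w" i j k "snd w"] by (simp add: R_def)
 finally show ?thesis .
 next
 case False
 then have "F i k w = 0" using F_zero[of "fst w" i k "snd w"] by simp
 then show ?thesis by simp
 qed
 have int1: "integrable (LL) (%(t, x). B i j k (t, x) * ?\<theta> (t, x))"
 using lborel_pair.integrable_snd[OF int] unfolding 1 by (simp add: lborel_prod case_prod_unfold)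
 have int2: "integrable (LL) (%(t, y). F i k (t, y) * R (t, y))"
 using lborel_pair.integrable_fst[OF int] unfolding 2 by (simp add: lborel_prod case_prod_unfold)
 have F0: "(LI y. F i k (t, y) * R (t, y)) = indicator {0<..<T} t *\<^sub>R (LI y. F i k (t, y) * R (t, y))" for t
 by (cases "t : {0<..<T}") (auto simp: F_zero)
 have "(LINT t:{0<..<T}|lborel. LI x. B i j k (t, x) * heat_op ps (t, x)) = (LI t. LI x. B i j k (t, x) * ?\<theta> (t, x))"
 unfolding set_lebesgue_integral_def
 by (intro bo_cong refl) (simp add: mult.left_commute)
 also have "... = (LI z. B i j k z * ?\<theta> z)"
 using lborel_pair.integral_fst[OF int1] by (simp add: lborel_prod case_prod_unfold)
 also have "... = (LI w. F i k w * R w)"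
 using lborel_pair.Fubini_integral[OF int] unfolding 1 2 .
 also have "... = (LI t. LI y. F i k (t, y) * R (t, y))"
 using lborel_pair.integral_fst[OF int2] by (simp add: lborel_prod case_prod_unfold)
 also have "... = (LINT t:{0<..<T}|lborel. LI y. F i k (t, y) * R (t, y))"
 unfolding set_lebesgue_integral_def F0[symmetric] ..
 finally show "(LINT t:{0<..<T}|lborel. LI x. B i j k (t, x) * heat_op ps (t, x)) = (LINT t:{0<..<T}|lborel. LI y. F i k (t, y) * R (t, y))" .
 show "sinteg {0<..<T} (%t. LI y. F i k (t, y) * R (t, y))"
 using lborel_pair.integrable_fst[OF int2] unfolding set_integrable_def F0[symmetric] .
qed

lemma F_pairing_integrable:
 assumes "g : TFT T"
 shows "sinteg {0<..<T} (%t. LI y. F i k (t, y) * g (t, y))"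
proof (rule curve_pairing(2)[OF T F_meas _ _ _ assms])
 fix T' assume T': "T' < T"
 show "\<exists>C. \<forall>t\<in>{0<..T'}. L2_norm (%x. F i k (t, x)) <= C"
 proof -
 obtain C where "\<forall>t\<le>T'. L2_norm (%x. F i k (t, x)) <= C" using F_L2_bound[OF T'] by blast
 then show ?thesis by (intro exI[of _ C]) simp
 qed
qed (auto intro: F_L2)

text \<open>The weak formulation before the pressure is identified: the terms with \<open>N\<close>
  are what the integral of p div(phi) will supply, and the Kronecker deltas of
  \<open>oseen_dual\<close> collapse to the convection term on the right.\<close>

lemma vel_weak:
 fixes ps :: "3 => real \<times> (real^3) => real"
 assumes u0: "u0 : L2" and ps: "!!j. ps j : TFT T"
 defines "N \<equiv> %i k t y. newton_conv (%x. SS j. dx j (dx k (dx i (ps j))) (t, x)) y"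
 shows "sinteg {0<..<T} (%t. SS j. LI x. vel u0 t j x * heat_op (ps j) (t, x))"
 and "sinteg {0<..<T} (%t. SS i k. LI y. F i k (t, y) * N i k t y)"
 and "(SS j. LI y. u0 y $ j * ps j (0, y))
 + (LINT t:{0<..<T}|lborel. (SS j. LI x. vel u0 t j x * heat_op (ps j) (t, x))
 + (SS i k. LI y. F i k (t, y) * N i k t y))
 = - (LINT t:{0<..<T}|lborel. SS i k. LI y. F i k (t, y) * dx i (ps k) (t, y))"
proof -
 let ?I = "{0<..<T}"
 have u: "(%x. u0 x $ j) : L2" for j using u0 by (simp add: L2_vec_iff)
 note \<theta> = test_heat_op[OF ps]
 define n where "n i j k t y = newton_conv (%x. dx j (dx k (dx i (ps j))) (t, x)) y" for i j k t y
 have n_int: "integ (%y. F i k (t, y) * n i j k t y)" for i j k t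
 unfolding n_def
 by (rule test_newton_pairing(3)[OF F_int test_slice[OF test_ddir[OF test_ddir[OF test_ddir[OF ps]]]]])
 have N_eq: "N i k t y = (SS j. n i j k t y)" for i k t y
 proof -
 have "integ (%x. newton_kernel (x - y) * dx j (dx k (dx i (ps j))) (t, x))" for j
 proof -
 have g: "(%x. dx j (dx k (dx i (ps j))) (t, x)) : TF"
 by (rule test_slice[OF test_ddir[OF test_ddir[OF test_ddir[OF ps]]]])
 obtain C where "!!x. \<bar>dx j (dx k (dx i (ps j))) (t, x)\<bar> <= C" using test_abs_bounded[OF g] by blast
 then show ?thesis by (rule newton_conv_integrable[OF test_integrable[OF g]])
 qed
 then show ?thesis unfolding N_def n_def newton_conv_def by (simp add: sum_distrib_left)
 qed
 have N_sum: "(LI y. F i k (t, y) * N i k t y) = (SS j. LI y. F i k (t, y) * n i j k t y)" for i k t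
 unfolding N_eq sum_distrib_left by (intro bo_integral_sum n_int)
 have g_int: "integ (%y. F i k (t, y) * dx l (ps j) (t, y))" for i k t l j
 by (rule L2_mult_integrable[OF F_L2 test_L2[OF test_slice[OF test_ddir[OF ps]]]])
 have split: "(LI y. F i k (t, y) * (of_bool (j = k) * dx i (ps j) (t, y) + n i j k t y))
 = of_bool (j = k) * (LI y. F i k (t, y) * dx i (ps j) (t, y)) + (LI y. F i k (t, y) * n i j k t y)" for i j k t
 using g_int[where i = i and k = k and t = t and l = i and j = j] n_int[where i = i and k = k and t = t and j = j] by (simp add: distrib_left mult.left_commute)
 have Bw: "(LINT t:?I|lborel. LI x. B i j k (t, x) * heat_op (ps j) (t, x))
 = (LINT t:?I|lborel. of_bool (j = k) * (LI y. F i k (t, y) * dx i (ps j) (t, y)) + (LI y. F i k (t, y) * n i j k t y))"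
 "sinteg ?I (%t. of_bool (j = k) * (LI y. F i k (t, y) * dx i (ps j) (t, y)) + (LI y. F i k (t, y) * n i j k t y))" for i j k
 using B_weak[OF ps[of j], where i = i and j = j and k = k] B_weak_integrable[OF ps[of j], where i = i and j = j and k = k] unfolding fst_conv snd_conv n_def[symmetric] split by blast+
 have gi: "sinteg ?I (%t. LI y. F i k (t, y) * dx l (ps j) (t, y))" for i k l j
 by (rule F_pairing_integrable[OF test_ddir[OF ps]])
 have gi': "sinteg ?I (%t. of_bool b * (LI y. F i k (t, y) * dx l (ps j) (t, y)))" for i k l j b
 using gi by (cases b) (simp_all add: set_integrable_def)
 \<comment> \<open>Fubini gave integrability in time for the two parts of \<open>R\<close> together;
   the Newton part is isolated by subtracting the local part.\<close>
 have ni: "sinteg ?I (%t. LI y. F i k (t, y) * n i j k t y)" for i j k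
 using set_integral_diff(1)[OF Bw(2)[where i = i and j = j and k = k] gi'[where i = i and k = k and l = i and j = j and b = "j = k"]] by simp
 have hi: "sinteg ?I (%t. LI x. heat_flow (%x. u0 x $ j) t x * heat_op (ps j) (t, x))" for j
 by (rule cont_L2_pairing_integrable[OF T cont_L2_mono[OF heat_flow_cont_L2[OF u]] \<theta>]) auto
 have Bi: "sinteg ?I (%t. LI x. B i j k (t, x) * heat_op (ps j) (t, x))" for i j k
 by (rule cont_L2_pairing_integrable[OF T B_cont_L2 \<theta>])
 have vi: "sinteg ?I (%t. LI x. vel u0 t j x * heat_op (ps j) (t, x))" for j
 by (rule cont_L2_pairing_integrable[OF T vel_cont_L2[OF u0] \<theta>])
 have sum_int: "sinteg ?I (%t. \<Sum>i\<in>S. f i t)" "(LINT t:?I|lborel. (\<Sum>i\<in>S. f i t)) = (\<Sum>i\<in>S. LINT t:?I|lborel. f i t)"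
 if "!!i. sinteg ?I (f i)" for f :: "3 => real => real" and S
 using that unfolding set_integrable_def set_lebesgue_integral_def scaleR_sum_right
 by (rule bo_integrable_sum, rule bo_integral_sum)
 show S1: "sinteg ?I (%t. SS j. LI x. vel u0 t j x * heat_op (ps j) (t, x))"
 by (rule sum_int(1)[OF vi])
 show S2: "sinteg ?I (%t. SS i k. LI y. F i k (t, y) * N i k t y)"
 unfolding N_sum by (intro sum_int(1) ni)
 have vel_split: "(LINT t:?I|lborel. LI x. vel u0 t j x * heat_op (ps j) (t, x))
 = - (LI y. u0 y $ j * ps j (0, y)) - (SS i k. 
 of_bool (j = k) * (LINT t:?I|lborel. LI y. F i k (t, y) * dx i (ps j) (t, y)) + (LINT t:?I|lborel. LI y. F i k (t, y) * n i j k t y))" for j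
 proof -
 have "(LINT t:?I|lborel. LI x. vel u0 t j x * heat_op (ps j) (t, x))
 = (LINT t:?I|lborel. (LI x. heat_flow (%x. u0 x $ j) t x * heat_op (ps j) (t, x)) - (SS i k. LI x. B i j k (t, x) * heat_op (ps j) (t, x)))"
 proof (rule set_lebesgue_integral_cong, simp, intro allI impI)
 fix t assume "t : ?I"
 then have t: "t < T" "t : {0..}" by auto
 have gL: "(%x. heat_op (ps j) (t, x)) : L2" by (rule test_L2[OF test_slice[OF \<theta>]])
 have hL: "integ (%x. heat_flow (%x. u0 x $ j) t x * heat_op (ps j) (t, x))"
 by (rule L2_mult_integrable[OF cont_L2_L2[OF heat_flow_cont_L2[OF u] t(2)] gL])
 have BL: "integ (%x. B i j k (t, x) * heat_op (ps j) (t, x))" for i k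
 by (rule L2_mult_integrable[OF B_L2[OF t(1)] gL])
 have "(LI x. (SS i k. B i j k (t, x) * heat_op (ps j) (t, x)))
 = (SS i k. LI x. B i j k (t, x) * heat_op (ps j) (t, x))"
 by (subst bo_integral_sum; (subst bo_integral_sum)?;
 intro bo_integrable_sum BL refl)
 moreover have "(LI x. vel u0 t j x * heat_op (ps j) (t, x))
 = (LI x. heat_flow (%x. u0 x $ j) t x * heat_op (ps j) (t, x)) - (LI x. (SS i k. B i j k (t, x) * heat_op (ps j) (t, x)))"
 unfolding vel_def left_diff_distrib sum_distrib_right
 by (intro bo_integral_diff hL bo_integrable_sum BL)
 ultimately show "(LI x. vel u0 t j x * heat_op (ps j) (t, x))
 = (LI x. heat_flow (%x. u0 x $ j) t x * heat_op (ps j) (t, x)) - (SS i k. LI x. B i j k (t, x) * heat_op (ps j) (t, x))"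
 by simp
 qed
 also have "... = (LINT t:?I|lborel. LI x. heat_flow (%x. u0 x $ j) t x * heat_op (ps j) (t, x))
 - (LINT t:?I|lborel. SS i k. LI x. B i j k (t, x) * heat_op (ps j) (t, x))"
 by (intro set_integral_diff(2) hi sum_int(1) Bi)
 also have "(LINT t:?I|lborel. LI x. heat_flow (%x. u0 x $ j) t x * heat_op (ps j) (t, x)) = - (LI y. u0 y $ j * ps j (0, y))"
 by (rule heat_flow_weak[OF T u ps])
 also have "(LINT t:?I|lborel. SS i k. LI x. B i j k (t, x) * heat_op (ps j) (t, x))
 = (SS i k. LINT t:?I|lborel. LI x. B i j k (t, x) * heat_op (ps j) (t, x))"
 by (subst sum_int(2); (subst sum_int(2))?; intro sum_int(1) Bi refl)
 also have "... = (SS i k. 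
 of_bool (j = k) * (LINT t:?I|lborel. LI y. F i k (t, y) * dx i (ps j) (t, y)) + (LINT t:?I|lborel. LI y. F i k (t, y) * n i j k t y))"
 proof (intro sum.cong refl)
 fix i k
 show "(LINT t:?I|lborel. LI x. B i j k (t, x) * heat_op (ps j) (t, x))
 = of_bool (j = k) * (LINT t:?I|lborel. LI y. F i k (t, y) * dx i (ps j) (t, y)) + (LINT t:?I|lborel. LI y. F i k (t, y) * n i j k t y)"
 unfolding Bw(1) set_integral_add(2)[OF gi' ni] by simp
 qed
 finally show ?thesis .
 qed
 define a where "a i k = (LINT t:?I|lborel. LI y. F i k (t, y) * dx i (ps k) (t, y))" for i k
 define b where "b i j k = (LINT t:?I|lborel. LI y. F i k (t, y) * n i j k t y)" for i j k
 define c where "c j = (LI y. u0 y $ j * ps j (0, y))" for j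
 have vs: "(LINT t:?I|lborel. LI x. vel u0 t j x * heat_op (ps j) (t, x)) = - c j - (SS i. a i j) - (SS i k. b i j k)" for j
 proof -
 have "(SS k. of_bool (j = k) * (LINT t:?I|lborel. LI y. F i k (t, y) * dx i (ps j) (t, y))) = a i j" for i
 by (simp add: a_def of_bool_def if_distrib[of "%x. x * _"] cong: if_cong)
 then show ?thesis unfolding vel_split by (simp add: sum.distrib b_def c_def)
 qed
 have Nb: "(LINT t:?I|lborel. SS i k. LI y. F i k (t, y) * N i k t y) = (SS i k j. b i j k)"
 unfolding N_sum b_def
 by (subst sum_int(2), intro sum_int(1) ni, subst sum_int(2), intro sum_int(1) ni, subst sum_int(2), intro ni, rule refl)
 have ab: "(LINT t:?I|lborel. SS i k. LI y. F i k (t, y) * dx i (ps k) (t, y)) = (SS i k. a i k)"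
 unfolding a_def by (subst sum_int(2), intro sum_int(1) gi, subst sum_int(2), intro gi, rule refl)
 have sw: "(SS j i k. b i j k) = (SS i k j. b i j k)"
 unfolding sum.swap[of "%j i. SS k. b i j k"] by (intro sum.cong refl sum.swap)
 have sa: "(SS j i. a i j) = (SS i k. a i k)" by (rule sum.swap)
 have "(LINT t:?I|lborel. (SS j. LI x. vel u0 t j x * heat_op (ps j) (t, x))
 + (SS i k. LI y. F i k (t, y) * N i k t y))
 = (SS j. LINT t:?I|lborel. LI x. vel u0 t j x * heat_op (ps j) (t, x)) + (SS i k j. b i j k)"
 unfolding set_integral_add(2)[OF S1 S2] Nb sum_int(2)[OF vi] ..
 also have "... = - (SS j. c j) - (SS i k. a i k)"
 unfolding vs sum_subtractf sum_negf sw sa by simp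
 finally show "(SS j. LI y. u0 y $ j * ps j (0, y))
 + (LINT t:?I|lborel. (SS j. LI x. vel u0 t j x * heat_op (ps j) (t, x))
 + (SS i k. LI y. F i k (t, y) * N i k t y))
 = - (LINT t:?I|lborel. SS i k. LI y. F i k (t, y) * dx i (ps k) (t, y))"
 unfolding ab c_def by simp
qed

text \<open>The Kronecker delta leaves the heat kernel against d_i d_k g. In the other term the
  repeated index produces a Laplacian, and -Laplacian P = \<Phi> makes the two cancel.\<close>

lemma oseen_divergence:
 assumes t: "0 < t" and g: "g : TF"
 shows "(SS j. LI x. oseen_grad i j k t (x - y) * pd j g x) = 0"
proof -
 note sm = test_smooth[OF g]
 have Tkig: "pd k (pd i g) : TF" by (intro test_pd g)
 have int: "integ (%x. pot t (x - y) * pd j (pd j (pd k (pd i g))) x)" for j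
 by (intro pot_conv_integrable t test_integrable[of _ UNIV] test_pd g)
 have comm: "pd j (pd k (pd i (pd j g))) = pd j (pd j (pd k (pd i g)))" for j
 using sm by (simp add: pd_commute[of g i j] pd_commute[of "pd i g" k j] smooth_pd)
 have "(SS j. LI x. oseen_grad i j k t (x - y) * pd j g x)
 = (SS j. - of_bool (j = k) * (LI x. heat t (x - y) * pd i (pd j g) x)) - (SS j. LI x. pot t (x - y) * pd j (pd j (pd k (pd i g))) x)"
 unfolding oseen_grad_by_parts[OF t test_pd[OF g]] comm by (simp only: sum_subtractf)
 also have "(SS j. - of_bool (j = k) * (LI x. heat t (x - y) * pd i (pd j g) x)) = - (LI x. heat t (x - y) * pd i (pd k g) x)"
 by (simp add: of_bool_def sum_negf if_distrib[of "%x. x * _"] cong: if_cong)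
 also have "(SS j. LI x. pot t (x - y) * pd j (pd j (pd k (pd i g))) x) = (LI x. pot t (x - y) * laplacian (pd k (pd i g)) x)"
 unfolding laplacian_def sum_distrib_left by (intro bo_integral_sum[symmetric] int)
 also have "... = - (LI x. heat t (x - y) * pd k (pd i g) x)"
 using laplacian_by_parts(1)[OF pot_regular(1-4)[OF t] Tkig] by (simp add: laplacian_pot[OF t])
 also have "pd k (pd i g) = pd i (pd k g)" by (rule pd_commute[OF sm])
 finally show ?thesis by simp
qed

text \<open>The heat flow is a superposition of translates of the divergence-free \<open>u0\<close>.
  For the potential, Fubini isolates each time slice of the kernel, which is divergence free by
  \<open>oseen_divergence\<close>.\<close>

lemma vel_div_free:
 assumes u0: "u0 : H_space" and t: "0 < t" "t < T" and g: "g : TF"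
 shows "(SS j. LI x. vel u0 t j x * pd j g x) = 0"
proof -
 have u0L: "u0 : L2" and df: "!!g. g : TF ==> (LI x. u0 x \<bullet> grad g x) = 0"
 using u0 by (auto simp: H_space_def weakly_div_free_def)
 have u: "(%x. u0 x $ j) : L2" for j using u0L by (simp add: L2_vec_iff)
 have [measurable]: "(%x. u0 x $ j) : BM" for j using u by (rule L2_measurable)
 have gL: "pd j g : L2" for j by (rule test_L2[OF test_pd[OF g]])
 have [measurable]: "pd j g : BM" for j using gL by (rule L2_measurable)
 have sum_ip: "(SS j. LI x. v x $ j * pd j f x) = (LI x. v x \<bullet> grad f x)"
 if "v : L2" "f : TF" for v f
 proof -
 have "integ (%x. v x $ j * pd j f x)" for j
 using that by (intro L2_mult_integrable test_L2[OF test_pd]) (auto simp: L2_vec_iff)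
 then show ?thesis by (simp add: inner_vec_def grad_def)
 qed
 have h1: "integ (heat 1)" by (rule heat_integrable) simp
 have fm: "(%(z, x). u0 (x + sqrt t *\<^sub>R z) $ j) : BM2" for j
 using measurable_compose[of "%z. snd z + sqrt t *\<^sub>R fst z" "LL" borel "%x. u0 x $ j"]
 by (simp add: split_beta)
 have fL: "(%x. u0 (x + sqrt t *\<^sub>R z) $ j) : L2" "L2_norm (%x. u0 (x + sqrt t *\<^sub>R z) $ j) = L2_norm (%x. u0 x $ j)" for j z
 using L2_shift[OF u] L2_norm_shift[OF u] by blast+
 have kF: "integ (%z. \<bar>heat 1 z\<bar> * (L2_norm (%x. u0 (x + sqrt t *\<^sub>R z) $ j))\<^sup>2)" for j
 unfolding fL(2) using h1 by simp
 note Lh = L2_integral(4,5)[OF sigma_finite_lborel fm h1 fL(1) kF gL]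
 have hp: "(SS j. LI x. heat_flow (%x. u0 x $ j) t x * pd j g x) = 0"
 proof -
 have ii: "integ (%z. heat 1 z * (LI x. u0 (x + sqrt t *\<^sub>R z) $ j * pd j g x))" for j
 using lborel_pair.integrable_fst[OF Lh(1)[of j j]] by (simp add: mult.assoc)
 have "(SS j. LI x. heat_flow (%x. u0 x $ j) t x * pd j g x)
 = (SS j. LI z. heat 1 z * (LI x. u0 (x + sqrt t *\<^sub>R z) $ j * pd j g x))"
 unfolding heat_flow_def using Lh(2) by simp
 also have "... = (LI z. (SS j. heat 1 z * (LI x. u0 (x + sqrt t *\<^sub>R z) $ j * pd j g x)))"
 by (intro bo_integral_sum[symmetric] ii)
 also have "... = (LINT z|(lborel :: (real^3) measure). 0)"
 proof (intro bo_cong refl)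
 fix z :: "real^3"
 let ?y = "sqrt t *\<^sub>R z"
 have gy: "(%x. g (x - ?y)) : TF" by (rule test_translate[OF g])
 have "(LI x. u0 (x + ?y) $ j * pd j g x) = (LI x. u0 x $ j * pd j (%x. g (x - ?y)) x)" for j
 proof -
 have "(LI x. (%x. u0 (x + ?y) $ j * pd j g x) (x - ?y)) = (LI x. u0 (x + ?y) $ j * pd j g x)"
 by (rule integral_translate) (use fL(1)[of z j, THEN L2_measurable] in measurable)
 then show ?thesis by (simp add: pd_translate[OF test_smooth[OF g]])
 qed
 then have "(SS j. LI x. u0 (x + ?y) $ j * pd j g x) = 0"
 using sum_ip[OF u0L gy] df[OF gy] by simp
 then show "(SS j. heat 1 z * (LI x. u0 (x + ?y) $ j * pd j g x)) = 0"
 unfolding sum_distrib_left[symmetric] by simp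
 qed
 finally show ?thesis by simp
 qed
 have Bp: "(SS j. LI x. B i j k (t, x) * pd j g x) = 0" for i k
 proof -
 obtain C where C: "\<forall>s\<le>t. L2_norm (%x. F i k (s, x)) <= C" using F_L2_bound[OF t(2)] by blast
 have CC: "L2_norm (%x. F i k ((t, x) - w)) <= C" if "st_kernel T i j k w ~= 0" for w j
 using st_kernel_nonzero[OF that] C by (simp add: F_shift)
 note Ki = st_kernel_integrable[OF T]
 have kF: "integ (%w. \<bar>st_kernel T i j k w\<bar> * (L2_norm (%x. F i k ((t, x) - w)))\<^sup>2)" for j
 by (rule L2_integral_bounded_integrable[OF sigma_finite_lborel Ki F_shift_meas F_shift(1) CC])
 define A where "A j w = st_kernel T i j k w * (LI x. F i k ((t, x) - w) * pd j g x)" for j w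
 have BA: "(LI x. B i j k (t, x) * pd j g x) = (LI w. A j w)" for j
 unfolding B_def A_def by (rule L2_integral(5)[OF sigma_finite_lborel F_shift_meas Ki F_shift(1) kF gL])
 have iA: "integ (A j)" for j
 using lborel_pair.integrable_fst[OF L2_integral(4)[OF sigma_finite_lborel F_shift_meas Ki F_shift(1) kF gL[of j]]]
 unfolding A_def[abs_def] by (simp add: mult.assoc)
 have iA': "integrable (LL) (%(\<tau>, \<zeta>). A j (\<tau>, \<zeta>))" for j using iA by (simp add: lborel_prod)
 have inner: "(LI \<zeta>. A j (\<tau>, \<zeta>)) = indicator {0<..<T} \<tau> * (LI y. (LI x. oseen_grad i j k \<tau> (x - y) * pd j g x) * F i k (t - \<tau>, y))" for j \<tau>
 proof (cases "\<tau> : {0<..<T}")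
 case True
 have "(LI x. F i k ((t, x) - (\<tau>, \<zeta>)) * pd j g x) = (LI y. pd j g (y + \<zeta>) * F i k (t - \<tau>, y))" for \<zeta>
 proof -
 have "(LI x. (%y. pd j g (y + \<zeta>) * F i k (t - \<tau>, y)) (x - \<zeta>)) = (LI y. pd j g (y + \<zeta>) * F i k (t - \<tau>, y))"
 by (rule integral_translate) measurable
 then show ?thesis by (simp add: minus_prod_def mult.commute)
 qed
 then have "(LI \<zeta>. A j (\<tau>, \<zeta>)) = (LI \<zeta>. oseen_grad i j k \<tau> \<zeta> * (LI y. pd j g (y + \<zeta>) * F i k (t - \<tau>, y)))"
 using True by (simp add: A_def st_kernel_def)
 also have "... = (LI y. (LI x. oseen_grad i j k \<tau> (x - y) * pd j g x) * F i k (t - \<tau>, y))"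
 using True by (intro L2_conv_pairing[symmetric] oseen_grad_integrable gL F_L2) simp
 finally show ?thesis using True by simp
 qed (simp add: A_def st_kernel_def)
 have "(SS j. LI x. B i j k (t, x) * pd j g x) = (SS j. LI \<tau>. LI \<zeta>. A j (\<tau>, \<zeta>))"
 unfolding BA using lborel_pair.integral_fst[OF iA'] by (simp add: lborel_prod)
 also have "... = (LI \<tau>. (SS j. LI \<zeta>. A j (\<tau>, \<zeta>)))"
 by (intro bo_integral_sum[symmetric] lborel_pair.integrable_fst[OF iA'])
 also have "... = (LINT \<tau>|(lborel :: real measure). 0)"
 proof (intro bo_cong refl)
 fix \<tau> :: real
 show "(SS j. LI \<zeta>. A j (\<tau>, \<zeta>)) = 0"
 proof (cases "\<tau> : {0<..<T}")
 case True
 then have \<tau>: "0 < \<tau>" by simp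
 have "integ (%y. (LI x. oseen_grad i j k \<tau> (x - y) * pd j g x) * F i k (t - \<tau>, y))" for j
 by (intro L2_mult_integrable L2_conv oseen_grad_integrable \<tau> gL F_L2)
 then have "(SS j. LI \<zeta>. A j (\<tau>, \<zeta>))
 = (LI y. (SS j. LI x. oseen_grad i j k \<tau> (x - y) * pd j g x) * F i k (t - \<tau>, y))"
 unfolding inner using True by (simp add: sum_distrib_right)
 then show ?thesis by (simp add: oseen_divergence[OF \<tau> g])
 qed (simp add: inner)
 qed
 finally show ?thesis by simp
 qed
 have "(LI x. vel u0 t j x * pd j g x) = (LI x. heat_flow (%x. u0 x $ j) t x * pd j g x)
 - (SS i k. LI x. B i j k (t, x) * pd j g x)" for j
 proof -
 have hL: "integ (%x. heat_flow (%x. u0 x $ j) t x * pd j g x)"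
 using t by (intro L2_mult_integrable cont_L2_L2[OF heat_flow_cont_L2[OF u]] gL) auto
 have BL: "integ (%x. B i j k (t, x) * pd j g x)" for i k by (intro L2_mult_integrable B_L2 t gL)
 have "(LI x. (SS i k. B i j k (t, x) * pd j g x)) = (SS i k. LI x. B i j k (t, x) * pd j g x)"
 by (subst bo_integral_sum; (subst bo_integral_sum)?;
 intro bo_integrable_sum BL refl)
 moreover have "(LI x. vel u0 t j x * pd j g x)
 = (LI x. heat_flow (%x. u0 x $ j) t x * pd j g x) - (LI x. (SS i k. B i j k (t, x) * pd j g x))"
 unfolding vel_def left_diff_distrib sum_distrib_right
 by (intro bo_integral_diff hL bo_integrable_sum BL)
 ultimately show ?thesis by simp
 qed
 then have "(SS j. LI x. vel u0 t j x * pd j g x)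
 = (SS j. LI x. heat_flow (%x. u0 x $ j) t x * pd j g x) - (SS j i k. LI x. B i j k (t, x) * pd j g x)"
 by (simp add: sum_subtractf)
 also have "(SS j i k. LI x. B i j k (t, x) * pd j g x)
 = (SS i k j. LI x. B i j k (t, x) * pd j g x)"
 unfolding sum.swap[of "%j i. SS k. LI x. B i j k (t, x) * pd j g x"] by (intro sum.cong refl sum.swap)
 finally show ?thesis by (simp add: hp Bp)
qed

end

subsection \<open>Existence\<close>

lemma Linf_norm_AE_le:
 assumes "Linf_norm f <= ereal C" shows "AE x in lborel. norm (f x) <= C"
 using esssup_AE[of "%x. ereal (norm (f x))" lborel]
proof eventually_elim
 case (elim x)
 from order_trans[OF elim assms[unfolded Linf_norm_def]] show ?case by simp
qed

text \<open>A compactness argument by bisection: near 0 the bound \<open>M\<close> applies, near any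
  other time continuity raises the bound at the centre by at most 1. The exceptional null set may
  depend on the time, so the bound is formulated for each slice.\<close>

lemma Linf_locally_bounded:
 fixes Y :: "real => 'a::euclidean_space => 'b::euclidean_space"
 assumes Y: "Y : cont_Linf {0<..<T}" and M: "\<forall>\<^sub>F t in at_right 0. Linf_norm (Y t) <= ereal M" and T': "T' < T"
 shows "\<exists>C\<ge>0. \<forall>t\<in>{0<..T'}. AE x in lborel. norm (Y t x) <= C"
proof (cases "0 <= T'")
 case True
 define P where "P a b \<longleftrightarrow> (\<exists>C\<ge>0. \<forall>t\<in>{a..b}. 0 < t \<longrightarrow> (AE x in lborel. norm (Y t x) <= C))" for a b
 have mono: "AE x in lborel. norm (Y t x) <= D" if "AE x in lborel. norm (Y t x) <= C" "C <= D" for t C D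
 using that(1) by eventually_elim (use that(2) in linarith)
 have "P 0 T'"
 using True
 proof (induction rule: Bolzano)
 case (trans a b c)
 obtain C where C: "0 <= C" "\<forall>t\<in>{a..b}. 0 < t \<longrightarrow> (AE x in lborel. norm (Y t x) <= C)" using trans(1) unfolding P_def by blast
 obtain D where D: "\<forall>t\<in>{b..c}. 0 < t \<longrightarrow> (AE x in lborel. norm (Y t x) <= D)" using trans(2) unfolding P_def by blast
 have "AE x in lborel. norm (Y t x) <= max C D" if "t : {a..c}" "0 < t" for t
 proof (cases "t <= b")
 case True
 with that C(2) have "AE x in lborel. norm (Y t x) <= C" by simp
 then show ?thesis by (rule mono) simp
 next
 case False
 with that D have "AE x in lborel. norm (Y t x) <= D" by simp
 then show ?thesis by (rule mono) simp
 qed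
 then show ?case unfolding P_def using C(1) by (intro exI[of _ "max C D"]) auto
 next
 case (local x)
 show ?case
 proof (cases "x = 0")
 case True
 obtain b where b: "0 < b" "\<forall>y>0. y < b \<longrightarrow> Linf_norm (Y y) <= ereal M" using M unfolding eventually_at_right_field by blast
 have "P l r" if "l <= x" "x <= r" "r - l < b" for l r
 unfolding P_def
 proof (intro exI[of _ "max 0 M"] conjI ballI impI)
 fix t assume "t : {l..r}" "0 < t"
 then have "Linf_norm (Y t) <= ereal M" using that True b(2) by simp
 from Linf_norm_AE_le[OF this] show "AE x in lborel. norm (Y t x) <= max 0 M" by (rule mono) simp
 qed simp
 then show ?thesis using b(1) by blast
 next
 case False
 then have x: "x : {0<..<T}" using local T' by simp
 have "Linf_norm (Y x) < \<infinity>" using Y x by (simp add: cont_Linf_def Linf_def)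
 then obtain m where m: "Linf_norm (Y x) <= ereal m" by (cases "Linf_norm (Y x)") auto
 have "((%s. Linf_norm (%y. Y s y - Y x y)) \<longlongrightarrow> 0) (at x within {0<..<T})" using Y x by (simp add: cont_Linf_def)
 then have "\<forall>\<^sub>F s in at x within {0<..<T}. Linf_norm (%y. Y s y - Y x y) < ereal 1" by (rule order_tendstoD) simp
 then obtain d where d: "0 < d" "!!s. s : {0<..<T} ==> s ~= x ==> dist s x < d ==> Linf_norm (%y. Y s y - Y x y) < ereal 1"
 unfolding eventually_at by blast
 have "P l r" if "l <= x" "x <= r" "r - l < min d (T - x)" for l r
 unfolding P_def
 proof (intro exI[of _ "max 0 m + 1"] conjI ballI impI)
 fix t assume t: "t : {l..r}" "0 < t"
 then have t': "t : {0<..<T}" "dist t x < d" using that by (auto simp: dist_real_def)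
 show "AE y in lborel. norm (Y t y) <= max 0 m + 1"
 proof (cases "t = x")
 case True
 show ?thesis unfolding True by (rule mono[OF Linf_norm_AE_le[OF m]]) simp
 next
 case False
 from Linf_norm_AE_le[OF less_imp_le[OF d(2)[OF t'(1) False t'(2)]]] Linf_norm_AE_le[OF m] show ?thesis
 proof eventually_elim
 case (elim y)
 then show ?case using norm_triangle_sub[of "Y t y" "Y x y"] by simp
 qed
 qed
 qed simp
 then show ?thesis using d(1) x by (intro exI[of _ "min d (T - x)"]) simp
 qed
 qed
 then show ?thesis unfolding P_def by auto
qed (auto intro: exI[of _ 0])

lemma L2_mult_bounded:
 fixes f g :: "'a::euclidean_space => real"
 assumes f: "f : L2" and g: "g : BM" and C: "AE x in lborel. \<bar>g x\<bar> <= C" "0 <= C"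
 shows "(%x. f x * g x) : L2" and "L2_norm (%x. f x * g x) <= C * L2_norm f"
proof -
 have [measurable]: "f : BM" "g : BM" using f g by (auto intro: L2_measurable)
 have i: "integ (%x. C\<^sup>2 * (f x)\<^sup>2)" using f by (simp add: L2_real_iff)
 have le: "AE x in lborel. (f x * g x)\<^sup>2 <= C\<^sup>2 * (f x)\<^sup>2"
 using C(1)
 proof eventually_elim
 case (elim x)
 have "(g x)\<^sup>2 <= C\<^sup>2" using power_mono[OF elim, of 2] by simp
 then show ?case using mult_left_mono[of "(g x)\<^sup>2" "C\<^sup>2" "(f x)\<^sup>2"] by (simp add: power_mult_distrib mult.commute)
 qed
 show L: "(%x. f x * g x) : L2"
 unfolding L2_real_iff by (intro conjI bo_integrable_bound[OF i]) (use le in auto)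
 show "L2_norm (%x. f x * g x) <= C * L2_norm f"
 proof (rule power2_le_imp_le)
 show "(L2_norm (%x. f x * g x))\<^sup>2 <= (C * L2_norm f)\<^sup>2"
 unfolding L2_norm_sq power_mult_distrib[of C] integral_mult_right_zero[symmetric]
 by (rule integral_mono_AE[OF _ i le]) (use L in \<open>simp add: L2_real_iff del: power_mult_distrib\<close>)
 qed (use C in simp)
qed

lemma cont_L2_cong_AE:
 fixes u v :: "real => 'a::euclidean_space => real"
 assumes u: "u : cont_L2 I" and v: "!!t. t : I ==> v t : BM" and uv: "!!t. t : I ==> AE x in lborel. v t x = u t x"
 shows "v : cont_L2 I"
 unfolding cont_L2_def
proof (intro CollectI ballI conjI)
 fix t assume t: "t : I"
 have vL: "v t : L2" if "t : I" for t
 by (rule L2_cong_AE[OF cont_L2_L2[OF u that] v[OF that]]) (use uv[OF that] in \<open>auto elim: eventually_mono\<close>)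
 show "v t : L2" by (rule vL[OF t])
 have eq: "L2_norm (%x. v s x - v t x) = L2_norm (%x. u s x - u t x)" if s: "s : I" for s
 proof (rule L2_norm_cong_AE)
 show "(%x. v s x - v t x) : BM" by (intro borel_measurable_diff v s t)
 show "(%x. u s x - u t x) : BM" by (intro borel_measurable_diff L2_measurable cont_L2_L2[OF u] s t)
 show "AE x in lborel. v s x - v t x = u s x - u t x" using uv[OF s] uv[OF t] by eventually_elim simp
 qed
 show "((%s. L2_norm (%x. v s x - v t x)) \<longlongrightarrow> 0) (at t within I)"
 proof (rule Lim_transform_eventually)
 show "((%s. L2_norm (%x. u s x - u t x)) \<longlongrightarrow> 0) (at t within I)" using u t by (simp add: cont_L2_def)
 show "\<forall>\<^sub>F s in at t within I. L2_norm (%x. u s x - u t x) = L2_norm (%x. v s x - v t x)"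
 using eq by (auto simp: eventually_at intro!: exI[of _ 1])
 qed
qed

lemma fst_borel_measurable: "fst : borel_measurable (borel :: (real \<times> (real^3)) measure)"
 by (intro borel_measurable_continuous_onI continuous_intros)

text \<open>Continuity of the products in \<open>L2\<close> uses the splitting (Y_k(s) - Y_k(t))
  Y_i(s) + (Y_i(s) - Y_i(t)) Y_k(t) and the local sup bound. The \<open>L2\<close> bounds pair a sup
  bound with an \<open>L2\<close> norm, the \<open>L1\<close> bounds two \<open>L2\<close>
  norms.\<close>

lemma forcing_exists:
 fixes Y :: "real => real^3 => real^3"
 assumes T: "0 < T" and Y: "Y : cont_L2 {0..<T}"
 and bound: "!!T'. T' < T ==> \<exists>C\<ge>0. \<forall>t\<in>{0<..T'}. AE x in lborel. norm (Y t x) <= C"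
 shows "\<exists>F. forcing T F \<and> (\<forall>t\<in>{0<..<T}. \<forall>i k. AE x in lborel. F i k (t, x) = Y t x $ i * Y t x $ k)"
proof -
 let ?I = "{0<..<T}"
 let ?P = "%i k t x. Y t x $ i * Y t x $ k"
 have Yi: "(%t x. Y t x $ i) : cont_L2 {0..<T}" for i using Y by (simp add: cont_L2_vec_iff)
 have YL: "(%x. Y t x $ i) : L2" if "t : ?I" for t i using cont_L2_L2[OF Yi[of i], of t] that by simp
 have Ym: "(%x. Y t x $ i) : BM" if "t : ?I" for t i by (rule L2_measurable[OF YL[OF that]])
 have bi: "AE x in lborel. \<bar>Y t x $ i\<bar> <= C" if "AE x in lborel. norm (Y t x) <= C" for t i C
 using that by eventually_elim (rule order_trans[OF component_le_norm_cart])
 have PL: "(%x. ?P i k t x) : L2" if t: "t : ?I" for i k t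
 proof -
 obtain C where C: "0 <= C" "\<forall>s\<in>{0<..t}. AE x in lborel. norm (Y s x) <= C" using bound[of t] t by auto
 then have "AE x in lborel. norm (Y t x) <= C" using t by simp
 from L2_mult_bounded(1)[OF YL[OF t] Ym[OF t] bi[OF this] C(1)] show ?thesis .
 qed
 have Pc: "(%t x. ?P i k t x) : cont_L2 ?I" for i k
 unfolding cont_L2_def
 proof (intro CollectI ballI conjI)
 fix t assume t: "t : ?I"
 show "(%x. ?P i k t x) : L2" by (rule PL[OF t])
 \<comment> \<open>Any time strictly between \<open>t\<close> and \<open>T\<close> serves; it
   provides a neighbourhood of \<open>t\<close> on which one sup bound holds.\<close>
 define T' where "T' = (t + T) / 2"
 have T': "t < T'" "T' < T" using t by (auto simp: T'_def)
 obtain C where C: "0 <= C" "\<forall>s\<in>{0<..T'}. AE x in lborel. norm (Y s x) <= C" using bound[OF T'(2)] by blast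
 have Ct: "AE x in lborel. norm (Y t x) <= C" using C(2) t T' by simp
 let ?D = "%j s. L2_norm (%x. Y s x $ j - Y t x $ j)"
 have le: "L2_norm (%x. ?P i k s x - ?P i k t x) <= C * ?D k s + C * ?D i s" if s: "s : {0<..T'}" for s
 proof -
 have s': "s : ?I" using s T' by simp
 have Cs: "AE x in lborel. norm (Y s x) <= C" using C(2) s by simp
 note A = L2_mult_bounded[OF L2_diff[OF YL[OF s', of k] YL[OF t, of k]] Ym[OF s', of i] bi[OF Cs] C(1)]
 note B = L2_mult_bounded[OF L2_diff[OF YL[OF s', of i] YL[OF t, of i]] Ym[OF t, of k] bi[OF Ct] C(1)]
 have "(%x. ?P i k s x - ?P i k t x) = (%x. (Y s x $ k - Y t x $ k) * Y s x $ i + (Y s x $ i - Y t x $ i) * Y t x $ k)"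
 by (auto simp: algebra_simps)
 then have "L2_norm (%x. ?P i k s x - ?P i k t x) <= L2_norm (%x. (Y s x $ k - Y t x $ k) * Y s x $ i) + L2_norm (%x. (Y s x $ i - Y t x $ i) * Y t x $ k)"
 using L2_triangle[OF A(1) B(1)] by simp
 then show ?thesis using A(2) B(2) by linarith
 qed
 have lim: "((%s. ?D j s) \<longlongrightarrow> 0) (at t within ?I)" for j
 proof -
 have "(%t x. Y t x $ j) : cont_L2 ?I" by (rule cont_L2_mono[OF Yi]) auto
 then show ?thesis using t unfolding cont_L2_def by blast
 qed
 show "((%s. L2_norm (%x. ?P i k s x - ?P i k t x)) \<longlongrightarrow> 0) (at t within ?I)"
 proof (rule Lim_null_comparison)
 show "\<forall>\<^sub>F s in at t within ?I. norm (L2_norm (%x. ?P i k s x - ?P i k t x)) <= C * ?D k s + C * ?D i s"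
 unfolding eventually_at using T' le by (intro exI[of _ "T' - t"]) (auto simp: dist_real_def)
 show "((%s. C * ?D k s + C * ?D i s) \<longlongrightarrow> 0) (at t within ?I)"
 by (intro tendsto_add_zero tendsto_mult_right_zero lim)
 qed
 qed
 have "\<exists>G. G : borel_measurable (borel :: (real \<times> (real^3)) measure) \<and> (\<forall>t\<in>?I. AE x in lborel. G (t, x) = ?P i k t x)" for i k
 by (rule cont_L2_representative[OF Pc[of i k]]) (rule exI, erule conjI, rule ballI, simp)
 note rep = this
 have "\<exists>G. \<forall>i k. G i k : borel_measurable (borel :: (real \<times> (real^3)) measure) \<and> (\<forall>t\<in>?I. AE x in lborel. G i k (t, x) = ?P i k t x)"
 by (rule choice, rule allI, rule choice, rule allI, rule rep)
 then obtain G where Gm [measurable]: "!!i k. G i k : borel_measurable (borel :: (real \<times> (real^3)) measure)"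
 and G: "!!i k t. t : ?I ==> AE x in lborel. G i k (t, x) = ?P i k t x" by blast
 define F where "F i k z = indicator ?I (fst z) * G i k z" for i k z
 have F0: "F i k (t, x) = 0" if "t \<notin> ?I" for i k t x using that by (simp add: F_def)
 have Fm [measurable]: "F i k : BM" for i k
 using fst_borel_measurable unfolding F_def by measurable
 have FP: "AE x in lborel. F i k (t, x) = ?P i k t x" if "t : ?I" for i k t
 using G[OF that] that by (simp add: F_def)
 have Fmt: "(%x. F i k (t, x)) : BM" for i k t by measurable
 have D: "\<exists>D\<ge>0. \<forall>t\<in>{0<..T'}. \<forall>i. L2_norm (%x. Y t x $ i) <= D" if T': "T' < T" for T'
 proof -
 have "\<exists>D>0. \<forall>t\<in>{0..T'}. L2_norm (%x. Y t x $ i) <= D" for i by (rule cont_L2_bounded[OF Yi T', of i]) blast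
 then obtain d where d: "!!i. 0 < d i" "!!i t. t : {0..T'} ==> L2_norm (%x. Y t x $ i) <= d i" by metis
 have "L2_norm (%x. Y t x $ i) <= (SS i. d i)" if "t : {0<..T'}" for t i
 proof -
 have "d i <= (SS i. d i)" by (rule member_le_sum) (auto intro: less_imp_le d)
 then show ?thesis using d(2)[of t i] that by simp
 qed
 moreover have "0 <= (SS i. d i)" by (intro sum_nonneg less_imp_le d(1))
 ultimately show ?thesis by blast
 qed
 have Fint: "integ (%x. F i k (t, x))" "(LI x. \<bar>F i k (t, x)\<bar>) <= L2_norm (%x. Y t x $ i) * L2_norm (%x. Y t x $ k)" if t: "t : ?I" for i k t
 proof -
 note [measurable] = Ym[OF t]
 have ae: "AE x in lborel. ?P i k t x = F i k (t, x)" using FP[OF t, of i k] by eventually_elim simp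
 show "integ (%x. F i k (t, x))"
 using L2_mult_integrable[OF YL[OF t] YL[OF t]] Fmt ae by (subst integrable_cong_AE[OF _ _ FP[OF t]]) auto
 have "(LI x. \<bar>F i k (t, x)\<bar>) = (LI x. \<bar>Y t x $ i\<bar> * \<bar>Y t x $ k\<bar>)"
 proof (rule integral_cong_AE)
 show "AE x in lborel. \<bar>F i k (t, x)\<bar> = \<bar>Y t x $ i\<bar> * \<bar>Y t x $ k\<bar>" using ae by eventually_elim (simp add: abs_mult[symmetric])
 qed measurable
 also have "... <= L2_norm (%x. Y t x $ i) * L2_norm (%x. Y t x $ k)"
 using L2_Cauchy_Schwarz[OF L2_abs[OF YL[OF t, of i]] L2_abs[OF YL[OF t, of k]]] by (simp add: L2_norm_abs)
 finally show "(LI x. \<bar>F i k (t, x)\<bar>) <= L2_norm (%x. Y t x $ i) * L2_norm (%x. Y t x $ k)" .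
 qed
 have F0': "(%x. F i k (t, x)) = (%x. 0)" if "t \<notin> ?I" for i k t using F0[OF that] by simp
 have "forcing T F"
 proof
 show "(%t x. F i k (t, x)) : cont_L2 ?I" for i k by (rule cont_L2_cong_AE[OF Pc Fmt FP])
 show "integ (%x. F i k (t, x))" for i k t using Fint(1) F0' by (cases "t : ?I") auto
 fix i k T' assume T': "T' < T"
 obtain C where C: "0 <= C" "\<forall>s\<in>{0<..T'}. AE x in lborel. norm (Y s x) <= C" using bound[OF T'] by blast
 obtain d where d: "0 <= d" "\<forall>t\<in>{0<..T'}. \<forall>i. L2_norm (%x. Y t x $ i) <= d" using D[OF T'] by blast
 have "L2_norm (%x. F i k (t, x)) <= C * d" if "t <= T'" for t
 proof (cases "t : ?I")
 case True
 then have Ct: "AE x in lborel. norm (Y t x) <= C" "L2_norm (%x. Y t x $ i) <= d" using C(2) d(2) that by auto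
 have "L2_norm (%x. F i k (t, x)) = L2_norm (%x. ?P i k t x)"
 by (rule L2_norm_cong_AE[OF Fmt L2_measurable[OF PL[OF True]] FP[OF True]])
 also have "... <= C * L2_norm (%x. Y t x $ i)" by (rule L2_mult_bounded(2)[OF YL[OF True] Ym[OF True] bi[OF Ct(1)] C(1)])
 also have "... <= C * d" by (rule mult_left_mono[OF Ct(2) C(1)])
 finally show ?thesis .
 next
 case False
 then show ?thesis using C(1) d(1) unfolding F0'[OF False] by (simp add: L2_norm_def)
 qed
 then show "\<exists>C. \<forall>t\<le>T'. L2_norm (%x. F i k (t, x)) <= C" by blast
 have "(LI x. \<bar>F i k (t, x)\<bar>) <= d * d" if "t <= T'" for t
 proof (cases "t : ?I")
 case True
 then have "L2_norm (%x. Y t x $ i) * L2_norm (%x. Y t x $ k) <= d * d" using d that by (intro mult_mono) auto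
 then show ?thesis using Fint(2)[OF True, of i k] by linarith
 qed (simp add: F0)
 then show "\<exists>C. \<forall>t\<le>T'. (LI x. \<bar>F i k (t, x)\<bar>) <= C" by blast
 qed (use T F0 in auto)
 then show ?thesis using FP by blast
qed

section \<open>The pressure: measurable choice, pairing and local integrability\<close>

context forcing
begin

text \<open>The condition that \<open>is_stokes_pressure\<close> puts on a single time slice, with
  \<open>F\<close> in place of the products.\<close>

definition pressure_at :: "real => (real^3 => real) => bool"
 where "pressure_at t p \<longleftrightarrow> (\<exists>h :: 3 => 3 => real^3 => real.
 (\<forall>k i. h k i : L2 \<and> has_distr_deriv2 k i (newton_potential (%y. F i k (t, y))) (h k i)) \<and>
 (AE x in lborel. p x = (SS k i. h k i x)))"

text \<open>The Riesz transforms are chosen separately at each time, yet by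
  \<open>riesz_transform_diff_bound\<close> they form continuous curves in \<open>L2\<close> and so
  admit jointly measurable representatives.\<close>

lemma pressure_exists: "\<exists>q \<in> BM. \<forall>t\<in>{0<..<T}. pressure_at t (%x. q (t, x))"
proof -
 have "\<exists>h. h : L2 \<and> has_distr_deriv2 k i (newton_potential (%y. F i k (t, y))) h" for k i t
 using riesz_transform_exists[OF F_int F_L2, of k i i k t] by blast
 then obtain h where h: "!!k i t. h k i t : L2" "!!k i t. has_distr_deriv2 k i (newton_potential (%y. F i k (t, y))) (h k i t)"
 by metis
 have "h k i : cont_L2 {0<..<T}" for k i
 unfolding cont_L2_def
 proof (intro CollectI ballI conjI h)
 fix t assume t: "t : {0<..<T}"
 show "((%s. L2_norm (%x. h k i s x - h k i t x)) \<longlongrightarrow> 0) (at t within {0<..<T})"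
 proof (rule Lim_null_comparison)
 show "\<forall>\<^sub>F s in at t within {0<..<T}. norm (L2_norm (%x. h k i s x - h k i t x)) <= 2 * L2_norm (%x. F i k (s, x) - F i k (t, x))"
 using riesz_transform_diff_bound[OF F_int F_L2 F_int F_L2 h h] by (intro always_eventually allI) simp
 show "((%s. 2 * L2_norm (%x. F i k (s, x) - F i k (t, x))) \<longlongrightarrow> 0) (at t within {0<..<T})"
 using F_cont[of i k] t by (intro tendsto_mult_right_zero) (simp add: cont_L2_def)
 qed
 qed
 note hc = this
 have "\<exists>G. G : borel_measurable (borel :: (real \<times> (real^3)) measure) \<and> (\<forall>t\<in>{0<..<T}. AE x in lborel. G (t, x) = h k i t x)" for k i
 by (rule cont_L2_representative[OF hc[of k i]]) (rule exI, erule conjI, rule ballI, simp)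
 then obtain G where Gm [measurable]: "!!k i. G k i : borel_measurable (borel :: (real \<times> (real^3)) measure)"
 and G: "!!k i t. t : {0<..<T} ==> AE x in lborel. G k i (t, x) = h k i t x" by metis
 have "pressure_at t (%x. SS k i. G k i (t, x))" if t: "t : {0<..<T}" for t
 unfolding pressure_at_def
 proof (intro exI[of _ "%k i. h k i t"] conjI allI h)
 have "AE x in lborel. \<forall>k\<in>UNIV. \<forall>i\<in>UNIV. G k i (t, x) = h k i t x"
 by (intro AE_finite_allI finite) (use G[OF t] in auto)
 then show "AE x in lborel. (SS k i. G k i (t, x)) = (SS k i. h k i t x)"
 by eventually_elim simp
 qed
 then show ?thesis by (intro bexI[of _ "%z. SS k i. G k i z"]) auto
qed

lemma
 assumes p: "pressure_at t p" and [measurable]: "p : BM"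
 shows pressure_at_L2: "p : L2"
 and pressure_at_norm: "L2_norm p <= (SS k i. 2 * L2_norm (%x. F i k (t, x)))"
 and pressure_at_pairing: "g : TF ==>
 (LI x. p x * g x) = (SS i k. LI y. F i k (t, y) * newton_conv (pd k (pd i g)) y)"
proof -
 obtain h :: "3 => 3 => real^3 => real" where h: "!!k i. h k i : L2" "!!k i. has_distr_deriv2 k i (newton_potential (%y. F i k (t, y))) (h k i)"
 and ae: "AE x in lborel. p x = (SS k i. h k i x)"
 using p unfolding pressure_at_def by blast
 have S: "(%x. SS k i. h k i x) : L2" by (intro L2_sum h)
 show pL: "p : L2" by (rule L2_cong_AE[OF S]) (use ae in \<open>auto elim: eventually_mono\<close>)
 have "L2_norm p = L2_norm (%x. SS k i. h k i x)"
 by (rule L2_norm_cong_AE[OF _ L2_measurable[OF S] ae]) measurable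
 also have "... <= (SS k. L2_norm (%x. SS i. h k i x))"
 by (rule L2_norm_sum_le[where f = "%k x. SS i. h k i x"]) (auto intro: L2_sum h)
 also have "... <= (SS k i. L2_norm (h k i))" by (intro sum_mono L2_norm_sum_le finite h)
 also have "... <= (SS k i. 2 * L2_norm (%x. F i k (t, x)))"
 by (intro sum_mono riesz_transform_bound[OF F_int F_L2 h])
 finally show "L2_norm p <= (SS k i. 2 * L2_norm (%x. F i k (t, x)))" .
 assume g: "g : TF"
 note gL = test_L2[OF g]
 have "(LI x. p x * g x) = (LI x. (SS k i. h k i x) * g x)"
 by (rule integral_cong_AE) (use ae L2_measurable[OF S] L2_measurable[OF gL] in \<open>auto elim: eventually_mono\<close>)
 also have "... = (SS k i. LI x. h k i x * g x)"
 unfolding sum_distrib_right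
 by (subst bo_integral_sum; (subst bo_integral_sum)?;
 intro bo_integrable_sum L2_mult_integrable h gL refl)
 also have "... = (SS k i. LI y. F i k (t, y) * newton_conv (pd k (pd i g)) y)"
 proof (intro sum.cong refl)
 fix k i
 have "(LI x. h k i x * g x) = (LI x. newton_potential (%y. F i k (t, y)) x * pd k (pd i g) x)"
 using h(2)[of k i] g by (simp add: has_distr_deriv2_def)
 also have "... = (LI y. F i k (t, y) * newton_conv (pd k (pd i g)) y)"
 by (rule test_newton_pairing(1)[OF F_int test_pd[OF test_pd[OF g]]])
 finally show "(LI x. h k i x * g x) = (LI y. F i k (t, y) * newton_conv (pd k (pd i g)) y)" .
 qed
 finally show "(LI x. p x * g x) = (SS i k. LI y. F i k (t, y) * newton_conv (pd k (pd i g)) y)"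
 by (subst sum.swap)
qed

text \<open>For 0 < t <= T' the slices are uniformly bounded in \<open>L2\<close>, where T' is the
  latest time met by the compact set (or 0). At t = 0 nothing is known, but a single time is
  negligible.\<close>

lemma pressure_L1_loc:
 assumes q [measurable]: "q : BM" and p: "!!t. t : {0<..<T} ==> pressure_at t (%x. q (t, x))"
 shows "q : L1_loc ({0..<T} \<times> UNIV)"
 unfolding L1_loc_def
proof (intro CollectI allI impI)
 fix K :: "(real \<times> (real^3)) set" assume K: "compact K" "K \<subseteq> {0..<T} \<times> UNIV"
 have [measurable]: "K : sets borel" using K by (simp add: borel_compact)
 have "compact (insert 0 (fst ` K))" using K(1) by (intro compact_insert compact_continuous_image continuous_intros)
 then obtain T' where T': "T' : insert 0 (fst ` K)" "\<forall>r\<in>insert 0 (fst ` K). r <= T'"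
 using compact_attains_sup[of "insert 0 (fst ` K)"] by blast
 then have "T' < T" using K(2) T by auto
 then have "\<exists>C. \<forall>t\<le>T'. L2_norm (%x. F i k (t, x)) <= C" for i k by (rule F_L2_bound)
 then obtain C where C: "!!i k t. t <= T' ==> L2_norm (%x. F i k (t, x)) <= C i k" by metis
 have sK: "compact (snd ` K)" using K(1) by (intro compact_continuous_image continuous_intros)
 have [measurable]: "snd ` K : sets borel" using sK by (rule borel_compact)
 have iK: "(%x. indicator (snd ` K) x :: real) : L2"
 using emeasure_compact_finite[OF sK] unfolding L2_real_iff power2_eq_square indicator_inter_arith[symmetric] Int_absorb by (auto simp: less_top intro!: integrable_real_indicator)
 have qm: "(%x. q (t, x)) : BM" for t by measurable
 define E where "E = L2_norm (%x. indicator (snd ` K) x :: real) * \<bar>SS k i. 2 * C i k\<bar>"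
 let ?h = "%t x. indicator K (t, x) * q (t, x)"
 have Kt: "t : {0<..<T}" "t <= T'" if "(t, x) : K" "t ~= 0" for t x using that K(2) T'(2) by force+
 have zero: "?h t = (%x. 0)" if t: "\<not> (t : {0<..<T} \<and> t <= T')" "t ~= 0" for t
 proof -
 have "(t, x) \<notin> K" for x using Kt[of t x] t by blast
 then show ?thesis by simp
 qed
 have bound: "integ (?h t)" "(LI x. norm (?h t x)) <= E" if t: "t : {0<..<T}" "t <= T'" for t
 proof -
 have qL: "(%x. q (t, x)) : L2" by (rule pressure_at_L2[OF p[OF t(1)] qm])
 have i: "integ (%x. indicator (snd ` K) x * \<bar>q (t, x)\<bar>)" by (rule L2_mult_integrable[OF iK L2_abs[OF qL]])
 have le: "norm (?h t x) <= indicator (snd ` K) x * \<bar>q (t, x)\<bar>" for x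
 by (cases "(t, x) : K") (force simp: abs_mult indicator_def image_iff)+
 show ih: "integ (?h t)"
 by (rule bo_integrable_bound[OF i]) (use le in \<open>auto intro: order_trans[OF _ abs_ge_self]\<close>)
 have "(LI x. norm (?h t x)) <= (LI x. indicator (snd ` K) x * \<bar>q (t, x)\<bar>)"
 by (intro integral_mono integrable_norm ih i le)
 also have "... <= L2_norm (%x. indicator (snd ` K) x :: real) * L2_norm (%x. q (t, x))"
 using L2_Cauchy_Schwarz[OF iK L2_abs[OF qL]] by (simp add: L2_norm_abs)
 also have "... <= E"
 unfolding E_def
 proof (intro mult_left_mono L2_norm_nonneg)
 have "L2_norm (%x. q (t, x)) <= (SS k i. 2 * L2_norm (%x. F i k (t, x)))" by (rule pressure_at_norm[OF p[OF t(1)] qm])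
 also have "... <= (SS k i. 2 * C i k)" by (intro sum_mono mult_left_mono C t) simp
 finally show "L2_norm (%x. q (t, x)) <= \<bar>SS k i. 2 * C i k\<bar>" by simp
 qed
 finally show "(LI x. norm (?h t x)) <= E" .
 qed
 have E0: "0 <= E" by (simp add: E_def)
 have m: "(%(t, x). ?h t x) : BM2" by measurable
 have n0: "AE t in lborel. t ~= (0::real)" by (rule AE_lborel_singleton)
 have "integrable (LL) (%(t, x). ?h t x)"
 proof (rule lborel_pair.Fubini_integrable[OF m])
 show "AE t in lborel. integ (%x. case (t, x) of (t, x) => ?h t x)"
 using n0
 proof eventually_elim
 case (elim t)
 then show ?case using bound(1)[of t] zero[of t] by (cases "t : {0<..<T} \<and> t <= T'") auto
 qed
 show "integ (%t. LI x. norm (case (t, x) of (t, x) => ?h t x))"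
 proof (rule bo_integrable_bound)
 show "integ (%t. indicator {0<..<T} t * E)" using T by (intro integrable_mult_left integrable_real_indicator) auto
 show "AE t in lborel. norm (LI x. norm (case (t, x) of (t, x) => ?h t x)) <= norm (indicator {0<..<T} t * E)"
 using n0
 proof eventually_elim
 case (elim t)
 show ?case
 proof (cases "t : {0<..<T} \<and> t <= T'")
 case True then show ?thesis using bound(2)[of t] E0 by simp
 next
 case False
 from zero[OF this elim] have "(%x. norm (?h t x)) = (%x. 0)" by (simp add: fun_eq_iff)
 then have "(LI x. norm (?h t x)) = 0" by (simp only: bo_integral_zero)
 then show ?thesis by simp
 qed
 qed
 qed measurable
 qed
 then show "sinteg K q" by (simp add: set_integrable_def lborel_prod case_prod_unfold)
qed

end

section \<open>Components of vector-valued test functions and assembly of the solution\<close>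

lemma ddir_vec_nth: "smooth ph ==> ddir v (%z. ph z $ j) = (%z. ddir v ph z $ j)" for ph :: "'a::real_normed_vector => real^3"
 by (intro ext ddir_linear_comp[OF bounded_linear_vec_nth] smooth_differentiable)

lemma spacetime_test_functions_components:
 assumes "ph : spacetime_test_functions T"
 shows "(%z. ph z $ j) : TFT T"
 and "(vector_derivative (%s. ph (s, x)) (at t) + laplacian (%z. ph (t, z)) x) $ j = heat_op (%z. ph z $ j) (t, x)"
 and "divergence (%z. ph (t, z)) x = (SS j. dx j (%z. ph z $ j) (t, x))"
 and "v \<bullet> advect a (%z. ph (t, z)) x = (SS i k. a $ i * v $ k * dx i (%z. ph z $ k) (t, x))"
proof -
 have ph: "ph : TFT T" using assms by (simp add: spacetime_test_functions_def)
 note s = test_smooth[OF ph]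
 have n: "ddir v (%z. ph z $ j) = (%z. ddir v ph z $ j)" for v j by (rule ddir_vec_nth[OF s])
 have n2: "ddir w (%z. ddir v ph z $ j) = (%z. ddir w (ddir v ph) z $ j)" for v w j by (rule ddir_vec_nth[OF smooth_ddir[OF s]])
 show "(%z. ph z $ j) : TFT T" by (rule test_linear_comp[OF bounded_linear_vec_nth ph])
 have "vector_derivative (%s. ph (s, x)) (at t) = dt ph (t, x)" by (rule vector_derivative_at[OF dt_slice[OF s]])
 then show "(vector_derivative (%s. ph (s, x)) (at t) + laplacian (%z. ph (t, z)) x) $ j = heat_op (%z. ph z $ j) (t, x)"
 by (simp add: laplacian_slice[OF s] heat_op_def n n2 fun_cong[OF n] fun_cong[OF n2])
 show "divergence (%z. ph (t, z)) x = (SS j. dx j (%z. ph z $ j) (t, x))"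
 by (simp add: divergence_def pd_slice[OF s] fun_cong[OF n])
 show "v \<bullet> advect a (%z. ph (t, z)) x = (SS i k. a $ i * v $ k * dx i (%z. ph z $ k) (t, x))"
 by (subst sum.swap) (simp add: advect_def pd_slice[OF s] fun_cong[OF n] inner_vec_def sum_distrib_left mult_ac)
qed

context forcing
begin

text \<open>The identities proved for \<open>vel\<close> transfer because at each time in (0,T) the
  slices agree almost everywhere, and spatial integrals do not see the difference.\<close>

lemma
 assumes u0: "u0 : H_space" and Ym: "!!t. t : {0<..<T} ==> Y t : BM"
 and FY: "!!t i k. t : {0<..<T} ==> AE y in lborel. F i k (t, y) = Y t y $ i * Y t y $ k"
 shows stokes_velocity_cont_L2: "stokes_velocity u0 Y : cont_L2 {0..<T}"
 and stokes_velocity_solution: "(!!t. t : {0<..<T} ==> p t : BM) ==>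
 (!!t. t : {0<..<T} ==> pressure_at t (p t)) ==> distributional_stokes_solution T u0 Y (stokes_velocity u0 Y) p"
proof -
 have u0L: "u0 : L2" using u0 by (simp add: H_space_def)
 let ?u = "stokes_velocity u0 Y"
 note sv = stokes_velocity_AE[OF u0L Ym FY]
 have um: "(%x. ?u t x $ j) : BM" and ua: "AE x in lborel. ?u t x $ j = vel u0 t j x" if t: "0 < t" "t < T" for t j
 by (rule sv; (use t in simp)?)+
 show uc: "?u : cont_L2 {0..<T}"
 unfolding cont_L2_vec_iff
 proof
 fix j
 show "(%t x. ?u t x $ j) : cont_L2 {0..<T}"
 proof (rule cont_L2_cong_AE[OF vel_cont_L2[OF u0L]])
 fix t assume t: "t : {0..<T}"
 have u0j: "(%x. u0 x $ j) : BM" using u0L by (intro L2_measurable) (simp add: L2_vec_iff)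
 show "(%x. ?u t x $ j) : BM"
 using t um[of t j] u0j by (cases "t = 0") (auto simp: stokes_velocity_def)
 show "AE x in lborel. ?u t x $ j = vel u0 t j x"
 using t ua[of t j] by (cases "t = 0") (auto simp: stokes_velocity_def vel_def heat_flow_0 B_0)
 qed
 qed
 assume pm: "!!t. t : {0<..<T} ==> p t : BM" and pa: "!!t. t : {0<..<T} ==> pressure_at t (p t)"
 have uL: "(%x. ?u t x $ j) : L2" if "t : {0<..<T}" for t j
 using cont_L2_L2[OF uc, of t] that by (auto simp: L2_vec_iff)
 have vp: "(LI x. ?u t x $ j * g x) = (LI x. vel u0 t j x * g x)" if t: "t : {0<..<T}" and g: "g : BM" for t j g
 proof (rule integral_cong_AE)
 have vm: "(%x. vel u0 t j x) : BM" using cont_L2_L2[OF vel_cont_L2[OF u0L]] t by (intro L2_measurable) auto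
 show "(%x. ?u t x $ j * g x) : borel_measurable lborel" "(%x. vel u0 t j x * g x) : borel_measurable lborel"
 using um[of t j] t g vm by auto
 show "AE x in lborel. ?u t x $ j * g x = vel u0 t j x * g x"
 using ua[of t j] t by (auto elim: eventually_mono)
 qed
 show "distributional_stokes_solution T u0 Y ?u p"
 unfolding distributional_stokes_solution_def
 proof (intro conjI ballI)
 fix t assume t: "t : {0<..<T}"
 show "weakly_div_free (?u t)"
 unfolding weakly_div_free_def
 proof
 fix g :: "real^3 => real" assume g: "g : TF"
 note gL = test_L2[OF test_pd[OF g]]
 have "(LI x. ?u t x \<bullet> grad g x) = (SS j. LI x. ?u t x $ j * pd j g x)"
 unfolding inner_vec_def grad_def by (simp, intro bo_integral_sum L2_mult_integrable uL t gL)
 also have "... = (SS j. LI x. vel u0 t j x * pd j g x)" by (simp add: vp[OF t L2_measurable[OF gL]])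
 also have "... = 0" using t by (intro vel_div_free[OF u0] g) auto
 finally show "(LI x. ?u t x \<bullet> grad g x) = 0" .
 qed
 next
 fix ph assume ph: "ph : spacetime_test_functions T"
 note c = spacetime_test_functions_components[OF ph]
 define ps where "ps j = (%z. ph z $ j)" for j
 note c = c[folded ps_def]
 have pss: "smooth (ps j)" for j by (rule test_smooth[OF c(1)])
 define N where "N i k t y = newton_conv (%x. SS j. dx j (dx k (dx i (ps j))) (t, x)) y" for i k t y
 note V = vel_weak[where ps = ps, OF u0L c(1), folded N_def]
 have L: "(LI x. ?u t x \<bullet> (vector_derivative (%s. ph (s, x)) (at t) + laplacian (%z. ph (t, z)) x) + p t x * divergence (%z. ph (t, z)) x)
 = (SS j. LI x. vel u0 t j x * heat_op (ps j) (t, x)) + (SS i k. LI y. F i k (t, y) * N i k t y)"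
 if t: "t : {0<..<T}" for t
 proof -
 let ?g = "%x. SS j. dx j (ps j) (t, x)"
 have gT: "?g : TF" by (intro test_sum test_slice[OF test_ddir[OF c(1)]])
 have hL: "(%x. heat_op (ps j) (t, x)) : L2" for j by (rule test_L2[OF test_slice[OF test_heat_op[OF c(1)]]])
 have pL: "p t : L2" by (rule pressure_at_L2[OF pa[OF t] pm[OF t]])
 have "(LI x. ?u t x \<bullet> (vector_derivative (%s. ph (s, x)) (at t) + laplacian (%z. ph (t, z)) x) + p t x * divergence (%z. ph (t, z)) x)
 = (LI x. (SS j. ?u t x $ j * heat_op (ps j) (t, x)) + p t x * ?g x)"
 unfolding inner_vec_def c(2,3) by simp
 also have "... = (LI x. (SS j. ?u t x $ j * heat_op (ps j) (t, x))) + (LI x. p t x * ?g x)"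
 by (intro bo_integral_add bo_integrable_sum L2_mult_integrable uL t hL pL test_L2[OF gT])
 also have "(LI x. (SS j. ?u t x $ j * heat_op (ps j) (t, x))) = (SS j. LI x. ?u t x $ j * heat_op (ps j) (t, x))"
 by (intro bo_integral_sum L2_mult_integrable uL t hL)
 also have "... = (SS j. LI x. vel u0 t j x * heat_op (ps j) (t, x))" by (simp only: vp[OF t L2_measurable[OF hL]])
 also have "(LI x. p t x * ?g x) = (SS i k. LI y. F i k (t, y) * newton_conv (pd k (pd i ?g)) y)"
 by (rule pressure_at_pairing[OF pa[OF t] pm[OF t] gT])
 also have "... = (SS i k. LI y. F i k (t, y) * N i k t y)"
 proof -
 \<comment> \<open>The pressure is tested with the divergence of the test field; after commuting
   derivatives its second derivatives are exactly the density inside \<open>N\<close>.\<close>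
 have pp: "pd k (pd i ?g) = (%x. SS j. dx j (dx k (dx i (ps j))) (t, x))" for i k
 proof -
 have pg: "pd i (%x. SS j. g j (t, x)) = (%x. SS j. dx i (g j) (t, x))" if "!!j. smooth (g j)" for i and g :: "3 => real \<times> (real^3) => real"
 using pd_sum[of UNIV "%j x. g j (t, x)" i] smooth_slice[OF that] by (simp add: pd_slice[OF that])
 have pk: "pd k (pd i ?g) = (%x. SS j. dx k (dx i (dx j (ps j))) (t, x))"
 unfolding pg[OF smooth_ddir[OF pss]]
 by (rule pg[OF smooth_ddir[OF smooth_ddir[OF pss]]])
 have cm: "dx k (dx i (dx j (ps j))) = dx j (dx k (dx i (ps j)))" for j
 by (simp add: ddir_commute[OF pss, where v = "(0, axis i 1)" and w = "(0, axis j 1)"] ddir_commute[OF smooth_ddir[OF pss], where v = "(0, axis k 1)" and w = "(0, axis j 1)"])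
 show ?thesis unfolding pk by (intro ext sum.cong refl fun_cong[OF cm])
 qed
 show ?thesis unfolding pp N_def ..
 qed
 finally show ?thesis .
 qed
 have R: "(LI x. Y t x \<bullet> advect (Y t x) (%z. ph (t, z)) x) = (SS i k. LI y. F i k (t, y) * dx i (ps k) (t, y))"
 if t: "t : {0<..<T}" for t
 proof -
 have dL: "(%y. dx i (ps k) (t, y)) : L2" for i k by (rule test_L2[OF test_slice[OF test_ddir[OF c(1)]]])
 note [measurable] = L2_measurable[OF dL]
 have [measurable]: "(%x. Y t x $ i) : BM" for i using Ym[OF t] by (simp add: borel_measurable_vec_iff)
 have "(LI x. Y t x \<bullet> advect (Y t x) (%z. ph (t, z)) x) = (LI y. (SS i k. F i k (t, y) * dx i (ps k) (t, y)))"
 proof (rule integral_cong_AE)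
 have "AE y in lborel. \<forall>i\<in>UNIV. \<forall>k\<in>UNIV. F i k (t, y) = Y t y $ i * Y t y $ k"
 by (intro AE_finite_allI finite) (use FY[OF t] in auto)
 then show "AE y in lborel. Y t y \<bullet> advect (Y t y) (%z. ph (t, z)) y = (SS i k. F i k (t, y) * dx i (ps k) (t, y))"
 by eventually_elim (simp add: c(4))
 qed (unfold c(4), measurable)
 also have "... = (SS i k. LI y. F i k (t, y) * dx i (ps k) (t, y))"
 by (subst bo_integral_sum; (subst bo_integral_sum)?;
 intro bo_integrable_sum L2_mult_integrable F_L2 dL refl)
 finally show ?thesis .
 qed
 have I: "(LI x. u0 x \<bullet> ph (0, x)) = (SS j. LI y. u0 y $ j * ps j (0, y))"
 proof -
 have u0j: "(%x. u0 x $ j) : L2" for j using u0L by (simp add: L2_vec_iff)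
 have "(LI x. u0 x \<bullet> ph (0, x)) = (LI x. (SS j. u0 x $ j * ps j (0, x)))" by (simp add: inner_vec_def ps_def)
 then show ?thesis
 by (simp only:) (intro bo_integral_sum L2_mult_integrable u0j test_L2[OF test_slice[OF c(1)]])
 qed
 have LL: "(LINT t:{0<..<T}|lborel. LI x. 
 ?u t x \<bullet> (vector_derivative (%s. ph (s, x)) (at t) + laplacian (%z. ph (t, z)) x) + p t x * divergence (%z. ph (t, z)) x)
 = (LINT t:{0<..<T}|lborel. (SS j. LI x. vel u0 t j x * heat_op (ps j) (t, x)) + (SS i k. LI y. F i k (t, y) * N i k t y))"
 by (rule set_lebesgue_integral_cong) (use L in auto)
 have RR: "(LINT t:{0<..<T}|lborel. LI x. Y t x \<bullet> advect (Y t x) (%z. ph (t, z)) x)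
 = (LINT t:{0<..<T}|lborel. SS i k. LI y. F i k (t, y) * dx i (ps k) (t, y))"
 by (rule set_lebesgue_integral_cong) (use R in auto)
 show "(LI x. u0 x \<bullet> ph (0, x))
 + (LINT t:{0<..<T}|lborel. LI x. 
 ?u t x \<bullet> (vector_derivative (%s. ph (s, x)) (at t) + laplacian (%z. ph (t, z)) x)
 + p t x * divergence (%z. ph (t, z)) x)
 = - (LINT t:{0<..<T}|lborel. LI x. Y t x \<bullet> advect (Y t x) (%z. ph (t, z)) x)"
 unfolding I LL RR by (rule V(3))
 qed
qed

end

subsection \<open>Uniqueness of the pressure\<close>

text \<open>The derivative of the translates is integrated along h in [0,1]. Each intermediate
  translate is an admissible test function because its support stays in the compact set
  \<open>K\<close>. The lemma serves spatial shifts of the pressure and a shift in time for the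
  ordinary differential equation.\<close>

lemma shift_invariant:
 fixes f ph :: "'a::euclidean_space => real"
 assumes f: "f : L1_loc S" and zero: "!!\<eta>. \<eta> : test_functions S ==> (LI x. f x * ddir v \<eta> x) = 0"
 and ph: "smooth ph" and K: "compact K" "K \<subseteq> S" "!!h x. h : {0..1} ==> x \<notin> K ==> ph (x + h *\<^sub>R v) = 0"
 shows "(LI x. f x * ph x) = (LI x. f x * ph (x + v))"
proof -
 let ?d = "%h x. ddir v ph (x + h *\<^sub>R v)"
 have tr: "(%x. ph (x + h *\<^sub>R v)) : test_functions S" if "h : {0..1}" for h
 by (rule test_functionsI[OF _ K(1,2) K(3)[OF that]]) (rule smooth_affine[OF bounded_linear_ident ph])
 have dtr: "ddir v (%x. ph (x + h *\<^sub>R v)) = ?d h" for h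
 by (rule ext) (rule ddir_affine[OF bounded_linear_ident ph])
 have d0: "?d h x = 0" if "h : {0..1}" "x \<notin> K" for h x
 proof -
 have "ddir v (%x. ph (x + h *\<^sub>R v)) x = 0"
 by (rule ddir_zero_outside[OF compact_imp_closed[OF K(1)] _ that(2)]) (use K(3)[OF that(1)] in blast)
 then show ?thesis unfolding fun_cong[OF dtr] .
 qed
 have dc: "continuous_on UNIV (ddir v ph)" by (rule smooth_continuous_on[OF smooth_ddir[OF ph]])
 have [measurable]: "ddir v ph : BM" by (rule borel_measurable_continuous_onI[OF dc])
 have "bounded ((%z. ddir v ph (snd z + fst z *\<^sub>R v)) ` ({0..1} \<times> K))"
 by (intro compact_imp_bounded compact_continuous_image continuous_on_compose2[OF dc] continuous_intros compact_Times K) auto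
 then obtain C where C: "\<forall>y \<in> (%z. ddir v ph (snd z + fst z *\<^sub>R v)) ` ({0..1} \<times> K). norm y <= C"
 unfolding bounded_iff by blast
 have dC: "\<bar>?d h x\<bar> <= \<bar>C\<bar>" if "h : {0..1}" for h x
 proof (cases "x : K")
 case True
 then have "\<bar>?d h x\<bar> <= C" using C that by force
 then show ?thesis by simp
 qed (use d0[OF that] in simp)
 define k where "k x = indicator K x * f x" for x
 have k: "integ k" using f K by (simp add: L1_loc_def set_integrable_def k_def[abs_def])
 have [measurable]: "k : BM" using borel_measurable_integrable[OF k] by simp
 have kd: "k x * ?d h x = f x * ?d h x" if "h : {0..1}" for h x using d0[OF that] by (cases "x : K") (simp_all add: k_def)
 define Q where "Q h x = indicator {0..1::real} h * (k x * ?d h x)" for h x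
 have Qm: "(%(h, x). Q h x) : BM2" unfolding Q_def by measurable
 have Qle: "norm (Q h x) <= indicator {0..1} h * (\<bar>k x\<bar> * \<bar>C\<bar>)" for h x
 using dC by (auto simp: Q_def abs_mult indicator_def intro: mult_left_mono)
 have Qb: "integ (%x. indicator {0..1::real} h * (\<bar>k x\<bar> * \<bar>C\<bar>))" for h
 using k by (intro integrable_mult_right integrable_mult_left integrable_abs)
 have Qi: "integ (Q h)" for h
 proof (rule bo_integrable_bound[OF Qb])
 show "AE x in lborel. norm (Q h x) <= norm (indicator {0..1} h * (\<bar>k x\<bar> * \<bar>C\<bar>))"
 using Qle[of h] by (intro AE_I2) (simp add: order_trans[OF _ abs_ge_self])
 qed (unfold Q_def, measurable)
 have int: "integrable (LL) (%(h, x). Q h x)"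
 proof (rule Fubini_bound[OF Qm])
 show "integ (%h. indicator {0..1::real} h * (LI x. \<bar>k x\<bar> * \<bar>C\<bar>))"
 by (intro integrable_mult_left integrable_real_indicator) auto
 show "(LI x. norm (Q h x)) <= indicator {0..1} h * (LI x. \<bar>k x\<bar> * \<bar>C\<bar>)" for h
 unfolding integral_mult_right_zero[symmetric] by (intro integral_mono integrable_norm Qi Qle Qb)
 show "AE h in lborel. integ (%x. Q h x)" using Qi by simp
qed
 have ftc: "(LI h. Q h x) = f x * ph (x + v) - f x * ph x" for x
 proof -
 have "(LI h. indicator {0..1} h *\<^sub>R ?d h x) = ph (x + 1 *\<^sub>R v) - ph (x + 0 *\<^sub>R v)"
 by (rule integral_FTC_atLeastAtMost[where F = "%h. ph (x + h *\<^sub>R v)"])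
 (auto intro!: smooth_vector_derivative[OF ph] continuous_on_compose2[OF dc] continuous_intros)
 then have 1: "(LI h. indicator {0..1} h * ?d h x) = ph (x + v) - ph x" by simp
 have "(LI h. Q h x) = (LI h. f x * (indicator {0..1} h * ?d h x))"
 proof (intro bo_cong refl)
 fix h show "Q h x = f x * (indicator {0..1} h * ?d h x)" using kd[of h x] by (cases "h : {0..1}") (simp_all add: Q_def)
 qed
 then show ?thesis using 1 by (simp add: right_diff_distrib)
 qed
 have "(LI x. f x * ph (x + v) - f x * ph x) = (LI h. LI x. Q h x)"
 using lborel_pair.Fubini_integral[OF int] unfolding ftc .
 also have "... = (LINT h|(lborel :: real measure). 0)"
 proof (intro bo_cong refl)
 fix h :: real
 show "(LI x. Q h x) = 0"
 proof (cases "h : {0..1}")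
 case True
 have "(LI x. Q h x) = (LI x. f x * ?d h x)"
 using True by (intro bo_cong refl) (simp add: Q_def kd[OF True, unfolded mult_cancel_right])
 then show ?thesis using zero[OF tr[OF True]] unfolding fun_cong[OF dtr] by simp
 qed (simp add: Q_def)
 qed
 finally have e: "(LI x. f x * ph (x + v) - f x * ph x) = 0" by simp
 have fi: "integ (%x. f x * ph (x + h *\<^sub>R v))" if h: "h : {0..1}" for h
 proof -
 obtain D where D: "\<forall>x. \<bar>ph (x + h *\<^sub>R v)\<bar> <= D" using test_abs_bounded[OF tr[OF h]] by blast
 have m: "(%x. ph (x + h *\<^sub>R v)) : BM" by (rule test_measurable[OF tr[OF h]])
 have "integ (%x. k x * ph (x + h *\<^sub>R v))"
 proof (rule bo_integrable_bound[OF integrable_mult_left[OF integrable_abs[OF k], where c = "D"]])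
 show "AE x in lborel. norm (k x * ph (x + h *\<^sub>R v)) <= norm (\<bar>k x\<bar> * D)"
 using D by (intro AE_I2) (simp add: abs_mult mult_left_mono order_trans[OF _ abs_ge_self])
 qed (use m in measurable)
 also have "(%x. k x * ph (x + h *\<^sub>R v)) = (%x. f x * ph (x + h *\<^sub>R v))"
 proof
 fix x show "k x * ph (x + h *\<^sub>R v) = f x * ph (x + h *\<^sub>R v)" using K(3)[OF h, of x] by (cases "x : K") (simp_all add: k_def)
 qed
 finally show ?thesis .
 qed
 show ?thesis using e fi[of 0] fi[of 1] by simp
qed

lemma L1_loc_times_test:
 fixes f ph :: "'a::euclidean_space => real"
 assumes ph: "ph : test_functions S" and f: "!!K. compact K ==> K \<subseteq> S ==> sinteg K f"
 shows "integ (%x. f x * ph x)"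
proof -
 obtain K where K: "compact K" "K \<subseteq> S" "\<forall>z. z \<notin> K \<longrightarrow> ph z = 0" using test_support[OF ph] by blast
 obtain C where C: "\<forall>z. \<bar>ph z\<bar> <= C" using test_abs_bounded[OF ph] by blast
 have i: "integ (%z. indicator K z * f z)" using f[OF K(1,2)] by (simp add: set_integrable_def)
 have m: "ph : borel_measurable lborel" using test_measurable[OF ph] by simp
 have "integ (%z. indicator K z * f z * ph z)"
 proof (rule bo_integrable_bound[OF integrable_mult_left[OF integrable_abs[OF i], where c = C]])
 have "\<bar>indicator K z * f z * ph z\<bar> <= \<bar>\<bar>indicator K z * f z\<bar> * C\<bar>" for z
 unfolding abs_mult[of "indicator K z * f z"] using C by (intro order_trans[OF mult_left_mono abs_ge_self]) auto
 then show "AE z in lborel. norm (indicator K z * f z * ph z) <= norm (\<bar>indicator K z * f z\<bar> * C)"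
 by (intro AE_I2) (simp only: real_norm_def)
 qed (intro borel_measurable_times[OF borel_measurable_integrable[OF i] m])
 also have "(%z. indicator K z * f z * ph z) = (%z. f z * ph z)"
 proof
 fix z show "indicator K z * f z * ph z = f z * ph z" using K(3) by (cases "z : K") auto
 qed
 finally show ?thesis .
qed

text \<open>Local integrability gives measurability on compact sets only; the open strip is
  exhausted by compact cylinders, and the function is set to 0 outside.\<close>

lemma L1_loc_borel:
 fixes f :: "real \<times> (real^3) => real"
 assumes f: "f : L1_loc ({0<..<T} \<times> UNIV)"
 shows "(%z. indicator {0<..<T} (fst z) * f z) : BM"
proof -
 define K where "K n = {1 / real (Suc n)..T - 1 / real (Suc n)} \<times> cball (0::real^3) (real n)" for n
 have pos: "0 < 1 / real (Suc n)" for n by simp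
 have KS: "K n \<subseteq> {0<..<T} \<times> UNIV" for n
 proof
 fix z assume "z : K n"
 then have "1 / real (Suc n) <= fst z" "fst z <= T - 1 / real (Suc n)" by (auto simp: K_def)
 then have "0 < fst z" "fst z < T" using pos[of n] by linarith+
 then show "z : {0<..<T} \<times> UNIV" by (simp add: mem_Times_iff)
 qed
 show ?thesis
 proof (rule borel_measurable_LIMSEQ_real)
 fix n
 have "compact (K n)" unfolding K_def by (intro compact_Times) auto
 then have "integ (%z. indicator (K n) z *\<^sub>R f z)" using f KS[of n] by (simp add: L1_loc_def set_integrable_def)
 then show "(%z. indicator (K n) z * f z) : BM" using borel_measurable_integrable by fastforce
 next
 fix z :: "real \<times> (real^3)"
 show "(%n. indicator (K n) z * f z) ----> indicator {0<..<T} (fst z) * f z"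
 proof (cases "fst z : {0<..<T}")
 case True
 have "(%n. 1 / real (Suc n)) ----> 0" using LIMSEQ_inverse_real_of_nat by (simp add: inverse_eq_divide)
 then have "\<forall>\<^sub>F n in sequentially. 1 / real (Suc n) < min (fst z) (T - fst z)" using True by (intro order_tendstoD(2)) auto
 moreover have "\<forall>\<^sub>F n in sequentially. norm (snd z) <= real n" by (rule eventually_sequentiallyI[of "nat \<lceil>norm (snd z)\<rceil>"]) linarith
 ultimately have "\<forall>\<^sub>F n in sequentially. indicator (K n) z * f z = indicator {0<..<T} (fst z) * f z"
 proof eventually_elim
 case (elim n)
 then have "z : K n" unfolding K_def by (cases z) auto
 then show ?case using True by simp
 qed
 then show ?thesis by (rule tendsto_eventually)
 next
 case False
 have "z \<notin> K n" for n using KS[of n] False by auto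
 then show ?thesis using False by simp
 qed
 qed
qed

text \<open>For each shift the function is invariant outside a null set that depends on the shift.
  Fubini exchanges the quantifiers: for almost every point the value equals that at almost every
  spatial translate, and therefore the mean over any cube at the same time.\<close>

lemma constant_in_space:
 fixes \<pi> :: "real \<times> (real^3) => real"
 assumes \<pi>: "\<pi> : L1_loc ({0<..<T} \<times> UNIV)"
 and zero: "!!\<theta> j. \<theta> : test_functions ({0<..<T} \<times> UNIV) ==> (LI z. \<pi> z * dx j \<theta> z) = 0"
 shows "\<exists>c. AE z in lborel. fst z : {0<..<T} \<longrightarrow> \<pi> z = c (fst z)"
proof -
 let ?S = "{0<..<T} \<times> (UNIV :: (real^3) set)"
 define f where "f z = indicator {0<..<T} (fst z) * \<pi> z" for z
 have fm [measurable]: "f : BM" using L1_loc_borel[OF \<pi>] by (simp add: f_def[abs_def])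
 have fS: "f z = \<pi> z" if "z : ?S" for z using that by (auto simp: f_def)
 have \<pi>L: "sinteg K \<pi>" if "compact K" "K \<subseteq> ?S" for K using \<pi> that by (simp add: L1_loc_def)
 have fL: "sinteg K f" if "compact K" "K \<subseteq> ?S" for K
 proof -
 have "(%z. indicator K z *\<^sub>R \<pi> z) = (%z. indicator K z *\<^sub>R f z)"
 proof
 fix z show "indicator K z *\<^sub>R \<pi> z = indicator K z *\<^sub>R f z" using fS[of z] that(2) by (cases "z : K") auto
 qed
 then show ?thesis using \<pi>L[OF that] by (simp add: set_integrable_def)
 qed
 have dv: "(LI z. \<pi> z * ddir (0, h) \<eta> z) = 0" if \<eta>: "\<eta> : test_functions ?S" for h \<eta>
 proof -
 have d: "ddir (0, h) \<eta> z = (SS j. h $ j * dx j \<eta> z)" for z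
 proof -
 have lin: "linear (%w. frechet_derivative \<eta> (at z) w)"
 by (rule linear_frechet_derivative[OF smooth_differentiable[OF test_smooth[OF \<eta>]]])
 have "(0, h) = (SS j. (h $ j) *\<^sub>R (0 :: real, axis j 1 :: real^3))"
 by (simp add: prod_eq_iff fst_sum snd_sum basis_expansion scalar_mult_eq_scaleR[symmetric])
 then show ?thesis using linear_sum[OF lin, of "%j. (h $ j) *\<^sub>R (0, axis j 1)" UNIV] by (simp only: linear_cmul[OF lin] real_scaleR_def)
 qed
 have i: "integ (%z. h $ j * (\<pi> z * dx j \<eta> z))" for j
 by (intro integrable_mult_right L1_loc_times_test[OF test_ddir[OF \<eta>]] \<pi>L)
 have "(LI z. \<pi> z * ddir (0, h) \<eta> z) = (LI z. (SS j. h $ j * (\<pi> z * dx j \<eta> z)))"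
 unfolding d sum_distrib_left by (simp only: mult.left_commute)
 also have "... = (SS j. LI z. h $ j * (\<pi> z * dx j \<eta> z))" by (intro bo_integral_sum i)
 finally show ?thesis using zero[OF \<eta>] by simp
 qed
 have shift: "AE z in lborel. z : ?S \<longrightarrow> f z - f (z - (0, h)) = 0" for h
 proof (rule fundamental_lemma)
 show "open ?S" by (intro open_Times) auto
 have tS: "(%z. z - (0, h)) ` L \<subseteq> ?S" if "L \<subseteq> ?S" for L using that by auto
 have shint: "sinteg L (%z. f (z - (0, h)))" if L: "compact L" "L \<subseteq> ?S" for L
 proof -
 let ?L = "(%z. z - (0, h)) ` L"
 have cL: "compact ?L" using L(1) by (intro compact_continuous_image continuous_intros)
 have [measurable]: "?L : sets borel" using cL by (rule borel_compact)
 have "integ (%z. indicator ?L z * f z)"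
 using fL[OF cL tS[OF L(2)]] by (simp add: set_integrable_def)
 then have "integ (%z. (%z. indicator ?L z * f z) (z - (0, h)))"
 by (subst integrable_translate_iff) measurable
 moreover have "z - (0, h) : ?L \<longleftrightarrow> z : L" for z by (auto simp: image_iff)
 then have "indicator ?L (z - (0, h)) = (indicator L z :: real)" for z by (simp only: indicator_def)
 ultimately show ?thesis by (simp add: set_integrable_def)
 qed
 show "sinteg (cbox l u) (%z. f z - f (z - (0, h)))" if "cbox l u \<subseteq> ?S" for l u
 by (intro set_integral_diff fL shint compact_cbox that)
 fix ph :: "real \<times> (real^3) => real" assume ph: "ph : test_functions ?S"
 obtain K0 where K0: "compact K0" "K0 \<subseteq> ?S" "\<forall>z. z \<notin> K0 \<longrightarrow> ph z = 0" using test_support[OF ph] by blast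
 define K where "K = (%w. snd w - fst w *\<^sub>R (0, h)) ` ({0..1} \<times> K0)"
 have Kc: "compact K" unfolding K_def using K0(1) by (intro compact_continuous_image continuous_intros compact_Times) auto
 have KS: "K \<subseteq> ?S" unfolding K_def using K0(2) by force
 have K0K: "z : K" if "z + r *\<^sub>R (0, h) : K0" "r : {0..1}" for z r
 unfolding K_def by (rule image_eqI[of _ _ "(r, z + r *\<^sub>R (0, h))"]) (use that in auto)
 have phK: "ph (z + r *\<^sub>R (0, h)) = 0" if "r : {0..1}" "z \<notin> K" for r z using K0K[of z r] K0(3) that by blast
 have phm [measurable]: "ph : BM" by (rule test_measurable[OF ph])
 have \<pi>f: "\<pi> z * ph (z + r *\<^sub>R (0, h)) = f z * ph (z + r *\<^sub>R (0, h))" if "r : {0..1}" for z r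
 using phK[OF that, of z] fS[of z] KS by (cases "z : K") auto
 have "(LI z. \<pi> z * ph z) = (LI z. \<pi> z * ph (z + (0, h)))"
 by (rule shift_invariant[OF \<pi> dv test_smooth[OF ph] Kc KS phK])
 moreover have "(%z. \<pi> z * ph z) = (%z. f z * ph z)" "(%z. \<pi> z * ph (z + (0, h))) = (%z. f z * ph (z + (0, h)))"
 using \<pi>f[of 0] \<pi>f[of 1] by (simp_all add: fun_eq_iff zero_prod_def[symmetric])
 ultimately have "(LI z. f z * ph z) = (LI z. f z * ph (z + (0, h)))" by simp
 also have "... = (LI z. (%z. f z * ph (z + (0, h))) (z - (0, h)))"
 by (rule integral_translate[symmetric]) measurable
 finally have e: "(LI z. f z * ph z) = (LI z. f (z - (0, h)) * ph z)" by simp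
 show "(LI z. (f z - f (z - (0, h))) * ph z) = 0"
 using e L1_loc_times_test[OF ph fL] L1_loc_times_test[OF ph shint] by (simp add: left_diff_distrib)
 qed
 have ae': "AE h in lborel. AE z in lborel. fst z : {0<..<T} \<longrightarrow> f z = f (z - (0, h))"
 proof (rule AE_I2)
 fix h show "AE z in lborel. fst z : {0<..<T} \<longrightarrow> f z = f (z - (0, h))"
 using shift[of h] by eventually_elim (simp add: mem_Times_iff)
 qed
 have [measurable]: "(%w. fst w - (0, snd w)) : borel_measurable ((borel :: (real \<times> (real^3)) measure) \<Otimes>\<^sub>M borel)"
 unfolding borel_prod by (intro borel_measurable_continuous_onI continuous_intros)
 have [measurable]: "(%w. fst (fst w)) : borel_measurable ((borel :: (real \<times> (real^3)) measure) \<Otimes>\<^sub>M (borel :: (real^3) measure))"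
 unfolding borel_prod by (intro borel_measurable_continuous_onI continuous_intros)
 have ms: "{w : space ((lborel :: (real \<times> (real^3)) measure) \<Otimes>\<^sub>M lborel). fst (fst w) : {0<..<T} \<longrightarrow> f (fst w) = f (fst w - (0, snd w))} : sets ((lborel :: (real \<times> (real^3)) measure) \<Otimes>\<^sub>M lborel)"
 by measurable
 have ae: "AE z in lborel. AE h in lborel. fst z : {0<..<T} \<longrightarrow> f z = f (z - (0, h))"
 by (rule lborel_pair.AE_commute[where P = "%z h. fst z : {0<..<T} \<longrightarrow> f z = f (z - (0, h))", THEN iffD2, OF ms ae'])
 \<comment> \<open>The weight of a unit cube, of integral 1; \<open>c\<close> is the mean of
   \<open>f\<close> over this cube at a given time.\<close>
 define ind where "ind y = (indicator (cbox 0 One) y :: real)" for y :: "real^3"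
 have [measurable]: "ind : BM" unfolding ind_def by measurable
 have ind1: "(LI y. ind y) = 1" unfolding ind_def by simp
 define c where "c t = (LI y. ind y * f (t, y))" for t
 have "AE z in lborel. fst z : {0<..<T} \<longrightarrow> \<pi> z = c (fst z)"
 using ae
 proof eventually_elim
 case (elim z)
 show ?case
 proof
 assume z: "fst z : {0<..<T}"
 obtain t x where tx: "z = (t, x)" by (cases z)
 have m [measurable]: "(%y. ind y * f (t, y)) : BM" by measurable
 have mx: "(%h. ind (x - h) * f (t, x - h)) : borel_measurable lborel" by measurable
 have mz: "(%h. ind (x - h) * f z) : borel_measurable lborel" by measurable
 have "c t = (LI h. ind (x - h) * f (t, x - h))"
 unfolding c_def using integral_reflect[OF m, of x] by simp
 also have "... = (LI h. ind (x - h) * f z)"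
 proof (rule integral_cong_AE[OF mx mz])
 show "AE h in lborel. ind (x - h) * f (t, x - h) = ind (x - h) * f z"
 using elim by eventually_elim (use z in \<open>simp add: tx\<close>)
 qed
 also have "... = f z" using integral_reflect[of ind x] ind1 by simp
 finally show "\<pi> z = c (fst z)" using fS[of z] z tx by simp
 qed
 qed
 then show ?thesis by blast
qed

text \<open>A solution is defined by iterated integrals, but its pressure is only jointly locally
  integrable. The velocity is handled slice by slice, while the pressure term becomes one space-time
  integral, on which distributional arguments can act.\<close>

lemma solution_split:
 assumes T: "0 < T" and v: "v : cont_L2 {0..<T}" and q: "(%(t, x). q t x) : L1_loc ({0..<T} \<times> UNIV)"
 and ph: "ph : spacetime_test_functions T"
 shows "integ (%z. indicator {0<..<T} (fst z) * (q (fst z) (snd z) * (SS j. dx j (%z. ph z $ j) z)))"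
 and "sinteg {0<..<T} (%t. LI x. v t x $ j * heat_op (%z. ph z $ j) (t, x))"
 and "(LINT t:{0<..<T}|lborel. LI x. v t x \<bullet> (vector_derivative (%s. ph (s, x)) (at t) + laplacian (%z. ph (t, z)) x)
 + q t x * divergence (%z. ph (t, z)) x)
 = (SS j. LINT t:{0<..<T}|lborel. LI x. v t x $ j * heat_op (%z. ph z $ j) (t, x)) + (LI z. indicator {0<..<T} (fst z) * (q (fst z) (snd z) * (SS j. dx j (%z. ph z $ j) z)))"
proof -
 let ?I = "{0<..<T}" and ?r = "%z. indicator {0<..<T} (fst z) * (q (fst z) (snd z) * (SS j. dx j (%z. ph z $ j) z))"
 note c = spacetime_test_functions_components[OF ph]
 define D where "D z = (SS j. dx j (%z. ph z $ j) z)" for z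
 have DT: "D : TFT T" unfolding D_def[abs_def] by (intro test_sum test_ddir c(1))
 \<comment> \<open>The test functions reach into negative times, where nothing is known about
   \<open>q\<close>; the cut-off at 0 restores local integrability on their whole domain.\<close>
 have i: "sinteg K (%z. indicator {0..} (fst z) * q (fst z) (snd z))" if K: "compact K" "K \<subseteq> {..<T} \<times> UNIV" for K
 proof -
 have "compact (K \<inter> ({0..} \<times> UNIV))" "K \<inter> ({0..} \<times> UNIV) \<subseteq> {0..<T} \<times> UNIV" using K by (auto intro!: compact_Int_closed closed_Times)
 then have "integ (%z. indicator (K \<inter> ({0..} \<times> UNIV)) z * q (fst z) (snd z))"
 using q by (simp add: L1_loc_def set_integrable_def case_prod_unfold)
 also have "(%z. indicator (K \<inter> ({0..} \<times> UNIV)) z * q (fst z) (snd z)) = (%z. indicator K z *\<^sub>R (indicator {0..} (fst z) * q (fst z) (snd z)))"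
 by (auto simp: fun_eq_iff indicator_def)
 finally show ?thesis by (simp add: set_integrable_def)
 qed
 have fm: "(%z :: real \<times> (real^3). indicator ?I (fst z) :: real) : borel_measurable lborel" using fst_borel_measurable by measurable
 have req: "?r z = indicator ?I (fst z) * (indicator {0..} (fst z) * q (fst z) (snd z) * D z)" for z
 unfolding D_def by (auto simp: indicator_def)
 have i': "integ (%z. indicator {0..} (fst z) * q (fst z) (snd z) * D z)" by (rule L1_loc_times_test[OF DT i])
 show r: "integ ?r"
 unfolding req
 by (rule bo_integrable_bound[OF i'], rule borel_measurable_times[OF fm borel_measurable_integrable[OF i']])
 (auto simp: indicator_def)
 have vj: "(%t x. v t x $ j) : cont_L2 {0..<T}" for j using v by (simp add: cont_L2_vec_iff)
 show A: "sinteg ?I (%t. LI x. v t x $ j * heat_op (%z. ph z $ j) (t, x))" for j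
 by (rule cont_L2_pairing_integrable[OF T vj test_heat_op[OF c(1)]])
 define a where "a t = (SS j. LI x. v t x $ j * heat_op (%z. ph z $ j) (t, x))" for t
 have a: "integ (%t. indicator ?I t *\<^sub>R a t)"
 unfolding a_def scaleR_sum_right using A unfolding set_integrable_def by (rule bo_integrable_sum)
 have r': "integrable (LL) (%(t, x). ?r (t, x))" using r by (simp add: lborel_prod case_prod_unfold)
 have rm: "(%(t, x). ?r (t, x)) : BM2" by (rule borel_measurable_integrable[OF r'])
 \<comment> \<open>At a time where the pressure slice is not integrable, neither is its sum with the
   velocity part, and the Bochner integral takes the default value 0. Such times form a null
   set.\<close>
 let ?e = "%t. if integ (%x. ?r (t, x)) then indicator ?I t *\<^sub>R a t + (LI x. ?r (t, x)) else 0"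
 have e: "indicator ?I t *\<^sub>R (LI x. v t x \<bullet> (vector_derivative (%s. ph (s, x)) (at t) + laplacian (%z. ph (t, z)) x)
 + q t x * divergence (%z. ph (t, z)) x) = ?e t" for t
 proof (cases "t : ?I")
 case True
 have vi: "integ (%x. v t x $ j * heat_op (%z. ph z $ j) (t, x))" for j
 using cont_L2_L2[OF vj] True by (intro L2_mult_integrable test_L2[OF test_slice[OF test_heat_op[OF c(1)]]]) auto
 have si: "integ (%x. SS j. v t x $ j * heat_op (%z. ph z $ j) (t, x))" by (intro bo_integrable_sum vi)
 have sa: "(LI x. (SS j. v t x $ j * heat_op (%z. ph z $ j) (t, x))) = a t"
 unfolding a_def by (intro bo_integral_sum vi)
 have eq: "(%x. v t x \<bullet> (vector_derivative (%s. ph (s, x)) (at t) + laplacian (%z. ph (t, z)) x) + q t x * divergence (%z. ph (t, z)) x)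
 = (%x. (SS j. v t x $ j * heat_op (%z. ph z $ j) (t, x)) + ?r (t, x))"
 using True unfolding inner_vec_def c(2,3) by simp
 show ?thesis
 proof (cases "integ (%x. ?r (t, x))")
 case int: True
 show ?thesis unfolding eq bo_integral_add[OF si int] sa using True int by simp
 next
 case False
 have nf: "\<not> integ (%x. (SS j. v t x $ j * heat_op (%z. ph z $ j) (t, x)) + ?r (t, x))"
 proof
 assume "integ (%x. (SS j. v t x $ j * heat_op (%z. ph z $ j) (t, x)) + ?r (t, x))"
 from bo_integrable_diff[OF this si] False show False by (simp only: add_diff_cancel_left')
 qed
 show ?thesis unfolding eq not_integrable_integral_eq[OF nf] using False by (simp only: if_False scaleR_zero_right)
 qed
 qed simp
 have "AE t in lborel. integ (%x. ?r (t, x))" using lborel_pair.AE_integrable_fst'[OF r'] by simp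
 then have ae: "AE t in lborel. ?e t = indicator ?I t *\<^sub>R a t + (LI x. ?r (t, x))" by eventually_elim (simp only: if_True)
 have ri: "integ (%t. LI x. ?r (t, x))" using lborel_pair.integrable_fst[OF r'] by simp
 have am: "(%t. indicator ?I t *\<^sub>R a t + (LI x. ?r (t, x))) : borel_measurable lborel"
 by (intro borel_measurable_add borel_measurable_integrable a ri)
 have em: "?e : borel_measurable lborel"
 proof (rule measurable_If[OF am])
 show "{t : space lborel. integ (%x. ?r (t, x))} : sets lborel"
 using lborel.borel_measurable_lebesgue_integrable[OF rm] by (simp only: pred_def)
 qed simp
 have "(LI t. ?e t) = (LI t. indicator ?I t *\<^sub>R a t + (LI x. ?r (t, x)))"
 by (rule integral_cong_AE[OF em am ae])
 also have "... = (LI t. indicator ?I t *\<^sub>R a t) + (LI t. LI x. ?r (t, x))"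
 by (rule bo_integral_add[OF a ri])
 also have "(LI t. LI x. ?r (t, x)) = (LI z. ?r z)"
 using lborel_pair.integral_fst[OF r'] by (simp add: lborel_prod case_prod_unfold)
 also have "(LI t. indicator ?I t *\<^sub>R a t)
 = (SS j. LINT t:?I|lborel. LI x. v t x $ j * heat_op (%z. ph z $ j) (t, x))"
 unfolding a_def scaleR_sum_right set_lebesgue_integral_def using A unfolding set_integrable_def by (rule bo_integral_sum)
 finally show "(LINT t:?I|lborel. LI x. v t x \<bullet> (vector_derivative (%s. ph (s, x)) (at t) + laplacian (%z. ph (t, z)) x)
 + q t x * divergence (%z. ph (t, z)) x)
 = (SS j. LINT t:?I|lborel. LI x. v t x $ j * heat_op (%z. ph z $ j) (t, x)) + (LI z. ?r z)"
 unfolding set_lebesgue_integral_def e .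
qed

lemma difference_weak:
 assumes T: "0 < T" and u: "(u, p) : stokes_class T" "distributional_stokes_solution T u0 Y u p"
 and v: "(v, q) : stokes_class T" "distributional_stokes_solution T u0 Y v q" and ph: "ph : spacetime_test_functions T"
 shows "(SS j. LINT t:{0<..<T}|lborel. LI x. (v t x $ j - u t x $ j) * heat_op (%z. ph z $ j) (t, x))
 + (LI z. indicator {0<..<T} (fst z) * ((q (fst z) (snd z) - p (fst z) (snd z)) * (SS j. dx j (%z. ph z $ j) z))) = 0"
proof -
 let ?I = "{0<..<T}"
 have uc: "u : cont_L2 {0..<T}" "(%(t, x). p t x) : L1_loc ({0..<T} \<times> UNIV)" and vc: "v : cont_L2 {0..<T}" "(%(t, x). q t x) : L1_loc ({0..<T} \<times> UNIV)"
 using u(1) v(1) by (auto simp: stokes_class_def)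
 note U = solution_split[OF T uc ph] and V = solution_split[OF T vc ph]
 note c = spacetime_test_functions_components[OF ph]
 let ?A = "%v j. LINT t:?I|lborel. LI x. v t x $ j * heat_op (%z. ph z $ j) (t, x)"
 have A: "(LINT t:?I|lborel. LI x. (v t x $ j - u t x $ j) * heat_op (%z. ph z $ j) (t, x)) = ?A v j - ?A u j" for j
 proof -
 have L: "(%x. u t x $ j) : L2" "(%x. v t x $ j) : L2" if "t : ?I" for t
 using cont_L2_L2[OF uc(1), of t] cont_L2_L2[OF vc(1), of t] that by (auto simp: L2_vec_iff)
 have "(LINT t:?I|lborel. LI x. (v t x $ j - u t x $ j) * heat_op (%z. ph z $ j) (t, x))
 = (LINT t:?I|lborel. (LI x. v t x $ j * heat_op (%z. ph z $ j) (t, x)) - (LI x. u t x $ j * heat_op (%z. ph z $ j) (t, x)))"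
 proof (rule set_lebesgue_integral_cong, simp, intro allI impI)
 fix t assume t: "t : ?I"
 have hL: "(%x. heat_op (%z. ph z $ j) (t, x)) : L2" by (rule test_L2[OF test_slice[OF test_heat_op[OF c(1)]]])
 show "(LI x. (v t x $ j - u t x $ j) * heat_op (%z. ph z $ j) (t, x))
 = (LI x. v t x $ j * heat_op (%z. ph z $ j) (t, x)) - (LI x. u t x $ j * heat_op (%z. ph z $ j) (t, x))"
 unfolding left_diff_distrib by (intro bo_integral_diff L2_mult_integrable L hL t)
 qed
 also have "... = ?A v j - ?A u j" by (rule set_integral_diff(2)[OF V(2) U(2)])
 finally show ?thesis .
 qed
 have P: "(LI z. indicator ?I (fst z) * ((q (fst z) (snd z) - p (fst z) (snd z)) * (SS j. dx j (%z. ph z $ j) z)))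
 = (LI z. indicator ?I (fst z) * (q (fst z) (snd z) * (SS j. dx j (%z. ph z $ j) z)))
 - (LI z. indicator ?I (fst z) * (p (fst z) (snd z) * (SS j. dx j (%z. ph z $ j) z)))"
 unfolding left_diff_distrib right_diff_distrib by (rule bo_integral_diff[OF V(1) U(1)])
 have "(LI x. u0 x \<bullet> ph (0, x)) + ((SS j. ?A u j) + (LI z. indicator ?I (fst z) * (p (fst z) (snd z) * (SS j. dx j (%z. ph z $ j) z))))
 = (LI x. u0 x \<bullet> ph (0, x)) + ((SS j. ?A v j) + (LI z. indicator ?I (fst z) * (q (fst z) (snd z) * (SS j. dx j (%z. ph z $ j) z))))"
 unfolding U(3)[symmetric] V(3)[symmetric]
 using u(2) v(2) ph unfolding distributional_stokes_solution_def by simp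
 then show ?thesis unfolding A P sum_subtractf by linarith
qed

text \<open>With equal velocities only the pressure term of the difference survives. The test field
  \<theta> e_j has divergence d_j \<theta>, so each spatial derivative of the pressure difference
  vanishes as a distribution.\<close>

lemma pressure_unique:
 assumes T: "0 < T" and u: "(u, p) : stokes_class T" "distributional_stokes_solution T u0 Y u p"
 and v: "(v, q) : stokes_class T" "distributional_stokes_solution T u0 Y v q"
 and uv: "!!t. t : {0<..<T} ==> AE x in lborel. v t x = u t x"
 shows "\<exists>c :: real => real. AE (t, x) in lborel. t : {0<..<T} \<longrightarrow> q t x = p t x + c t"
proof -
 let ?I = "{0<..<T}" let ?S = "{0<..<T} \<times> (UNIV :: (real^3) set)"
 define \<pi> where "\<pi> z = q (fst z) (snd z) - p (fst z) (snd z)" for z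
 have \<pi>: "\<pi> : L1_loc ?S"
 unfolding L1_loc_def \<pi>_def[abs_def]
 proof (intro CollectI allI impI set_integral_diff)
 fix K assume K: "compact K" "K \<subseteq> ?S"
 have K': "K \<subseteq> {0..<T} \<times> UNIV" using K(2) by auto
 show "sinteg K (%z. q (fst z) (snd z))" "sinteg K (%z. p (fst z) (snd z))"
 using u(1) v(1) K(1) K' by (auto simp: stokes_class_def L1_loc_def case_prod_unfold)
 qed
 have zero: "(LI z. \<pi> z * dx j \<theta> z) = 0" if \<theta>: "\<theta> : test_functions ?S" for \<theta> j
 proof -
 let ?ph = "%z. \<theta> z *\<^sub>R (axis j 1 :: real^3)"
 have "?S \<subseteq> {..<T} \<times> UNIV" by auto
 then have "\<theta> : TFT T" using test_mono \<theta> by blast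
 then have ph: "?ph : spacetime_test_functions T"
 unfolding spacetime_test_functions_def by (rule test_linear_comp[OF bounded_linear_scaleR_left])
 have d: "(SS l. dx l (%z. ?ph z $ l) z) = dx j \<theta> z" for z
 proof -
 have "dx l (%z. ?ph z $ l) z = (if l = j then dx j \<theta> z else 0)" for l
 proof (cases "l = j")
 case False
 then have "(%z. ?ph z $ l) = (%z. 0)" by (simp add: axis_def)
 then show ?thesis using False by simp
 qed (simp add: axis_def)
 then show ?thesis by simp
 qed
 have w0: "(LINT t:?I|lborel. LI x. (v t x $ l - u t x $ l) * heat_op (%z. ?ph z $ l) (t, x)) = 0" for l
 proof -
 have "(LI x. (v t x $ l - u t x $ l) * heat_op (%z. ?ph z $ l) (t, x)) = 0" if t: "t : ?I" for t
 proof (rule integral_eq_zero_AE)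
 show "AE x in lborel. (v t x $ l - u t x $ l) * heat_op (%z. ?ph z $ l) (t, x) = 0" using uv[OF t] by eventually_elim simp
 qed
 then show ?thesis unfolding set_lebesgue_integral_def by (intro integral_eq_zero_AE AE_I2) (auto simp: indicator_def)
 qed
 have "(LI z. indicator ?I (fst z) * (\<pi> z * dx j \<theta> z)) = 0"
 using difference_weak[OF T u v ph] unfolding d w0 \<pi>_def by simp
 moreover have "indicator ?I (fst z) * (\<pi> z * dx j \<theta> z) = \<pi> z * dx j \<theta> z" for z
 proof (cases "z : ?S")
 case False
 obtain K where K: "K \<subseteq> ?S" "\<forall>z. z \<notin> K \<longrightarrow> dx j \<theta> z = 0" using test_support[OF test_ddir[OF \<theta>]] by blast
 then have "dx j \<theta> z = 0" using False by blast
 then show ?thesis by simp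
 qed auto
 ultimately show ?thesis by simp
 qed
 obtain c where "AE z in lborel. fst z : ?I \<longrightarrow> \<pi> z = c (fst z)" using constant_in_space[OF \<pi> zero] by blast
 then have "AE (t, x) in lborel. t : ?I \<longrightarrow> q t x = p t x + c t"
 by eventually_elim (auto simp: \<pi>_def)
 then show ?thesis by blast
qed

subsection \<open>Uniqueness of the velocity\<close>

text \<open>Test functions need not vanish at 0, so the identity encodes a(0) = 0 together with a' =
  b. Subtracting the primitive of \<open>b\<close> and extending by 0 to negative times leaves a
  function with zero distributional derivative on all times below \<open>T\<close>; it vanishes for
  negative times, hence almost everywhere, and continuity concludes.\<close>

lemma weak_ode:
 fixes a b :: "real => real"
 assumes T: "0 < T" and a: "continuous_on {0..<T} a" and b: "continuous_on {0..<T} b"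
 and weak: "!!\<eta>. \<eta> : test_functions {..<T} ==> (LINT t:{0<..<T}|lborel. ddir 1 \<eta> t * a t + \<eta> t * b t) = 0"
 and t: "t : {0..<T}"
 shows "a t = integral {0..t} b"
proof -
 define B where "B t = integral {0..t} b" for t
 define c where "c t = a t - B t" for t
 define f where "f t = indicator {0<..<T} t * c t" for t
 have sub: "continuous_on {0..r} a" "continuous_on {0..r} b" if "r < T" for r
 by (rule continuous_on_subset[OF a], use that in auto, rule continuous_on_subset[OF b], use that in auto)
 have dB: "(B has_real_derivative b s) (at s within {0..r})" if "r < T" "s : {0..r}" for s r
 unfolding B_def using integral_has_real_derivative[OF sub(2)[OF that(1)] that(2)] .
 have Bc: "continuous_on {0..r} B" if "r < T" for r
 unfolding continuous_on_eq_continuous_within using DERIV_continuous[OF dB[OF that]] by blast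
 have cc: "continuous_on {0..r} c" if "r < T" for r unfolding c_def by (intro continuous_on_diff sub(1) Bc that)
 have fL: "f : L1_loc {..<T}"
 unfolding L1_loc_def
 proof (intro CollectI allI impI)
 fix K :: "real set" assume K: "compact K" "K \<subseteq> {..<T}"
 have "compact (insert 0 K)" using K(1) by (rule compact_insert)
 then obtain r where r: "r : insert 0 K" "\<forall>s\<in>insert 0 K. s <= r" using compact_attains_sup[of "insert 0 K"] by blast
 then have "r < T" using K(2) T by auto
 from borel_integrable_atLeastAtMost'[OF cc[OF this]] have i: "sinteg {0..r} c" .
 have [measurable]: "K : sets borel" using K(1) by (rule borel_compact)
 have "sinteg (K \<inter> {0<..<T}) c"
 by (rule set_integrable_subset[OF i]) (use r in \<open>auto simp: less_imp_le\<close>)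
 then show "sinteg K f" by (simp add: set_integrable_def f_def indicator_inter_arith mult.assoc)
 qed
 have zero1: "(LI x. f x * ddir 1 \<eta> x) = 0" if \<eta>: "\<eta> : test_functions {..<T}" for \<eta>
 proof -
 obtain K where K: "compact K" "K \<subseteq> {..<T}" "!!s. s \<notin> K ==> \<eta> s = 0" "!!s v. s \<notin> K ==> ddir v \<eta> s = 0" by (rule test_functionsE[OF \<eta>]) (rule that; assumption)
 have "compact (insert 0 K)" using K(1) by (rule compact_insert)
 then obtain m where m: "m : insert 0 K" "\<forall>s\<in>insert 0 K. s <= m" using compact_attains_sup[of "insert 0 K"] by blast
 then have "m < T" using K(2) T by auto
 then obtain r where r: "m < r" "r < T" using dense by blast
 have r0: "0 < r" using m r by force
 have out: "s \<notin> K" if "r <= s" for s using m(2) r(1) that by force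
 have \<eta>s: "smooth \<eta>" by (rule test_smooth[OF \<eta>])
 have \<eta>d: "(\<eta> has_vector_derivative ddir 1 \<eta> s) (at s within S)" for s S using smooth_vector_derivative[OF \<eta>s, of 0 1 s S] by simp
 have \<eta>c: "continuous_on S \<eta>" "continuous_on S (ddir 1 \<eta>)" for S
 using smooth_continuous_on[OF \<eta>s] smooth_continuous_on[OF smooth_ddir[OF \<eta>s]] by blast+
 let ?g1 = "%t. ddir 1 \<eta> t * a t + \<eta> t * b t" and ?g2 = "%t. ddir 1 \<eta> t * B t + \<eta> t * b t"
 have cut: "(LINT t:{0<..<T}|lborel. g t) = (LINT t:{0..r}|lborel. g t)" if "!!t. t \<notin> K ==> g t = 0" for g :: "real => real"
 unfolding set_lebesgue_integral_def
 proof (rule integral_discrete_difference[of "{0}"])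
 fix s :: real assume "s \<notin> {0}"
 then show "indicator {0<..<T} s *\<^sub>R g s = indicator {0..r} s *\<^sub>R g s" using that[OF out, of s] r(2) by (auto simp: indicator_def)
 qed auto
 have i1: "sinteg {0..r} ?g1" by (intro borel_integrable_atLeastAtMost' continuous_intros \<eta>c sub r)
 have i2: "sinteg {0..r} ?g2" by (intro borel_integrable_atLeastAtMost' continuous_intros \<eta>c sub Bc r)
 have "(LI t. indicator {0..r} t *\<^sub>R ?g2 t) = \<eta> r * B r - \<eta> 0 * B 0"
 proof (rule integral_FTC_atLeastAtMost)
 fix s assume "0 <= s" "s <= r"
 then have "((%t. \<eta> t * B t) has_vector_derivative \<eta> s * b s + ddir 1 \<eta> s * B s) (at s within {0..r})"
 using has_vector_derivative_mult[OF \<eta>d dB[OF r(2), unfolded has_real_derivative_iff_has_vector_derivative]] by simp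
 then show "((%t. \<eta> t * B t) has_vector_derivative ?g2 s) (at s within {0..r})" by (simp add: add.commute)
 qed (use r0 in \<open>auto intro!: continuous_intros \<eta>c sub Bc r\<close>)
 also have "... = 0" using K(3)[OF out, of r] by (simp add: B_def)
 finally have g2: "(LINT t:{0..r}|lborel. ?g2 t) = 0" by (simp add: set_lebesgue_integral_def)
 have g1: "(LINT t:{0..r}|lborel. ?g1 t) = 0" using cut[of ?g1] weak[OF \<eta>] K(3,4) by simp
 have "(LI x. f x * ddir 1 \<eta> x) = (LINT t:{0<..<T}|lborel. ddir 1 \<eta> t * c t)"
 unfolding set_lebesgue_integral_def f_def by (intro bo_cong refl) simp
 also have "... = (LINT t:{0..r}|lborel. ddir 1 \<eta> t * c t)" by (rule cut) (simp add: K(4))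
 also have "... = (LINT t:{0..r}|lborel. ?g1 t - ?g2 t)" by (simp add: c_def algebra_simps)
 also have "... = 0" unfolding set_integral_diff(2)[OF i1 i2] g1 g2 by simp
 finally show ?thesis .
 qed
 have "AE x in lborel. x : {..<T} \<longrightarrow> f x = 0"
 proof (rule fundamental_lemma)
 show "sinteg (cbox l u) f" if "cbox l u \<subseteq> {..<T}" for l u using fL that compact_cbox[of l u] unfolding L1_loc_def by blast
 fix ph :: "real => real" assume ph: "ph : test_functions {..<T}"
 obtain K where K: "compact K" "K \<subseteq> {..<T}" "\<forall>s. s \<notin> K \<longrightarrow> ph s = 0" using test_support[OF ph] by blast
 obtain M where M: "\<forall>s\<in>K. \<bar>s\<bar> <= M" using compact_imp_bounded[OF K(1)] unfolding bounded_iff real_norm_def by blast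
 \<comment> \<open>The shift by \<open>L\<close> pushes the support of \<open>ph\<close> into the
   times t <= 0, where \<open>f\<close> is 0.\<close>
 define L where "L = \<bar>M\<bar>"
 define K' where "K' = (%z. snd z - fst z *\<^sub>R L) ` ({0..1} \<times> K)"
 have c': "compact K'" unfolding K'_def using K(1) by (intro compact_continuous_image continuous_intros compact_Times) auto
 have s': "K' \<subseteq> {..<T}"
 proof
 fix x assume "x : K'"
 then obtain h y where hy: "h : {0..1}" "y : K" "x = y - h * L" unfolding K'_def by auto
 have "0 <= h * L" using hy(1) by (simp add: L_def)
 then show "x : {..<T}" using K(2) hy by auto
 qed
 have z': "ph (x + h *\<^sub>R L) = 0" if "h : {0..1}" "x \<notin> K'" for h x
 proof -
 have "x + h *\<^sub>R L \<notin> K"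
 proof
 assume "x + h *\<^sub>R L : K"
 then have "x : K'" unfolding K'_def using that(1) by (intro image_eqI[of _ _ "(h, x + h *\<^sub>R L)"]) auto
 then show False using that(2) by simp
 qed
 then show ?thesis using K(3) by simp
 qed
 have "(LI x. f x * ph x) = (LI x. f x * ph (x + L))"
 proof (rule shift_invariant[OF fL _ test_smooth[OF ph] c' s' z'])
 fix \<eta> :: "real => real" assume \<eta>: "\<eta> : test_functions {..<T}"
 have "ddir L \<eta> x = L * ddir 1 \<eta> x" for x
 using linear_cmul[OF linear_frechet_derivative[OF smooth_differentiable[OF test_smooth[OF \<eta>]]], of x L 1] by simp
 then show "(LI x. f x * ddir L \<eta> x) = 0" using zero1[OF \<eta>] by (simp add: mult.left_commute)
 qed
 also have "(%x. f x * ph (x + L)) = (%x. 0)"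
 proof
 fix x
 show "f x * ph (x + L) = 0"
 proof (cases "0 < x")
 case True
 then have "x + L \<notin> K" using M by (force simp: L_def)
 then show ?thesis using K(3) by simp
 qed (simp add: f_def)
 qed
 finally show "(LI x. f x * ph x) = 0" by simp
 qed simp
 then have ae: "AE x in lborel. x \<notin> {x : {0<..<T}. c x ~= 0}" by eventually_elim (auto simp: f_def)
 \<comment> \<open>By continuity the set where \<open>c\<close> is nonzero is open; being a null set
   as well, it is empty.\<close>
 define N where "N = {x : {0<..<T}. c x ~= 0}"
 have cI: "continuous_on {0<..<T} c"
 proof (rule continuous_on_subset)
 show "continuous_on {0..<T} c"
 unfolding continuous_on_eq_continuous_within
 proof
 fix s assume s: "s : {0..<T}"
 then obtain r where r: "s < r" "r < T" using dense by auto
 have "continuous (at s within {0..r}) c" using cc[OF r(2)] s r by (simp add: continuous_on_eq_continuous_within)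
 moreover have "at s within {0..r} = at s within {0..<T}"
 by (rule at_within_nhd[of _ "{..<r}"]) (use s r in auto)
 ultimately show "continuous (at s within {0..<T}) c" by simp
 qed
 qed auto
 have "open N"
 proof -
 have "open (c -` (- {0}) \<inter> {0<..<T})"
 using continuous_on_open_vimage[OF open_greaterThanLessThan, of 0 T c] cI open_Compl[OF closed_singleton[of "0::real"]] by blast
 moreover have "N = c -` (- {0}) \<inter> {0<..<T}" by (auto simp: N_def)
 ultimately show ?thesis by simp
 qed
 then have "N : null_sets lborel" using ae by (subst AE_iff_null_sets) (auto simp: N_def)
 then have "negligible N" using null_sets_completionI negligible_iff_null_sets by blast
 then have N0: "N = {}" using open_not_negligible[OF \<open>open N\<close>] by blast
 have "c t = 0"
 proof (rule continuous_constant_on_closure[of "{0<..<(t + T) / 2}" c])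
 have "(t + T) / 2 < T" "0 < (t + T) / 2" "t <= (t + T) / 2" using t by auto
 then show "continuous_on (closure {0<..<(t + T) / 2}) c" "t : closure {0<..<(t + T) / 2}" using cc t by (simp_all add: closure_greaterThanLessThan)
 show "c x = 0" if "x : {0<..<(t + T) / 2}" for x
 using N0 that t by (force simp: N_def)
 qed
 then show ?thesis by (simp add: c_def B_def)
qed

lemma cont_L2_pairing_continuous:
 fixes u :: "real => real^3 => real"
 assumes u: "u : cont_L2 I" and g: "g : L2" shows "continuous_on I (%t. LI x. u t x * g x)"
 unfolding continuous_on_def
proof
 fix t assume t: "t : I"
 show "((%s. LI x. u s x * g x) \<longlongrightarrow> (LI x. u t x * g x)) (at t within I)"
 proof (rule Lim_null[THEN iffD2], rule Lim_null_comparison)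
 have "norm ((LI x. u s x * g x) - (LI x. u t x * g x)) <= L2_norm (%x. u s x - u t x) * L2_norm g" if "s : I" for s
 proof -
 note L = cont_L2_L2[OF u that] cont_L2_L2[OF u t]
 have "(LI x. u s x * g x) - (LI x. u t x * g x) = (LI x. (u s x - u t x) * g x)"
 using L2_mult_integrable[OF L(1) g] L2_mult_integrable[OF L(2) g] by (simp add: left_diff_distrib)
 then show ?thesis using L2_Cauchy_Schwarz[OF L2_diff[OF L] g] by simp
 qed
 then show "\<forall>\<^sub>F s in at t within I. norm ((LI x. u s x * g x) - (LI x. u t x * g x)) <= L2_norm (%x. u s x - u t x) * L2_norm g"
 by (auto simp: eventually_at intro!: exI[of _ 1])
 show "((%s. L2_norm (%x. u s x - u t x) * L2_norm g) \<longlongrightarrow> 0) (at t within I)"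
 using u t by (intro tendsto_mult_left_zero) (simp add: cont_L2_def)
 qed
qed

section \<open>Contraction, differentiation and decay of the heat semigroup\<close>

lemma heat_flow_L2: "f : L2 ==> 0 <= t ==> heat_flow f t : L2"
 using cont_L2_L2[OF heat_flow_cont_L2] by simp

lemma heat_flow_norm_le:
 assumes f: "f : L2" and t: "0 < t" shows "L2_norm (heat_flow f t) <= L2_norm f"
proof -
 have "heat_flow f t = (%x. LI y. heat t (y - x) * f y)"
 by (rule ext) (rule heat_flow_eq[OF t L2_measurable[OF f]])
 then show ?thesis using L2_conv_norm[OF heat_integrable[OF t] f] by (simp add: heat_nonneg[OF t] heat_integral[OF t])
qed

text \<open>Duhamel's identity for a test function that is constant in time, integrated against
  \<open>f\<close>.\<close>

lemma heat_pairing_increment: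
 assumes f: "f : L2" and g: "g : TF" and ab: "0 < \<alpha>" "\<alpha> <= \<beta>"
 shows "(LI x. heat_flow g \<beta> x * f x) - (LI x. heat_flow g \<alpha> x * f x)
 = (LINT b:{\<alpha>..\<beta>}|lborel. LI x. heat_flow (laplacian g) b x * f x)"
proof -
 have lg: "laplacian g : TF" by (rule test_laplacian[OF g])
 note gL = test_L2[OF g] and lgL = test_L2[OF lg]
 have [measurable]: "laplacian g : BM" by (rule L2_measurable[OF lgL])
 \<comment> \<open>The maximum with \<alpha> keeps every slice in \<open>L2\<close> with one bound
   for all real \<open>b\<close>; below \<alpha> the weight \<open>?k\<close> vanishes.\<close>
 let ?F = "%b x. heat_flow (laplacian g) (max \<alpha> b) x"
 let ?k = "%b. indicator {\<alpha>..\<beta>} b :: real"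
 have FL: "?F b : L2" "L2_norm (?F b) <= L2_norm (laplacian g)" for b
 using ab by (auto intro!: heat_flow_L2[OF lgL] heat_flow_norm_le[OF lgL])
 have Fm: "(%(b, x). ?F b x) : BM2" unfolding heat_flow_def by measurable
 have k: "integ ?k" using ab by (intro integrable_real_indicator) auto
 have kF: "integ (%b. \<bar>?k b\<bar> * (L2_norm (?F b))\<^sup>2)"
 by (rule L2_integral_bounded_integrable[OF sigma_finite_lborel k Fm FL])
 have pw: "heat_flow g \<beta> y - heat_flow g \<alpha> y = (LI b. ?k b * ?F b y)" for y
 proof -
 obtain K where K: "compact K" "!!x. x \<notin> K ==> g x = 0" using test_functionsE[OF g] by metis
 have gc: "continuous_on S g" for S by (rule test_continuous[OF g])
 have "(LINT t:{\<alpha>..\<beta>}|lborel. LI x. heat t (x - y) * (0 + laplacian g x))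
 = (LI x. heat \<beta> (x - y) * g x) - (LI x. heat \<alpha> (x - y) * g x)"
 proof (rule heat_sol.duhamel[where g = "%t. g" and g' = "%t x. 0", OF ab g _ _ _ K(1)])
 show "continuous_on ({\<alpha>..\<beta>} \<times> UNIV) (%(t, x). g x)" unfolding case_prod_unfold by (intro continuous_on_compose2[OF gc[of UNIV]] continuous_intros) auto
 qed (use K(2) in auto)
 also have "... = heat_flow g \<beta> y - heat_flow g \<alpha> y" using ab L2_measurable[OF gL] by (simp add: heat_flow_eq)
 finally have 1: "heat_flow g \<beta> y - heat_flow g \<alpha> y = (LINT t:{\<alpha>..\<beta>}|lborel. LI x. heat t (x - y) * (0 + laplacian g x))" ..
 show ?thesis
 unfolding 1 set_lebesgue_integral_def using ab
 by (intro bo_cong refl) (auto simp: indicator_def max_def heat_flow_eq)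
 qed
 have "(LI x. heat_flow g \<beta> x * f x) - (LI x. heat_flow g \<alpha> x * f x) = (LI x. (heat_flow g \<beta> x - heat_flow g \<alpha> x) * f x)"
 using ab L2_mult_integrable[OF heat_flow_L2[OF gL] f] by (simp add: left_diff_distrib)
 also have "... = (LI b. ?k b * (LI x. ?F b x * f x))"
 unfolding pw by (rule L2_integral(5)[OF sigma_finite_lborel Fm k FL(1) kF f])
 also have "... = (LINT b:{\<alpha>..\<beta>}|lborel. LI x. heat_flow (laplacian g) b x * f x)"
 unfolding set_lebesgue_integral_def by (intro bo_cong refl) (auto simp: indicator_def max_def)
 finally show ?thesis .
qed

lemma heat_pairing_deriv:
 assumes f: "f : L2" and g: "g : TF" and b: "0 < b"
 shows "((%b. LI x. heat_flow g b x * f x) has_real_derivative (LI x. heat_flow (laplacian g) b x * f x)) (at b)"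
proof -
 let ?P = "%b. LI x. heat_flow g b x * f x" and ?Q = "%b. LI x. heat_flow (laplacian g) b x * f x"
 let ?J = "{b / 2..2 * b}"
 have Qc: "continuous_on {0..} ?Q"
 by (rule cont_L2_pairing_continuous[OF heat_flow_cont_L2 f]) (rule test_L2[OF test_laplacian[OF g]])
 have QJ: "continuous_on S ?Q" if "S \<subseteq> {0..}" for S by (rule continuous_on_subset[OF Qc that])
 have eq: "?P (b / 2) + integral {b / 2..c} ?Q = ?P c" if "c : ?J" for c
 proof -
 have "sinteg {b / 2..c} ?Q" using b by (intro borel_integrable_atLeastAtMost' QJ) auto
 then show ?thesis using heat_pairing_increment[OF f g, of "b / 2" c] b that by (simp add: set_borel_integral_eq_integral(2))
 qed
 have "((%c. ?P (b / 2) + integral {b / 2..c} ?Q) has_real_derivative 0 + ?Q b) (at b within ?J)"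
 by (intro DERIV_add DERIV_const integral_has_real_derivative QJ) (use b in auto)
 then have "(?P has_real_derivative 0 + ?Q b) (at b within ?J)"
 by (rule has_field_derivative_transform_within[OF _ zero_less_one]) (use b eq in auto)
 then show ?thesis using b by (simp add: at_within_Icc_at)
qed

text \<open>Young's inequality is used with the roles exchanged, the test function in
  \<open>L1\<close> and the heat kernel in \<open>L2\<close>. The squared \<open>L2\<close> norm of
  the kernel is at most its supremum times its mass, and 1/t is a sufficient bound for t >=
  1.\<close>

lemma heat_flow_decay:
 assumes g: "g : TF" shows "((%t. L2_norm (heat_flow g t)) \<longlongrightarrow> 0) at_top"
proof (rule Lim_null_comparison)
 let ?k = "%z. g (0 - z)"
 have gm [measurable]: "g : BM" by (rule test_measurable[OF g])
 have k: "integ ?k" using test_integrable[OF g] integrable_reflect_iff[OF gm, of 0] by simp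
 show "\<forall>\<^sub>F t in at_top. norm (L2_norm (heat_flow g t)) <= (LI z. \<bar>?k z\<bar>) * sqrt (1 / t)"
 proof (rule eventually_at_top_linorderI[of 1])
 fix t :: real assume "1 <= t"
 then have t: "0 < t" "1 <= sqrt t" by auto
 have "1 <= 8 * pi * sqrt pi" using mult_mono[of 1 "8 * pi" 1 "sqrt pi"] pi_gt3 by simp
 then have "1 * (t * 1) <= 8 * pi * sqrt pi * (t * sqrt t)" using t by (intro mult_mono) auto
 then have le: "heat t x <= 1 / t" for x
 using heat_le[OF t(1), of x] t by (elim order_trans) (simp add: frac_le)
 have sq: "(heat t x)\<^sup>2 <= heat t x * (1 / t)" for x
 unfolding power2_eq_square by (intro mult_left_mono le heat_nonneg t)
 have hi: "integ (%x. heat t x * (1 / t))" by (intro integrable_mult_left heat_integrable t)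
 have hL: "heat t : L2"
 unfolding L2_real_iff
 proof
 show "integ (%x. (heat t x)\<^sup>2)"
 by (rule bo_integrable_bound[OF hi]) (use sq heat_nonneg[OF t(1)] t(1) in auto)
 qed measurable
 have "(L2_norm (heat t))\<^sup>2 <= (LI x. heat t x * (1 / t))"
 unfolding L2_norm_sq by (rule integral_mono[OF _ hi sq]) (use hL in \<open>simp add: L2_real_iff\<close>)
 then have "(L2_norm (heat t))\<^sup>2 <= 1 / t" using heat_integral[OF t(1)] by simp
 then have n: "L2_norm (heat t) <= sqrt (1 / t)" by (rule real_le_rsqrt)
 have "heat_flow g t x = (LI z. ?k (z - x) * heat t z)" for x
 proof -
 have "(LI y. (%z. g (x - z) * heat t z) (x - y)) = (LI z. g (x - z) * heat t z)"
 by (rule integral_reflect) measurable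
 then show ?thesis using heat_flow_eq[OF t(1) gm, of x] by (simp add: heat_diff_commute[of t x] mult.commute)
 qed
 then have "L2_norm (heat_flow g t) <= (LI z. \<bar>?k z\<bar>) * L2_norm (heat t)"
 using L2_conv_norm[OF k hL] by presburger
 also have "... <= (LI z. \<bar>?k z\<bar>) * sqrt (1 / t)" by (intro mult_left_mono n bo_integral_nonneg) simp
 finally show "norm (L2_norm (heat_flow g t)) <= (LI z. \<bar>?k z\<bar>) * sqrt (1 / t)" by simp
 qed
 have "((%t :: real. sqrt (1 / t)) \<longlongrightarrow> sqrt 0) at_top"
 by (intro tendsto_intros tendsto_divide_0[OF tendsto_const] filterlim_at_top_imp_at_infinity filterlim_ident)
 then show "((%t. (LI z. \<bar>?k z\<bar>) * sqrt (1 / t)) \<longlongrightarrow> 0) at_top" by (intro tendsto_mult_right_zero) simp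
qed

text \<open>The identity \<open>eq\<close> holds for every translate of the test functions;
  integrating it over the shift with Gaussian weight replaces both by their heat flows. The exchange
  with the time integral uses a jointly measurable representative of \<open>w\<close>.\<close>

lemma heat_average:
 assumes w: "w : cont_L2 {0..<T}" and g: "g : L2" and h: "h : L2" and t: "t : {0..<T}" and b: "0 < b"
 and eq: "!!z. (LI x. w t x * g (x + z)) = (LINT s:{0..t}|lborel. LI x. w s x * h (x + z))"
 shows "(LI x. heat_flow g b x * w t x) = (LINT s:{0..t}|lborel. LI x. heat_flow h b x * w s x)"
proof -
 obtain W where Wm [measurable]: "W : borel_measurable (borel :: (real \<times> (real^3)) measure)" and W: "!!t. t : {0..<T} ==> AE x in lborel. W (t, x) = w t x"
 using cont_L2_representative[OF w] by blast
 have [measurable]: "g : BM" "h : BM" using g h by (auto intro: L2_measurable)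
 have wL: "w s : L2" if "s : {0..t}" for s using that t by (intro cont_L2_L2[OF w]) auto
 have h1: "integ (heat 1)" by (rule heat_integrable) simp
 have pair: "(LI x. heat_flow k b x * f x) = (LI z. heat 1 z * (LI x. f x * k (x + sqrt b *\<^sub>R z)))"
 if k: "k : L2" and f: "f : L2" for k f
 proof -
 have [measurable]: "k : BM" by (rule L2_measurable[OF k])
 have km: "(%(z, x). k (x + sqrt b *\<^sub>R z)) : BM2" by measurable
 note S = L2_shift[OF k] and N = L2_norm_shift[OF k]
 have kF: "integ (%z. \<bar>heat 1 z\<bar> * (L2_norm (%x. k (x + sqrt b *\<^sub>R z)))\<^sup>2)" unfolding N using h1 by simp
 show ?thesis
 unfolding heat_flow_def using L2_integral(5)[OF sigma_finite_lborel km h1 S kF f] by (simp add: mult.commute)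
 qed
 have "t < T" using t by simp
 obtain C where C: "0 < C" "!!s. s : {0..t} ==> L2_norm (w s) <= C" by (rule cont_L2_bounded[OF w \<open>t < T\<close>]) (rule that; assumption)
 define E where "E z s = indicator {0..t} s * (LI x. W (s, x) * h (x + sqrt b *\<^sub>R z))" for z s
 have E: "E z s = indicator {0..t} s * (LI x. w s x * h (x + sqrt b *\<^sub>R z))" for z s
 proof (cases "s : {0..t}")
 case True
 have [measurable]: "w s : BM" by (rule L2_measurable[OF wL[OF True]])
 have "s : {0..<T}" using True t by auto
 note Ws = W[OF this]
 have "(LI x. W (s, x) * h (x + sqrt b *\<^sub>R z)) = (LI x. w s x * h (x + sqrt b *\<^sub>R z))"
 proof (rule integral_cong_AE)
 show "AE x in lborel. W (s, x) * h (x + sqrt b *\<^sub>R z) = w s x * h (x + sqrt b *\<^sub>R z)" using Ws by eventually_elim simp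
 qed measurable
 then show ?thesis by (simp add: E_def)
 qed (simp add: E_def)
 have Em: "(%(z, s). heat 1 z * E z s) : BM2" unfolding E_def by measurable
 have Eb: "norm (E z s) <= indicator {0..t} s * (\<bar>C\<bar> * L2_norm h)" for z s
 proof (cases "s : {0..t}")
 case True
 have "\<bar>LI x. w s x * h (x + sqrt b *\<^sub>R z)\<bar> <= L2_norm (w s) * L2_norm (%x. h (x + sqrt b *\<^sub>R z))"
 by (rule L2_Cauchy_Schwarz[OF wL[OF True] L2_shift[OF h]])
 also have "... <= \<bar>C\<bar> * L2_norm h" unfolding L2_norm_shift[OF h] using C(2)[OF True] by (intro mult_right_mono) auto
 finally show ?thesis unfolding E using True by simp
 qed (simp add: E)
 have ti: "integ (%s. indicator {0..t} s * (\<bar>C\<bar> * L2_norm h))" using t by (intro integrable_mult_left integrable_real_indicator) auto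
 have Ei: "integ (E z)" for z
 proof (rule bo_integrable_bound[OF ti])
 show "AE s in lborel. norm (E z s) <= norm (indicator {0..t} s * (\<bar>C\<bar> * L2_norm h))"
 using Eb[of z] by (intro AE_I2) (simp only: real_norm_def, rule order_trans[OF _ abs_ge_self])
 qed (unfold E_def, measurable)
 have int: "integrable (LL) (%(z, s). heat 1 z * E z s)"
 proof (rule lborel_pair.Fubini_integrable[OF Em])
 show "AE z in lborel. integ (%s. case (z, s) of (z, s) => heat 1 z * E z s)" using Ei by simp
 show "integ (%z. LI s. norm (case (z, s) of (z, s) => heat 1 z * E z s))"
 proof (rule bo_integrable_bound[OF integrable_mult_left[OF h1, where c = "LI s. indicator {0..t} s * (\<bar>C\<bar> * L2_norm h)"]])
 have "(LI s. norm (heat 1 z * E z s)) <= heat 1 z * (LI s. indicator {0..t} s * (\<bar>C\<bar> * L2_norm h))" for z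
 proof -
 have "(LI s. norm (heat 1 z * E z s)) = heat 1 z * (LI s. norm (E z s))" by (simp add: abs_mult heat_nonneg)
 also have "... <= heat 1 z * (LI s. indicator {0..t} s * (\<bar>C\<bar> * L2_norm h))"
 by (intro mult_left_mono integral_mono integrable_norm Ei ti Eb heat_nonneg) simp
 finally show ?thesis .
 qed
 then show "AE z in lborel. norm (LI s. norm (case (z, s) of (z, s) => heat 1 z * E z s))
 <= norm (heat 1 z * (LI s. indicator {0..t} s * (\<bar>C\<bar> * L2_norm h)))"
 by (intro AE_I2) (simp only: prod.case real_norm_def abs_of_nonneg[OF bo_integral_nonneg[OF abs_ge_zero]], rule order_trans[OF _ abs_ge_self])
 qed (use Em in measurable)
 qed
 have wt: "w t : L2" using t by (intro wL) auto
 have "(LI x. heat_flow g b x * w t x) = (LI z. heat 1 z * (LI x. w t x * g (x + sqrt b *\<^sub>R z)))" by (rule pair[OF g wt])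
 also have "... = (LI z. LI s. heat 1 z * E z s)"
 unfolding eq set_lebesgue_integral_def E by simp
 also have "... = (LI s. LI z. heat 1 z * E z s)" by (rule lborel_pair.Fubini_integral[OF int, symmetric])
 also have "... = (LINT s:{0..t}|lborel. LI x. heat_flow h b x * w s x)"
 unfolding set_lebesgue_integral_def
 proof (intro bo_cong refl)
 fix s show "(LI z. heat 1 z * E z s) = indicator {0..t} s *\<^sub>R (LI x. heat_flow h b x * w s x)"
 using pair[OF h wL, of s] unfolding E by (cases "s : {0..t}") simp_all
 qed
 finally show ?thesis .
qed

text \<open>The function \<open>F\<close> is constant along the characteristics \<open>s + \<beta> = const\<close> of \<open>\<partial>\<^sub>s F = \<partial>\<^sub>\<beta> F\<close>.\<close>

lemma transport:
 fixes F G :: "real => real => real"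
 assumes t: "0 <= t" and b: "0 < b"
 and D1: "!!s \<beta>. s : {0..t} ==> 0 < \<beta> ==> ((%s. F s \<beta>) has_real_derivative G s \<beta>) (at s within {0..t})"
 and D2: "!!s \<beta>. s : {0..t} ==> 0 < \<beta> ==> (F s has_real_derivative G s \<beta>) (at \<beta>)"
 and lip: "!!s \<alpha> \<beta>. s : {0..t} ==> 0 < \<alpha> ==> \<alpha> <= \<beta> ==> \<bar>G s \<beta> - G s \<alpha>\<bar> <= C * (\<beta> - \<alpha>)"
 and cont: "!!s e. s : {0..t} ==> 0 < e ==> \<exists>d>0. \<forall>r\<in>{0..t}. \<bar>r - s\<bar> < d \<longrightarrow> (\<forall>\<beta>>0. \<bar>G r \<beta> - G s \<beta>\<bar> <= e)"
 shows "F t b = F 0 (t + b)"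
proof -
 define \<Phi> where "\<Phi> s = F s (t + b - s)" for s
 \<comment> \<open>From \<open>r\<close> to \<open>s\<close> along the characteristic, \<beta> is
   changed at fixed time \<open>r\<close> and then time at fixed \<beta>. The two mean value terms
   have opposite signs and nearly cancel, which replaces joint differentiability of
   \<open>F\<close>.\<close>
 have step: "\<exists>\<xi>\<in>{r..s}. \<exists>\<zeta>\<in>{t + b - s..t + b - r}. \<Phi> s - \<Phi> r = (s - r) * (G \<xi> (t + b - s) - G r \<zeta>)"
 if rs: "r : {0..t}" "s : {0..t}" "r <= s" for r s
 proof -
 let ?A = "t + b - s" and ?B = "t + b - r"
 have pos: "0 < ?A" "?A <= ?B" using rs b by auto
 have "\<exists>\<xi>\<in>{r..s}. F s ?A - F r ?A = (%h. h * G \<xi> ?A) (s - r)"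
 proof (rule mvt_very_simple[OF rs(3)])
 fix x assume "r <= x" "x <= s"
 then have "((%s. F s ?A) has_real_derivative G x ?A) (at x within {r..s})"
 using rs by (intro has_field_derivative_subset[OF D1[OF _ pos(1)]]) auto
 then show "((%s. F s ?A) has_derivative (%h. h * G x ?A)) (at x within {r..s})"
 by (simp add: has_field_derivative_def mult_commute_abs)
 qed
 then obtain \<xi> where \<xi>: "\<xi> : {r..s}" "F s ?A - F r ?A = (s - r) * G \<xi> ?A" by auto
 have "\<exists>\<zeta>\<in>{?A..?B}. F r ?B - F r ?A = (%h. h * G r \<zeta>) (?B - ?A)"
 proof (rule mvt_very_simple[OF pos(2)])
 fix x assume "?A <= x" "x <= ?B"
 then have "(F r has_real_derivative G r x) (at x within {?A..?B})"
 using pos by (intro has_field_derivative_at_within[OF D2[OF rs(1)]]) linarith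
 then show "(F r has_derivative (%h. h * G r x)) (at x within {?A..?B})"
 by (simp add: has_field_derivative_def mult_commute_abs)
 qed
 then obtain \<zeta> where \<zeta>: "\<zeta> : {?A..?B}" "F r ?B - F r ?A = (s - r) * G r \<zeta>" by auto
 have "\<Phi> s - \<Phi> r = (s - r) * (G \<xi> ?A - G r \<zeta>)" using \<xi>(2) \<zeta>(2) by (simp add: \<Phi>_def right_diff_distrib)
 then show ?thesis using \<xi>(1) \<zeta>(1) by blast
 qed
 have small: "\<bar>G \<xi> A - G r \<zeta>\<bar> <= 2 * e + \<bar>C\<bar> * \<delta>"
 if "\<forall>r\<in>{0..t}. \<bar>r - x\<bar> < d \<longrightarrow> (\<forall>\<beta>>0. \<bar>G r \<beta> - G x \<beta>\<bar> <= e)" "x : {0..t}" "\<xi> : {0..t}" "r : {0..t}" "\<bar>\<xi> - x\<bar> < d" "\<bar>r - x\<bar> < d"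
 "0 < A" "A <= \<zeta>" "\<zeta> <= A + \<delta>" for x d e \<xi> r A \<zeta> \<delta>
 proof -
 have "\<bar>G \<xi> A - G x A\<bar> <= e" "\<bar>G r \<zeta> - G x \<zeta>\<bar> <= e" using that by auto
 moreover have "\<bar>G x \<zeta> - G x A\<bar> <= C * (\<zeta> - A)" using that by (intro lip) auto
 moreover have "C * (\<zeta> - A) <= \<bar>C\<bar> * \<delta>" using that by (intro mult_mono) auto
 ultimately show ?thesis by linarith
 qed
 have "(\<Phi> has_real_derivative 0) (at x within {0..t})" if x: "x : {0..t}" for x
 unfolding has_field_derivative_iff
 proof (rule tendstoI)
 fix e :: real assume e: "0 < e"
 obtain d where d: "0 < d" "\<forall>r\<in>{0..t}. \<bar>r - x\<bar> < d \<longrightarrow> (\<forall>\<beta>>0. \<bar>G r \<beta> - G x \<beta>\<bar> <= e / 4)" using cont[OF x, of "e / 4"] e by auto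
 \<comment> \<open>The two continuity errors contribute e/2 together, and this \<delta> keeps the
   Lipschitz error below e/2.\<close>
 define \<delta> where "\<delta> = min d (e / (4 * (\<bar>C\<bar> + 1)))"
 have \<delta>: "0 < \<delta>" using d e by (simp add: \<delta>_def)
 have C\<delta>: "\<bar>C\<bar> * \<delta> < e / 2"
 proof -
 have "\<bar>C\<bar> * \<delta> <= \<bar>C\<bar> * (e / (4 * (\<bar>C\<bar> + 1)))" by (intro mult_left_mono) (auto simp: \<delta>_def)
 also have "... < e / 2" using e by (simp add: field_simps add_pos_nonneg)
 finally show ?thesis .
 qed
 have "dist ((\<Phi> y - \<Phi> x) / (y - x)) 0 < e" if y: "y : {0..t}" "y ~= x" "dist y x < \<delta>" for y
 proof -
 have yd: "\<bar>y - x\<bar> < d" "\<bar>y - x\<bar> < \<delta>" using y(3) by (auto simp: \<delta>_def dist_real_def)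
 have "\<exists>q. \<Phi> y - \<Phi> x = (y - x) * q \<and> \<bar>q\<bar> <= 2 * (e / 4) + \<bar>C\<bar> * \<delta>"
 proof (cases "x <= y")
 case True
 then obtain \<xi> \<zeta> where q: "\<xi> : {x..y}" "\<zeta> : {t + b - y..t + b - x}" "\<Phi> y - \<Phi> x = (y - x) * (G \<xi> (t + b - y) - G x \<zeta>)"
 using step[OF x y(1)] by blast
 then show ?thesis using True x y b yd by (intro exI[of _ "G \<xi> (t + b - y) - G x \<zeta>"] conjI small[OF d(2) x]) auto
 next
 case False
 then obtain \<xi> \<zeta> where q: "\<xi> : {y..x}" "\<zeta> : {t + b - x..t + b - y}" "\<Phi> x - \<Phi> y = (x - y) * (G \<xi> (t + b - x) - G y \<zeta>)"
 using step[OF y(1) x] by force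
 have "\<Phi> y - \<Phi> x = (y - x) * (G \<xi> (t + b - x) - G y \<zeta>)" using q(3) by (simp add: algebra_simps)
 then show ?thesis using False x y b yd q(1,2) by (intro exI[of _ "G \<xi> (t + b - x) - G y \<zeta>"] conjI small[OF d(2) x]) auto
 qed
 then obtain q where q: "\<Phi> y - \<Phi> x = (y - x) * q" "\<bar>q\<bar> <= 2 * (e / 4) + \<bar>C\<bar> * \<delta>" by blast
 then have "(\<Phi> y - \<Phi> x) / (y - x) = q" using y(2) by simp
 then show ?thesis using q(2) C\<delta> by (simp add: dist_real_def)
 qed
 then show "\<forall>\<^sub>F y in at x within {0..t}. dist ((\<Phi> y - \<Phi> x) / (y - x)) 0 < e"
 unfolding eventually_at using \<delta> by blast
 qed
 then obtain c where "!!x. x : {0..t} ==> \<Phi> x = c" using has_field_derivative_zero_constant[of "{0..t}" \<Phi>] by auto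
 then have "\<Phi> t = \<Phi> 0" using t by simp
 then show ?thesis by (simp add: \<Phi>_def)
qed

text \<open>The equation is available only against Laplacians of test functions, so it first gives
  that the Laplacian of \<open>w\<close> vanishes weakly. That a square-integrable harmonic function
  is 0 is then obtained from the decay of the heat flow of the test function, in place of a
  Liouville theorem.\<close>

lemma heat_weak_zero:
 fixes w :: "real => real^3 => real"
 assumes T: "0 < T" and w: "w : cont_L2 {0..<T}"
 and weak: "!!ps \<eta>. ps : TF ==> \<eta> : test_functions {..<T} ==>
 (LINT t:{0<..<T}|lborel. ddir 1 \<eta> t * (LI x. w t x * laplacian ps x) + \<eta> t * (LI x. w t x * laplacian (laplacian ps) x)) = 0"
 and t: "t : {0..<T}"
 shows "AE x in lborel. w t x = 0"
proof -
 have wL: "w s : L2" if "s : {0..t}" for s using that t by (intro cont_L2_L2[OF w]) auto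
 have wt: "w t : L2" using t by (intro wL) auto
 have "t < T" using t by simp
 obtain C where C: "0 < C" "!!s. s : {0..t} ==> L2_norm (w s) <= C" by (rule cont_L2_bounded[OF w \<open>t < T\<close>]) (rule that; assumption)
 have "(LI x. w t x * ps x) = (LI x. 0 * ps x)" if ps: "ps : TF" for ps
 proof -
 define g where "g m = (laplacian ^^ m) ps" for m
 have gT: "g m : TF" for m unfolding g_def by (induction m) (simp_all add: ps test_laplacian)
 have gS: "laplacian (g m) = g (Suc m)" for m by (simp add: g_def)
 note gL = test_L2[OF gT]
 \<comment> \<open>Differentiation in \<open>b\<close> raises \<open>m\<close> by one, and by
   \<open>avg\<close> so does differentiation in \<open>s\<close> when m = 1. This is the transport
   equation solved below.\<close>
 define F where "F m s b = (LI x. heat_flow (g m) b x * w s x)" for m s b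
 have ode: "(LI x. w s x * laplacian ps' x) = (LINT r:{0..s}|lborel. LI x. w r x * laplacian (laplacian ps') x)"
 if ps': "ps' : TF" and s: "s : {0..t}" for ps' s
 proof -
 note L = test_L2[OF test_laplacian[OF ps']] test_L2[OF test_laplacian[OF test_laplacian[OF ps']]]
 note ca = cont_L2_pairing_continuous[OF w L(1)] and cb = cont_L2_pairing_continuous[OF w L(2)]
 have s': "s : {0..<T}" using s t by auto
 have i: "sinteg {0..s} (%r. LI x. w r x * laplacian (laplacian ps') x)"
 by (rule borel_integrable_atLeastAtMost'[OF continuous_on_subset[OF cb]]) (use s' in auto)
 show ?thesis
 unfolding set_borel_integral_eq_integral(2)[OF i] by (rule weak_ode[OF T ca cb weak[OF ps'] s'])
 qed
 have avg: "F 1 s b = (LINT r:{0..s}|lborel. F 2 r b)" if s: "s : {0..t}" and b: "0 < b" for s b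
 unfolding F_def
 proof (rule heat_average[OF w gL gL _ b])
 show "s : {0..<T}" using s t by auto
 fix z
 have psz: "(%x. ps (x - (- z))) : TF" by (rule test_translate[OF ps])
 have sm: "smooth ps" "smooth (laplacian ps)" by (rule test_smooth[OF ps], rule test_smooth[OF test_laplacian[OF ps]])
 have g12: "g 1 = laplacian ps" "g 2 = laplacian (laplacian ps)" by (simp_all add: g_def numeral_2_eq_2)
 show "(LI x. w s x * g 1 (x + z)) = (LINT r:{0..s}|lborel. LI x. w r x * g 2 (x + z))"
 using ode[OF psz s] unfolding laplacian_translate[OF sm(1)] laplacian_translate[OF sm(2)] g12 by simp
 qed
 have D2: "(F m s has_real_derivative F (Suc m) s b) (at b)" if "s : {0..t}" "0 < b" for m s b
 unfolding F_def gS[symmetric] by (rule heat_pairing_deriv[OF wL[OF that(1)] gT that(2)])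
 have Fb: "\<bar>F m s b\<bar> <= L2_norm (g m) * C" if "s : {0..t}" "0 < b" for m s b
 proof -
 have "\<bar>F m s b\<bar> <= L2_norm (heat_flow (g m) b) * L2_norm (w s)"
 unfolding F_def using that by (intro L2_Cauchy_Schwarz heat_flow_L2 gL wL) auto
 also have "... <= L2_norm (g m) * C" using that by (intro mult_mono heat_flow_norm_le gL C(2)) auto
 finally show ?thesis .
 qed
 have F1: "F 1 t b = 0" if b: "0 < b" for b
 proof -
 have cF: "continuous_on {0..t} (%s. F 2 s \<beta>)" if "0 < \<beta>" for \<beta>
 proof -
 have "continuous_on {0..<T} (%s. LI x. w s x * heat_flow (g 2) \<beta> x)"
 using that by (intro cont_L2_pairing_continuous[OF w] heat_flow_L2 gL) simp
 then show ?thesis unfolding F_def using t by (simp add: mult.commute) (rule continuous_on_subset, auto)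
 qed
 have "F 1 t b = F 1 0 (t + b)"
 \<comment> \<open>The Lipschitz constant in the averaging variable is a bound for
   \<open>F 3\<close>, so three Laplacians fall on the test function.\<close>
 proof (rule transport[where C = "L2_norm (g 3) * C" and G = "F 2"])
 fix s \<beta> :: real assume s: "s : {0..t}" and \<beta>: "0 < \<beta>"
 show "(F 1 s has_real_derivative F 2 s \<beta>) (at \<beta>)" using D2[OF s \<beta>, of 1] by (simp add: numeral_2_eq_2)
 have "((%s. integral {0..s} (%r. F 2 r \<beta>)) has_real_derivative F 2 s \<beta>) (at s within {0..t})"
 by (rule integral_has_real_derivative[OF cF[OF \<beta>] s])
 then show "((%s. F 1 s \<beta>) has_real_derivative F 2 s \<beta>) (at s within {0..t})"
 proof (rule has_field_derivative_transform_within[OF _ zero_less_one s])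
 fix r assume r: "r : {0..t}"
 have "sinteg {0..r} (%r. F 2 r \<beta>)"
 by (rule borel_integrable_atLeastAtMost'[OF continuous_on_subset[OF cF[OF \<beta>]]]) (use r in auto)
 then show "integral {0..r} (%r. F 2 r \<beta>) = F 1 r \<beta>" unfolding avg[OF r \<beta>] by (rule set_borel_integral_eq_integral(2)[symmetric])
 qed
 next
 fix s \<alpha> \<beta> :: real assume s: "s : {0..t}" and ab: "0 < \<alpha>" "\<alpha> <= \<beta>"
 show "\<bar>F 2 s \<beta> - F 2 s \<alpha>\<bar> <= L2_norm (g 3) * C * (\<beta> - \<alpha>)"
 proof (cases "\<alpha> = \<beta>")
 case False
 have "\<exists>z>\<alpha>. z < \<beta> \<and> F 2 s \<beta> - F 2 s \<alpha> = (\<beta> - \<alpha>) * F 3 s z"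
 using MVT2[of \<alpha> \<beta> "F 2 s" "F 3 s"] D2[OF s, of _ 2] ab False by (auto simp: eval_nat_numeral)
 then obtain z where z: "\<alpha> < z" "F 2 s \<beta> - F 2 s \<alpha> = (\<beta> - \<alpha>) * F 3 s z" by blast
 have "\<bar>F 3 s z\<bar> <= L2_norm (g 3) * C" using z ab by (intro Fb s) auto
 then show ?thesis using ab mult_left_mono[of "\<bar>F 3 s z\<bar>" "L2_norm (g 3) * C" "\<beta> - \<alpha>"] by (simp add: z(2) abs_mult mult.commute)
 qed simp
 next
 fix s e :: real assume s: "s : {0..t}" and e: "0 < e"
 define n where "n = L2_norm (g 2) + 1"
 have n: "0 < n" by (simp add: n_def add_nonneg_pos)
 have s': "s : {0..<T}" using s t by auto
 obtain d where d: "0 < d" "!!r. r : {0..<T} ==> \<bar>r - s\<bar> < d ==> L2_norm (%x. w r x - w s x) < e / n"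
 by (rule cont_L2_dist[OF w s' divide_pos_pos[OF e n]]) (rule that; assumption)
 have "\<bar>F 2 r \<beta> - F 2 s \<beta>\<bar> <= e" if r: "r : {0..t}" "\<bar>r - s\<bar> < d" and \<beta>: "0 < \<beta>" for r \<beta>
 proof -
 have hL: "heat_flow (g 2) \<beta> : L2" using \<beta> by (intro heat_flow_L2 gL) simp
 have r': "r : {0..<T}" using r t by auto
 have "F 2 r \<beta> - F 2 s \<beta> = (LI x. heat_flow (g 2) \<beta> x * (w r x - w s x))"
 unfolding F_def using L2_mult_integrable[OF hL wL[OF r(1)]] L2_mult_integrable[OF hL wL[OF s]] by (simp add: right_diff_distrib)
 also have "\<bar>...\<bar> <= L2_norm (heat_flow (g 2) \<beta>) * L2_norm (%x. w r x - w s x)"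
 by (intro L2_Cauchy_Schwarz hL L2_diff wL r s)
 also have "... <= n * (e / n)"
 using heat_flow_norm_le[OF gL \<beta>, of 2] d(2)[OF r' r(2)] n by (intro mult_mono) (auto simp: n_def)
 finally show ?thesis using n by simp
 qed
 then show "\<exists>d>0. \<forall>r\<in>{0..t}. \<bar>r - s\<bar> < d \<longrightarrow> (\<forall>\<beta>>0. \<bar>F 2 r \<beta> - F 2 s \<beta>\<bar> <= e)" using d(1) by blast
 qed (use t b in auto)
 \<comment> \<open>At time 0 the averaged equation integrates over a single point; this is where the
   zero initial data enter.\<close>
 also have "F 1 0 (t + b) = 0"
 proof -
 have "F 1 0 (t + b) = (LINT r:{0..0}|lborel. F 2 r (t + b))" using t b by (intro avg) auto
 also have "... = 0" unfolding set_lebesgue_integral_def by (rule integral_eq_zero_AE) (use AE_lborel_singleton[of "0::real"] in \<open>auto elim!: eventually_mono\<close>)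
 finally show ?thesis .
 qed
 finally show ?thesis .
 qed
 have t': "t : {0..t}" using t by simp
 have const: "F 0 t \<alpha> = F 0 t \<beta>" if "0 < \<alpha>" "\<alpha> < \<beta>" for \<alpha> \<beta>
 proof -
 have "\<exists>z. \<alpha> < z \<and> z < \<beta> \<and> F 0 t \<beta> - F 0 t \<alpha> = (\<beta> - \<alpha>) * F (Suc 0) t z"
 by (rule MVT2[OF that(2)]) (rule D2[OF t'], use that in linarith)
 then obtain z where z: "\<alpha> < z" "F 0 t \<beta> - F 0 t \<alpha> = (\<beta> - \<alpha>) * F (Suc 0) t z" by blast
 have "F (Suc 0) t z = 0" using F1[of z] z(1) that(1) by simp
 then show ?thesis using z(2) by simp
 qed
 have zero: "F 0 t \<alpha> = 0" if \<alpha>: "0 < \<alpha>" for \<alpha>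
 proof -
 have "((%b. L2_norm (heat_flow (g 0) b) * L2_norm (w t)) \<longlongrightarrow> 0) at_top"
 by (intro tendsto_mult_left_zero heat_flow_decay gT)
 moreover have "\<forall>\<^sub>F b in at_top. \<bar>F 0 t \<alpha>\<bar> <= L2_norm (heat_flow (g 0) b) * L2_norm (w t)"
 using eventually_gt_at_top[of \<alpha>]
 proof eventually_elim
 case (elim b)
 have "\<bar>F 0 t b\<bar> <= L2_norm (heat_flow (g 0) b) * L2_norm (w t)"
 unfolding F_def using elim \<alpha> by (intro L2_Cauchy_Schwarz heat_flow_L2 gL wt) auto
 then show ?case using const[OF \<alpha> elim] by simp
 qed
 ultimately have "\<bar>F 0 t \<alpha>\<bar> <= 0" by (intro tendsto_lowerbound) auto
 then show ?thesis by simp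
 qed
 have "continuous_on {0..} (F 0 t)" unfolding F_def by (rule cont_L2_pairing_continuous[OF heat_flow_cont_L2[OF gL] wt])
 note Fc = this
 \<comment> \<open>The heat flow is continuous in \<open>L2\<close> down to time 0, where it returns
   the test function itself.\<close>
 have "F 0 t 0 = 0"
 proof (rule continuous_constant_on_closure[of "{0<..}" "F 0 t"])
 show "continuous_on (closure {0<..}) (F 0 t)" using Fc by simp
 show "F 0 t x = 0" if "x : {0<..}" for x using zero[of x] that by simp
 qed simp
 then show ?thesis by (simp add: F_def heat_flow_0 g_def mult.commute)
 qed
 then show ?thesis using L2_eq_AE_if_test[OF wt L2_zero] by simp
qed


section \<open>Elimination of the pressure from the difference of two solutions\<close>

lemma cont_L2_diff:
 fixes u v :: "real => 'a::euclidean_space => real"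
 assumes u: "u : cont_L2 I" and v: "v : cont_L2 I" shows "(%t x. v t x - u t x) : cont_L2 I"
 unfolding cont_L2_def
proof (intro CollectI ballI conjI)
 fix t assume t: "t : I"
 note L = cont_L2_L2[OF u] cont_L2_L2[OF v]
 show "(%x. v t x - u t x) : L2" by (intro L2_diff L t)
 show "((%s. L2_norm (%x. v s x - u s x - (v t x - u t x))) \<longlongrightarrow> 0) (at t within I)"
 proof (rule Lim_null_comparison)
 have "norm (L2_norm (%x. v s x - u s x - (v t x - u t x))) <= L2_norm (%x. v s x - v t x) + L2_norm (%x. u s x - u t x)" if s: "s : I" for s
 using L2_triangle_diff[OF L2_diff[OF L(2)[OF s] L(2)[OF t]] L2_diff[OF L(1)[OF s] L(1)[OF t]]] by (simp add: algebra_simps)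
 then show "\<forall>\<^sub>F s in at t within I. norm (L2_norm (%x. v s x - u s x - (v t x - u t x))) <= L2_norm (%x. v s x - v t x) + L2_norm (%x. u s x - u t x)"
 by (auto simp: eventually_at intro!: exI[of _ 1])
 show "((%s. L2_norm (%x. v s x - v t x) + L2_norm (%x. u s x - u t x)) \<longlongrightarrow> 0) (at t within I)"
 using u v t by (intro tendsto_add_zero) (simp_all add: cont_L2_def)
 qed
qed

lemma test_separated:
 fixes \<eta> :: "real => real" and g :: "real^3 => real"
 assumes \<eta>: "\<eta> : test_functions {..<T}" and g: "g : TF"
 shows "(%z. \<eta> (fst z) * g (snd z)) : TFT T"
 and "dx i (%z. \<eta> (fst z) * g (snd z)) = (%z. \<eta> (fst z) * pd i g (snd z))"
 and "heat_op (%z. \<eta> (fst z) * g (snd z)) (t, x) = ddir 1 \<eta> t * g x + \<eta> t * laplacian g x"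
proof -
 have s: "smooth \<eta>" "smooth g" using \<eta> g test_smooth by blast+
 have s1: "smooth (%z :: real \<times> (real^3). \<eta> (fst z))" using smooth_affine[OF bounded_linear_fst s(1), of 0] by simp
 have s2: "smooth (%z :: real \<times> (real^3). g (snd z))" if "smooth g" for g :: "real^3 => real" using smooth_affine[OF bounded_linear_snd that, of 0] by simp
 obtain K where K: "compact K" "K \<subseteq> {..<T}" "\<forall>s. s \<notin> K \<longrightarrow> \<eta> s = 0" using test_support[OF \<eta>] by blast
 obtain L where L: "compact L" "\<forall>x. x \<notin> L \<longrightarrow> g x = 0" using test_support[OF g] by blast
 show "(%z. \<eta> (fst z) * g (snd z)) : TFT T"
 by (rule test_functionsI[OF smooth_mult[OF s1 s2[OF s(2)]] compact_Times[OF K(1) L(1)]]) (use K L in \<open>auto simp: mem_Times_iff\<close>)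
 have d1: "ddir v (%z :: real \<times> (real^3). \<eta> (fst z)) z = ddir (fst v) \<eta> (fst z)" for v z
 using ddir_affine[OF bounded_linear_fst s(1), where c = 0] by simp
 have d2: "ddir v (%z :: real \<times> (real^3). g (snd z)) z = ddir (snd v) g (snd z)" if "smooth g" for v z and g :: "real^3 => real"
 using ddir_affine[OF bounded_linear_snd that, where c = 0] by simp
 have z0: "ddir 0 f y = 0" if "smooth f" for f :: "'b::real_normed_vector => real" and y
 using linear_0[OF linear_frechet_derivative[OF smooth_differentiable[OF that]]] by simp
 have dxg: "dx i (%z. \<eta> (fst z) * g (snd z)) = (%z. \<eta> (fst z) * pd i g (snd z))" if "smooth g" for i and g :: "real^3 => real"
 using ddir_mult[OF s1 s2[OF that]] d1 d2[OF that] z0[OF s(1)] by (simp add: fun_eq_iff pd_def)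
 show "dx i (%z. \<eta> (fst z) * g (snd z)) = (%z. \<eta> (fst z) * pd i g (snd z))" by (rule dxg[OF s(2)])
 have "dt (%z. \<eta> (fst z) * g (snd z)) (t, x) = ddir 1 \<eta> t * g x"
 using ddir_mult[OF s1 s2[OF s(2)]] d1 d2[OF s(2)] z0[OF s(2)] by simp
 moreover have "dx i (dx i (%z. \<eta> (fst z) * g (snd z))) (t, x) = \<eta> t * pd i (pd i g) x" for i
 unfolding dxg[OF s(2)] fun_cong[OF dxg[OF smooth_pd[OF s(2)]]] by simp
 ultimately show "heat_op (%z. \<eta> (fst z) * g (snd z)) (t, x) = ddir 1 \<eta> t * g x + \<eta> t * laplacian g x"
 by (simp only: heat_op_def laplacian_def sum_distrib_left)
qed

text \<open>Fields of the form \<open>\<eta>(t) (\<Delta>\<psi> e\<^sub>j - \<nabla>\<partial>\<^sub>j\<psi>)\<close> are divergence free, so that testing with them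
 eliminates the pressure and leaves a heat equation for \<open>\<Delta>w\<^sub>j\<close>.\<close>

lemma velocity_unique:
 assumes T: "0 < T" and u: "(u, p) : stokes_class T" "distributional_stokes_solution T u0 Y u p"
 and v: "(v, q) : stokes_class T" "distributional_stokes_solution T u0 Y v q" and t: "t : {0..<T}"
 shows "AE x in lborel. v t x = u t x"
proof -
 let ?I = "{0<..<T}"
 define w where "w j t x = v t x $ j - u t x $ j" for j t x
 have uc: "(%t x. u t x $ j) : cont_L2 {0..<T}" and vc: "(%t x. v t x $ j) : cont_L2 {0..<T}" for j
 using u(1) v(1) cont_L2_vec_iff unfolding stokes_class_def by blast+
 have wc: "w j : cont_L2 {0..<T}" for j unfolding w_def[abs_def] by (rule cont_L2_diff[OF uc vc])
 have wL: "w j t : L2" if "t : ?I" for j t using that by (intro cont_L2_L2[OF wc]) auto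
 have div0: "(SS l. LI x. w l t x * pd l g x) = 0" if t: "t : ?I" and g: "g : TF" for t g
 proof -
 note gL = test_L2[OF test_pd[OF g]]
 have t0: "t : {0..<T}" using t by auto
 have i: "integ (%x. u t x $ l * pd l g x)" "integ (%x. v t x $ l * pd l g x)" for l
 by (intro L2_mult_integrable cont_L2_L2[OF uc t0] cont_L2_L2[OF vc t0] gL)+
 have "(LI x. u t x \<bullet> grad g x) = 0" "(LI x. v t x \<bullet> grad g x) = 0"
 using u(2) v(2) t g by (simp_all add: distributional_stokes_solution_def weakly_div_free_def)
 then have "(SS l. LI x. u t x $ l * pd l g x) = 0" "(SS l. LI x. v t x $ l * pd l g x) = 0"
 using i by (simp_all add: inner_vec_def grad_def)
 then show ?thesis using i by (simp add: w_def left_diff_distrib sum_subtractf)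
 qed
 have "AE x in lborel. w j t x = 0" for j
 proof (rule heat_weak_zero[OF T wc _ t])
 fix ps :: "real^3 => real" and \<eta> :: "real => real"
 assume ps: "ps : TF" and \<eta>: "\<eta> : test_functions {..<T}"
 have pss: "smooth ps" by (rule test_smooth[OF ps])
 have lps: "laplacian ps : TF" by (rule test_laplacian[OF ps])
 have lpss: "smooth (laplacian ps)" by (rule test_smooth[OF lps])
 have pdl: "pd i (%x. c * f x - g x) = (%x. c * pd i f x - pd i g x)" if "smooth f" "smooth g" for i c and f g :: "real^3 => real"
 using ddir_diff[OF smooth_cmult[OF that(1)] that(2)] pd_cmult[OF that(1)] unfolding pd_eq_ddir by (simp add: fun_eq_iff)
 have lapl: "laplacian (%x. c * f x - g x) = (%x. c * laplacian f x - laplacian g x)" if "smooth f" "smooth g" for c and f g :: "real^3 => real"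
 using that by (simp add: laplacian_eq pdl smooth_pd sum_subtractf sum_distrib_left)
 define G where "G l = (%x. of_bool (l = j) * laplacian ps x - pd l (pd j ps) x)" for l
 have GT: "G l : TF" for l
 unfolding G_def by (intro test_diff test_cmult test_pd lps ps)
 have pG: "pd l (G l) = (%x. of_bool (l = j) * pd l (laplacian ps) x - pd l (pd l (pd j ps)) x)" for l
 unfolding G_def by (rule pdl[OF lpss]) (intro smooth_pd pss)
 have lG: "laplacian (G l) = (%x. of_bool (l = j) * laplacian (laplacian ps) x - pd l (pd j (laplacian ps)) x)" for l
 unfolding G_def lapl[OF lpss smooth_pd[OF smooth_pd[OF pss]]] by (simp add: pd_laplacian smooth_pd pss)
 have ob: "(SS l. of_bool (l = j) * c l) = c j" for c :: "3 => real"
 by (simp add: of_bool_def if_distrib[of "%x. x * _"] cong: if_cong)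
 have divG: "(SS l. pd l (G l) x) = 0" for x
 unfolding pG by (simp add: sum_subtractf ob pd_laplacian[OF pss] laplacian_def)
 define ph where "ph z = (SS l. (\<eta> (fst z) * G l (snd z)) *\<^sub>R (axis l 1 :: real^3))" for z :: "real \<times> (real^3)"
 have phl: "ph z $ l = \<eta> (fst z) * G l (snd z)" for z l
 by (simp add: ph_def axis_def if_distrib[of "%x. _ * x"] cong: if_cong)
 have phT: "ph : spacetime_test_functions T"
 unfolding spacetime_test_functions_def ph_def[abs_def]
 by (intro test_sum test_linear_comp[OF bounded_linear_scaleR_left] test_separated(1)[OF \<eta> GT])
 note S = test_separated[OF \<eta> GT]
 have D0: "(SS l. dx l (%z. \<eta> (fst z) * G l (snd z)) z) = 0" for z
 unfolding fun_cong[OF S(2)] using divG[of "snd z"] by (simp add: sum_distrib_left[symmetric])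
 have "(SS l. LINT t:?I|lborel. LI x. w l t x * heat_op (%z. \<eta> (fst z) * G l (snd z)) (t, x)) = 0"
 using difference_weak[OF T u v phT] unfolding phl D0 by (simp add: w_def)
 also have "(SS l. LINT t:?I|lborel. LI x. w l t x * heat_op (%z. \<eta> (fst z) * G l (snd z)) (t, x))
 = (LI t. (SS l. indicator ?I t *\<^sub>R (LI x. w l t x * heat_op (%z. \<eta> (fst z) * G l (snd z)) (t, x))))"
 unfolding set_lebesgue_integral_def
 by (intro bo_integral_sum[symmetric] cont_L2_pairing_integrable[OF T wc test_heat_op[OF S(1)], unfolded set_integrable_def])
 also have "... = (LINT t:?I|lborel. ddir 1 \<eta> t * (LI x. w j t x * laplacian ps x) + \<eta> t * (LI x. w j t x * laplacian (laplacian ps) x))"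
 unfolding set_lebesgue_integral_def scaleR_sum_right[symmetric]
 proof (intro bo_cong refl)
 fix t
 show "indicator ?I t *\<^sub>R (SS l. LI x. w l t x * heat_op (%z. \<eta> (fst z) * G l (snd z)) (t, x))
 = indicator ?I t *\<^sub>R (ddir 1 \<eta> t * (LI x. w j t x * laplacian ps x) + \<eta> t * (LI x. w j t x * laplacian (laplacian ps) x))"
 proof (cases "t : ?I")
 case True
 have i: "integ (%x. w l t x * f x)" if "f : TF" for f l
 by (intro L2_mult_integrable wL True test_L2[OF that])
 have sG: "(LI x. w l t x * (of_bool (l = j) * f x - pd l (pd j g) x))
 = of_bool (l = j) * (LI x. w l t x * f x) - (LI x. w l t x * pd l (pd j g) x)"
 if "f : TF" "g : TF" for f g l
 using i[OF that(1)] i[OF test_pd[OF test_pd[OF that(2)]]] by (simp add: right_diff_distrib mult.left_commute)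
 \<comment> \<open>The gradient part drops out because \<open>w\<close> is weakly divergence free:
   \<open>div0\<close> is applied to the test function d_j g.\<close>
 have sum_j: "(SS l. LI x. w l t x * (of_bool (l = j) * f x - pd l (pd j g) x)) = (LI x. w j t x * f x)"
 if "f : TF" "g : TF" for f g
 unfolding sG[OF that] sum_subtractf ob div0[OF True test_pd[OF that(2)]] by simp
 have "(LI x. w l t x * heat_op (%z. \<eta> (fst z) * G l (snd z)) (t, x))
 = ddir 1 \<eta> t * (LI x. w l t x * G l x) + \<eta> t * (LI x. w l t x * laplacian (G l) x)" for l
 unfolding S(3) using i[OF GT, of l l] i[OF test_laplacian[OF GT], of l l] by (simp add: distrib_left mult.left_commute[of "w l t _"])
 then have "(SS l. LI x. w l t x * heat_op (%z. \<eta> (fst z) * G l (snd z)) (t, x))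
 = ddir 1 \<eta> t * (SS l. LI x. w l t x * G l x) + \<eta> t * (SS l. LI x. w l t x * laplacian (G l) x)"
 by (simp add: sum.distrib sum_distrib_left)
 also have "(SS l. LI x. w l t x * G l x) = (LI x. w j t x * laplacian ps x)"
 unfolding G_def by (rule sum_j[OF lps ps])
 also have "(SS l. LI x. w l t x * laplacian (G l) x) = (LI x. w j t x * laplacian (laplacian ps) x)"
 unfolding lG by (rule sum_j[OF test_laplacian[OF lps] lps])
 finally show ?thesis by simp
 qed simp
 qed
 finally show "(LINT t:?I|lborel. ddir 1 \<eta> t * (LI x. w j t x * laplacian ps x) + \<eta> t * (LI x. w j t x * laplacian (laplacian ps) x)) = 0" .
 qed
 then have "AE x in lborel. \<forall>j\<in>UNIV. w j t x = 0" by (intro AE_finite_allI finite)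
 then show ?thesis by eventually_elim (simp add: w_def vec_eq_iff)
qed

theorem theorem2p6:
  fixes T :: real
    and u0 :: "real^3 \<Rightarrow> real^3"
    and Y :: "real \<Rightarrow> real^3 \<Rightarrow> real^3"
  assumes "T > 0"
    and "u0 \<in> H_space"
    and "Y \<in> cont_L2 {0..<T}"
    and "Y \<in> cont_Linf {0<..<T}"
    and "\<forall>t\<in>{0..<T}. weakly_div_free (Y t)"
    and "\<exists>M :: real. \<forall>\<^sub>F t in at_right 0. Linf_norm (Y t) \<le> ereal M"
  shows "(\<exists>p. is_stokes_pressure T Y p) \<and>
    (\<forall>p. is_stokes_pressure T Y p \<longrightarrow>
       (stokes_velocity u0 Y, p) \<in> stokes_class T \<and>
       distributional_stokes_solution T u0 Y (stokes_velocity u0 Y) p \<and>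
       (\<forall>v q. (v, q) \<in> stokes_class T \<and> distributional_stokes_solution T u0 Y v q \<longrightarrow>
          same_stokes_solution T (stokes_velocity u0 Y, p) (v, q)))"
proof -
 let ?I = "{0<..<T}" and ?S = "{0..<T} \<times> (UNIV :: (real^3) set)"
 obtain M :: real where M: "\<forall>\<^sub>F t in at_right 0. Linf_norm (Y t) <= ereal M" using assms(6) by blast
 obtain F where F: "forcing T F" and FY: "!!t i k. t : ?I ==> AE x in lborel. F i k (t, x) = Y t x $ i * Y t x $ k"
 using forcing_exists[OF assms(1,3) Linf_locally_bounded[OF assms(4) M]] by blast
 interpret forcing T F by (rule F)
 have Ym: "Y t : BM" if "t : ?I" for t using that by (intro L2_measurable cont_L2_L2[OF assms(3)]) auto
 have Sm: "?S : sets borel" by (intro borel_Times) auto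
 \<comment> \<open>The potential depends only on the almost everywhere class of its density, so
   \<open>F\<close> may replace the product at every point \<open>x\<close>.\<close>
 have np: "newton_potential (%y. Y t y $ i * Y t y $ k) = newton_potential (%y. F i k (t, y))" if t: "t : ?I" for t i k
 proof
 fix x
 have [measurable]: "(%y. Y t y $ l) : BM" for l using Ym[OF t] by (simp add: borel_measurable_vec_iff)
 show "newton_potential (%y. Y t y $ i * Y t y $ k) x = newton_potential (%y. F i k (t, y)) x"
 unfolding newton_potential_def
 proof (rule integral_cong_AE)
 show "AE y in lborel. Y t y $ i * Y t y $ k / (4 * pi * norm (x - y)) = F i k (t, y) / (4 * pi * norm (x - y))"
 using FY[OF t, of i k] by eventually_elim simp
 qed measurable
 qed
 have pa: "pressure_at t p' \<longleftrightarrow> (\<exists>h :: 3 => 3 => real^3 => real.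
 (\<forall>k i. h k i : L2 \<and> has_distr_deriv2 k i (newton_potential (%y. Y t y $ i * Y t y $ k)) (h k i)) \<and>
 (AE x in lborel. p' x = (SS k i. h k i x)))" if "t : ?I" for t p'
 unfolding pressure_at_def np[OF that] ..
 obtain q0 where q0: "q0 : BM" "\<forall>t\<in>?I. pressure_at t (%x. q0 (t, x))" using pressure_exists by blast
 have "is_stokes_pressure T Y (%t x. q0 (t, x))"
 unfolding is_stokes_pressure_def set_borel_measurable_def using q0 Sm pa by (auto intro!: borel_measurable_scaleR)
 moreover have "(stokes_velocity u0 Y, p) : stokes_class T \<and> distributional_stokes_solution T u0 Y (stokes_velocity u0 Y) p \<and>
 (\<forall>v q. (v, q) : stokes_class T \<and> distributional_stokes_solution T u0 Y v q \<longrightarrow> same_stokes_solution T (stokes_velocity u0 Y, p) (v, q))"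
 if p: "is_stokes_pressure T Y p" for p
 proof -
 \<comment> \<open>The hypothesis makes \<open>p\<close> measurable only on the strip; cutting it
   off there gives a Borel function to which the results for joint representatives apply.\<close>
 define q where "q z = indicator ?S z * p (fst z) (snd z)" for z
 have qm: "q : BM"
 using p by (simp add: is_stokes_pressure_def set_borel_measurable_def q_def[abs_def] case_prod_unfold)
 have qp: "q (t, x) = p t x" if "t : ?I" for t x using that by (simp add: q_def)
 have pat: "pressure_at t (p t)" if "t : ?I" for t using p pa[OF that] that by (simp add: is_stokes_pressure_def)
 have "(%x. q (t, x)) : BM" for t using qm by measurable
 then have pm: "p t : BM" if "t : ?I" for t using qp[OF that] by (metis (no_types, lifting) ext)
 have "q : L1_loc ?S" by (rule pressure_L1_loc[OF qm]) (use pat qp in simp)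
 then have "(%(t, x). p t x) : L1_loc ?S"
 unfolding L1_loc_def
 proof (intro CollectI allI impI; elim CollectE allE impE)
 fix K assume K: "K \<subseteq> ?S" "sinteg K q"
 have "indicator K z *\<^sub>R q z = indicator K z *\<^sub>R p (fst z) (snd z)" for z using K(1) by (cases "z : K") (auto simp: q_def)
 then show "sinteg K (%(t, x). p t x)" using K(2) unfolding set_integrable_def case_prod_unfold by (simp only:)
 qed
 then have cl: "(stokes_velocity u0 Y, p) : stokes_class T"
 using stokes_velocity_cont_L2[OF assms(2) Ym FY] by (simp add: stokes_class_def)
 have sol: "distributional_stokes_solution T u0 Y (stokes_velocity u0 Y) p"
 by (rule stokes_velocity_solution[OF assms(2) Ym FY pm pat])
 have "same_stokes_solution T (stokes_velocity u0 Y, p) (v, q)"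
 if vq: "(v, q) : stokes_class T" "distributional_stokes_solution T u0 Y v q" for v q
 proof -
 note eq = velocity_unique[OF assms(1) cl sol vq]
 have "AE x in lborel. v t x = stokes_velocity u0 Y t x" if "t : ?I" for t using that by (intro eq) auto
 from pressure_unique[OF assms(1) cl sol vq this] show ?thesis using eq by (simp add: same_stokes_solution_def)
 qed
 then show ?thesis using cl sol by blast
 qed
 ultimately show ?thesis by blast
qed

end
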